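(* Let $M$ be a compact subset of $\{x_1=x_2=0,\ |x_3|\le 1/2\}\subset\mathbb{R}^3$ and let $C=\{x_1^2+x_2^2\le 1,\ |x_3|\le 1/2\}\subset\mathbb{R}^3$. Then there is a sequence of properly embedded minimal disks $\Sigma_k\subset C$ with $\partial\Sigma_k\subset\partial C$, each containing the vertical segment $\{(0,0,t): |t|\le 1/2\}$, such that: (A) $\lim_{k\to\infty}|A_{\Sigma_k}|^2(p)=\infty$ for all $p\in M$. (B) For any $\delta>0$, $\sup_k\sup_{\Sigma_k\setminus M_\delta}|A_{\Sigma_k}|^2<\infty$, where $M_\delta=\bigcup_{p\in M}B_\delta(p)$. (C) $\Sigma_k\setminus\{x_3\text{-axis}\}=\Sigma_{1,k}\cup\Sigma_{2,k}$ for multi-valued graphs $\Sigma_{1,k}$ and $\Sigma_{2,k}$. (D) For each interval $I=(t_1,t_2)$ of the complement of $M$ in the $x_3$-axis (that is, each bounded connected component of the complement, so that $(0,0,t_1),(0,0,t_2)\in M$), the surfaces $\Sigma_k\cap\{t_1<x_3<t_2\}$ converge, smoothly on compact subsets of $C\cap\{t_1<x_3<t_2\}$, to an embedded minimal disk $\Sigma_I$ with $\overline{\Sigma_I}\setminus\Sigma_I=C\cap\{x_3=t_1 \text{ or } x_3=t_2\}$. Moreover, $\Sigma_I\setminus\{x_3\text{-axis}\}=\Sigma_{1,I}\cup\Sigma_{2,I}$ for $\infty$-valued graphs $\Sigma_{1,I}$ and $\Sigma_{2,I}$, each of which spirals into the plane $\{x_3=t_1\}$ from above and into the plane $\{x_3=t_2\}$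 from below.
   Context: Coordinates on $\mathbb{R}^3$ are $(x_1,x_2,x_3)$. $B_s(p)$ is the ball of radius $s$ centred at $p$ in $\mathbb{R}^3$. $A_\Sigma$ is the second fundamental form of an immersed surface $\Sigma\subset\mathbb{R}^3$ and $|A_\Sigma|^2$ its squared norm; for $\Sigma$ minimal $|A_\Sigma|^2=-2K_\Sigma$, with $K_\Sigma$ the Gauss curvature. Multi-valued graphs: let $\mathcal{P}$ be the universal cover of $\mathbb{R}^2\setminus\{0\}$ with global polar coordinates $(\rho,\theta)$, $\rho>0$, $\theta\in\mathbb{R}$. A multi-valued graph (about the $x_3$-axis) is a surface of the form $\{(\rho\cos\theta,\rho\sin\theta,u(\rho,\theta)):(\rho,\theta)\in D\}$ for a domain $D\subset\mathcal{P}$ (possibly including part of its boundary) and a smooth function $u$ on $D$. It is $N$-valued over an annulus $\{s\le\rho\le r\}$ if $D$ contains a set $\{s\le\rho\le r,\ \theta_0\le\theta\le\theta_0+2\pi N\}$, and $\infty$-valued if it is $N$-valued for every $N$. An $\infty$-valued graph in $C\cap\{t_1<x_3<t_2\}$ spirals into the plane $\{x_3=t_1\}$ from above if, for every $\tau>0$, every $s\in(0,1)$ and every $N$, its part in $\{t_1<x_3<t_1+\tau\}$ contains an $N$-valued graph over $\{s\le\rho\le1\}$; spiraling into $\{x_3=t_2\}$ from below is defined in the same way using $\{t_2-\tau<x_3<t_2\}$. *)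

theory Defs
  imports "HOL-Analysis.Analysis"
begin

section \<open>Smooth maps\<close>

primrec iter_deriv ::
  "'a list \<Rightarrow> ('a::euclidean_space \<Rightarrow> 'b::real_normed_vector) \<Rightarrow> 'a \<Rightarrow> 'b" where
  "iter_deriv [] f = f"
| "iter_deriv (v # vs) f = (\<lambda>x. frechet_derivative (iter_deriv vs f) (at x) v)"

text \<open>If all iterated partial derivatives are differentiable on an open set, they are in
  particular continuous there; so this is the usual class of infinitely differentiable maps.\<close>

definition smooth_on :: "('a::euclidean_space \<Rightarrow> 'b::real_normed_vector) \<Rightarrow> 'a set \<Rightarrow> bool" where
  "smooth_on f U \<longleftrightarrow>
     open U \<and> (\<forall>vs. set vs \<subseteq> Basis \<longrightarrow> iter_deriv vs f differentiable_on U)"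


section \<open>Parametrized surfaces in 3-space\<close>

definition first_fundamental_form :: "(real^2 \<Rightarrow> real^3) \<Rightarrow> real^2 \<Rightarrow> real^2^2" where
  "first_fundamental_form F w =
     (\<chi> i j. iter_deriv [axis i 1] F w \<bullet> iter_deriv [axis j 1] F w)"

definition unit_normal :: "(real^2 \<Rightarrow> real^3) \<Rightarrow> real^2 \<Rightarrow> real^3" where
  "unit_normal F w = sgn (cross3 (iter_deriv [axis 1 1] F w) (iter_deriv [axis 2 1] F w))"

definition second_fundamental_form :: "(real^2 \<Rightarrow> real^3) \<Rightarrow> real^2 \<Rightarrow> real^2^2" where
  "second_fundamental_form F w = (\<chi> i j. iter_deriv [axis i 1, axis j 1] F w \<bullet> unit_normal F w)"

text \<open>The second fundamental form with one index raised by the metric: its trace is the mean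
  curvature (the sum of the principal curvatures), and the trace of its square is the squared
  norm of the second fundamental form with respect to the metric.\<close>

definition shape_operator :: "(real^2 \<Rightarrow> real^3) \<Rightarrow> real^2 \<Rightarrow> real^2^2" where
  "shape_operator F w = matrix_inv (first_fundamental_form F w) ** second_fundamental_form F w"

definition mean_curvature :: "(real^2 \<Rightarrow> real^3) \<Rightarrow> real^2 \<Rightarrow> real" where
  "mean_curvature F w = trace (shape_operator F w)"

text \<open>\<open>norm_A_sq F W p\<close> is the squared norm of the second fundamental form of the surface
  \<open>F ` W\<close> at its point \<open>p\<close>; it is only used for \<open>F\<close> injective on \<open>W\<close> and \<open>p \<in> F ` W\<close>.\<close>

definition norm_A_sq :: "(real^2 \<Rightarrow> real^3) \<Rightarrow> (real^2) set \<Rightarrow> real^3 \<Rightarrow> real" where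
  "norm_A_sq F W p =
     (let S = shape_operator F (inv_into W F p) in trace (S ** S))"


section \<open>Embedded minimal disks\<close>

text \<open>Surfaces may have boundary, and are smooth up to the boundary in the sense that the
  parametrization extends smoothly past the boundary of the parameter domain \<open>W\<close>. A disk is a
  simply connected surface with boundary that is not closed: up to homeomorphism, the closed unit
  disk with a closed set \<open>Z\<close> of boundary points removed. So \<open>Z = {}\<close> gives the closed disk,
  \<open>Z = sphere 0 1\<close> the open disk, and \<open>Z\<close> consisting of two points a strip
  \<open>{t1<..<t2} \<times> {-1..1}\<close>. The boundary of the surface is \<open>F ` (W \<inter> frontier W)\<close>.\<close>

definition embedded_minimal_disk ::
  "(real^2 \<Rightarrow> real^3) \<Rightarrow> (real^2) set \<Rightarrow> (real^3) set \<Rightarrow> bool" where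
  "embedded_minimal_disk F W \<Sigma> \<longleftrightarrow>
     \<Sigma> = F ` W \<and>
     (\<exists>Z. closed Z \<and> Z \<subseteq> sphere 0 1 \<and> W homeomorphic (cball (0::real^2) 1 - Z)) \<and>
     (\<exists>U. W \<subseteq> U \<and> smooth_on F U) \<and>
     (\<forall>w\<in>W. inj (frechet_derivative F (at w)) \<and> mean_curvature F w = 0) \<and>
     (\<exists>G. homeomorphism W \<Sigma> F G)"

text \<open>In a compact region \<open>C\<close>, a properly embedded disk is compact, and it meets the
  boundary of \<open>C\<close> exactly in its own boundary.\<close>

definition properly_embedded_minimal_disk ::
  "(real^2 \<Rightarrow> real^3) \<Rightarrow> (real^2) set \<Rightarrow> (real^3) set \<Rightarrow> (real^3) set \<Rightarrow> bool" where
  "properly_embedded_minimal_disk F W \<Sigma> C \<longleftrightarrow>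
     embedded_minimal_disk F W \<Sigma> \<and> compact W \<and> \<Sigma> \<subseteq> C \<and> F ` frontier W = \<Sigma> \<inter> frontier C"


section \<open>Multi-valued graphs\<close>

text \<open>The universal cover of the punctured plane is represented by the half plane of polar
  coordinates \<open>(\<rho>, \<theta>)\<close> with \<open>\<rho> > 0\<close>. The definition says that \<open>D\<close> is an open connected set
  together with part of its boundary.\<close>

definition polar_domain :: "(real \<times> real) set \<Rightarrow> bool" where
  "polar_domain D \<longleftrightarrow>
     D \<subseteq> {p. fst p > 0} \<and>
     (\<exists>O'. open O' \<and> connected O' \<and> O' \<noteq> {} \<and> O' \<subseteq> D \<and> D \<subseteq> closure O')"

definition graph_over :: "(real \<times> real) set \<Rightarrow> (real \<times> real \<Rightarrow> real) \<Rightarrow> (real^3) set \<Rightarrow> bool" where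
  "graph_over D u S \<longleftrightarrow>
     polar_domain D \<and> (\<exists>U. D \<subseteq> U \<and> smooth_on u U) \<and>
     S = (\<lambda>(\<rho>, \<theta>). vector [\<rho> * cos \<theta>, \<rho> * sin \<theta>, u (\<rho>, \<theta>)]) ` D"

definition multi_valued_graph :: "(real^3) set \<Rightarrow> bool" where
  "multi_valued_graph S \<longleftrightarrow> (\<exists>D u. graph_over D u S)"

definition N_valued_over :: "nat \<Rightarrow> real \<Rightarrow> real \<Rightarrow> (real \<times> real) set \<Rightarrow> bool" where
  "N_valued_over N s r D \<longleftrightarrow> (\<exists>\<theta>0. {s..r} \<times> {\<theta>0..\<theta>0 + 2 * pi * real N} \<subseteq> D)"

definition N_valued_graph_over :: "nat \<Rightarrow> real \<Rightarrow> real \<Rightarrow> (real^3) set \<Rightarrow> bool" where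
  "N_valued_graph_over N s r S \<longleftrightarrow> (\<exists>D u. graph_over D u S \<and> N_valued_over N s r D)"

definition infinite_valued_graph :: "(real^3) set \<Rightarrow> bool" where
  "infinite_valued_graph S \<longleftrightarrow>
     (\<exists>D u. graph_over D u S \<and> (\<exists>s r. 0 < s \<and> s < r \<and> (\<forall>N. N_valued_over N s r D)))"

definition slab :: "real \<Rightarrow> real \<Rightarrow> (real^3) set" where
  "slab a b = {p. a < p $ 3 \<and> p $ 3 < b}"

definition spirals_into_from_above :: "(real^3) set \<Rightarrow> real \<Rightarrow> bool" where
  "spirals_into_from_above S t \<longleftrightarrow>
     (\<forall>\<tau>>0. \<forall>s\<in>{0<..<1}. \<forall>N. \<exists>G \<subseteq> S \<inter> slab t (t + \<tau>). N_valued_graph_over N s 1 G)"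

definition spirals_into_from_below :: "(real^3) set \<Rightarrow> real \<Rightarrow> bool" where
  "spirals_into_from_below S t \<longleftrightarrow>
     (\<forall>\<tau>>0. \<forall>s\<in>{0<..<1}. \<forall>N. \<exists>G \<subseteq> S \<inter> slab (t - \<tau>) t. N_valued_graph_over N s 1 G)"


section \<open>Smooth convergence of surfaces on compact subsets\<close>

text \<open>The surfaces \<open>S k\<close> converge to the embedded surface \<open>F ` W\<close>, smoothly on compact subsets
  of \<open>\<Omega>\<close>: for every compact \<open>K \<subseteq> \<Omega>\<close>, the whole of \<open>S k \<inter> K\<close> is eventually covered by a single
  injective piece of \<open>S k\<close>, parametrized over a compact set \<open>L\<close> of parameters of the limit surface,
  and these parametrizations converge to \<open>F\<close> uniformly with all derivatives. The set \<open>L\<close> contains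
  all the parameters that \<open>F\<close> maps to \<open>K\<close>; it may have to be slightly larger, since points of
  \<open>S k\<close> in \<open>K\<close> may correspond to points of the limit just outside \<open>K\<close>.\<close>

definition converge_smoothly_on_compacts ::
  "(nat \<Rightarrow> (real^3) set) \<Rightarrow> (real^2 \<Rightarrow> real^3) \<Rightarrow> (real^2) set \<Rightarrow> (real^3) set \<Rightarrow> bool" where
  "converge_smoothly_on_compacts S F W \<Omega> \<longleftrightarrow>
     (\<forall>K. compact K \<and> K \<subseteq> \<Omega> \<longrightarrow>
       (\<exists>L \<phi>. compact L \<and> L \<subseteq> W \<and> {w\<in>W. F w \<in> K} \<subseteq> L \<and>
          (\<forall>\<^sub>F k in sequentially.
             (\<exists>U. L \<subseteq> U \<and> smooth_on (\<phi> k) U) \<and> inj_on (\<phi> k) L \<and>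
             \<phi> k ` L \<subseteq> S k \<and> S k \<inter> K \<subseteq> \<phi> k ` L) \<and>
          (\<forall>vs. set vs \<subseteq> Basis \<longrightarrow>
             uniform_limit L (\<lambda>k. iter_deriv vs (\<phi> k)) (iter_deriv vs F) sequentially)))"


section \<open>The cylinder and its axis\<close>

definition axis_point :: "real \<Rightarrow> real^3" where
  "axis_point t = vector [0, 0, t]"

definition x3_axis :: "(real^3) set" where
  "x3_axis = {p. p $ 1 = 0 \<and> p $ 2 = 0}"

definition cylinder :: "(real^3) set" where
  "cylinder = {p. (p $ 1)\<^sup>2 + (p $ 2)\<^sup>2 \<le> 1 \<and> \<bar>p $ 3\<bar> \<le> 1/2}"

end

theory Submission
  imports Defs "HOL-Complex_Analysis.Cauchy_Integral_Formula" "HOL-Library.Discrete_Functions"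
    "HOL-Library.Diagonal_Subsequence"
begin

text \<open>The disks have Weierstrass data \<open>g = exp (i h)\<close>, \<open>\<phi> = dz\<close>, where
  \<open>h' = f \<kappa> = \<Sum>j. wt j / ((z - p j)\<^sup>2 + \<kappa>\<^sup>2)\<^sup>2\<close> for a sequence \<open>p\<close> that is quantitatively dense in
  the set \<open>S\<close> of heights of the points of \<open>M\<close>, so that \<open>f \<kappa>\<close> is at least of order \<open>d\<^sup>-\<^sup>2\<close> with
  \<open>d = dist(x, S) + \<bar>\<kappa>\<bar>\<close>. Since \<open>\<phi> = dz\<close>, the slice at height \<open>x\<close> is the image of the vertical line
  \<open>Re z = x\<close>. Its direction turns by at most \<open>1/2\<close> while its length already exceeds the radius of
  the cylinder; hence slices are almost straight, the radius increases along each half of a slice,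
  and the surface is embedded. The two halves off the axis are multi-valued graphs because the angle
  increases with \<open>x\<close> at a fixed radius. Moreover \<open>\<bar>A\<bar>\<^sup>2 = 2 \<bar>f\<bar>\<^sup>2 / cosh\<^sup>4 v\<close> with \<open>v = Im h\<close>; on the axis
  \<open>v = 0\<close>, so that \<open>\<bar>A\<bar>\<close> blows up exactly over \<open>S\<close>, and off the axis the growth of \<open>cosh v\<close> wins.
  On a gap of \<open>S\<close> the data extend continuously to \<open>\<kappa> = 0\<close> once the values of \<open>g\<close> at one height
  converge, which a diagonal subsequence over the rational heights achieves for all gaps at once; as
  \<open>f 0\<close> is not integrable at the ends of the gap, the limit spirals into both planes.\<close>

section \<open>Families of smooth maps depending continuously on a parameter\<close>

text \<open>Two demands on the height \<open>y\<close> of the domain compete. A slice turns by about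
  \<open>f * y^2 / d\<close>, which forces \<open>y\<close> below a multiple of
  \<open>sqrt (d / f)\<close>, whereas its length comes from \<open>cosh v\<close> with
  \<open>v\<close> about \<open>f * y\<close>. At the top of the domain \<open>v\<close> is of order
  \<open>m = sqrt (f * d)\<close>, and a fourth power bound for \<open>cosh\<close> gives a length
  of order \<open>m^4 * (d / m) = m * (m^2 * d)\<close>. A large lower bound for
  \<open>f * d^2\<close>, uniform over all compact sets including Cantor sets, therefore settles
  everything; weights of order \<open>j^-2\<close> and the squared kernel are chosen to provide it.
  As \<kappa> tends to 0 the integral of \<open>f\<close> across a point of \<open>S\<close>
  diverges, so the phases of \<open>g\<close> on different gaps are unrelated. Surfaces over one gap
  are determined up to a rotation, and the rotation has to be made convergent on each of countably
  many gaps; hence the subsequence. Regularity of a single surface and smooth convergence are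
  obtained together, from one calculus of families whose parameter set may be a null sequence with
  its limit.\<close>

text \<open>The derivatives are jointly continuous in parameter and point, so on compact sets smoothness
  of a family in this sense yields smooth convergence as the parameter converges.\<close>

primrec ck ::
  "nat \<Rightarrow> ('i::topological_space \<times> 'a::euclidean_space) set \<Rightarrow> ('i \<Rightarrow> 'a \<Rightarrow> 'b::real_normed_vector) \<Rightarrow> bool"
where
  "ck 0 \<Omega> f \<longleftrightarrow> continuous_on \<Omega> (\<lambda>(k, w). f k w)"
| "ck (Suc n) \<Omega> f \<longleftrightarrow> continuous_on \<Omega> (\<lambda>(k, w). f k w) \<and>
     (\<exists>f'. (\<forall>(k, w)\<in>\<Omega>. (f k has_derivative f' k w) (at w)) \<and> (\<forall>b\<in>Basis. ck n \<Omega> (\<lambda>k w. f' k w b)))"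

text \<open>Openness is asked of the slices only: the parameter set may be a null sequence together
  with \<open>0\<close>, and derivatives are taken in \<open>w\<close> at a fixed parameter.\<close>

definition open_slices :: "('i \<times> 'a::topological_space) set \<Rightarrow> bool" where
  "open_slices \<Omega> \<longleftrightarrow> (\<forall>k. open {w. (k, w) \<in> \<Omega>})"

lemma ck_continuous: "ck n \<Omega> f \<Longrightarrow> continuous_on \<Omega> (\<lambda>(k, w). f k w)"
  by (cases n) auto

lemma ck_SucI:
  assumes "continuous_on \<Omega> (\<lambda>(k, w). f k w)"
    and "\<And>k w. (k, w) \<in> \<Omega> \<Longrightarrow> (f k has_derivative f' k w) (at w)"
    and "\<And>b. b \<in> Basis \<Longrightarrow> ck n \<Omega> (\<lambda>k w. f' k w b)"
  shows "ck (Suc n) \<Omega> f"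
  unfolding ck.simps
  by (intro conjI exI[of _ f']) (use assms in auto)

lemma ck_SucE:
  assumes "ck (Suc n) \<Omega> f"
  obtains f' where "\<And>k w. (k, w) \<in> \<Omega> \<Longrightarrow> (f k has_derivative f' k w) (at w)"
    and "\<And>b. b \<in> Basis \<Longrightarrow> ck n \<Omega> (\<lambda>k w. f' k w b)"
  using assms by auto

declare ck.simps(2) [simp del]

lemma ck_SucD: "ck (Suc n) \<Omega> f \<Longrightarrow> ck n \<Omega> f"
proof (induction n arbitrary: f)
  case (Suc n)
  obtain f' where f': "\<And>k w. (k, w) \<in> \<Omega> \<Longrightarrow> (f k has_derivative f' k w) (at w)"
    and "\<And>b. b \<in> Basis \<Longrightarrow> ck (Suc n) \<Omega> (\<lambda>k w. f' k w b)"
    using Suc.prems by (rule ck_SucE) blast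
  then show ?case
    by (intro ck_SucI[of \<Omega> f f' n]) (auto intro: ck_continuous[OF Suc.prems] Suc.IH simp del: ck.simps)
qed (simp add: ck_continuous)

lemma ck_const: "ck n \<Omega> (\<lambda>k w. c)"
  by (induction n arbitrary: c) (auto intro!: ck_SucI[where f' = "\<lambda>_ _ _. 0"] simp del: ck.simps(2))

lemma ck_subset: "ck n \<Omega> f \<Longrightarrow> \<Omega>' \<subseteq> \<Omega> \<Longrightarrow> ck n \<Omega>' f"
proof (induction n arbitrary: f)
  case (Suc n)
  obtain f' where f': "\<And>k w. (k, w) \<in> \<Omega> \<Longrightarrow> (f k has_derivative f' k w) (at w)"
    and "\<And>b. b \<in> Basis \<Longrightarrow> ck n \<Omega> (\<lambda>k w. f' k w b)"
    using Suc.prems(1) by (rule ck_SucE) blast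
  then show ?case
    using Suc by (intro ck_SucI[where f' = f'] continuous_on_subset[OF ck_continuous[OF Suc.prems(1)]]) auto
qed (auto intro: continuous_on_subset)

text \<open>A derivative at \<open>w\<close> sees \<open>f k\<close> only near \<open>w\<close>, so
  agreement on an open slice lets the same \<open>f'\<close> serve both functions.\<close>

lemma ck_cong:
  assumes "open_slices \<Omega>" "\<And>k w. (k, w) \<in> \<Omega> \<Longrightarrow> f k w = g k w" "ck n \<Omega> f"
  shows "ck n \<Omega> g"
proof -
  have cont: "continuous_on \<Omega> (\<lambda>(k, w). g k w)"
    by (rule continuous_on_eq[OF ck_continuous[OF assms(3)]]) (use assms(2) in auto)
  show ?thesis
  proof (cases n)
    case 0
    then show ?thesis using cont by simp
  next
    case (Suc m)
    obtain f' where f': "\<And>k w. (k, w) \<in> \<Omega> \<Longrightarrow> (f k has_derivative f' k w) (at w)"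
      and f'': "\<And>b. b \<in> Basis \<Longrightarrow> ck m \<Omega> (\<lambda>k w. f' k w b)"
      using assms(3) unfolding Suc by (rule ck_SucE) blast
    have "(g k has_derivative f' k w) (at w)" if "(k, w) \<in> \<Omega>" for k w
      by (rule has_derivative_transform_within_open[OF f'[OF that], of "{w. (k, w) \<in> \<Omega>}"])
        (use that assms(1,2) in \<open>auto simp: open_slices_def\<close>)
    then show ?thesis
      unfolding Suc by (intro ck_SucI[where f' = f'] cont f'')
  qed
qed

lemma ck_add:
  assumes "ck n \<Omega> f" "ck n \<Omega> g"
  shows "ck n \<Omega> (\<lambda>k w. f k w + g k w)"
  using assms
proof (induction n arbitrary: f g)
  case 0
  then show ?case by (simp add: case_prod_unfold continuous_on_add)
next
  case (Suc n)
  obtain f' where f': "\<And>k w. (k, w) \<in> \<Omega> \<Longrightarrow> (f k has_derivative f' k w) (at w)"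
    and f'': "\<And>b. b \<in> Basis \<Longrightarrow> ck n \<Omega> (\<lambda>k w. f' k w b)"
    using Suc.prems(1) by (rule ck_SucE) blast
  obtain g' where g': "\<And>k w. (k, w) \<in> \<Omega> \<Longrightarrow> (g k has_derivative g' k w) (at w)"
    and g'': "\<And>b. b \<in> Basis \<Longrightarrow> ck n \<Omega> (\<lambda>k w. g' k w b)"
    using Suc.prems(2) by (rule ck_SucE) blast
  show ?case
  proof (rule ck_SucI)
    show "continuous_on \<Omega> (\<lambda>(k, w). f k w + g k w)"
      using ck_continuous[OF Suc.prems(1)] ck_continuous[OF Suc.prems(2)]
      by (simp add: case_prod_unfold continuous_on_add)
    show "((\<lambda>w. f k w + g k w) has_derivative (\<lambda>v. f' k w v + g' k w v)) (at w)"
      if "(k, w) \<in> \<Omega>" for k w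
      using f'[OF that] g'[OF that] by (rule has_derivative_add)
  qed (use Suc.IH f'' g'' in auto)
qed

lemma ck_bounded_linear:
  assumes h: "bounded_linear h" and "ck n \<Omega> f"
  shows "ck n \<Omega> (\<lambda>k w. h (f k w))"
  using assms(2)
proof (induction n arbitrary: f)
  case 0
  then show ?case by (simp add: case_prod_unfold bounded_linear.continuous_on[OF h])
next
  case (Suc n)
  obtain f' where f': "\<And>k w. (k, w) \<in> \<Omega> \<Longrightarrow> (f k has_derivative f' k w) (at w)"
    and f'': "\<And>b. b \<in> Basis \<Longrightarrow> ck n \<Omega> (\<lambda>k w. f' k w b)"
    using Suc.prems(1) by (rule ck_SucE) blast
  show ?case
  proof (rule ck_SucI)
    show "continuous_on \<Omega> (\<lambda>(k, w). h (f k w))"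
      using ck_continuous[OF Suc.prems(1)]
      by (simp add: case_prod_unfold bounded_linear.continuous_on[OF h])
    show "((\<lambda>w. h (f k w)) has_derivative (\<lambda>v. h (f' k w v))) (at w)"
      if "(k, w) \<in> \<Omega>" for k w
      using f'[OF that] by (rule bounded_linear.has_derivative[OF h])
  qed (use Suc.IH f'' in auto)
qed

lemma ck_bounded_bilinear:
  fixes f :: "'i::topological_space \<Rightarrow> 'a::euclidean_space \<Rightarrow> 'b::real_normed_vector"
    and g :: "'i \<Rightarrow> 'a \<Rightarrow> 'c::real_normed_vector"
  assumes h: "bounded_bilinear h" and "ck n \<Omega> f" "ck n \<Omega> g"
  shows "ck n \<Omega> (\<lambda>k w. h (f k w) (g k w))"
  using assms(2,3)
proof (induction n arbitrary: f g)
  case 0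
  then show ?case by (simp add: case_prod_unfold bounded_bilinear.continuous_on[OF h])
next
  case (Suc n)
  obtain f' where f': "\<And>k w. (k, w) \<in> \<Omega> \<Longrightarrow> (f k has_derivative f' k w) (at w)"
    and f'': "\<And>b. b \<in> Basis \<Longrightarrow> ck n \<Omega> (\<lambda>k w. f' k w b)"
    using Suc.prems(1) by (rule ck_SucE) blast
  obtain g' where g': "\<And>k w. (k, w) \<in> \<Omega> \<Longrightarrow> (g k has_derivative g' k w) (at w)"
    and g'': "\<And>b. b \<in> Basis \<Longrightarrow> ck n \<Omega> (\<lambda>k w. g' k w b)"
    using Suc.prems(2) by (rule ck_SucE) blast
  show ?case
  proof (rule ck_SucI)
    show "continuous_on \<Omega> (\<lambda>(k, w). h (f k w) (g k w))"
      using ck_continuous[OF Suc.prems(1)] ck_continuous[OF Suc.prems(2)]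
      by (simp add: case_prod_unfold bounded_bilinear.continuous_on[OF h])
    show "((\<lambda>w. h (f k w) (g k w)) has_derivative (\<lambda>v. h (f k w) (g' k w v) + h (f' k w v) (g k w))) (at w)"
      if "(k, w) \<in> \<Omega>" for k w
      using f'[OF that] g'[OF that] by (rule bounded_bilinear.FDERIV[OF h])
    show "ck n \<Omega> (\<lambda>k w. h (f k w) (g' k w b) + h (f' k w b) (g k w))" if "b \<in> Basis" for b
      using f''[OF that] g''[OF that] Suc by (intro ck_add) (auto intro: ck_SucD)
  qed
qed

lemmas ck_mult = ck_bounded_bilinear[OF bounded_bilinear_mult]
lemmas ck_scaleR = ck_bounded_bilinear[OF bounded_bilinear_scaleR]
lemmas ck_Re = ck_bounded_linear[OF bounded_linear_Re]
lemmas ck_Im = ck_bounded_linear[OF bounded_linear_Im]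
lemmas ck_cnj = ck_bounded_linear[OF bounded_linear_cnj]
lemmas ck_minus = ck_bounded_linear[OF bounded_linear_minus[OF bounded_linear_ident]]

lemma ck_diff:
  assumes "ck n \<Omega> f" "ck n \<Omega> g"
  shows "ck n \<Omega> (\<lambda>k w. f k w - g k w)"
  using ck_add[OF assms(1) ck_minus[OF assms(2)]] by simp

lemma ck_sum:
  assumes "\<And>i. i \<in> I \<Longrightarrow> ck n \<Omega> (f i)"
  shows "ck n \<Omega> (\<lambda>k w. \<Sum>i\<in>I. f i k w)"
  using assms by (induction I rule: infinite_finite_induct) (auto intro: ck_const ck_add)

lemma ck_linear:
  assumes "bounded_linear h"
  shows "ck n \<Omega> (\<lambda>k w. h w)"
proof (cases n)
  case 0
  then show ?thesis
    by (auto simp: case_prod_unfold intro!: bounded_linear.continuous_on[OF assms] continuous_intros)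
next
  case (Suc m)
  show ?thesis unfolding Suc
    by (rule ck_SucI[where f' = "\<lambda>_ _. h"])
      (auto simp: case_prod_unfold bounded_linear_imp_has_derivative[OF assms] ck_const
        intro!: bounded_linear.continuous_on[OF assms] continuous_intros)
qed

lemmas ck_id = ck_linear[OF bounded_linear_ident]

lemma ck_Pair:
  assumes "ck n \<Omega> f" "ck n \<Omega> g"
  shows "ck n \<Omega> (\<lambda>k w. (f k w, g k w))"
proof -
  have "bounded_linear (\<lambda>x. (x, 0))" "bounded_linear (\<lambda>x. (0, x))"
    by (auto intro!: bounded_linear_Pair bounded_linear_ident bounded_linear_zero)
  from ck_add[OF ck_bounded_linear[OF this(1) assms(1)] ck_bounded_linear[OF this(2) assms(2)]]
  show ?thesis by simp
qed

lemma linear_sum_Basis: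
  fixes h :: "'a::euclidean_space \<Rightarrow> 'b::real_vector"
  assumes "linear h"
  shows "h v = (\<Sum>b\<in>Basis. (v \<bullet> b) *\<^sub>R h b)"
proof -
  have "h v = h (\<Sum>b\<in>Basis. (v \<bullet> b) *\<^sub>R b)"
    by (simp add: euclidean_representation)
  also have "\<dots> = (\<Sum>b\<in>Basis. (v \<bullet> b) *\<^sub>R h b)"
    by (simp add: linear_sum[OF assms] linear_cmul[OF assms])
  finally show ?thesis .
qed

lemma ck_compose:
  fixes f :: "'i::topological_space \<Rightarrow> 'c::euclidean_space \<Rightarrow> 'b::real_normed_vector"
    and g :: "'i \<Rightarrow> 'a::euclidean_space \<Rightarrow> 'c"
  assumes "ck n \<Omega>' f" "ck n \<Omega> g" and sub: "\<And>k w. (k, w) \<in> \<Omega> \<Longrightarrow> (k, g k w) \<in> \<Omega>'"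
  shows "ck n \<Omega> (\<lambda>k w. f k (g k w))"
  using assms(1,2)
proof (induction n arbitrary: f)
  have cont: "continuous_on \<Omega> (\<lambda>(k, w). f k (g k w))"
    if f: "continuous_on \<Omega>' (\<lambda>(k, w). f k w)" and g: "continuous_on \<Omega> (\<lambda>(k, w). g k w)"
    for f :: "'i \<Rightarrow> 'c \<Rightarrow> 'b"
  proof -
    have "continuous_on \<Omega> (\<lambda>x. (fst x, g (fst x) (snd x)))"
      using g by (intro continuous_intros) (simp add: case_prod_unfold)
    from continuous_on_compose2[OF f this] show ?thesis
      using sub by (force simp: case_prod_unfold)
  qed
  {
    case 0
    then show ?case using cont by simp
  next
    case (Suc n)
    obtain f' where f': "\<And>k w. (k, w) \<in> \<Omega>' \<Longrightarrow> (f k has_derivative f' k w) (at w)"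
      and f'': "\<And>b. b \<in> Basis \<Longrightarrow> ck n \<Omega>' (\<lambda>k w. f' k w b)"
      using Suc.prems(1) by (rule ck_SucE) blast
    obtain g' where g': "\<And>k w. (k, w) \<in> \<Omega> \<Longrightarrow> (g k has_derivative g' k w) (at w)"
      and g'': "\<And>b. b \<in> Basis \<Longrightarrow> ck n \<Omega> (\<lambda>k w. g' k w b)"
      using Suc.prems(2) by (rule ck_SucE) blast
    show ?case
    proof (rule ck_SucI)
      show "continuous_on \<Omega> (\<lambda>(k, w). f k (g k w))"
        using cont Suc.prems by (intro cont) (auto intro: ck_continuous)
      \<comment> \<open>The chain rule is expanded over \<open>Basis\<close> because
        \<open>ck\<close> controls \<open>f'\<close> in basis directions only, not along the varying
        vector \<open>g' k w v\<close>.\<close>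
      show "((\<lambda>w. f k (g k w)) has_derivative
          (\<lambda>v. \<Sum>c\<in>Basis. (g' k w v \<bullet> c) *\<^sub>R f' k (g k w) c)) (at w)"
        if "(k, w) \<in> \<Omega>" for k w
      proof -
        have "((\<lambda>w. f k (g k w)) has_derivative (\<lambda>v. f' k (g k w) (g' k w v))) (at w)"
          using has_derivative_compose[OF g'[OF that] f'[OF sub[OF that]]] .
        moreover have "linear (f' k (g k w))"
          using f'[OF sub[OF that]] has_derivative_linear by blast
        ultimately show ?thesis by (subst (asm) linear_sum_Basis) auto
      qed
      show "ck n \<Omega> (\<lambda>k w. \<Sum>c\<in>Basis. (g' k w b \<bullet> c) *\<^sub>R f' k (g k w) c)" if "b \<in> Basis" for b
        using Suc.prems(2) g''[OF that]
        by (intro ck_sum ck_scaleR ck_bounded_linear[OF bounded_linear_inner_left] Suc.IH f'') (auto intro: ck_SucD)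
    qed
  }
qed

lemma ck_inverse_real:
  assumes "ck n \<Omega> f" "\<And>k w. (k, w) \<in> \<Omega> \<Longrightarrow> f k w \<noteq> (0::real)"
  shows "ck n \<Omega> (\<lambda>k w. inverse (f k w))"
proof -
  \<comment> \<open>Inversion is first treated as a family constant in the parameter: its derivative
    is a product of inversions, so the induction closes. The general case is a composition.\<close>
  have "ck n (UNIV \<times> {w. w \<noteq> 0}) (\<lambda>(k::'a) (w::real). inverse w)"
  proof (induction n)
    case 0
    show ?case by (auto simp: case_prod_unfold intro!: continuous_intros)
  next
    case (Suc n)
    have "ck n (UNIV \<times> {w. w \<noteq> 0}) (\<lambda>(k::'a) (w::real). - (inverse w * b * inverse w))" if "b \<in> Basis" for b
      by (intro ck_minus ck_mult ck_const Suc.IH)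
    then show ?case
      by (intro ck_SucI[where f' = "\<lambda>k w v. - (inverse w * v * inverse w)"] has_derivative_inverse')
        (auto simp: case_prod_unfold intro!: continuous_intros)
  qed
  then show ?thesis
    by (rule ck_compose[OF _ assms(1)]) (use assms(2) in auto)
qed

lemma ck_iter_deriv:
  fixes f :: "'i::topological_space \<Rightarrow> 'a::euclidean_space \<Rightarrow> 'b::real_normed_vector"
  assumes \<Omega>: "open_slices \<Omega>"
  shows "set vs \<subseteq> Basis \<Longrightarrow> ck (n + length vs) \<Omega> f \<Longrightarrow> ck n \<Omega> (\<lambda>k. iter_deriv vs (f k))"
proof (induction vs arbitrary: n)
  case (Cons v vs)
  have "ck (Suc n) \<Omega> (\<lambda>k. iter_deriv vs (f k))"
    by (rule Cons.IH) (use Cons.prems in auto)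
  then obtain f' where f': "\<And>k w. (k, w) \<in> \<Omega> \<Longrightarrow> (iter_deriv vs (f k) has_derivative f' k w) (at w)"
    and f'': "\<And>b. b \<in> Basis \<Longrightarrow> ck n \<Omega> (\<lambda>k w. f' k w b)"
    by (rule ck_SucE) blast
  have "ck n \<Omega> (\<lambda>k w. f' k w v)" using Cons.prems by (intro f'') auto
  then show ?case
    by (rule ck_cong[OF \<Omega>, rotated]) (use frechet_derivative_at[OF f'] in auto)
qed auto

lemma ck_imp_smooth_on:
  assumes \<Omega>: "open_slices \<Omega>" and f: "\<And>n. ck n \<Omega> f"
  shows "smooth_on (f k) {w. (k, w) \<in> \<Omega>}"
  unfolding smooth_on_def
proof (intro conjI allI impI)
  show o: "open {w. (k, w) \<in> \<Omega>}" using \<Omega> by (auto simp: open_slices_def)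
  fix vs :: "'b list" assume "set vs \<subseteq> Basis"
  then have "ck (Suc 0) \<Omega> (\<lambda>k. iter_deriv vs (f k))"
    using f by (intro ck_iter_deriv[OF \<Omega>])
  then obtain f' where f': "\<And>k w. (k, w) \<in> \<Omega> \<Longrightarrow> (iter_deriv vs (f k) has_derivative f' k w) (at w)"
    by (rule ck_SucE) blast
  then show "iter_deriv vs (f k) differentiable_on {w. (k, w) \<in> \<Omega>}"
    using o by (intro differentiable_at_imp_differentiable_on) (auto simp: differentiable_def)
qed

text \<open>The parameters \<open>s n\<close> together with their limit form a compact set, so joint
  continuity on its product with \<open>L\<close> is uniform. With \<open>g\<close> an iterated
  derivative this is the convergence demanded of the surfaces.\<close>

lemma continuous_imp_uniform_limit:
  fixes g :: "'i::heine_borel \<Rightarrow> 'a::metric_space \<Rightarrow> 'b::metric_space"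
  assumes g: "continuous_on \<Omega> (\<lambda>(k, w). g k w)" and L: "compact L"
    and s: "s \<longlonglongrightarrow> k0" and sub: "\<And>n. {s n} \<times> L \<subseteq> \<Omega>" "{k0} \<times> L \<subseteq> \<Omega>"
  shows "uniform_limit L (\<lambda>n. g (s n)) (g k0) sequentially"
proof -
  define T where "T = insert k0 (range s)"
  have "compact T"
    unfolding T_def using s by (rule compact_sequence_with_limit)
  then have "compact (T \<times> L)" using L by (rule compact_Times)
  moreover have "T \<times> L \<subseteq> \<Omega>" using sub by (auto simp: T_def)
  ultimately have "uniformly_continuous_on (T \<times> L) (\<lambda>(k, w). g k w)"
    using g by (auto intro: compact_uniformly_continuous continuous_on_subset)
  show ?thesis
  proof (rule uniform_limitI)
    fix e :: real assume "e > 0"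
    then obtain d where d: "d > 0" "\<And>x x'. x \<in> T \<times> L \<Longrightarrow> x' \<in> T \<times> L \<Longrightarrow> dist x' x < d \<Longrightarrow>
        dist (case x' of (k, w) \<Rightarrow> g k w) (case x of (k, w) \<Rightarrow> g k w) < e"
      using \<open>uniformly_continuous_on (T \<times> L) (\<lambda>(k, w). g k w)\<close>
      unfolding uniformly_continuous_on_def by metis
    from tendstoD[OF s d(1)] show "\<forall>\<^sub>F n in sequentially. \<forall>w\<in>L. dist (g (s n) w) (g k0 w) < e"
    proof eventually_elim
      case (elim n)
      then show ?case using d(2)[of "(k0, _)" "(s n, _)"] by (auto simp: T_def dist_Pair_Pair)
    qed
  qed
qed

section \<open>Implicitly defined functions\<close>

text \<open>A pointwise implicit function theorem: the linearized equation first yields a Lipschitz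
  bound for \<open>Y\<close> at \<open>w0\<close>, and that bound then turns the error term of
  \<open>p\<close> into an error of smaller order than \<open>norm (w - w0)\<close>.\<close>

lemma implicit_has_derivative:
  fixes p :: "'a::real_normed_vector \<times> real \<Rightarrow> real" and Y :: "'a \<Rightarrow> real"
  assumes p: "(p has_derivative A) (at (w0, Y w0))" and c: "A (0, 1) \<noteq> 0"
    and Y: "continuous (at w0) Y" and ev: "\<forall>\<^sub>F w in nhds w0. p (w, Y w) = 0"
  shows "(Y has_derivative (\<lambda>v. - A (v, 0) / A (0, 1))) (at w0)"
proof -
  define c where "c = A (0, 1)"
  have lin: "bounded_linear A" using p by (rule has_derivative_bounded_linear)
  have A: "A (v, s) = A (v, 0) + s * c" for v s
  proof -
    have "A (v, s) = A ((v, 0) + s *\<^sub>R (0, 1))" by simp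
    also have "\<dots> = A (v, 0) + s * c"
      using bounded_linear.linear[OF lin] by (simp only: linear_add linear_cmul real_scaleR_def c_def)
    finally show ?thesis .
  qed
  obtain K where K: "K > 0" "\<And>x. norm (A x) \<le> norm x * K"
    using bounded_linear.pos_bounded[OF lin] by blast
  have KA: "\<bar>A (v, 0)\<bar> \<le> K * norm v" for v
    using K(2)[of "(v, 0)"] by (simp add: mult.commute norm_Pair)
  have bl: "bounded_linear (\<lambda>v. - A (v, 0) / A (0, 1))"
    by (intro bounded_linear_divide bounded_linear_compose[OF bounded_linear_divide] bounded_linear_minus
        bounded_linear_compose[OF lin] bounded_linear_Pair bounded_linear_ident bounded_linear_zero)
  have c0: "\<bar>c\<bar> > 0" using assms(2) by (simp add: c_def)
  define C where "C = 2 * (K + \<bar>c\<bar>) / \<bar>c\<bar>"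
  have C0: "C > 0" using K c0 by (simp add: C_def)
  show ?thesis
    unfolding has_derivative_at_alt
  proof (intro conjI allI impI bl)
    fix e :: real assume e: "e > 0"
    \<comment> \<open>The first entry lets \<open>\<epsilon> * E\<close> be absorbed into
      \<open>E * \<bar>c\<bar>\<close>, which gives \<open>E \<le> C * D\<close>; the second makes
      the final error at most \<open>e * D\<close> after division by
      \<open>\<bar>c\<bar>\<close>.\<close>
    define \<epsilon> where "\<epsilon> = min (\<bar>c\<bar> / 2) (e * \<bar>c\<bar> / (1 + C))"
    have \<epsilon>: "\<epsilon> > 0" "\<epsilon> \<le> \<bar>c\<bar> / 2" "\<epsilon> * (1 + C) \<le> e * \<bar>c\<bar>"
    proof -
      have "\<epsilon> \<le> e * \<bar>c\<bar> / (1 + C)" by (simp add: \<epsilon>_def)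
      then show "\<epsilon> * (1 + C) \<le> e * \<bar>c\<bar>" using C0 by (simp add: pos_le_divide_eq)
      show "\<epsilon> > 0" using c0 e C0 by (simp add: \<epsilon>_def)
      show "\<epsilon> \<le> \<bar>c\<bar> / 2" unfolding \<epsilon>_def by (rule min.cobounded1)
    qed
    obtain d where d: "d > 0" "\<And>y. norm (y - (w0, Y w0)) < d \<Longrightarrow>
        norm (p y - p (w0, Y w0) - A (y - (w0, Y w0))) \<le> \<epsilon> * norm (y - (w0, Y w0))"
      using p \<epsilon>(1) unfolding has_derivative_at_alt by blast
    have "((\<lambda>w. (w, Y w)) \<longlongrightarrow> (w0, Y w0)) (nhds w0)"
      using Y by (intro tendsto_intros) (auto simp: continuous_at tendsto_at_iff_tendsto_nhds filterlim_ident)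
    then have "\<forall>\<^sub>F w in nhds w0. dist (w, Y w) (w0, Y w0) < d"
      using d(1) by (rule tendstoD)
    with ev have "\<forall>\<^sub>F w in nhds w0. p (w, Y w) = 0 \<and> dist (w, Y w) (w0, Y w0) < d"
      by (rule eventually_conj)
    then obtain r where r: "r > 0" "\<And>w. dist w w0 < r \<Longrightarrow> p (w, Y w) = 0 \<and> dist (w, Y w) (w0, Y w0) < d"
      unfolding eventually_nhds_metric by blast
    have p0: "p (w0, Y w0) = 0" using r(2)[of w0] r(1) by simp
    show "\<exists>d>0. \<forall>y. norm (y - w0) < d \<longrightarrow>
        norm (Y y - Y w0 - - A (y - w0, 0) / A (0, 1)) \<le> e * norm (y - w0)"
    proof (intro exI conjI allI impI, rule r(1))
      fix w assume "norm (w - w0) < r"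
      then have w: "p (w, Y w) = 0" "norm ((w, Y w) - (w0, Y w0)) < d"
        using r(2)[of w] by (auto simp: dist_norm)
      define D where "D = norm (w - w0)"
      define E where "E = \<bar>Y w - Y w0\<bar>"
      define R where "R = A (w - w0, 0) + (Y w - Y w0) * c"
      have "\<bar>R\<bar> \<le> \<epsilon> * norm (w - w0, Y w - Y w0)"
        using d(2)[OF w(2)] w(1) p0 A[of "w - w0" "Y w - Y w0"] by (simp add: R_def)
      also have "\<dots> \<le> \<epsilon> * (D + E)"
        using norm_Pair_le[of "w - w0" "Y w - Y w0"] \<epsilon>(1) by (intro mult_left_mono) (auto simp: D_def E_def)
      finally have R: "\<bar>R\<bar> \<le> \<epsilon> * (D + E)" .
      have DE: "D \<ge> 0" "E \<ge> 0" by (auto simp: D_def E_def)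
      have "E * \<bar>c\<bar> = \<bar>R - A (w - w0, 0)\<bar>"
        by (simp add: E_def R_def abs_mult)
      also have "\<dots> \<le> \<epsilon> * (D + E) + K * D"
        using R KA[of "w - w0"] by (simp add: D_def)
      also have "\<dots> \<le> \<bar>c\<bar> / 2 * (D + E) + K * D"
        using \<epsilon>(2) DE by (intro add_right_mono mult_right_mono) auto
      finally have "E * \<bar>c\<bar> / 2 \<le> (\<bar>c\<bar> / 2 + K) * D"
        by (simp add: algebra_simps add_divide_distrib)
      also have "\<dots> \<le> (\<bar>c\<bar> + K) * D" using DE by (intro mult_right_mono) auto
      finally have E: "E \<le> C * D" using c0 by (simp add: C_def field_simps)
      have "\<bar>R\<bar> \<le> \<epsilon> * (D + E)" by (rule R)
      also have "\<dots> \<le> \<epsilon> * ((1 + C) * D)"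
        using E \<epsilon>(1) by (intro mult_left_mono) (auto simp: algebra_simps)
      also have "\<dots> \<le> e * \<bar>c\<bar> * D" using \<epsilon>(3) DE by (simp add: mult.assoc[symmetric] mult_right_mono)
      finally have "\<bar>R\<bar> / \<bar>c\<bar> \<le> e * D" using c0 by (simp add: field_simps)
      moreover have "Y w - Y w0 - - A (w - w0, 0) / A (0, 1) = R / c"
        using c0 by (simp add: R_def c_def[symmetric] field_simps)
      ultimately show "norm (Y w - Y w0 - - A (w - w0, 0) / A (0, 1)) \<le> e * norm (w - w0)"
        by (simp add: D_def)
    qed
  qed
qed

text \<open>A bootstrap: the derivative of \<open>Y\<close> is a quotient of partial derivatives of
  \<open>p\<close> evaluated along \<open>Y\<close>, so order \<open>n\<close> for \<open>Y\<close>
  gives order \<open>n + 1\<close>. The non-degeneracy condition speaks of any real derivative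
  \<open>c\<close>, so that it can be checked without knowing the derivative that \<open>ck\<close>
  provides.\<close>

lemma ck_implicit:
  fixes p :: "'i::topological_space \<Rightarrow> 'a::euclidean_space \<times> real \<Rightarrow> real" and Y :: "'i \<Rightarrow> 'a \<Rightarrow> real"
  assumes \<Omega>: "open_slices \<Omega>" and p: "\<And>n. ck n \<Omega>' p" and Y: "continuous_on \<Omega> (\<lambda>(k, w). Y k w)"
    and sub: "\<And>k w. (k, w) \<in> \<Omega> \<Longrightarrow> (k, (w, Y k w)) \<in> \<Omega>'"
    and eq: "\<And>k w. (k, w) \<in> \<Omega> \<Longrightarrow> p k (w, Y k w) = 0"
    and nz: "\<And>k w c. (k, w) \<in> \<Omega> \<Longrightarrow> ((\<lambda>s. p k (w, s)) has_real_derivative c) (at (Y k w)) \<Longrightarrow> c \<noteq> 0"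
  shows "ck n \<Omega> Y"
proof (induction n)
  case 0
  show ?case using Y by simp
next
  case (Suc n)
  from p[of "Suc n"] obtain p' where p': "\<And>k w. (k, w) \<in> \<Omega>' \<Longrightarrow> (p k has_derivative p' k w) (at w)"
    and p'': "\<And>b. b \<in> Basis \<Longrightarrow> ck n \<Omega>' (\<lambda>k w. p' k w b)"
    by (rule ck_SucE) blast
  have c: "p' k (w, Y k w) (0, 1) \<noteq> 0" if "(k, w) \<in> \<Omega>" for k w
  proof (rule nz[OF that])
    have d: "(p k has_derivative p' k (w, Y k w)) (at (w, Y k w))"
      using p' sub[OF that] by blast
    have "((\<lambda>s. (w, s)) has_derivative (\<lambda>s. (0, s))) (at (Y k w))"
      by (auto intro!: derivative_eq_intros)
    from has_derivative_compose[OF this d]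
    have "((\<lambda>s. p k (w, s)) has_derivative (\<lambda>s. p' k (w, Y k w) (0, s))) (at (Y k w))" .
    moreover have "(\<lambda>s. p' k (w, Y k w) (0, s)) = (*) (p' k (w, Y k w) (0, 1))"
    proof
      fix s
      show "p' k (w, Y k w) (0, s) = p' k (w, Y k w) (0, 1) * s"
        using linear_cmul[OF has_derivative_linear[OF d], of s "(0, 1)"] by (simp add: mult.commute)
    qed
    ultimately show "((\<lambda>s. p k (w, s)) has_real_derivative p' k (w, Y k w) (0, 1)) (at (Y k w))"
      unfolding has_field_derivative_def by (simp only:)
  qed
  show ?case
  proof (rule ck_SucI)
    show "continuous_on \<Omega> (\<lambda>(k, w). Y k w)" by (rule Y)
    show "(Y k has_derivative (\<lambda>v. - p' k (w, Y k w) (v, 0) / p' k (w, Y k w) (0, 1))) (at w)"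
      if "(k, w) \<in> \<Omega>" for k w
    proof (rule implicit_has_derivative)
      show "(p k has_derivative p' k (w, Y k w)) (at (w, Y k w))"
        using p' sub[OF that] by blast
      have o: "open {w. (k, w) \<in> \<Omega>}" using \<Omega> by (auto simp: open_slices_def)
      then show "\<forall>\<^sub>F w in nhds w. p k (w, Y k w) = 0"
        using that eq by (auto simp: eventually_nhds)
      have "continuous_on {w. (k, w) \<in> \<Omega>} (\<lambda>w. case (k, w) of (k, w) \<Rightarrow> Y k w)"
        by (rule continuous_on_compose2[OF Y]) (auto intro!: continuous_intros)
      then show "continuous (at w) (Y k)"
        using o that by (simp add: continuous_on_eq_continuous_at)
    qed (use c that in auto)
    fix b :: 'a assume b: "b \<in> Basis"
    have comp: "ck n \<Omega> (\<lambda>k w. p' k (w, Y k w) b')" if "b' \<in> Basis" for b'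
      by (rule ck_compose[OF p''[OF that], where g = "\<lambda>k w. (w, Y k w)"])
        (use sub in \<open>auto intro!: ck_Pair ck_id Suc.IH\<close>)
    have "ck n \<Omega> (\<lambda>k w. - p' k (w, Y k w) (b, 0) * inverse (p' k (w, Y k w) (0, 1)))"
      by (intro ck_mult ck_minus ck_inverse_real comp c) (use b in \<open>auto simp: Basis_prod_def\<close>)
    then show "ck n \<Omega> (\<lambda>k w. - p' k (w, Y k w) (b, 0) / p' k (w, Y k w) (0, 1))"
      by (simp add: field_simps)
  qed
qed

section \<open>Holomorphic families\<close>

text \<open>Joint continuity alone suffices: it makes \<open>f k'\<close> uniformly close to
  \<open>f k\<close> on a disc, and the Cauchy inequality transfers closeness to the derivatives.
  The first hypothesis provides a disc whose radius is the same for all parameters near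
  \<open>k\<close>.\<close>

lemma ck_holomorphic:
  fixes f :: "'i::topological_space \<Rightarrow> complex \<Rightarrow> complex"
  assumes op: "\<And>k w. (k, w) \<in> \<Omega> \<Longrightarrow> \<exists>A r. open A \<and> k \<in> A \<and> r > 0 \<and> (fst ` \<Omega> \<inter> A) \<times> cball w r \<subseteq> \<Omega>"
    and cont: "continuous_on \<Omega> (\<lambda>(k, w). f k w)"
    and holo: "\<And>k. f k holomorphic_on {w. (k, w) \<in> \<Omega>}"
  shows "ck n \<Omega> f"
  using cont holo
proof (induction n arbitrary: f)
  case (Suc n)
  have o: "open {w. (k, w) \<in> \<Omega>}" for k
    unfolding open_contains_cball
  proof safe
    fix w assume "(k, w) \<in> \<Omega>"
    with op[OF this] show "\<exists>e>0. cball w e \<subseteq> {w. (k, w) \<in> \<Omega>}" by force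
  qed
  have der: "(f k has_field_derivative deriv (f k) w) (at w)" if "(k, w) \<in> \<Omega>" for k w
    using Suc.prems(2) o that by (auto intro: holomorphic_derivI)
  have cont': "continuous_on \<Omega> (\<lambda>(k, w). deriv (f k) w)"
    unfolding continuous_on_def
  proof
    fix x assume x: "x \<in> \<Omega>"
    obtain k w where kw: "x = (k, w)" by (cases x)
    obtain A r where A: "open A" "k \<in> A" "r > 0" "(fst ` \<Omega> \<inter> A) \<times> cball w r \<subseteq> \<Omega>"
      using op[of k w] x kw by auto
    have k: "k \<in> fst ` \<Omega>" using x kw by force
    have "isCont (deriv (f k)) w"
      using holomorphic_deriv[OF Suc.prems(2)[of k] o] x kw o
      by (auto dest!: holomorphic_on_imp_continuous_on simp: continuous_on_eq_continuous_at)
    show "((\<lambda>(k, w). deriv (f k) w) \<longlongrightarrow> (case x of (k, w) \<Rightarrow> deriv (f k) w)) (at x within \<Omega>)"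
      unfolding tendsto_iff
    proof (intro allI impI)
      fix e :: real assume e: "e > 0"
      \<comment> \<open>Chosen so that the Cauchy inequality with radius \<open>r/2\<close> gives
        \<open>e / 4\<close> for the derivatives.\<close>
      define e1 where "e1 = e * (r/2) / 4"
      have e1: "e1 > 0" using e A by (simp add: e1_def)
      define K where "K = cball w r"
      \<comment> \<open>Pointwise continuity is made uniform over the compact disc \<open>K\<close>
        by a finite subcover; the intersection of finitely many parameter neighbourhoods is still
        open.\<close>
      have "\<exists>A'. open A' \<and> k \<in> A' \<and> (\<forall>k'\<in>A' \<inter> A \<inter> fst ` \<Omega>. \<forall>z\<in>K. dist (f k' z) (f k z) < e1)"
      proof -
        have "\<exists>B C. open B \<and> open C \<and> k \<in> B \<and> z \<in> C \<and>
            (\<forall>k'\<in>B \<inter> A \<inter> fst ` \<Omega>. \<forall>z'\<in>C \<inter> K. dist (f k' z') (f k z') < e1)" if "z \<in> K" for z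
        proof -
          have kz: "(k, z) \<in> \<Omega>" using A k that by (auto simp: K_def)
          have "\<forall>\<^sub>F y in at (k, z) within \<Omega>. dist (case y of (k, w) \<Rightarrow> f k w) (f k z) < e1 / 2"
          proof -
            have "((\<lambda>(k, w). f k w) \<longlongrightarrow> (case (k, z) of (k, w) \<Rightarrow> f k w)) (at (k, z) within \<Omega>)"
              using Suc.prems(1) kz unfolding continuous_on_def by blast
            from tendstoD[OF this, of "e1 / 2"] show ?thesis using e1 by simp
          qed
          then obtain W where W: "open W" "(k, z) \<in> W"
            "\<And>y. y \<in> W \<Longrightarrow> y \<in> \<Omega> \<Longrightarrow> dist (case y of (k, w) \<Rightarrow> f k w) (f k z) < e1 / 2"
            unfolding eventually_at_topological using e1 by (metis (no_types, lifting) case_prod_conv dist_self half_gt_zero)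
          obtain B C where BC: "open B" "open C" "k \<in> B" "z \<in> C" "B \<times> C \<subseteq> W"
            using open_prod_elim[OF W(1,2)] by (metis mem_Sigma_iff)
          have "dist (f k' z') (f k z') < e1" if "k' \<in> B \<inter> A \<inter> fst ` \<Omega>" "z' \<in> C \<inter> K" for k' z'
          proof -
            have "(k', z') \<in> \<Omega>" "(k, z') \<in> \<Omega>" using A k that by (auto simp: K_def)
            then have "dist (f k' z') (f k z) < e1 / 2" "dist (f k z') (f k z) < e1 / 2"
              using W(3)[of "(k', z')"] W(3)[of "(k, z')"] BC that by auto
            then show ?thesis by (metis dist_triangle_half_l)
          qed
          then show ?thesis using BC by blast
        qed
        then obtain B C where BC: "\<And>z. z \<in> K \<Longrightarrow> open (B z) \<and> open (C z) \<and> k \<in> B z \<and> z \<in> C z \<and>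
            (\<forall>k'\<in>B z \<inter> A \<inter> fst ` \<Omega>. \<forall>z'\<in>C z \<inter> K. dist (f k' z') (f k z') < e1)"
          by metis
        have "compact K" by (simp add: K_def)
        then obtain Z where Z: "Z \<subseteq> K" "finite Z" "K \<subseteq> (\<Union>z\<in>Z. C z)"
          by (rule compactE_image[where f = C and C = K]) (use BC in auto)
        show ?thesis
        proof (intro exI conjI ballI)
          show "open (\<Inter>z\<in>Z. B z)" using Z BC by (intro open_INT) auto
          show "k \<in> (\<Inter>z\<in>Z. B z)" using Z BC by auto
          fix k' z' assume k': "k' \<in> (\<Inter>z\<in>Z. B z) \<inter> A \<inter> fst ` \<Omega>" and z': "z' \<in> K"
          obtain z where z: "z \<in> Z" "z' \<in> C z" using Z z' by blast
          have "k' \<in> B z \<inter> A \<inter> fst ` \<Omega>" "z' \<in> C z \<inter> K" "z \<in> K" using k' z z' Z by auto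
          then show "dist (f k' z') (f k z') < e1" using BC by blast
        qed
      qed
      then obtain A' where A': "open A'" "k \<in> A'"
        "\<And>k' z. k' \<in> A' \<inter> A \<inter> fst ` \<Omega> \<Longrightarrow> z \<in> K \<Longrightarrow> dist (f k' z) (f k z) < e1" by blast
      obtain \<delta> where \<delta>: "\<delta> > 0" "\<And>z. dist z w < \<delta> \<Longrightarrow> dist (deriv (f k) z) (deriv (f k) w) < e / 2"
        using \<open>isCont (deriv (f k)) w\<close> e unfolding continuous_at_eps_delta by (metis half_gt_zero)
      have main: "dist (deriv (f k') z) (deriv (f k) w) < e"
        if k': "k' \<in> A' \<inter> A" and z: "dist z w < min \<delta> (r/2)" and "(k', z) \<in> \<Omega>" for k' z
      proof -
        have k'': "k' \<in> A' \<inter> A \<inter> fst ` \<Omega>" using that by force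
        have cb: "cball z (r/2) \<subseteq> K"
        proof
          fix y assume "y \<in> cball z (r/2)"
          then show "y \<in> K" using z dist_triangle[of w y z] by (simp add: K_def dist_commute)
        qed
        have in\<Omega>: "{k'} \<times> K \<subseteq> \<Omega>" "{k} \<times> K \<subseteq> \<Omega>" using A k k'' by (auto simp: K_def)
        have h: "f k' holomorphic_on cball z (r/2)" "f k holomorphic_on cball z (r/2)"
          by (rule holomorphic_on_subset[OF Suc.prems(2)], use cb in\<Omega> in auto)+
        have zin: "z \<in> cball z (r/2)" using A by simp
        have d: "(f k' has_field_derivative deriv (f k') z) (at z)" "(f k has_field_derivative deriv (f k) z) (at z)"
          using in\<Omega> subsetD[OF cb zin] by (auto intro!: der)
        have "norm ((deriv ^^ 1) (\<lambda>y. f k' y - f k y) z) \<le> fact 1 * e1 / (r/2)^1"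
        proof (rule Cauchy_inequality)
          show "(\<lambda>y. f k' y - f k y) holomorphic_on ball z (r/2)"
            using h by (intro holomorphic_intros) (auto intro: holomorphic_on_subset)
          show "continuous_on (cball z (r/2)) (\<lambda>y. f k' y - f k y)"
            using h by (intro continuous_intros) (auto intro: holomorphic_on_imp_continuous_on)
          fix x assume "norm (z - x) = r/2"
          then have "x \<in> K" using cb by (auto simp: dist_norm)
          then show "norm (f k' x - f k x) \<le> e1" using A'(3)[OF k''] by (force simp: dist_norm)
        qed (use A in auto)
        have "norm (deriv (f k') z - deriv (f k) z) \<le> e1 / (r/2)"
        proof -
          have "f k' field_differentiable at z" "f k field_differentiable at z"
            unfolding field_differentiable_def using d by blast+
          then show ?thesis
            using \<open>norm ((deriv ^^ 1) (\<lambda>y. f k' y - f k y) z) \<le> fact 1 * e1 / (r/2)^1\<close>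
            by (simp add: deriv_diff)
        qed
        also have "\<dots> = e / 4" using A by (simp add: e1_def)
        finally have "dist (deriv (f k') z) (deriv (f k) z) < e / 2" using e by (simp add: dist_norm)
        moreover have "dist (deriv (f k) z) (deriv (f k) w) < e / 2" using \<delta> z by auto
        ultimately show ?thesis by (metis dist_commute dist_triangle_half_l)
      qed
      show "\<forall>\<^sub>F y in at x within \<Omega>. dist (case y of (k, w) \<Rightarrow> deriv (f k) w)
          (case x of (k, w) \<Rightarrow> deriv (f k) w) < e"
        unfolding eventually_at_topological
      proof (intro exI conjI ballI impI)
        show "open ((A' \<inter> A) \<times> ball w (min \<delta> (r/2)))" using A A' by (intro open_Times) auto
        show "x \<in> (A' \<inter> A) \<times> ball w (min \<delta> (r/2))" using A A' \<delta> kw by auto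
        fix y assume "y \<in> (A' \<inter> A) \<times> ball w (min \<delta> (r/2))" "y \<in> \<Omega>"
        then show "dist (case y of (k, w) \<Rightarrow> deriv (f k) w) (case x of (k, w) \<Rightarrow> deriv (f k) w) < e"
          using main kw by (cases y) (auto simp: dist_commute)
      qed
    qed
  qed
  have "ck n \<Omega> (\<lambda>k. deriv (f k))"
    by (rule Suc.IH[OF cont']) (use holomorphic_deriv[OF Suc.prems(2) o] in auto)
  then have "ck n \<Omega> (\<lambda>k w. deriv (f k) w * b)" for b
    by (intro ck_mult ck_const)
  then show ?case
    using der Suc.prems(1)
    by (intro ck_SucI[where f' = "\<lambda>k w v. deriv (f k) w * v"]) (auto simp: has_field_derivative_def)
qed auto

section \<open>The Weierstrass data\<close>

text \<open>The points are enumerated by dyadic level: the indices from \<open>2^n\<close> to \<open>2^(n+1)\<close> give a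
  net of mesh about \<open>2^(-n)\<close>.\<close>

lemma ex_dense_sequence:
  fixes S :: "real set"
  assumes S: "closed S" "S \<noteq> {}" "S \<subseteq> {-2..2}"
  obtains p :: "nat \<Rightarrow> real" where "\<And>j. p j \<in> S"
    and "\<And>x \<eta>. x \<in> S \<Longrightarrow> 0 < \<eta> \<Longrightarrow> \<eta> \<le> 4 \<Longrightarrow> \<exists>j. \<bar>x - p j\<bar> \<le> \<eta> \<and> \<eta> * (real j + 1) \<le> 32"
proof -
  \<comment> \<open>For \<open>j = 2^n + i\<close> with \<open>i < 2^n\<close> this equals
    \<open>4 * i / 2^n - 2\<close>: each dyadic block of indices runs through a grid of mesh
    \<open>4 / 2^n\<close> in the interval from -2 to 2, and \<open>- 6\<close> removes the
    contribution of the leading \<open>2^n\<close>.\<close>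
  define t :: "nat \<Rightarrow> real" where "t j = 4 * (real j / 2 ^ floor_log j) - 6" for j
  have "\<exists>y. y \<in> S \<and> infdist (t j) S = dist (t j) y" for j
    using infdist_attains_inf[OF S(1,2), of "t j"] by metis
  then obtain p where p: "\<And>j. p j \<in> S" "\<And>j. infdist (t j) S = dist (t j) (p j)" by metis
  have "\<exists>j. \<bar>x - p j\<bar> \<le> \<eta> \<and> \<eta> * (real j + 1) \<le> 32" if x: "x \<in> S" and \<eta>: "0 < \<eta>" "\<eta> \<le> 4" for x \<eta>
  proof -
    have ex: "\<exists>n. 8 / 2 ^ n \<le> \<eta>"
    proof -
      obtain n where "8 / \<eta> < 2 ^ n" using real_arch_pow[of 2 "8 / \<eta>"] by auto
      then show ?thesis using \<eta> by (intro exI[of _ n]) (simp add: field_simps)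
    qed
    \<comment> \<open>Leastness matters: it also gives \<open>\<eta> < 16 / 2 ^ n\<close>, which
      bounds the index \<open>j\<close> found in block \<open>n\<close>.\<close>
    define n where "n = (LEAST n. 8 / 2 ^ n \<le> \<eta>)"
    have n: "8 / 2 ^ n \<le> \<eta>" unfolding n_def by (rule LeastI_ex[OF ex])
    have "n \<noteq> 0" using n \<eta> by (intro notI) simp
    then obtain m where m: "n = Suc m" by (cases n) auto
    have "\<not> 8 / 2 ^ m \<le> \<eta>" using not_less_Least[of m "\<lambda>n. 8 / 2 ^ n \<le> \<eta>"] m by (simp add: n_def)
    then have n': "\<eta> < 16 / 2 ^ n" by (simp add: m)
    define \<sigma> where "\<sigma> = (x + 2) / 4"
    have \<sigma>: "0 \<le> \<sigma>" "\<sigma> \<le> 1" using x S(3) by (auto simp: \<sigma>_def)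
    \<comment> \<open>The minimum only acts at the right end \<open>\<sigma> = 1\<close>, where the
      floor would leave the block.\<close>
    define i where "i = min (nat \<lfloor>\<sigma> * 2 ^ n\<rfloor>) (2 ^ n - 1)"
    have i1: "i < 2 ^ n"
    proof -
      have "i \<le> 2 ^ n - 1" "(0::nat) < 2 ^ n" by (simp_all add: i_def)
      then show ?thesis by linarith
    qed
    have i2: "real i \<le> \<sigma> * 2 ^ n" "\<sigma> * 2 ^ n \<le> real i + 1"
    proof -
      have f: "real (nat \<lfloor>\<sigma> * 2 ^ n\<rfloor>) \<le> \<sigma> * 2 ^ n" "\<sigma> * 2 ^ n < real (nat \<lfloor>\<sigma> * 2 ^ n\<rfloor>) + 1"
        using \<sigma> by (auto simp: of_nat_nat intro!: floor_correct)
      have "real i \<le> real (nat \<lfloor>\<sigma> * 2 ^ n\<rfloor>)" by (simp add: i_def)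
      then show "real i \<le> \<sigma> * 2 ^ n" using f(1) by linarith
      have "\<sigma> * 2 ^ n \<le> 2 ^ n" using \<sigma> by simp
      then show "\<sigma> * 2 ^ n \<le> real i + 1" using f(2) by (auto simp: i_def min_def of_nat_diff)
    qed
    define j where "j = 2 ^ n + i"
    have "floor_log j = n" by (rule floor_log_eqI) (use i1 in \<open>auto simp: j_def\<close>)
    then have t: "t j = 4 * (real i / 2 ^ n) - 2" by (simp add: t_def j_def add_divide_distrib)
    have "x = 4 * \<sigma> - 2" by (simp add: \<sigma>_def add_divide_distrib)
    then have "x - t j = 4 * (\<sigma> - real i / 2 ^ n)" by (simp add: t)
    then have "\<bar>x - t j\<bar> = 4 * \<bar>\<sigma> - real i / 2 ^ n\<bar>" by (simp only: abs_mult)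
    also have "\<sigma> - real i / 2 ^ n = (\<sigma> * 2 ^ n - real i) / 2 ^ n" by (simp add: field_simps)
    also have "4 * \<bar>(\<sigma> * 2 ^ n - real i) / 2 ^ n\<bar> \<le> 4 * (1 / 2 ^ n)"
    proof -
      have "\<bar>\<sigma> * 2 ^ n - real i\<bar> \<le> 1" using i2 by (simp add: abs_le_iff)
      from divide_right_mono[OF this, of "2 ^ n"] show ?thesis by simp
    qed
    finally have xt: "\<bar>x - t j\<bar> \<le> 4 / 2 ^ n" by simp
    \<comment> \<open>\<open>p j\<close> is a point of \<open>S\<close> nearest to
      \<open>t j\<close>, hence no farther from it than \<open>x\<close>; replacing the grid point
      by a point of \<open>S\<close> at most doubles the distance.\<close>
    have "dist (t j) (p j) \<le> dist (t j) x" using infdist_le[OF x, of "t j"] p(2) by simp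
    then have "\<bar>x - p j\<bar> \<le> 8 / 2 ^ n" using xt unfolding dist_real_def by linarith
    then have "\<bar>x - p j\<bar> \<le> \<eta>" using n by linarith
    moreover have "\<eta> * (real j + 1) \<le> 32"
    proof -
      have "j + 1 \<le> 2 * 2 ^ n" using i1 by (simp add: j_def)
      then have "real (j + 1) \<le> real (2 * 2 ^ n)" unfolding of_nat_le_iff .
      then have "real j + 1 \<le> 2 * 2 ^ n" by simp
      then have "\<eta> * (real j + 1) \<le> 16 / 2 ^ n * (2 * 2 ^ n)" using n' \<eta> by (intro mult_mono) auto
      then show ?thesis by simp
    qed
    ultimately show ?thesis by blast
  qed
  with p(1) show ?thesis using that by blast
qed

section \<open>Estimates for one kernel\<close>

text \<open>\<zeta> differs from its value \<open>a\<close> at height 0 by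
  \<open>- y^2 + 2 * i * s * y\<close>, which with \<open>q = \<bar>y\<bar> / d\<close> is at most
  \<open>6 * q * a\<close>. As \<open>q \<le> 1 / 100\<close>, this keeps the modulus of \<zeta>
  above \<open>0.94 * a\<close> and that of \<open>\<zeta> + a\<close> below
  \<open>2.06 * a\<close>; factoring the difference of squares gives
  \<open>6 * 2.06 / 0.94^2\<close>, just below 14, and 15 is a round bound for it.\<close>

lemma kernel_estimate:
  fixes s \<kappa> y d :: real
  defines "\<zeta> \<equiv> (Complex s y)\<^sup>2 + (complex_of_real \<kappa>)\<^sup>2" and "a \<equiv> s\<^sup>2 + \<kappa>\<^sup>2"
  assumes d: "0 < d" "d \<le> \<bar>s\<bar> + \<bar>\<kappa>\<bar>" and y: "\<bar>y\<bar> \<le> d / 100"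
  shows "\<zeta> \<noteq> 0" and "d\<^sup>2 / 2 \<le> a" and "cmod (1 / \<zeta>\<^sup>2 - of_real (1 / a\<^sup>2)) \<le> 15 * (\<bar>y\<bar> / d) * (1 / a\<^sup>2)"
proof -
  define l where "l = \<bar>s\<bar> + \<bar>\<kappa>\<bar>"
  have l: "l > 0" "d \<le> l" using d by (auto simp: l_def)
  have al: "l\<^sup>2 / 2 \<le> a"
    using sum_squares_bound[of "\<bar>s\<bar>" "\<bar>\<kappa>\<bar>"] by (simp add: a_def l_def power2_sum)
  have "d\<^sup>2 \<le> l\<^sup>2" using l d by (intro power_mono) auto
  then show da: "d\<^sup>2 / 2 \<le> a" using al by simp
  have a: "a > 0" using da d by (smt (verit) half_gt_zero zero_less_power)
  define q where "q = \<bar>y\<bar> / d"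
  have q: "0 \<le> q" "q \<le> 1 / 100" using d y by (auto simp: q_def field_simps)
  have yq: "\<bar>y\<bar> = q * d" using d by (simp add: q_def)
  have "\<zeta> - of_real a = Complex (- y\<^sup>2) (2 * s * y)"
    by (simp add: \<zeta>_def a_def complex_eq_iff power2_eq_square)
  then have "cmod (\<zeta> - of_real a) \<le> \<bar>- y\<^sup>2\<bar> + \<bar>2 * s * y\<bar>"
    by (metis cmod_le complex.sel)
  also have "\<dots> = \<bar>y\<bar> * (\<bar>y\<bar> + 2 * \<bar>s\<bar>)"
    by (simp add: abs_mult power2_eq_square algebra_simps)
  also have "\<dots> \<le> \<bar>y\<bar> * (3 * l)"
    using y l by (intro mult_left_mono) (auto simp: l_def)
  also have "\<dots> = 3 * q * (d * l)" by (simp add: yq)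
  also have "\<dots> \<le> 3 * q * (2 * a)"
  proof -
    have "d * l \<le> l * l" using l by (intro mult_right_mono) auto
    also have "\<dots> \<le> 2 * a" using al by (simp add: power2_eq_square)
    finally show ?thesis using q by (intro mult_left_mono) auto
  qed
  finally have e: "cmod (\<zeta> - of_real a) \<le> 6 * q * a" by simp
  have qa: "6 * q * a \<le> 6 / 100 * a" using q a by simp
  have ca: "cmod (of_real a) = a" using a by simp
  have z1: "94 / 100 * a \<le> cmod \<zeta>"
  proof -
    have "cmod (of_real a) - cmod (of_real a - \<zeta>) \<le> cmod \<zeta>"
      using norm_triangle_ineq2[of "of_real a" "of_real a - \<zeta>"] by simp
    then show ?thesis using e qa ca norm_minus_commute[of "of_real a" \<zeta>] by linarith
  qed
  then show z0: "\<zeta> \<noteq> 0" using a by auto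
  have z2: "cmod (\<zeta> + of_real a) \<le> 206 / 100 * a"
  proof -
    have "(\<zeta> - of_real a) + 2 * of_real a = \<zeta> + of_real a" "cmod (2 * of_real a) = 2 * a"
      using a by (simp_all add: norm_mult)
    then have "cmod (\<zeta> + of_real a) \<le> cmod (\<zeta> - of_real a) + 2 * a"
      using norm_triangle_ineq[of "\<zeta> - of_real a" "2 * of_real a"] by (simp add: add.commute)
    then show ?thesis using e qa by linarith
  qed
  have "1 / \<zeta>\<^sup>2 - of_real (1 / a\<^sup>2) = - ((\<zeta> - of_real a) * (\<zeta> + of_real a)) / (\<zeta>\<^sup>2 * of_real (a\<^sup>2))"
    using z0 a by (simp add: field_simps power2_eq_square)
  then have "cmod (1 / \<zeta>\<^sup>2 - of_real (1 / a\<^sup>2)) = cmod (\<zeta> - of_real a) * cmod (\<zeta> + of_real a) / ((cmod \<zeta>)\<^sup>2 * a\<^sup>2)"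
    using a by (simp add: norm_divide norm_mult norm_power)
  also have "\<dots> \<le> (6 * q * a) * (206 / 100 * a) / ((94 / 100 * a)\<^sup>2 * a\<^sup>2)"
    using e z1 z2 a q by (intro frac_le mult_mono power_mono mult_pos_pos) auto
  also have "\<dots> = (6 * 206 * 100 / 94\<^sup>2) * q * (1 / a\<^sup>2)"
    using a by (simp add: field_simps power2_eq_square)
  also have "\<dots> \<le> 15 * q * (1 / a\<^sup>2)"
    using q by (intro mult_right_mono) auto
  finally show "cmod (1 / \<zeta>\<^sup>2 - of_real (1 / a\<^sup>2)) \<le> 15 * (\<bar>y\<bar> / d) * (1 / a\<^sup>2)"
    by (simp add: q_def)
qed

text \<open>The interval from -2 to 2 exceeds the height of the cylinder, which leaves room for a
  singular set outside it when \<open>M\<close> is empty.\<close>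

locale blowup_set =
  fixes S :: "real set" and p :: "nat \<Rightarrow> real"
  assumes S: "closed S" "S \<noteq> {}" "S \<subseteq> {-2..2}" and p_in: "\<And>j. p j \<in> S"
    and p_dense: "\<And>x \<eta>. x \<in> S \<Longrightarrow> 0 < \<eta> \<Longrightarrow> \<eta> \<le> 4 \<Longrightarrow> \<exists>j. \<bar>x - p j\<bar> \<le> \<eta> \<and> \<eta> * (real j + 1) \<le> 32"
begin

text \<open>Comparable to the distance from \<open>x\<close> to the closure of the set of poles
  \<open>p j \<plusminus> i \<kappa>\<close> of \<open>f \<kappa>\<close>, hence the natural length
  scale of \<open>f \<kappa>\<close> near \<open>x\<close>.\<close>

definition dd :: "real \<Rightarrow> real \<Rightarrow> real" where
  "dd \<kappa> x = infdist x S + \<bar>\<kappa>\<bar>"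

text \<open>The constant is large enough that \<open>fr \<kappa> x \<ge> 10^8 / (dd \<kappa> x)\<^sup>2\<close>.\<close>

definition wt :: "nat \<Rightarrow> real" where
  "wt j = 2560000000000 / (real j + 1)\<^sup>2"

definition f :: "real \<Rightarrow> complex \<Rightarrow> complex" where
  "f \<kappa> z = (\<Sum>j. of_real (wt j) * (1 / ((z - of_real (p j))\<^sup>2 + (of_real \<kappa>)\<^sup>2)\<^sup>2))"

definition fr :: "real \<Rightarrow> real \<Rightarrow> real" where
  "fr \<kappa> x = (\<Sum>j. wt j * (1 / ((x - p j)\<^sup>2 + \<kappa>\<^sup>2)\<^sup>2))"

text \<open>The aspect ratio 1/100 is the one of \<open>kernel_estimate\<close>; a positive lower
  bound \<eta> for \<open>dd\<close> makes the series uniformly convergent.\<close>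

definition dom :: "real \<Rightarrow> (real \<times> complex) set" where
  "dom \<eta> = {(\<kappa>, z). \<eta> < dd \<kappa> (Re z) \<and> \<bar>Im z\<bar> < dd \<kappa> (Re z) / 100}"

lemma dd_le: "dd \<kappa> x \<le> \<bar>x - p j\<bar> + \<bar>\<kappa>\<bar>"
  using infdist_le[OF p_in, of x j] by (simp add: dd_def dist_real_def)

lemma continuous_dd [continuous_intros]:
  "continuous_on A k \<Longrightarrow> continuous_on A x \<Longrightarrow> continuous_on A (\<lambda>u. dd (k u) (x u))"
  unfolding dd_def by (intro continuous_intros)

lemma open_dom: "open (dom \<eta>)"
proof -
  have "dom \<eta> = {u. \<eta> < dd (fst u) (Re (snd u))} \<inter> {u. \<bar>Im (snd u)\<bar> < dd (fst u) (Re (snd u)) / 100}"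
    by (auto simp: dom_def)
  then show ?thesis
    by (auto intro!: open_Int open_Collect_less continuous_intros)
qed

lemma wt_pos: "0 < wt j"
  by (simp add: wt_def)

lemma summable_wt: "summable wt"
proof -
  have "summable (\<lambda>j. 2560000000000 * inverse (real (Suc j) ^ 2))"
    by (intro summable_mult iffD2[OF summable_Suc_iff] inverse_power_summable) auto
  then show ?thesis by (simp add: wt_def[abs_def] field_simps)
qed

lemma kernel_bounds:
  assumes d: "0 < dd \<kappa> x" and y: "\<bar>y\<bar> \<le> dd \<kappa> x / 100"
  shows "(Complex x y - of_real (p j))\<^sup>2 + (of_real \<kappa>)\<^sup>2 \<noteq> 0"
    and "1 / ((x - p j)\<^sup>2 + \<kappa>\<^sup>2)\<^sup>2 \<le> 4 / dd \<kappa> x ^ 4"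
    and "cmod (1 / ((Complex x y - of_real (p j))\<^sup>2 + (of_real \<kappa>)\<^sup>2)\<^sup>2 - of_real (1 / ((x - p j)\<^sup>2 + \<kappa>\<^sup>2)\<^sup>2))
      \<le> 15 * (\<bar>y\<bar> / dd \<kappa> x) * (1 / ((x - p j)\<^sup>2 + \<kappa>\<^sup>2)\<^sup>2)"
    and "cmod (1 / ((Complex x y - of_real (p j))\<^sup>2 + (of_real \<kappa>)\<^sup>2)\<^sup>2) \<le> 8 / dd \<kappa> x ^ 4"
proof -
  have eq: "Complex x y - of_real (p j) = Complex (x - p j) y"
    by (simp add: complex_eq_iff)
  note k = kernel_estimate[OF d dd_le y]
  show "(Complex x y - of_real (p j))\<^sup>2 + (of_real \<kappa>)\<^sup>2 \<noteq> 0" using k(1) by (simp add: eq)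
  have "(dd \<kappa> x)\<^sup>2 / 2 \<le> (x - p j)\<^sup>2 + \<kappa>\<^sup>2" by (rule k(2))
  then have "((dd \<kappa> x)\<^sup>2 / 2)\<^sup>2 \<le> ((x - p j)\<^sup>2 + \<kappa>\<^sup>2)\<^sup>2" by (intro power_mono) auto
  then have "1 / ((x - p j)\<^sup>2 + \<kappa>\<^sup>2)\<^sup>2 \<le> 1 / ((dd \<kappa> x)\<^sup>2 / 2)\<^sup>2"
    using d by (intro frac_le) auto
  then show 2: "1 / ((x - p j)\<^sup>2 + \<kappa>\<^sup>2)\<^sup>2 \<le> 4 / dd \<kappa> x ^ 4"
    using d by (simp add: power_divide)
  show 3: "cmod (1 / ((Complex x y - of_real (p j))\<^sup>2 + (of_real \<kappa>)\<^sup>2)\<^sup>2 - of_real (1 / ((x - p j)\<^sup>2 + \<kappa>\<^sup>2)\<^sup>2))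
      \<le> 15 * (\<bar>y\<bar> / dd \<kappa> x) * (1 / ((x - p j)\<^sup>2 + \<kappa>\<^sup>2)\<^sup>2)"
    using k(3) by (simp add: eq)
  have "15 * (\<bar>y\<bar> / dd \<kappa> x) \<le> 1" using y d by (simp add: field_simps)
  then have "15 * (\<bar>y\<bar> / dd \<kappa> x) * (1 / ((x - p j)\<^sup>2 + \<kappa>\<^sup>2)\<^sup>2) \<le> 1 * (1 / ((x - p j)\<^sup>2 + \<kappa>\<^sup>2)\<^sup>2)"
    by (intro mult_right_mono) auto
  with 2 3 have "cmod (1 / ((Complex x y - of_real (p j))\<^sup>2 + (of_real \<kappa>)\<^sup>2)\<^sup>2 - of_real (1 / ((x - p j)\<^sup>2 + \<kappa>\<^sup>2)\<^sup>2))
      \<le> 4 / dd \<kappa> x ^ 4" by linarith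
  moreover have "cmod (of_real (1 / ((x - p j)\<^sup>2 + \<kappa>\<^sup>2)\<^sup>2)) \<le> 4 / dd \<kappa> x ^ 4"
    using 2 unfolding norm_of_real by simp
  ultimately show "cmod (1 / ((Complex x y - of_real (p j))\<^sup>2 + (of_real \<kappa>)\<^sup>2)\<^sup>2) \<le> 8 / dd \<kappa> x ^ 4"
    using norm_triangle_sub[of "1 / ((Complex x y - of_real (p j))\<^sup>2 + (of_real \<kappa>)\<^sup>2)\<^sup>2" "of_real (1 / ((x - p j)\<^sup>2 + \<kappa>\<^sup>2)\<^sup>2)"]
    by linarith
qed

lemma summable_f:
  assumes "0 < dd \<kappa> x" and "\<bar>y\<bar> \<le> dd \<kappa> x / 100"
  shows "summable (\<lambda>j. of_real (wt j) * (1 / ((Complex x y - of_real (p j))\<^sup>2 + (of_real \<kappa>)\<^sup>2)\<^sup>2))"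
proof (rule summable_comparison_test')
  show "summable (\<lambda>j. wt j * (8 / dd \<kappa> x ^ 4))" by (intro summable_mult2 summable_wt)
  show "norm (of_real (wt j) * (1 / ((Complex x y - of_real (p j))\<^sup>2 + (of_real \<kappa>)\<^sup>2)\<^sup>2)) \<le> wt j * (8 / dd \<kappa> x ^ 4)" for j
    using kernel_bounds(4)[OF assms] wt_pos[of j] unfolding norm_mult norm_of_real
    by (intro mult_mono) auto
qed

lemma summable_fr:
  assumes "0 < dd \<kappa> x"
  shows "summable (\<lambda>j. wt j * (1 / ((x - p j)\<^sup>2 + \<kappa>\<^sup>2)\<^sup>2))"
proof (rule summable_comparison_test')
  show "summable (\<lambda>j. wt j * (4 / dd \<kappa> x ^ 4))" by (intro summable_mult2 summable_wt)
  show "norm (wt j * (1 / ((x - p j)\<^sup>2 + \<kappa>\<^sup>2)\<^sup>2)) \<le> wt j * (4 / dd \<kappa> x ^ 4)" for j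
    using kernel_bounds(2)[OF assms, of 0] assms wt_pos[of j] unfolding norm_mult
    by (intro mult_mono) auto
qed

lemma f_of_real:
  assumes "0 < dd \<kappa> x"
  shows "f \<kappa> (of_real x) = of_real (fr \<kappa> x)"
proof -
  have "(\<lambda>j. complex_of_real (wt j * (1 / ((x - p j)\<^sup>2 + \<kappa>\<^sup>2)\<^sup>2))) sums of_real (fr \<kappa> x)"
    unfolding fr_def by (intro sums_of_real summable_sums summable_fr assms)
  then show ?thesis unfolding f_def by (intro sums_unique[symmetric]) simp
qed

lemma f_cnj: 
  assumes "0 < dd \<kappa> (Re z)" and "\<bar>Im z\<bar> \<le> dd \<kappa> (Re z) / 100"
  shows "f \<kappa> (cnj z) = cnj (f \<kappa> z)"
proof -
  have "(\<lambda>j. of_real (wt j) * (1 / ((z - of_real (p j))\<^sup>2 + (of_real \<kappa>)\<^sup>2)\<^sup>2)) sums f \<kappa> z"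
    unfolding f_def using summable_f[OF assms] by (intro summable_sums) simp
  then have "(\<lambda>j. cnj (of_real (wt j) * (1 / ((z - of_real (p j))\<^sup>2 + (of_real \<kappa>)\<^sup>2)\<^sup>2))) sums cnj (f \<kappa> z)"
    by (simp only: sums_cnj)
  then show ?thesis unfolding f_def by (intro sums_unique[symmetric]) simp
qed

text \<open>All terms of \<open>fr\<close> are positive and \<open>kernel_estimate\<close> bounds
  the relative error of each by the same number, so the errors add up to a multiple of
  \<open>fr\<close> itself.\<close>

lemma f_near_real:
  assumes "0 < dd \<kappa> x" and "\<bar>y\<bar> \<le> dd \<kappa> x / 100"
  shows "cmod (f \<kappa> (Complex x y) - of_real (fr \<kappa> x)) \<le> 15 * (\<bar>y\<bar> / dd \<kappa> x) * fr \<kappa> x"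
proof -
  let ?a = "\<lambda>j. of_real (wt j) * (1 / ((Complex x y - of_real (p j))\<^sup>2 + (of_real \<kappa>)\<^sup>2)\<^sup>2)"
  let ?b = "\<lambda>j. wt j * (1 / ((x - p j)\<^sup>2 + \<kappa>\<^sup>2)\<^sup>2)"
  have a: "summable ?a" by (rule summable_f[OF assms])
  have b: "summable ?b" by (rule summable_fr[OF assms(1)])
  have *: "norm (?a j - of_real (?b j)) \<le> 15 * (\<bar>y\<bar> / dd \<kappa> x) * ?b j" for j
  proof -
    have "?a j - of_real (?b j) = of_real (wt j) *
        (1 / ((Complex x y - of_real (p j))\<^sup>2 + (of_real \<kappa>)\<^sup>2)\<^sup>2 - of_real (1 / ((x - p j)\<^sup>2 + \<kappa>\<^sup>2)\<^sup>2))"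
      by (simp only: of_real_mult right_diff_distrib)
    also have "norm \<dots> \<le> wt j * (15 * (\<bar>y\<bar> / dd \<kappa> x) * (1 / ((x - p j)\<^sup>2 + \<kappa>\<^sup>2)\<^sup>2))"
      using kernel_bounds(3)[OF assms] wt_pos[of j] unfolding norm_mult norm_of_real
      by (intro mult_mono) auto
    finally show ?thesis by (simp add: mult_ac)
  qed
  have 1: "f \<kappa> (Complex x y) - of_real (fr \<kappa> x) = (\<Sum>j. ?a j - of_real (?b j))"
    unfolding f_def fr_def suminf_of_real[OF b] by (rule suminf_diff[OF a summable_of_real[OF b]])
  have 2: "cmod (\<Sum>j. ?a j - of_real (?b j)) \<le> (\<Sum>j. 15 * (\<bar>y\<bar> / dd \<kappa> x) * ?b j)"
    by (rule norm_suminf_le[OF * summable_mult[OF b]])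
  have 3: "(\<Sum>j. 15 * (\<bar>y\<bar> / dd \<kappa> x) * ?b j) = 15 * (\<bar>y\<bar> / dd \<kappa> x) * fr \<kappa> x"
    unfolding fr_def by (rule suminf_mult[OF b])
  show ?thesis unfolding 1 using 2 unfolding 3 .
qed

lemma fr_upper:
  assumes "0 < dd \<kappa> x"
  shows "fr \<kappa> x \<le> suminf wt * (4 / dd \<kappa> x ^ 4)"
proof -
  have "fr \<kappa> x \<le> (\<Sum>j. wt j * (4 / dd \<kappa> x ^ 4))"
    unfolding fr_def
    using kernel_bounds(2)[OF assms, of 0] assms
    by (intro suminf_le mult_left_mono summable_fr summable_mult2 summable_wt)
      (auto intro: less_imp_le[OF wt_pos])
  also have "\<dots> = suminf wt * (4 / dd \<kappa> x ^ 4)"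
    by (rule suminf_mult2[symmetric, OF summable_wt])
  finally show ?thesis .
qed

text \<open>A single term is enough: within distance of order \<open>dd\<close> there is a
  \<open>p j\<close> whose index is at most of order \<open>1 / dd\<close>. Its weight is then at
  least of order \<open>dd^2\<close> and its kernel at least of order \<open>dd^-4\<close>.\<close>

lemma fr_lower:
  assumes d: "0 < dd \<kappa> x" "dd \<kappa> x \<le> 4"
  shows "10 ^ 8 / (dd \<kappa> x)\<^sup>2 \<le> fr \<kappa> x"
proof -
  define \<eta> where "\<eta> = dd \<kappa> x"
  have \<eta>: "0 < \<eta>" "\<eta> \<le> 4" using d by (auto simp: \<eta>_def)
  obtain x0 where x0: "x0 \<in> S" "infdist x S = dist x x0"
    using infdist_attains_inf[OF S(1,2), of x] by metis
  obtain j where j: "\<bar>x0 - p j\<bar> \<le> \<eta>" "\<eta> * (real j + 1) \<le> 32"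
    using p_dense[OF x0(1) \<eta>] by blast
  have "\<bar>x - p j\<bar> \<le> infdist x S + \<bar>x0 - p j\<bar>"
    using abs_triangle_ineq[of "x - x0" "x0 - p j"] x0(2) by (simp add: dist_real_def)
  moreover have "infdist x S \<le> \<eta>" by (simp add: \<eta>_def dd_def)
  ultimately have "\<bar>x - p j\<bar> \<le> 2 * \<eta>" using j(1) by simp
  moreover have "\<bar>\<kappa>\<bar> \<le> \<eta>" using infdist_nonneg[of x S] by (simp add: \<eta>_def dd_def)
  ultimately
  have "\<bar>x - p j\<bar>\<^sup>2 \<le> (2 * \<eta>)\<^sup>2" "\<bar>\<kappa>\<bar>\<^sup>2 \<le> \<eta>\<^sup>2"
    by (intro power_mono; simp)+
  then have a: "(x - p j)\<^sup>2 + \<kappa>\<^sup>2 \<le> 5 * \<eta>\<^sup>2" by (simp add: power_mult_distrib)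
  have "\<eta>\<^sup>2 / 2 \<le> (x - p j)\<^sup>2 + \<kappa>\<^sup>2"
    using kernel_estimate(2)[OF d(1) dd_le, of 0 j] d by (simp add: \<eta>_def)
  then have a0: "0 < (x - p j)\<^sup>2 + \<kappa>\<^sup>2" using \<eta> by (smt (verit) half_gt_zero zero_less_power)
  \<comment> \<open>This fixes the constant in \<open>wt\<close>:
    \<open>2560000000000 = 10^8 * 32^2 * 5^2\<close>, with 32 from the density of \<open>p\<close>
    and 5 from the bound for the denominator.\<close>
  have "10 ^ 8 / \<eta>\<^sup>2 = 2560000000000 * (\<eta>\<^sup>2 / 32\<^sup>2) * (1 / (5 * \<eta>\<^sup>2)\<^sup>2)"
    using \<eta> by (simp add: field_simps power2_eq_square)
  also have "\<dots> \<le> wt j * (1 / ((x - p j)\<^sup>2 + \<kappa>\<^sup>2)\<^sup>2)"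
  proof (intro mult_mono)
    have "(\<eta> * (real j + 1))\<^sup>2 \<le> 32\<^sup>2" using j(2) \<eta> by (intro power_mono) auto
    then have "\<eta>\<^sup>2 * (real j + 1)\<^sup>2 \<le> 1024" by (simp only: power_mult_distrib) simp
    then show "2560000000000 * (\<eta>\<^sup>2 / 32\<^sup>2) \<le> wt j"
      by (simp add: wt_def pos_le_divide_eq)
    show "1 / (5 * \<eta>\<^sup>2)\<^sup>2 \<le> 1 / ((x - p j)\<^sup>2 + \<kappa>\<^sup>2)\<^sup>2"
      using a a0 by (intro frac_le power_mono) auto
  qed (auto intro: less_imp_le[OF wt_pos])
  also have "\<dots> \<le> fr \<kappa> x"
    unfolding fr_def
  proof -
    have "(\<Sum>i\<in>{j}. wt i * (1 / ((x - p i)\<^sup>2 + \<kappa>\<^sup>2)\<^sup>2)) \<le> (\<Sum>j. wt j * (1 / ((x - p j)\<^sup>2 + \<kappa>\<^sup>2)\<^sup>2))"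
      by (rule sum_le_suminf[OF summable_fr[OF d(1)]])
        (auto intro!: divide_nonneg_nonneg less_imp_le[OF wt_pos])
    then show "wt j * (1 / ((x - p j)\<^sup>2 + \<kappa>\<^sup>2)\<^sup>2) \<le> (\<Sum>j. wt j * (1 / ((x - p j)\<^sup>2 + \<kappa>\<^sup>2)\<^sup>2))" by simp
  qed
  finally show ?thesis by (simp add: \<eta>_def)
qed

section \<open>Continuity and holomorphy of the series\<close>

text \<open>The majorant \<open>wt j * (8 / \<eta> ^ 4)\<close> works for \<kappa> and
  \<open>z\<close> jointly, so the sum stays continuous down to \<open>\<kappa> = 0\<close> at
  heights off \<open>S\<close>.\<close>

lemma f_uniform_limit:
  assumes "0 < \<eta>"
  shows "uniform_limit (dom \<eta>) (\<lambda>n (\<kappa>, z). \<Sum>j<n. of_real (wt j) * (1 / ((z - of_real (p j))\<^sup>2 + (of_real \<kappa>)\<^sup>2)\<^sup>2))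
    (\<lambda>(\<kappa>, z). f \<kappa> z) sequentially"
proof -
  have "uniform_limit (dom \<eta>) (\<lambda>n u. \<Sum>j<n. of_real (wt j) * (1 / ((snd u - of_real (p j))\<^sup>2 + (of_real (fst u))\<^sup>2)\<^sup>2))
    (\<lambda>u. \<Sum>j. of_real (wt j) * (1 / ((snd u - of_real (p j))\<^sup>2 + (of_real (fst u))\<^sup>2)\<^sup>2)) sequentially"
  proof (rule Weierstrass_m_test)
    show "summable (\<lambda>j. wt j * (8 / \<eta> ^ 4))" by (intro summable_mult2 summable_wt)
    fix j and u :: "real \<times> complex" assume u: "u \<in> dom \<eta>"
    define \<kappa> where "\<kappa> = fst u"
    define x where "x = Re (snd u)"
    define y where "y = Im (snd u)"
    have z: "snd u = Complex x y" by (simp add: x_def y_def)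
    have d: "\<eta> < dd \<kappa> x" "\<bar>y\<bar> \<le> dd \<kappa> x / 100" using u by (auto simp: dom_def \<kappa>_def x_def y_def)
    have "cmod (1 / ((Complex x y - of_real (p j))\<^sup>2 + (of_real \<kappa>)\<^sup>2)\<^sup>2) \<le> 8 / dd \<kappa> x ^ 4"
      using d assms by (intro kernel_bounds(4)) auto
    also have "\<dots> \<le> 8 / \<eta> ^ 4" using d assms by (intro frac_le power_mono) auto
    finally show "norm (of_real (wt j) * (1 / ((snd u - of_real (p j))\<^sup>2 + (of_real (fst u))\<^sup>2)\<^sup>2)) \<le> wt j * (8 / \<eta> ^ 4)"
      using wt_pos[of j] unfolding norm_mult norm_of_real z \<kappa>_def[symmetric] by (intro mult_mono) auto
  qed
  then show ?thesis by (simp add: f_def case_prod_unfold)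
qed

lemma kernel_nz: "(\<kappa>, z) \<in> dom \<eta> \<Longrightarrow> 0 \<le> \<eta> \<Longrightarrow> (z - of_real (p j))\<^sup>2 + (of_real \<kappa>)\<^sup>2 \<noteq> 0"
  using kernel_bounds(1)[of \<kappa> "Re z" "Im z" j] by (auto simp: dom_def)

lemma dom_0: "dom 0 = (\<Union>\<eta>\<in>{0<..}. dom \<eta>)"
proof safe
  fix \<kappa> z assume "(\<kappa>, z) \<in> dom 0"
  then show "(\<kappa>, z) \<in> (\<Union>\<eta>\<in>{0<..}. dom \<eta>)"
    by (intro UN_I[of "dd \<kappa> (Re z) / 2"]) (auto simp: dom_def)
qed (auto simp: dom_def)

lemma continuous_f: "continuous_on (dom 0) (\<lambda>(\<kappa>, z). f \<kappa> z)"
  unfolding dom_0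
proof (rule continuous_on_open_UN)
  fix \<eta> :: real assume "\<eta> \<in> {0<..}"
  then have \<eta>: "\<eta> > 0" by simp
  show "continuous_on (dom \<eta>) (\<lambda>(\<kappa>, z). f \<kappa> z)"
  proof (rule uniform_limit_theorem[OF _ f_uniform_limit[OF \<eta>]])
    show "\<forall>\<^sub>F n in sequentially. continuous_on (dom \<eta>)
        (\<lambda>(\<kappa>, z). \<Sum>j<n. of_real (wt j) * (1 / ((z - of_real (p j))\<^sup>2 + (of_real \<kappa>)\<^sup>2)\<^sup>2))"
    proof (rule always_eventually, rule allI)
      fix n
      have "(snd u - of_real (p j))\<^sup>2 + (of_real (fst u))\<^sup>2 \<noteq> (0::complex)" if "u \<in> dom \<eta>" for u j
        using kernel_nz[of "fst u" "snd u" \<eta> j] \<eta> that by simp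
      then show "continuous_on (dom \<eta>)
        (\<lambda>(\<kappa>, z). \<Sum>j<n. of_real (wt j) * (1 / ((z - of_real (p j))\<^sup>2 + (of_real \<kappa>)\<^sup>2)\<^sup>2))"
        by (auto simp: case_prod_unfold intro!: continuous_intros)
    qed
  qed simp
qed (rule open_dom)

lemma holomorphic_f: "f \<kappa> holomorphic_on {z. (\<kappa>, z) \<in> dom 0}"
proof -
  have o: "open {z. (\<kappa>, z) \<in> dom \<eta>}" for \<eta>
    using open_vimage[OF open_dom, of "\<lambda>z. (\<kappa>, z)" \<eta>] by (simp add: vimage_def continuous_on_Pair)
  have "f \<kappa> holomorphic_on (\<Union>\<eta>\<in>{0<..}. {z. (\<kappa>, z) \<in> dom \<eta>})"
  proof (rule holomorphic_on_UN_open[OF _ o])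
    fix \<eta> :: real assume "\<eta> \<in> {0<..}"
    then have \<eta>: "\<eta> > 0" by simp
    show "f \<kappa> holomorphic_on {z. (\<kappa>, z) \<in> dom \<eta>}"
    proof (rule holomorphic_uniform_sequence[OF o])
      fix n
      show "(\<lambda>z. \<Sum>j<n. of_real (wt j) * (1 / ((z - of_real (p j))\<^sup>2 + (of_real \<kappa>)\<^sup>2)\<^sup>2))
          holomorphic_on {z. (\<kappa>, z) \<in> dom \<eta>}"
        using kernel_nz[of \<kappa> _ \<eta>] \<eta> by (intro holomorphic_intros) auto
    next
      fix z assume "z \<in> {z. (\<kappa>, z) \<in> dom \<eta>}"
      then obtain e where e: "e > 0" "cball z e \<subseteq> {z. (\<kappa>, z) \<in> dom \<eta>}"
        using o open_contains_cball by blast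
      have "uniform_limit (cball z e) (\<lambda>n z. \<Sum>j<n. of_real (wt j) * (1 / ((z - of_real (p j))\<^sup>2 + (of_real \<kappa>)\<^sup>2)\<^sup>2))
          (f \<kappa>) sequentially"
        unfolding uniform_limit_iff
      proof (intro allI impI)
        fix r :: real assume "r > 0"
        from uniform_limitD[OF f_uniform_limit[OF \<eta>] this]
        show "\<forall>\<^sub>F n in sequentially. \<forall>z\<in>cball z e.
          dist (\<Sum>j<n. of_real (wt j) * (1 / ((z - of_real (p j))\<^sup>2 + (of_real \<kappa>)\<^sup>2)\<^sup>2)) (f \<kappa> z) < r"
        proof eventually_elim
          case (elim n)
          then show ?case using e(2) by fastforce
        qed
      qed
      then show "\<exists>d>0. cball z d \<subseteq> {z. (\<kappa>, z) \<in> dom \<eta>} \<and>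
          uniform_limit (cball z d) (\<lambda>n z. \<Sum>j<n. of_real (wt j) * (1 / ((z - of_real (p j))\<^sup>2 + (of_real \<kappa>)\<^sup>2)\<^sup>2))
          (f \<kappa>) sequentially"
        using e by blast
    qed
  qed
  moreover have "{z. (\<kappa>, z) \<in> dom 0} = (\<Union>\<eta>\<in>{0<..}. {z. (\<kappa>, z) \<in> dom \<eta>})"
    using dom_0 by auto
  ultimately show ?thesis by simp
qed

end

section \<open>Primitives along segments\<close>

text \<open>The contour integral along the segment from \<open>a\<close> to \<open>b\<close>, pulled
  back to the fixed interval \<open>{0..1}\<close> so that its continuity in the end points and in
  the integrand is that of an integral depending on a parameter.\<close>

definition SI :: "(complex \<Rightarrow> complex) \<Rightarrow> complex \<Rightarrow> complex \<Rightarrow> complex" where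
  "SI g a b = (b - a) * integral {0..1} (\<lambda>t. g (a + of_real t * (b - a)))"

lemma SI_primitive:
  assumes "\<And>z. z \<in> closed_segment a b \<Longrightarrow> (\<Phi> has_field_derivative g z) (at z)"
  shows "SI g a b = \<Phi> b - \<Phi> a"
proof -
  have "((\<lambda>t. (b - a) * g (a + of_real t * (b - a))) has_integral
      (\<Phi> (a + of_real 1 * (b - a)) - \<Phi> (a + of_real 0 * (b - a)))) {0..1}"
  proof (rule fundamental_theorem_of_calculus)
    fix t :: real assume t: "t \<in> {0..1}"
    have "a + of_real t * (b - a) = (1 - t) *\<^sub>R a + t *\<^sub>R b"
      by (simp add: scaleR_conv_of_real algebra_simps)
    then have "a + of_real t * (b - a) \<in> closed_segment a b"
      using t by (auto simp: closed_segment_def)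
    then have "(\<Phi> has_field_derivative g (a + of_real t * (b - a))) (at (a + of_real t * (b - a)))"
      by (rule assms)
    moreover have "((\<lambda>t. a + of_real t * (b - a)) has_vector_derivative (b - a)) (at t)"
      by (auto intro!: derivative_eq_intros simp: has_vector_derivative_def scaleR_conv_of_real)
    ultimately have "(\<Phi> \<circ> (\<lambda>t. a + of_real t * (b - a)) has_vector_derivative
        (b - a) * g (a + of_real t * (b - a))) (at t)"
      by (intro field_vector_diff_chain_at)
    then show "((\<lambda>t. \<Phi> (a + of_real t * (b - a))) has_vector_derivative
        (b - a) * g (a + of_real t * (b - a))) (at t within {0..1})"
      by (auto simp: o_def intro: has_vector_derivative_at_within)
  qed simp
  from integral_unique[OF this] show ?thesis by (simp add: SI_def)
qed

lemma continuous_on_SI: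
  assumes "continuous_on U a" "continuous_on U b"
    and G: "continuous_on (U \<times> {0..1}) (\<lambda>(u, t). G u (a u + of_real t * (b u - a u)))"
  shows "continuous_on U (\<lambda>u. SI (G u) (a u) (b u))"
proof -
  have "continuous_on U (\<lambda>u. integral (cbox 0 1) (\<lambda>t. G u (a u + of_real t * (b u - a u))))"
    by (rule integral_continuous_on_param) (use G in \<open>simp add: box_real\<close>)
  then show ?thesis
    unfolding SI_def box_real using assms(1,2) by (intro continuous_intros)
qed

lemma SI_cong: "(\<And>z. z \<in> closed_segment a b \<Longrightarrow> f z = g z) \<Longrightarrow> SI f a b = SI g a b"
proof -
  assume *: "\<And>z. z \<in> closed_segment a b \<Longrightarrow> f z = g z"
  have "f (a + of_real t * (b - a)) = g (a + of_real t * (b - a))" if "t \<in> {0..1}" for t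
  proof -
    have "a + of_real t * (b - a) = (1 - t) *\<^sub>R a + t *\<^sub>R b"
      by (simp add: scaleR_conv_of_real algebra_simps)
    then show ?thesis using that by (intro *) (auto simp: closed_segment_def)
  qed
  then show ?thesis unfolding SI_def by (intro arg_cong[where f = "\<lambda>x. (b - a) * x"] integral_cong) auto
qed

lemma SI_cnj: "SI g (cnj a) (cnj b) = cnj (SI (\<lambda>z. cnj (g (cnj z))) a b)"
proof -
  have "integral {0..1} (\<lambda>t. g (cnj a + of_real t * (cnj b - cnj a)))
      = cnj (integral {0..1} (\<lambda>t. cnj (g (cnj (a + of_real t * (b - a))))))"
    by (subst Henstock_Kurzweil_Integration.integral_cnj) simp
  then show ?thesis by (simp add: SI_def)
qed

lemma segment_nbhd:
  fixes U :: "complex set"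
  assumes "open U" "closed_segment a b \<subseteq> U"
  obtains R where "open R" "convex R" "closed_segment a b \<subseteq> R" "R \<subseteq> U"
proof -
  obtain \<epsilon> where \<epsilon>: "\<epsilon> > 0" "(\<Union>x\<in>closed_segment a b. ball x \<epsilon>) \<subseteq> U"
    using compact_subset_open_imp_ball_epsilon_subset[OF compact_segment assms] by blast
  \<comment> \<open>The sum of the segment and a ball: a neighbourhood that is convex because both
    summands are.\<close>
  define R where "R = (\<Union>x\<in>closed_segment a b. \<Union>y\<in>ball 0 \<epsilon>. {x + y})"
  have "open R" unfolding R_def by (rule open_sums) simp
  moreover have "convex R" unfolding R_def by (rule convex_sums) auto
  moreover have "closed_segment a b \<subseteq> R"
  proof
    fix x assume x: "x \<in> closed_segment a b"
    have "x \<in> {x + 0}" "0 \<in> ball (0::complex) \<epsilon>" using \<epsilon>(1) by auto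
    then show "x \<in> R" unfolding R_def using x by blast
  qed
  moreover have "R \<subseteq> U"
  proof
    fix z assume "z \<in> R"
    then obtain x y where "x \<in> closed_segment a b" "y \<in> ball 0 \<epsilon>" "z = x + y" unfolding R_def by blast
    then have "z \<in> ball x \<epsilon>" by (simp add: dist_norm)
    then show "z \<in> U" using \<epsilon>(2) \<open>x \<in> closed_segment a b\<close> by blast
  qed
  ultimately show ?thesis using that by blast
qed

text \<open>The domains in use need not be convex, but a convex neighbourhood of one segment carries
  a primitive, and this is all that differentiating \<open>SI\<close> in its end points
  requires.\<close>

lemma local_primitive:
  assumes "open U" "closed_segment a b \<subseteq> U" "g holomorphic_on U"
  obtains R \<Phi> where "open R" "convex R" "closed_segment a b \<subseteq> R" "R \<subseteq> U"
    "\<And>z. z \<in> R \<Longrightarrow> (\<Phi> has_field_derivative g z) (at z)"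
proof -
  obtain R where R: "open R" "convex R" "closed_segment a b \<subseteq> R" "R \<subseteq> U"
    by (rule segment_nbhd[OF assms(1,2)])
  obtain \<Phi> where \<Phi>: "\<And>x. x \<in> R \<Longrightarrow> (\<Phi> has_field_derivative g x) (at x within R)"
    using holomorphic_convex_primitive'[OF R(2,1) holomorphic_on_subset[OF assms(3) R(4)]] by blast
  have "(\<Phi> has_field_derivative g x) (at x)" if "x \<in> R" for x
    using \<Phi>[OF that] unfolding at_within_open[OF that R(1)] .
  then show ?thesis using R that by blast
qed

text \<open>Both end points move with \<open>w\<close>; the foot of the segment slides along the
  real axis and contributes the term with \<open>Re v\<close>, which has to cancel against something
  else in every application.\<close>

lemma has_derivative_SI_vertical:
  assumes "open U" "closed_segment (of_real (Re z)) z \<subseteq> U" "g holomorphic_on U"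
  shows "((\<lambda>w. SI g (of_real (Re w)) w) has_derivative (\<lambda>v. g z * v - g (of_real (Re z)) * of_real (Re v))) (at z)"
proof -
  obtain R \<Phi> where R: "open R" "convex R" "closed_segment (of_real (Re z)) z \<subseteq> R" "R \<subseteq> U"
    and \<Phi>: "\<And>z. z \<in> R \<Longrightarrow> (\<Phi> has_field_derivative g z) (at z)"
    by (rule local_primitive[OF assms]) blast
  have zR: "z \<in> R" "of_real (Re z) \<in> R" using R(3) by auto
  define R' where "R' = R \<inter> (\<lambda>w. of_real (Re w)) -` R"
  have "open R'" unfolding R'_def
    by (intro open_Int open_vimage R continuous_intros)
  have 1: "(\<Phi> has_derivative (\<lambda>v. g z * v)) (at z)"
    using \<Phi>[OF zR(1)] by (simp add: has_field_derivative_def)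
  have "((\<lambda>w. complex_of_real (Re w)) has_derivative (\<lambda>v. of_real (Re v))) (at z)"
    by (intro bounded_linear_imp_has_derivative bounded_linear_compose[OF bounded_linear_of_real] bounded_linear_Re)
  moreover have "(\<Phi> has_derivative (\<lambda>v. g (of_real (Re z)) * v)) (at (of_real (Re z)))"
    using \<Phi>[OF zR(2)] by (simp add: has_field_derivative_def)
  ultimately have 2: "((\<lambda>w. \<Phi> (of_real (Re w))) has_derivative (\<lambda>v. g (of_real (Re z)) * of_real (Re v))) (at z)"
    by (rule has_derivative_compose)
  have 3: "((\<lambda>w. \<Phi> w - \<Phi> (of_real (Re w))) has_derivative (\<lambda>v. g z * v - g (of_real (Re z)) * of_real (Re v))) (at z)"
    by (rule has_derivative_diff[OF 1 2])
  show ?thesis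
  proof (rule has_derivative_transform_within_open[OF 3 \<open>open R'\<close>])
    show "z \<in> R'" using zR by (simp add: R'_def)
    fix w assume "w \<in> R'"
    then have "closed_segment (of_real (Re w)) w \<subseteq> R"
      using R(2) by (intro closed_segment_subset) (auto simp: R'_def)
    then show "\<Phi> w - \<Phi> (of_real (Re w)) = SI g (of_real (Re w)) w"
      using \<Phi> by (intro SI_primitive[symmetric]) blast
  qed
qed

lemma has_derivative_SI_horizontal:
  assumes "open U" "closed_segment (of_real x0) (of_real (Re z)) \<subseteq> U" "g holomorphic_on U"
  shows "((\<lambda>w. SI g (of_real x0) (of_real (Re w))) has_derivative (\<lambda>v. g (of_real (Re z)) * of_real (Re v))) (at z)"
proof -
  obtain R \<Phi> where R: "open R" "convex R" "closed_segment (of_real x0) (of_real (Re z)) \<subseteq> R" "R \<subseteq> U"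
    and \<Phi>: "\<And>z. z \<in> R \<Longrightarrow> (\<Phi> has_field_derivative g z) (at z)"
    by (rule local_primitive[OF assms]) blast
  have zR: "of_real x0 \<in> R" "of_real (Re z) \<in> R" using R(3) by auto
  define R' where "R' = (\<lambda>w. complex_of_real (Re w)) -` R"
  have "open R'" unfolding R'_def
    by (intro open_vimage R continuous_intros)
  have "((\<lambda>w. complex_of_real (Re w)) has_derivative (\<lambda>v. of_real (Re v))) (at z)"
    by (intro bounded_linear_imp_has_derivative bounded_linear_compose[OF bounded_linear_of_real] bounded_linear_Re)
  moreover have "(\<Phi> has_derivative (\<lambda>v. g (of_real (Re z)) * v)) (at (of_real (Re z)))"
    using \<Phi>[OF zR(2)] by (simp add: has_field_derivative_def)
  ultimately have 2: "((\<lambda>w. \<Phi> (of_real (Re w))) has_derivative (\<lambda>v. g (of_real (Re z)) * of_real (Re v))) (at z)"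
    by (rule has_derivative_compose)
  have 3: "((\<lambda>w. \<Phi> (of_real (Re w)) - \<Phi> (of_real x0)) has_derivative (\<lambda>v. g (of_real (Re z)) * of_real (Re v))) (at z)"
    using has_derivative_diff[OF 2 has_derivative_const] by simp
  show ?thesis
  proof (rule has_derivative_transform_within_open[OF 3 \<open>open R'\<close>])
    show "z \<in> R'" using zR by (simp add: R'_def)
    fix w assume "w \<in> R'"
    then have "closed_segment (of_real x0) (of_real (Re w)) \<subseteq> R"
      using R(2) zR by (intro closed_segment_subset) (auto simp: R'_def)
    then show "\<Phi> (of_real (Re w)) - \<Phi> (of_real x0) = SI g (of_real x0) (of_real (Re w))"
      using \<Phi> by (intro SI_primitive[symmetric]) blast
  qed
qed

lemma vertical_segment:
  assumes "w \<in> closed_segment (of_real (Re z)) z"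
  shows "Re w = Re z" "\<bar>Im w\<bar> \<le> \<bar>Im z\<bar>"
proof -
  obtain t where t: "0 \<le> t" "t \<le> 1" "w = (1 - t) *\<^sub>R of_real (Re z) + t *\<^sub>R z"
    using assms by (auto simp: closed_segment_def)
  show "Re w = Re z" by (simp add: t(3) algebra_simps)
  have "Im w = t * Im z" by (simp add: t(3))
  then show "\<bar>Im w\<bar> \<le> \<bar>Im z\<bar>" using t by (simp add: abs_mult mult_left_le_one_le)
qed

lemma unit_mult_cnj: "cmod g = 1 \<Longrightarrow> g * cnj g = 1"
  using complex_norm_square[of g] by simp

lemma cnj_inverse_unit:
  assumes "cmod g = 1"
  shows "cnj (1 / g) = g"
proof -
  have "g \<noteq> 0" using assms by auto
  then have "1 / g = cnj g" using unit_mult_cnj[OF assms] by (simp add: field_simps)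
  then show ?thesis by simp
qed

text \<open>The horizontal part of the Weierstrass representation with Gauss map \<open>G\<close> and \<open>\<phi> = dz\<close>; it is
  enough to integrate vertically because it vanishes on the real axis when \<open>\<bar>G\<bar> = 1\<close> there.\<close>

definition Xm :: "(complex \<Rightarrow> complex) \<Rightarrow> complex \<Rightarrow> complex" where
  "Xm G z = (cnj (SI (\<lambda>w. 1 / G w) (of_real (Re z)) z) - SI G (of_real (Re z)) z) / 2"

section \<open>The domain of the parametrization\<close>

context blowup_set
begin

text \<open>Up to the factor 1/4 this is \<open>om * fr\<close>, the size of \<open>v = Im h\<close>
  at the top of the domain; see \<open>om_fr\<close>.\<close>

definition mm :: "real \<Rightarrow> real \<Rightarrow> real" where
  "mm \<kappa> x = sqrt (fr \<kappa> x * dd \<kappa> x)"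

text \<open>For \<open>\<bar>y\<bar> < om \<kappa> x\<close> the real part of \<open>h\<close> varies by at most \<open>1/2\<close> along the vertical line, and
  \<open>om \<kappa> x / 2\<close> is high enough for the radius to reach \<open>2\<close>.\<close>

definition om :: "real \<Rightarrow> real \<Rightarrow> real" where
  "om \<kappa> x = dd \<kappa> x / (4 * mm \<kappa> x)"

definition UU :: "(real \<times> complex) set" where
  "UU = {(\<kappa>, z). \<bar>\<kappa>\<bar> < 1 \<and> \<bar>Re z\<bar> < 1 \<and> 0 < dd \<kappa> (Re z) \<and> \<bar>Im z\<bar> < om \<kappa> (Re z)}"

context
  fixes \<kappa> x assumes k: "\<bar>\<kappa>\<bar> < 1" "\<bar>x\<bar> < 1" "0 < dd \<kappa> x"
begin

lemma dd_le4: "dd \<kappa> x \<le> 4"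
proof -
  have "p 0 \<in> {-2..2}" using p_in S by blast
  then have "\<bar>x - p 0\<bar> \<le> 3" using k by auto
  then show ?thesis using dd_le[of \<kappa> x 0] k by linarith
qed

lemma fr_ge: "10 ^ 8 / (dd \<kappa> x)\<^sup>2 \<le> fr \<kappa> x"
  by (rule fr_lower[OF k(3) dd_le4])

lemma fr_pos: "0 < fr \<kappa> x"
  using fr_ge k by (smt (verit) divide_pos_pos zero_less_power)

lemma mm_sq: "(mm \<kappa> x)\<^sup>2 = fr \<kappa> x * dd \<kappa> x"
  using fr_pos k by (simp add: mm_def)

lemma mm_pos: "0 < mm \<kappa> x"
  using fr_pos k by (simp add: mm_def)

text \<open>The lower bound for \<open>fr\<close> in the form used by \<open>radius_large\<close>,
  where the radius turns out to be of order \<open>mm * (mm^2 * dd)\<close>.\<close>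

lemma mm_sq_dd: "10 ^ 8 \<le> (mm \<kappa> x)\<^sup>2 * dd \<kappa> x"
proof -
  have "10 ^ 8 = 10 ^ 8 / (dd \<kappa> x)\<^sup>2 * (dd \<kappa> x)\<^sup>2" using k by simp
  also have "\<dots> \<le> fr \<kappa> x * (dd \<kappa> x)\<^sup>2" using fr_ge by (intro mult_right_mono) auto
  finally show ?thesis unfolding mm_sq by (simp add: power2_eq_square mult_ac)
qed

lemma mm_ge: "5000 \<le> mm \<kappa> x"
proof -
  have "(mm \<kappa> x)\<^sup>2 * dd \<kappa> x \<le> (mm \<kappa> x)\<^sup>2 * 4" using dd_le4 by (intro mult_left_mono) auto
  then have "5000\<^sup>2 \<le> (mm \<kappa> x)\<^sup>2" using mm_sq_dd by simp
  then show ?thesis using mm_pos by (rule power2_le_imp_le[OF _ less_imp_le])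
qed

lemma om_pos: "0 < om \<kappa> x"
  using mm_pos k by (simp add: om_def)

lemma om_le: "om \<kappa> x \<le> dd \<kappa> x / 20000"
  unfolding om_def using mm_ge k by (intro frac_le) auto

lemma om_fr: "om \<kappa> x * fr \<kappa> x = mm \<kappa> x / 4"
proof -
  have "om \<kappa> x * fr \<kappa> x = (fr \<kappa> x * dd \<kappa> x) / (4 * mm \<kappa> x)" by (simp add: om_def)
  also have "\<dots> = mm \<kappa> x / 4" using mm_pos mm_sq[symmetric] by (simp add: power2_eq_square)
  finally show ?thesis .
qed

text \<open>Divided by \<open>dd\<close> this bounds the turning of a slice, and on its own it
  bounds \<open>y^2 * fr\<close> in the curvature estimate: the two reasons for the choice of
  \<open>om\<close>.\<close>

lemma om_sq_fr: "(om \<kappa> x)\<^sup>2 * fr \<kappa> x = dd \<kappa> x / 16"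
proof -
  have "(om \<kappa> x)\<^sup>2 * fr \<kappa> x = om \<kappa> x * (om \<kappa> x * fr \<kappa> x)" by (simp add: power2_eq_square)
  also have "\<dots> = dd \<kappa> x / 16" unfolding om_fr using mm_pos by (simp add: om_def)
  finally show ?thesis .
qed

end

lemma UU_dom: "UU \<subseteq> dom 0"
proof clarify
  fix \<kappa> z assume "(\<kappa>, z) \<in> UU"
  then have a: "\<bar>\<kappa>\<bar> < 1" "\<bar>Re z\<bar> < 1" "0 < dd \<kappa> (Re z)" "\<bar>Im z\<bar> < om \<kappa> (Re z)" by (auto simp: UU_def)
  then show "(\<kappa>, z) \<in> dom 0" using om_le[of \<kappa> "Re z"] by (auto simp: dom_def)
qed

lemma continuous_fr:
  "continuous_on {(\<kappa>, x). 0 < dd \<kappa> x} (\<lambda>(\<kappa>, x). fr \<kappa> x)"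
proof -
  have "continuous_on {(\<kappa>, x). 0 < dd \<kappa> x} (\<lambda>u. Re (case (fst u, complex_of_real (snd u)) of (\<kappa>, z) \<Rightarrow> f \<kappa> z))"
    by (intro continuous_on_Re continuous_on_compose2[OF continuous_f])
      (auto simp: dom_def intro!: continuous_intros)
  moreover have "Re (case (fst u, complex_of_real (snd u)) of (\<kappa>, z) \<Rightarrow> f \<kappa> z) = (\<lambda>(\<kappa>, x). fr \<kappa> x) u"
    if "u \<in> {(\<kappa>, x). 0 < dd \<kappa> x}" for u
    using that f_of_real by (auto simp: case_prod_unfold)
  ultimately show ?thesis by (rule continuous_on_eq)
qed

lemma continuous_om:
  "continuous_on {(\<kappa>, x). \<bar>\<kappa>\<bar> < 1 \<and> \<bar>x\<bar> < 1 \<and> 0 < dd \<kappa> x} (\<lambda>(\<kappa>, x). om \<kappa> x)"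
proof -
  have "continuous_on {(\<kappa>, x). \<bar>\<kappa>\<bar> < 1 \<and> \<bar>x\<bar> < 1 \<and> 0 < dd \<kappa> x} (\<lambda>u. fr (fst u) (snd u))"
    by (rule continuous_on_subset[OF continuous_fr[unfolded case_prod_unfold]]) (auto simp: case_prod_unfold)
  moreover have "mm (fst u) (snd u) \<noteq> 0" if "u \<in> {(\<kappa>, x). \<bar>\<kappa>\<bar> < 1 \<and> \<bar>x\<bar> < 1 \<and> 0 < dd \<kappa> x}" for u
    using that mm_pos[of "fst u" "snd u"] by (auto simp: case_prod_unfold)
  moreover have "continuous_on {(\<kappa>, x). \<bar>\<kappa>\<bar> < 1 \<and> \<bar>x\<bar> < 1 \<and> 0 < dd \<kappa> x} (\<lambda>u. mm (fst u) (snd u))"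
    unfolding mm_def by (intro continuous_intros calculation(1))
  ultimately show ?thesis
    unfolding om_def case_prod_unfold by (intro continuous_intros) auto
qed

lemma open_UU: "open UU"
proof -
  define V where "V = {u::real \<times> complex. \<bar>fst u\<bar> < 1 \<and> \<bar>Re (snd u)\<bar> < 1 \<and> 0 < dd (fst u) (Re (snd u))}"
  have "open V" unfolding V_def
    by (intro open_Collect_conj open_Collect_less continuous_intros)
  moreover have "continuous_on V (\<lambda>u. om (fst u) (Re (snd u)) - \<bar>Im (snd u)\<bar>)"
  proof (intro continuous_intros)
    have "continuous_on V (\<lambda>u. (\<lambda>(\<kappa>, x). om \<kappa> x) (fst u, Re (snd u)))"
      by (rule continuous_on_compose2[OF continuous_om]) (auto simp: V_def intro!: continuous_intros)
    then show "continuous_on V (\<lambda>u. om (fst u) (Re (snd u)))" by simp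
  qed
  ultimately have "open (V \<inter> (\<lambda>u. om (fst u) (Re (snd u)) - \<bar>Im (snd u)\<bar>) -` {0<..})"
    by (intro continuous_open_preimage) auto
  moreover have "V \<inter> (\<lambda>u. om (fst u) (Re (snd u)) - \<bar>Im (snd u)\<bar>) -` {0<..} = UU"
    by (auto simp: V_def UU_def)
  ultimately show ?thesis by simp
qed

end

section \<open>Horizontal slices\<close>

text \<open>Two instances matter: \<open>T = {\<kappa>}\<close> with \<open>\<kappa> > 0\<close> and \<open>J = {-1<..<1}\<close>, and a null sequence together
  with its limit \<open>0\<close> for \<open>T\<close> with a gap of \<open>S\<close> for \<open>J\<close>.\<close>

locale weierstrass = blowup_set +
  fixes T J :: "real set" and G :: "real \<Rightarrow> complex \<Rightarrow> complex"
  assumes T: "\<And>\<kappa>. \<kappa> \<in> T \<Longrightarrow> \<bar>\<kappa>\<bar> < 1"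
    and J: "open J" "is_interval J" "J \<subseteq> {-1<..<1}"
    and TJ: "\<And>\<kappa> x. \<kappa> \<in> T \<Longrightarrow> x \<in> J \<Longrightarrow> 0 < dd \<kappa> x"
    and G_cont: "continuous_on {(\<kappa>, z). \<kappa> \<in> T \<and> Re z \<in> J \<and> \<bar>Im z\<bar> < om \<kappa> (Re z)} (\<lambda>(\<kappa>, z). G \<kappa> z)"
    and G_deriv: "\<And>\<kappa> z. \<kappa> \<in> T \<Longrightarrow> Re z \<in> J \<Longrightarrow> \<bar>Im z\<bar> < om \<kappa> (Re z) \<Longrightarrow>
      (G \<kappa> has_field_derivative \<i> * f \<kappa> z * G \<kappa> z) (at z)"
    and G_unit: "\<And>\<kappa> x. \<kappa> \<in> T \<Longrightarrow> x \<in> J \<Longrightarrow> cmod (G \<kappa> (of_real x)) = 1"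
begin

definition \<Omega> :: "(real \<times> complex) set" where
  "\<Omega> = {(\<kappa>, z). \<kappa> \<in> T \<and> Re z \<in> J \<and> \<bar>Im z\<bar> < om \<kappa> (Re z)}"

definition X :: "real \<Rightarrow> complex \<Rightarrow> complex" where
  "X \<kappa> = Xm (G \<kappa>)"

lemma TJ_bounds: "\<kappa> \<in> T \<Longrightarrow> x \<in> J \<Longrightarrow> \<bar>\<kappa>\<bar> < 1 \<and> \<bar>x\<bar> < 1 \<and> 0 < dd \<kappa> x"
  using T J(3) TJ by (auto simp: abs_less_iff)

lemma \<Omega>_eq: "\<Omega> = UU \<inter> {u. fst u \<in> T \<and> Re (snd u) \<in> J}"
  using TJ_bounds by (auto simp: \<Omega>_def UU_def)

lemma \<Omega>_dom: "\<Omega> \<subseteq> dom 0"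
  using UU_dom by (auto simp: \<Omega>_eq)

lemma slice_eq: "\<kappa> \<in> T \<Longrightarrow> {z. (\<kappa>, z) \<in> \<Omega>} = {z. (\<kappa>, z) \<in> UU \<and> Re z \<in> J}"
  by (auto simp: \<Omega>_eq)

lemma open_slice: "open {z. (\<kappa>, z) \<in> \<Omega>}"
proof (cases "\<kappa> \<in> T")
  case True
  have "open ((\<lambda>z. (\<kappa>, z)) -` UU)"
    by (intro open_vimage open_UU continuous_intros)
  moreover have "open (Re -` J)" by (intro open_vimage J continuous_intros)
  ultimately have "open ((\<lambda>z. (\<kappa>, z)) -` UU \<inter> Re -` J)" by (rule open_Int)
  then show ?thesis by (simp add: slice_eq[OF True] vimage_def Int_def)
qed (simp add: \<Omega>_def)

text \<open>\<open>UU\<close> is open in parameter and point together; restricting to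
  \<open>T\<close> leaves a product neighbourhood relative to \<open>T\<close>, the form of room
  that \<open>ck_holomorphic\<close> asks for.\<close>

lemma \<Omega>_product:
  assumes "(\<kappa>, z) \<in> \<Omega>"
  shows "\<exists>A r. open A \<and> \<kappa> \<in> A \<and> r > 0 \<and> (fst ` \<Omega> \<inter> A) \<times> cball z r \<subseteq> \<Omega>"
proof -
  have "open (UU \<inter> (\<lambda>u. Re (snd u)) -` J)"
    by (intro open_Int open_UU open_vimage J continuous_intros)
  moreover have "(\<kappa>, z) \<in> UU \<inter> (\<lambda>u. Re (snd u)) -` J" using assms by (simp add: \<Omega>_eq)
  ultimately obtain A B where AB: "open A" "open B" "(\<kappa>, z) \<in> A \<times> B" "A \<times> B \<subseteq> UU \<inter> (\<lambda>u. Re (snd u)) -` J"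
    by (rule open_prod_elim) blast
  obtain r where r: "r > 0" "cball z r \<subseteq> B"
    using AB(2,3) open_contains_cball by blast
  have "(fst ` \<Omega> \<inter> A) \<times> cball z r \<subseteq> \<Omega>"
    using AB(4) r(2) by (fastforce simp: \<Omega>_eq)
  then show ?thesis using AB r by blast
qed

lemma vertical_segment_\<Omega>:
  assumes "(\<kappa>, z) \<in> \<Omega>"
  shows "closed_segment (of_real (Re z)) z \<subseteq> {z. (\<kappa>, z) \<in> \<Omega>}"
proof
  fix w assume "w \<in> closed_segment (of_real (Re z)) z"
  from vertical_segment[OF this] assms show "w \<in> {z. (\<kappa>, z) \<in> \<Omega>}" by (auto simp: \<Omega>_def)
qed

lemma holomorphic_f_\<Omega>: "f \<kappa> holomorphic_on {z. (\<kappa>, z) \<in> \<Omega>}"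
  using holomorphic_f \<Omega>_dom by (rule_tac holomorphic_on_subset) auto

lemma holomorphic_G: "G \<kappa> holomorphic_on {z. (\<kappa>, z) \<in> \<Omega>}"
proof -
  have "\<exists>d. (G \<kappa> has_field_derivative d) (at z)" if "z \<in> {z. (\<kappa>, z) \<in> \<Omega>}" for z
    using that by (auto simp: \<Omega>_def intro!: exI G_deriv)
  then show ?thesis unfolding holomorphic_on_open[OF open_slice] by blast
qed

lemma of_real_\<Omega>: "\<kappa> \<in> T \<Longrightarrow> x \<in> J \<Longrightarrow> (\<kappa>, of_real x) \<in> \<Omega>"
  using TJ_bounds om_pos by (auto simp: \<Omega>_def)

text \<open>With a primitive \<Phi> of \<open>f \<kappa>\<close> near the segment,
  \<open>G \<kappa> * exp (- i * \<Phi>)\<close> has derivative zero by the differential equation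
  for \<open>G\<close>.\<close>

lemma G_segment:
  assumes "closed_segment a b \<subseteq> {z. (\<kappa>, z) \<in> \<Omega>}"
  shows "G \<kappa> b = G \<kappa> a * exp (\<i> * SI (f \<kappa>) a b)"
proof -
  obtain R \<Phi> where R: "open R" "convex R" "closed_segment a b \<subseteq> R" "R \<subseteq> {z. (\<kappa>, z) \<in> \<Omega>}"
    and \<Phi>: "\<And>z. z \<in> R \<Longrightarrow> (\<Phi> has_field_derivative f \<kappa> z) (at z)"
    by (rule local_primitive[OF open_slice assms holomorphic_f_\<Omega>]) blast
  have "((\<lambda>z. G \<kappa> z * exp (- \<i> * \<Phi> z)) has_field_derivative 0) (at z within R)" if "z \<in> R" for z
  proof -
    have "(G \<kappa> has_field_derivative \<i> * f \<kappa> z * G \<kappa> z) (at z)"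
      using R(4) that by (intro G_deriv) (auto simp: \<Omega>_def)
    then have "((\<lambda>z. G \<kappa> z * exp (- \<i> * \<Phi> z)) has_field_derivative 0) (at z)"
      using \<Phi>[OF that] by (auto intro!: derivative_eq_intros simp: algebra_simps)
    then show ?thesis by (rule has_field_derivative_at_within)
  qed
  from has_field_derivative_zero_constant[OF R(2) this]
  obtain c where c: "\<And>z. z \<in> R \<Longrightarrow> G \<kappa> z * exp (- \<i> * \<Phi> z) = c" by blast
  have zR: "b \<in> R" "a \<in> R" using R(3) by auto
  have e: "exp (- \<i> * w) * exp (\<i> * w) = 1" for w by (simp flip: exp_add)
  have "G \<kappa> b = G \<kappa> b * exp (- \<i> * \<Phi> b) * exp (\<i> * \<Phi> b)"
    using e[of "\<Phi> b"] by (simp add: mult.assoc)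
  also have "\<dots> = G \<kappa> a * exp (- \<i> * \<Phi> a) * exp (\<i> * \<Phi> b)"
    using c zR by metis
  also have "\<dots> = G \<kappa> a * exp (\<i> * (\<Phi> b - \<Phi> a))"
    by (simp add: mult.assoc right_diff_distrib flip: exp_add)
  also have "\<Phi> b - \<Phi> a = SI (f \<kappa>) a b"
    using R(3) \<Phi> by (intro SI_primitive[symmetric]) blast
  finally show ?thesis .
qed

lemmas G_polar = G_segment[OF vertical_segment_\<Omega>]

lemma horizontal_segment_\<Omega>:
  assumes "\<kappa> \<in> T" "x0 \<in> J" "x \<in> J"
  shows "closed_segment (complex_of_real x0) (of_real x) \<subseteq> {z. (\<kappa>, z) \<in> \<Omega>}"
proof
  fix z assume "z \<in> closed_segment (complex_of_real x0) (of_real x)"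
  then obtain t where t: "0 \<le> t" "t \<le> 1" "z = (1 - t) *\<^sub>R complex_of_real x0 + t *\<^sub>R of_real x"
    by (auto simp: closed_segment_def)
  have "(1 - t) *\<^sub>R x0 + t *\<^sub>R x \<in> J"
    by (rule convexD_alt[OF is_interval_convex[OF J(2)] assms(2,3) t(1,2)])
  moreover have "z = of_real ((1 - t) *\<^sub>R x0 + t *\<^sub>R x)"
    by (simp add: t(3) scaleR_conv_of_real)
  ultimately show "z \<in> {z. (\<kappa>, z) \<in> \<Omega>}" using of_real_\<Omega>[OF assms(1)] by blast
qed

lemma G_nz: "(\<kappa>, z) \<in> \<Omega> \<Longrightarrow> G \<kappa> z \<noteq> 0"
  using G_polar[of \<kappa> z] G_unit[of \<kappa> "Re z"] by (auto simp: \<Omega>_def)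

text \<open>The two contributions of the moving foot on the real axis cancel because
  \<open>cnj (1 / g) = g\<close> for \<open>cmod g = 1\<close>. What remains is the Weierstrass
  differential, although \<open>X\<close> was defined by vertical integrals only.\<close>

lemma X_deriv:
  assumes "(\<kappa>, z) \<in> \<Omega>"
  shows "(X \<kappa> has_derivative (\<lambda>v. (cnj (v / G \<kappa> z) - v * G \<kappa> z) / 2)) (at z)"
proof -
  have h: "(\<lambda>w. 1 / G \<kappa> w) holomorphic_on {z. (\<kappa>, z) \<in> \<Omega>}"
    using G_nz by (intro holomorphic_intros holomorphic_G) auto
  note s = vertical_segment_\<Omega>[OF assms]
  define g where "g = G \<kappa> (of_real (Re z))"
  have "cmod g = 1" using assms G_unit[of \<kappa> "Re z"] by (auto simp: \<Omega>_def g_def)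
  then have g: "cnj (1 / g) = g" by (rule cnj_inverse_unit)
  have "(X \<kappa> has_derivative (\<lambda>v. (cnj (1 / G \<kappa> z * v - 1 / g * of_real (Re v))
      - (G \<kappa> z * v - g * of_real (Re v))) / 2)) (at z)"
    unfolding X_def Xm_def[abs_def] g_def
    by (intro bounded_linear.has_derivative[OF bounded_linear_divide] has_derivative_diff
        bounded_linear.has_derivative[OF bounded_linear_cnj]
        has_derivative_SI_vertical[OF open_slice s] h holomorphic_G)
  moreover have "(\<lambda>v. (cnj (1 / G \<kappa> z * v - 1 / g * of_real (Re v))
      - (G \<kappa> z * v - g * of_real (Re v))) / 2) = (\<lambda>v. (cnj (v / G \<kappa> z) - v * G \<kappa> z) / 2)"
  proof
    fix v
    have "cnj (1 / G \<kappa> z * v - 1 / g * of_real (Re v)) = cnj (v / G \<kappa> z) - cnj (1 / g) * of_real (Re v)"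
      by simp
    then show "(cnj (1 / G \<kappa> z * v - 1 / g * of_real (Re v)) - (G \<kappa> z * v - g * of_real (Re v))) / 2
        = (cnj (v / G \<kappa> z) - v * G \<kappa> z) / 2" unfolding g by (simp add: mult.commute)
  qed
  ultimately show ?thesis by simp
qed

lemma X_of_real: "X \<kappa> (of_real x) = 0"
  by (simp add: X_def Xm_def SI_def)

lemma continuous_vertical_SI:
  assumes g: "continuous_on \<Omega> (\<lambda>(\<kappa>, z). g \<kappa> z)"
  shows "continuous_on \<Omega> (\<lambda>u. SI (g (fst u)) (of_real (Re (snd u))) (snd u))"
proof (rule continuous_on_SI)
  show "continuous_on (\<Omega> \<times> {0..1}) (\<lambda>(u, t). g (fst u) (of_real (Re (snd u)) + of_real t * (snd u - of_real (Re (snd u)))))"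
  proof -
    have "continuous_on (\<Omega> \<times> {0..1}) (\<lambda>v. (\<lambda>(\<kappa>, z). g \<kappa> z)
       (fst (fst v), of_real (Re (snd (fst v))) + of_real (snd v) * (snd (fst v) - of_real (Re (snd (fst v))))))"
    proof (rule continuous_on_compose2[OF g])
      show "(\<lambda>v. (fst (fst v), of_real (Re (snd (fst v))) + of_real (snd v) * (snd (fst v) - of_real (Re (snd (fst v))))))
          ` (\<Omega> \<times> {0..1}) \<subseteq> \<Omega>"
      proof clarify
        fix \<kappa> z and t :: real assume a: "(\<kappa>, z) \<in> \<Omega>" "t \<in> {0..1}"
        have "of_real (Re z) + of_real t * (z - of_real (Re z)) = (1 - t) *\<^sub>R of_real (Re z) + t *\<^sub>R z"
          by (simp add: scaleR_conv_of_real algebra_simps)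
        then have "of_real (Re z) + of_real t * (z - of_real (Re z)) \<in> closed_segment (of_real (Re z)) z"
          using a by (auto simp: closed_segment_def)
        then show "(fst (fst ((\<kappa>, z), t)), of_real (Re (snd (fst ((\<kappa>, z), t)))) + of_real (snd ((\<kappa>, z), t))
            * (snd (fst ((\<kappa>, z), t)) - of_real (Re (snd (fst ((\<kappa>, z), t)))))) \<in> \<Omega>"
          using vertical_segment_\<Omega>[OF a(1)] by auto
      qed
    qed (intro continuous_intros)
    then show ?thesis by (simp add: case_prod_unfold)
  qed
qed (intro continuous_intros)+

lemma continuous_X: "continuous_on \<Omega> (\<lambda>(\<kappa>, z). X \<kappa> z)"
proof -
  have c: "continuous_on \<Omega> (\<lambda>(\<kappa>, z). G \<kappa> z)" using G_cont by (simp add: \<Omega>_def)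
  have "continuous_on \<Omega> (\<lambda>(\<kappa>, z). 1 / G \<kappa> z)"
    using c G_nz by (auto simp: case_prod_unfold intro!: continuous_intros)
  from continuous_vertical_SI[OF this] continuous_vertical_SI[OF c]
  show ?thesis unfolding X_def Xm_def case_prod_unfold by (intro continuous_intros) auto
qed

text \<open>Schwarz reflection: \<open>f\<close> is real on the axis, so
  \<open>G \<kappa> (cnj w)\<close> is the inverse of \<open>cnj (G \<kappa> w)\<close> and the two
  integrals in \<open>Xm\<close> change places. Geometrically the surface is invariant under the
  half-turn about the line it contains.\<close>

lemma X_cnj:
  assumes "(\<kappa>, z) \<in> \<Omega>"
  shows "X \<kappa> (cnj z) = - X \<kappa> z"
proof -
  have fc: "f \<kappa> (cnj w) = cnj (f \<kappa> w)" if "(\<kappa>, w) \<in> \<Omega>" for w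
    using that \<Omega>_dom by (intro f_cnj) (auto simp: dom_def)
  have Gc: "G \<kappa> (cnj w) = 1 / cnj (G \<kappa> w)" if w: "(\<kappa>, w) \<in> \<Omega>" for w
  proof -
    define g where "g = G \<kappa> (of_real (Re w))"
    have "cmod g = 1" using w G_unit[of \<kappa> "Re w"] by (auto simp: \<Omega>_def g_def)
    then have gg: "g * cnj g = 1" by (rule unit_mult_cnj)
    have "(\<kappa>, cnj w) \<in> \<Omega>" using w by (simp add: \<Omega>_def)
    from G_polar[OF this] have "G \<kappa> (cnj w) = g * exp (\<i> * SI (f \<kappa>) (cnj (of_real (Re w))) (cnj w))"
      by (simp add: g_def)
    also have "SI (f \<kappa>) (cnj (of_real (Re w))) (cnj w) = cnj (SI (\<lambda>z. cnj (f \<kappa> (cnj z))) (of_real (Re w)) w)"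
      by (rule SI_cnj)
    also have "SI (\<lambda>z. cnj (f \<kappa> (cnj z))) (of_real (Re w)) w = SI (f \<kappa>) (of_real (Re w)) w"
      using vertical_segment_\<Omega>[OF w] fc by (intro SI_cong) auto
    finally have 1: "G \<kappa> (cnj w) = g * exp (\<i> * cnj (SI (f \<kappa>) (of_real (Re w)) w))" .
    have "cnj (G \<kappa> w) = cnj g * exp (- \<i> * cnj (SI (f \<kappa>) (of_real (Re w)) w))"
      using G_polar[OF w] by (simp add: g_def exp_cnj)
    then have "G \<kappa> (cnj w) * cnj (G \<kappa> w) = (g * cnj g) * (exp (\<i> * cnj (SI (f \<kappa>) (of_real (Re w)) w)) * exp (- \<i> * cnj (SI (f \<kappa>) (of_real (Re w)) w)))"
      using 1 by (simp add: mult_ac)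
    also have "\<dots> = 1" by (simp add: gg flip: exp_add)
    finally show ?thesis using G_nz[OF w] by (simp add: field_simps)
  qed
  have 1: "SI (G \<kappa>) (of_real (Re z)) (cnj z) = cnj (SI (\<lambda>w. 1 / G \<kappa> w) (of_real (Re z)) z)"
  proof -
    have "SI (G \<kappa>) (cnj (of_real (Re z))) (cnj z) = cnj (SI (\<lambda>w. cnj (G \<kappa> (cnj w))) (of_real (Re z)) z)"
      by (rule SI_cnj)
    also have "SI (\<lambda>w. cnj (G \<kappa> (cnj w))) (of_real (Re z)) z = SI (\<lambda>w. 1 / G \<kappa> w) (of_real (Re z)) z"
      using vertical_segment_\<Omega>[OF assms] Gc by (intro SI_cong) auto
    finally show ?thesis by simp
  qed
  have 2: "SI (\<lambda>w. 1 / G \<kappa> w) (of_real (Re z)) (cnj z) = cnj (SI (G \<kappa>) (of_real (Re z)) z)"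
  proof -
    have "SI (\<lambda>w. 1 / G \<kappa> w) (cnj (of_real (Re z))) (cnj z) = cnj (SI (\<lambda>w. cnj (1 / G \<kappa> (cnj w))) (of_real (Re z)) z)"
      by (rule SI_cnj)
    also have "SI (\<lambda>w. cnj (1 / G \<kappa> (cnj w))) (of_real (Re z)) z = SI (G \<kappa>) (of_real (Re z)) z"
      using vertical_segment_\<Omega>[OF assms] Gc by (intro SI_cong) auto
    finally show ?thesis by simp
  qed
  show ?thesis unfolding X_def Xm_def by (simp add: 1 2 diff_divide_distrib)
qed

end

section \<open>Continuity of roots of monotone functions\<close>

text \<open>Slightly below and above the root \<open>Y u0\<close> the function has opposite strict
  signs; these persist for nearby \<open>u\<close>, and monotonicity traps \<open>Y u\<close> in
  between. \<open>A\<close> itself may fail to be open, so \<open>D\<close> is only relatively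
  open.\<close>

lemma continuous_on_root:
  fixes h :: "'a::topological_space \<Rightarrow> real \<Rightarrow> real"
  assumes cont: "continuous_on D (\<lambda>(u, y). h u y)" and D: "open O'" "D = A \<times> UNIV \<inter> O'"
    and mono: "\<And>u y1 y2. (u, y1) \<in> D \<Longrightarrow> (u, y2) \<in> D \<Longrightarrow> y1 < y2 \<Longrightarrow> h u y1 < h u y2"
    and Y: "\<And>u. u \<in> A \<Longrightarrow> (u, Y u) \<in> D" "\<And>u. u \<in> A \<Longrightarrow> h u (Y u) = 0"
  shows "continuous_on A Y"
  unfolding continuous_on_def
proof
  fix u0 assume u0: "u0 \<in> A"
  have ev: "\<forall>\<^sub>F u in at u0 within A. u \<in> A \<and> (u, y) \<in> D \<and> c < h u y \<and> h u y < d"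
    if yD: "(u0, y) \<in> D" and c: "c < h u0 y" "h u0 y < d" for y c d
  proof -
    have "((\<lambda>(u, y). h u y) \<longlongrightarrow> h u0 y) (at (u0, y) within D)"
      using cont yD unfolding continuous_on_def by force
    then have "\<forall>\<^sub>F v in at (u0, y) within D. c < (\<lambda>(u, y). h u y) v \<and> (\<lambda>(u, y). h u y) v < d"
      using c by (intro eventually_conj order_tendstoD)
    then obtain W where W: "open W" "(u0, y) \<in> W"
      "\<And>v. v \<in> W \<Longrightarrow> v \<noteq> (u0, y) \<Longrightarrow> v \<in> D \<Longrightarrow> c < (\<lambda>(u, y). h u y) v \<and> (\<lambda>(u, y). h u y) v < d"
      unfolding eventually_at_topological by blast
    have W': "c < h u z \<and> h u z < d" if "(u, z) \<in> W" "(u, z) \<in> D" for u z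
      using W(3)[OF that(1) _ that(2)] c by (cases "(u, z) = (u0, y)") auto
    have "open (W \<inter> O')" "(u0, y) \<in> W \<inter> O'" using W D yD by auto
    then obtain B C where BC: "open B" "(u0, y) \<in> B \<times> C" "B \<times> C \<subseteq> W \<inter> O'"
      by (rule open_prod_elim) blast
    show ?thesis
      unfolding eventually_at_topological
    proof (intro exI conjI ballI impI)
      show "open B" "u0 \<in> B" using BC by auto
      fix u assume u: "u \<in> B" "u \<in> A"
      then have "(u, y) \<in> W \<inter> O'" using BC by blast
      then have "(u, y) \<in> W" "(u, y) \<in> D" using u D(2) by auto
      then show "u \<in> A" "(u, y) \<in> D" "c < h u y" "h u y < d" using W' u by auto
    qed
  qed
  have near: "\<exists>e>0. \<forall>y. \<bar>y - Y u0\<bar> < e \<longrightarrow> (u0, y) \<in> D"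
  proof -
    have "(u0, Y u0) \<in> O'" using Y(1)[OF u0] D(2) by auto
    then obtain B C where BC: "open C" "(u0, Y u0) \<in> B \<times> C" "B \<times> C \<subseteq> O'"
      by (rule open_prod_elim[OF D(1)]) blast
    then obtain e where "e > 0" "ball (Y u0) e \<subseteq> C" using openE[OF BC(1)] by blast
    have "(u0, y) \<in> D" if "\<bar>y - Y u0\<bar> < e" for y
    proof -
      have "y \<in> C" using that \<open>ball (Y u0) e \<subseteq> C\<close> by (auto simp: dist_real_def abs_minus_commute)
      then show ?thesis using BC D(2) u0 by auto
    qed
    then show ?thesis using \<open>e > 0\<close> by blast
  qed
  then obtain e where e: "e > 0" "\<And>y. \<bar>y - Y u0\<bar> < e \<Longrightarrow> (u0, y) \<in> D" by blast
  show "(Y \<longlongrightarrow> Y u0) (at u0 within A)"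
  proof (rule order_tendstoI)
    fix a assume a: "a < Y u0"
    define y where "y = max a (Y u0 - e / 2)"
    have y: "a \<le> y" "y < Y u0" "\<bar>y - Y u0\<bar> < e" using a e(1) by (auto simp: y_def)
    have yD: "(u0, y) \<in> D" using y e by blast
    have "h u0 y < 0" using mono[OF yD Y(1)[OF u0] y(2)] Y(2)[OF u0] by simp
    from ev[OF yD _ this, of "h u0 y - 1"] have "\<forall>\<^sub>F u in at u0 within A. u \<in> A \<and> (u, y) \<in> D \<and> h u y < 0"
      by (auto elim: eventually_mono)
    then show "\<forall>\<^sub>F u in at u0 within A. a < Y u"
    proof eventually_elim
      case (elim u)
      have "y < Y u"
      proof (rule ccontr)
        assume "\<not> y < Y u"
        then have "h u (Y u) \<le> h u y"
          using mono[of u "Y u" y] elim Y(1)[of u] by (cases "Y u = y") auto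
        then show False using elim Y(2) by auto
      qed
      then show ?case using y by simp
    qed
  next
    fix a assume a: "Y u0 < a"
    define y where "y = min a (Y u0 + e / 2)"
    have y: "y \<le> a" "Y u0 < y" "\<bar>y - Y u0\<bar> < e" using a e(1) by (auto simp: y_def)
    have yD: "(u0, y) \<in> D" using y e by blast
    have "0 < h u0 y" using mono[OF Y(1)[OF u0] yD y(2)] Y(2)[OF u0] by simp
    from ev[OF yD this, of "h u0 y + 1"] have "\<forall>\<^sub>F u in at u0 within A. u \<in> A \<and> (u, y) \<in> D \<and> 0 < h u y"
      by (auto elim: eventually_mono)
    then show "\<forall>\<^sub>F u in at u0 within A. Y u < a"
    proof eventually_elim
      case (elim u)
      have "Y u < y"
      proof (rule ccontr)
        assume "\<not> Y u < y"
        then have "h u y \<le> h u (Y u)"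
          using mono[of u y "Y u"] elim Y(1)[of u] by (cases "Y u = y") auto
        then show False using elim Y(2) by auto
      qed
      then show ?case using y by simp
    qed
  qed
qed

text \<open>The fourth power is what \<open>radius_large\<close> uses: multiplied by a height of
  order \<open>dd / mm\<close> it leaves \<open>mm^3 * dd\<close>.\<close>

lemma cosh_lower_bound: "0 \<le> a \<Longrightarrow> (a / 4) ^ 4 / 2 \<le> cosh (a::real)"
proof -
  assume a: "0 \<le> a"
  have "a / 4 \<le> exp (a / 4)" using exp_ge_add_one_self[of "a / 4"] by linarith
  then have "(a / 4) ^ 4 \<le> exp (a / 4) ^ 4" using a by (intro power_mono) auto
  also have "\<dots> = exp a" by (simp flip: exp_of_nat_mult)
  also have "\<dots> \<le> exp a + exp (- a)" by simp
  finally have "(a / 4) ^ 4 \<le> exp a + exp (- a)" .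
  then show ?thesis unfolding cosh_field_def by (rule divide_right_mono) simp
qed

section \<open>Geometry of one slice\<close>

context weierstrass
begin

context
  fixes \<kappa> x :: real
  assumes kx: "\<kappa> \<in> T" "x \<in> J"
begin

text \<open>With \<open>h = u + i v\<close> this is \<open>v - i (u - u(x))\<close>, so that
  \<open>G = G(x) * exp (- N)\<close>: the real part governs the speed along the slice and the
  imaginary part its direction.\<close>

definition N :: "real \<Rightarrow> complex" where
  "N y = - \<i> * SI (f \<kappa>) (of_real x) (Complex x y)"

text \<open>The slice rotated so that its initial velocity is \<open>1\<close>.\<close>

definition xi :: "real \<Rightarrow> complex" where
  "xi y = \<i> * X \<kappa> (Complex x y) * cnj (G \<kappa> (of_real x))"

lemma in_\<Omega>: "\<bar>y\<bar> < om \<kappa> x \<Longrightarrow> (\<kappa>, Complex x y) \<in> \<Omega>"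
  using kx by (simp add: \<Omega>_def)

lemma bnd: "\<bar>\<kappa>\<bar> < 1" "\<bar>x\<bar> < 1" "0 < dd \<kappa> x"
  using TJ_bounds[OF kx] by auto

lemma Complex_deriv: "(Complex x has_derivative (\<lambda>h. of_real h * \<i>)) (at y)"
proof -
  have "((\<lambda>y. of_real x + of_real y * \<i>) has_derivative (\<lambda>h. of_real h * \<i>)) (at y)"
    by (auto intro!: derivative_eq_intros)
  moreover have "Complex x = (\<lambda>y. of_real x + of_real y * \<i>)"
    by (auto simp: Complex_eq mult.commute)
  ultimately show ?thesis by simp
qed

lemma N_deriv:
  assumes "\<bar>y\<bar> < om \<kappa> x"
  shows "(N has_vector_derivative f \<kappa> (Complex x y)) (at y)"
proof -
  let ?z = "Complex x y"
  have "((\<lambda>w. SI (f \<kappa>) (of_real (Re w)) w) has_derivative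
      (\<lambda>v. f \<kappa> ?z * v - f \<kappa> (of_real (Re ?z)) * of_real (Re v))) (at ?z)"
    using vertical_segment_\<Omega>[OF in_\<Omega>[OF assms]]
    by (intro has_derivative_SI_vertical[OF open_slice _ holomorphic_f_\<Omega>])
  from has_derivative_compose[OF Complex_deriv this]
  have "((\<lambda>y. SI (f \<kappa>) (of_real x) (Complex x y)) has_derivative (\<lambda>h. f \<kappa> ?z * (of_real h * \<i>))) (at y)"
    by simp
  then have "((\<lambda>y. - \<i> * SI (f \<kappa>) (of_real x) (Complex x y)) has_derivative (\<lambda>h. - \<i> * (f \<kappa> ?z * (of_real h * \<i>)))) (at y)"
    by (rule has_derivative_mult_right)
  moreover have "(\<lambda>h. - \<i> * (f \<kappa> ?z * (of_real h * \<i>))) = (\<lambda>h. h *\<^sub>R f \<kappa> ?z)"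
    by (auto simp: scaleR_conv_of_real mult_ac)
  ultimately show ?thesis
    unfolding has_vector_derivative_def N_def[abs_def] by simp
qed

lemma N_0: "N 0 = 0"
  by (simp add: N_def SI_def Complex_eq)

lemma f_slice:
  assumes "\<bar>y\<bar> < om \<kappa> x"
  shows "cmod (f \<kappa> (Complex x y) - of_real (fr \<kappa> x)) \<le> 15 * (\<bar>y\<bar> / dd \<kappa> x) * fr \<kappa> x"
    and "85 / 100 * fr \<kappa> x \<le> Re (f \<kappa> (Complex x y))" and "cmod (f \<kappa> (Complex x y)) \<le> 2 * fr \<kappa> x"
proof -
  have y: "\<bar>y\<bar> \<le> dd \<kappa> x / 20000" using assms om_le[OF bnd] by linarith
  then show 1: "cmod (f \<kappa> (Complex x y) - of_real (fr \<kappa> x)) \<le> 15 * (\<bar>y\<bar> / dd \<kappa> x) * fr \<kappa> x"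
    using bnd by (intro f_near_real) auto
  have "15 * (\<bar>y\<bar> / dd \<kappa> x) * fr \<kappa> x \<le> 15 / 100 * fr \<kappa> x"
    using y bnd fr_pos[OF bnd] by (intro mult_right_mono) (auto simp: field_simps)
  with 1 have 2: "cmod (f \<kappa> (Complex x y) - of_real (fr \<kappa> x)) \<le> 15 / 100 * fr \<kappa> x" by linarith
  have "\<bar>Re (f \<kappa> (Complex x y) - of_real (fr \<kappa> x))\<bar> \<le> 15 / 100 * fr \<kappa> x"
    using abs_Re_le_cmod 2 by (rule order_trans)
  then have "\<bar>Re (f \<kappa> (Complex x y)) - fr \<kappa> x\<bar> \<le> 15 / 100 * fr \<kappa> x" by simp
  then show "85 / 100 * fr \<kappa> x \<le> Re (f \<kappa> (Complex x y))" by linarith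
  have "cmod (f \<kappa> (Complex x y)) \<le> cmod (of_real (fr \<kappa> x)) + cmod (f \<kappa> (Complex x y) - of_real (fr \<kappa> x))"
    by (metis add_diff_cancel_left' diff_add_cancel norm_triangle_ineq add.commute)
  then show "cmod (f \<kappa> (Complex x y)) \<le> 2 * fr \<kappa> x"
    using 2 fr_pos[OF bnd] by simp
qed

lemma Re_N_deriv: "\<bar>y\<bar> < om \<kappa> x \<Longrightarrow> ((\<lambda>y. Re (N y)) has_real_derivative Re (f \<kappa> (Complex x y))) (at y)"
  and Im_N_deriv: "\<bar>y\<bar> < om \<kappa> x \<Longrightarrow> ((\<lambda>y. Im (N y)) has_real_derivative Im (f \<kappa> (Complex x y))) (at y)"
  using N_deriv has_vector_derivative_complex_iff has_real_derivative_iff_has_vector_derivative by blast+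

lemma Re_N_mono:
  assumes "0 \<le> y1" "y1 \<le> y2" "y2 < om \<kappa> x"
  shows "Re (N y1) + 85 / 100 * fr \<kappa> x * (y2 - y1) \<le> Re (N y2)"
proof -
  have "Re (N y1) - 85 / 100 * fr \<kappa> x * y1 \<le> Re (N y2) - 85 / 100 * fr \<kappa> x * y2"
  proof (rule DERIV_nonneg_imp_nondecreasing[OF assms(2)])
    fix y assume "y1 \<le> y" "y \<le> y2"
    then have y: "\<bar>y\<bar> < om \<kappa> x" using assms by auto
    have "((\<lambda>y. Re (N y) - 85 / 100 * fr \<kappa> x * y) has_real_derivative
        (Re (f \<kappa> (Complex x y)) - 85 / 100 * fr \<kappa> x)) (at y)"
      by (intro DERIV_diff Re_N_deriv[OF y] DERIV_cmult_Id)
    then show "\<exists>d. ((\<lambda>y. Re (N y) - 85 / 100 * fr \<kappa> x * y) has_real_derivative d) (at y) \<and> 0 \<le> d"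
      using f_slice(2)[OF y] by (intro exI conjI) auto
  qed
  then show ?thesis unfolding right_diff_distrib by linarith
qed

lemma Re_N_ge: "0 \<le> y \<Longrightarrow> y < om \<kappa> x \<Longrightarrow> 85 / 100 * fr \<kappa> x * y \<le> Re (N y)"
  using Re_N_mono[of 0 y] by (simp add: N_0)

text \<open>\<open>Im f\<close> vanishes on the axis and grows at most like
  \<open>15 * fr * \<bar>y\<bar> / dd\<close>. Integration gives a quadratic bound, and
  \<open>om_sq_fr\<close> turns it into 15/32, below 1/2. The sign \<open>s\<close> treats both
  halves of the absolute value at once.\<close>

lemma Im_N_le:
  assumes y: "0 \<le> y" "y < om \<kappa> x"
  shows "\<bar>Im (N y)\<bar> \<le> 1 / 2"
proof -
  define c where "c = 15 * fr \<kappa> x / dd \<kappa> x"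
  have sgn: "s * Im (N y) \<le> c * y\<^sup>2 / 2" if s: "s = 1 \<or> s = -1" for s :: real
  proof -
    have "c * 0\<^sup>2 / 2 - s * Im (N 0) \<le> c * y\<^sup>2 / 2 - s * Im (N y)"
    proof (rule DERIV_nonneg_imp_nondecreasing[OF y(1)])
      fix t assume t: "0 \<le> t" "t \<le> y"
      then have t': "\<bar>t\<bar> < om \<kappa> x" using y by auto
      have "((\<lambda>y. c * y\<^sup>2 / 2) has_real_derivative c * t) (at t)"
        by (auto intro!: derivative_eq_intros)
      then have 1: "((\<lambda>y. c * y\<^sup>2 / 2 - s * Im (N y)) has_real_derivative
          (c * t - s * Im (f \<kappa> (Complex x t)))) (at t)"
        by (intro DERIV_diff DERIV_cmult Im_N_deriv[OF t'])
      have "\<bar>Im (f \<kappa> (Complex x t))\<bar> \<le> c * t"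
      proof -
        have "15 * (\<bar>t\<bar> / dd \<kappa> x) * fr \<kappa> x = c * t" using t by (simp add: c_def)
        then show ?thesis
          using abs_Im_le_cmod[of "f \<kappa> (Complex x t) - of_real (fr \<kappa> x)"] f_slice(1)[OF t'] by simp
      qed
      then have "0 \<le> c * t - s * Im (f \<kappa> (Complex x t))" using s by (auto simp: abs_le_iff)
      with 1 show "\<exists>d. ((\<lambda>y. c * y\<^sup>2 / 2 - s * Im (N y)) has_real_derivative d) (at t) \<and> 0 \<le> d" by blast
    qed
    then show ?thesis by (simp add: N_0)
  qed
  have "c * y\<^sup>2 / 2 \<le> c * (om \<kappa> x)\<^sup>2 / 2"
    using y bnd fr_pos[OF bnd] by (intro divide_right_mono mult_left_mono power_mono) (auto simp: c_def)
  also have "\<dots> = 15 / 32"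
    using om_sq_fr[OF bnd] bnd by (simp add: c_def field_simps)
  finally show ?thesis using sgn[of 1] sgn[of "-1"] by (auto simp: abs_le_iff)
qed

lemma G_N:
  assumes "\<bar>y\<bar> < om \<kappa> x"
  shows "G \<kappa> (Complex x y) = G \<kappa> (of_real x) * exp (- N y)"
  using G_polar[OF in_\<Omega>[OF assms]] by (simp add: N_def)

lemma cmod_G: "\<bar>y\<bar> < om \<kappa> x \<Longrightarrow> cmod (G \<kappa> (Complex x y)) = exp (- Re (N y))"
  using G_N G_unit[OF kx] by (simp add: norm_mult)

text \<open>The speed is \<open>cosh v\<close> and the direction has turned by \<open>- Im N\<close>
  from the initial direction 1; by \<open>Im_N_le\<close> the velocity therefore stays in a fixed
  narrow cone about the positive real axis.\<close>

lemma xi_deriv: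
  assumes y: "\<bar>y\<bar> < om \<kappa> x"
  shows "(xi has_vector_derivative of_real (cosh (Re (N y))) * cis (- Im (N y))) (at y)"
proof -
  define z where "z = Complex x y"
  define g where "g = G \<kappa> (of_real x)"
  have gg: "g * cnj g = 1" "g \<noteq> 0" "cnj (1 / g) = g"
    using G_unit[OF kx] unit_mult_cnj cnj_inverse_unit by (auto simp: g_def)
  have Gz: "G \<kappa> z = g * exp (- N y)" using G_N[OF y] by (simp add: z_def g_def)
  have "(X \<kappa> has_derivative (\<lambda>v. (cnj (v / G \<kappa> z) - v * G \<kappa> z) / 2)) (at (Complex x y))"
    using X_deriv[OF in_\<Omega>[OF y]] by (simp add: z_def)
  from has_derivative_compose[OF Complex_deriv this]
  have "((\<lambda>y. X \<kappa> (Complex x y)) has_derivative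
      (\<lambda>h. (cnj (of_real h * \<i> / G \<kappa> z) - of_real h * \<i> * G \<kappa> z) / 2)) (at y)" .
  then have "((\<lambda>y. \<i> * X \<kappa> (Complex x y)) has_derivative
      (\<lambda>h. \<i> * ((cnj (of_real h * \<i> / G \<kappa> z) - of_real h * \<i> * G \<kappa> z) / 2))) (at y)"
    by (rule has_derivative_mult_right)
  then have 1: "((\<lambda>y. \<i> * X \<kappa> (Complex x y) * cnj g) has_derivative
      (\<lambda>h. \<i> * ((cnj (of_real h * \<i> / G \<kappa> z) - of_real h * \<i> * G \<kappa> z) / 2) * cnj g)) (at y)"
    by (rule has_derivative_mult_left)
  have 2: "\<i> * ((cnj (of_real h * \<i> / G \<kappa> z) - of_real h * \<i> * G \<kappa> z) / 2) * cnj g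
      = of_real h * (of_real (cosh (Re (N y))) * cis (- Im (N y)))" for h
  proof -
    have "1 / g = cnj g" using gg(1,2) by (simp add: field_simps)
    then have "1 / G \<kappa> z = cnj g * exp (N y)"
      unfolding Gz exp_minus by (simp add: divide_simps)
    then have "cnj (1 / G \<kappa> z) = g * exp (cnj (N y))" by (simp add: exp_cnj)
    then have "cnj (of_real h * \<i> * (1 / G \<kappa> z)) = - of_real h * \<i> * (g * exp (cnj (N y)))"
      unfolding complex_cnj_mult by simp
    then have "cnj (of_real h * \<i> / G \<kappa> z) = - of_real h * \<i> * (g * exp (cnj (N y)))"
      by simp
    then have "\<i> * ((cnj (of_real h * \<i> / G \<kappa> z) - of_real h * \<i> * G \<kappa> z) / 2) * cnj g
        = of_real h * (g * cnj g) * ((exp (cnj (N y)) + exp (- N y)) / 2)"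
      by (simp add: Gz field_simps)
    also have "exp (cnj (N y)) = of_real (exp (Re (N y))) * cis (- Im (N y))"
      by (simp add: exp_eq_polar)
    also have "exp (- N y) = of_real (exp (- Re (N y))) * cis (- Im (N y))"
      by (simp add: exp_eq_polar)
    finally show ?thesis unfolding gg(1)
      by (simp add: cosh_field_def field_simps)
  qed
  show ?thesis
    unfolding has_vector_derivative_def xi_def[abs_def]
    using 1[unfolded 2] by (simp add: scaleR_conv_of_real g_def)
qed

lemma Re_xi_deriv: "\<bar>y\<bar> < om \<kappa> x \<Longrightarrow>
    ((\<lambda>y. Re (xi y)) has_real_derivative cosh (Re (N y)) * cos (Im (N y))) (at y)"
  and Im_xi_deriv: "\<bar>y\<bar> < om \<kappa> x \<Longrightarrow>
    ((\<lambda>y. Im (xi y)) has_real_derivative - cosh (Re (N y)) * sin (Im (N y))) (at y)"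
proof -
  assume y: "\<bar>y\<bar> < om \<kappa> x"
  from xi_deriv[OF y]
  have "((\<lambda>y. Re (xi y)) has_vector_derivative Re (of_real (cosh (Re (N y))) * cis (- Im (N y)))) (at y)"
    "((\<lambda>y. Im (xi y)) has_vector_derivative Im (of_real (cosh (Re (N y))) * cis (- Im (N y)))) (at y)"
    by (simp_all only: has_vector_derivative_complex_iff has_real_derivative_iff_has_vector_derivative)
  then show "((\<lambda>y. Re (xi y)) has_real_derivative cosh (Re (N y)) * cos (Im (N y))) (at y)"
    "((\<lambda>y. Im (xi y)) has_real_derivative - cosh (Re (N y)) * sin (Im (N y))) (at y)"
    by (simp_all add: has_real_derivative_iff_has_vector_derivative)
qed

lemma xi_0: "xi 0 = 0"
  using X_of_real[of \<kappa> x] by (simp add: xi_def Complex_eq)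

text \<open>For angles up to 1/2 the cosine is at least \<open>1 - 1/8\<close> and the sine at most
  1/2; the slope 4/7 of the cone is the quotient of these bounds.\<close>

lemma cos_sin_bounds:
  assumes "0 \<le> y" "y < om \<kappa> x"
  shows "7 / 8 \<le> cos (Im (N y))" "\<bar>sin (Im (N y))\<bar> \<le> 4 / 7 * cos (Im (N y))"
proof -
  define b where "b = Im (N y)"
  have b: "\<bar>b\<bar> \<le> 1 / 2" using Im_N_le[OF assms] by (simp add: b_def)
  then have "\<bar>b\<bar>\<^sup>2 \<le> (1 / 2)\<^sup>2" by (intro power_mono) auto
  then have b2: "b\<^sup>2 \<le> 1 / 4" by (simp add: power_divide)
  have "sin (b / 2) ^ 2 \<le> \<bar>b / 2\<bar>\<^sup>2"
    using power_mono[OF abs_sin_x_le_abs_x[of "b / 2"], of 2] by simp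
  then have "cos b \<ge> 1 - b\<^sup>2 / 2"
    using cos_double_sin[of "b / 2"] by (simp add: power_divide)
  then show c: "7 / 8 \<le> cos (Im (N y))" using b2 by (simp add: b_def)
  have "\<bar>sin b\<bar> \<le> 1 / 2" using abs_sin_x_le_abs_x[of b] b by linarith
  then show "\<bar>sin (Im (N y))\<bar> \<le> 4 / 7 * cos (Im (N y))" using c by (simp add: b_def)
qed

lemma Re_xi_mono:
  assumes "0 \<le> y1" "y1 \<le> y2" "y2 < om \<kappa> x" and c: "\<And>y. y1 \<le> y \<Longrightarrow> y \<le> y2 \<Longrightarrow> c \<le> cosh (Re (N y))"
  shows "Re (xi y1) + 7 / 8 * c * (y2 - y1) \<le> Re (xi y2)"
proof -
  have "Re (xi y1) - 7 / 8 * c * y1 \<le> Re (xi y2) - 7 / 8 * c * y2"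
  proof (rule DERIV_nonneg_imp_nondecreasing[OF assms(2)])
    fix y assume y: "y1 \<le> y" "y \<le> y2"
    then have y': "\<bar>y\<bar> < om \<kappa> x" using assms by auto
    have 1: "((\<lambda>y. Re (xi y) - 7 / 8 * c * y) has_real_derivative
        (cosh (Re (N y)) * cos (Im (N y)) - 7 / 8 * c)) (at y)"
      by (intro DERIV_diff Re_xi_deriv[OF y'] DERIV_cmult_Id)
    have "cosh (Re (N y)) * (7 / 8) \<le> cosh (Re (N y)) * cos (Im (N y))"
      using cos_sin_bounds(1)[of y] y assms by (intro mult_left_mono) auto
    then have "0 \<le> cosh (Re (N y)) * cos (Im (N y)) - 7 / 8 * c" using c[OF y] by linarith
    with 1 show "\<exists>d. ((\<lambda>y. Re (xi y) - 7 / 8 * c * y) has_real_derivative d) (at y) \<and> 0 \<le> d" by blast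
  qed
  then show ?thesis unfolding right_diff_distrib by linarith
qed

lemma Re_xi_strict_mono:
  assumes "0 \<le> y1" "y1 < y2" "y2 < om \<kappa> x"
  shows "Re (xi y1) < Re (xi y2)"
proof -
  have "0 < 7 / 8 * 1 * (y2 - y1)" using assms by simp
  moreover have "Re (xi y1) + 7 / 8 * 1 * (y2 - y1) \<le> Re (xi y2)"
    by (rule Re_xi_mono) (use assms in \<open>auto simp: cosh_real_ge_1\<close>)
  ultimately show ?thesis by linarith
qed

lemma Re_xi_pos: "0 < y \<Longrightarrow> y < om \<kappa> x \<Longrightarrow> 0 < Re (xi y)"
  using Re_xi_strict_mono[of 0 y] by (simp add: xi_0)

text \<open>The cone is convex and contains every velocity, hence it also contains their
  integral.\<close>

lemma Im_xi_le:
  assumes y: "0 \<le> y" "y < om \<kappa> x"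
  shows "\<bar>Im (xi y)\<bar> \<le> 4 / 7 * Re (xi y)"
proof -
  have "s * Im (xi y) \<le> 4 / 7 * Re (xi y)" if s: "s = 1 \<or> s = -1" for s :: real
  proof -
    have "4 / 7 * Re (xi 0) - s * Im (xi 0) \<le> 4 / 7 * Re (xi y) - s * Im (xi y)"
    proof (rule DERIV_nonneg_imp_nondecreasing[OF y(1)])
      fix t assume t: "0 \<le> t" "t \<le> y"
      then have t': "\<bar>t\<bar> < om \<kappa> x" using y by auto
      have 1: "((\<lambda>y. 4 / 7 * Re (xi y) - s * Im (xi y)) has_real_derivative
          (4 / 7 * (cosh (Re (N t)) * cos (Im (N t))) - s * (- cosh (Re (N t)) * sin (Im (N t))))) (at t)"
        by (intro DERIV_diff DERIV_cmult Re_xi_deriv Im_xi_deriv t')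
      have "\<bar>sin (Im (N t))\<bar> \<le> 4 / 7 * cos (Im (N t))" using cos_sin_bounds(2)[of t] t y by auto
      then have "0 \<le> 4 / 7 * cos (Im (N t)) + s * sin (Im (N t))" using s by (auto simp: abs_le_iff)
      then have "0 \<le> cosh (Re (N t)) * (4 / 7 * cos (Im (N t)) + s * sin (Im (N t)))"
        by (intro mult_nonneg_nonneg) auto
      then have "0 \<le> 4 / 7 * (cosh (Re (N t)) * cos (Im (N t))) - s * (- cosh (Re (N t)) * sin (Im (N t)))"
        by (simp add: algebra_simps)
      with 1 show "\<exists>d. ((\<lambda>y. 4 / 7 * Re (xi y) - s * Im (xi y)) has_real_derivative d) (at t) \<and> 0 \<le> d" by blast
    qed
    then show ?thesis by (simp add: xi_0)
  qed
  from this[of 1] this[of "-1"] show ?thesis by (auto simp: abs_le_iff)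
qed

lemma cmod_xi: "cmod (xi y) = cmod (X \<kappa> (Complex x y))"
  using G_unit[OF kx] by (simp add: xi_def norm_mult)

text \<open>Half the derivative is the inner product of position and velocity. Both lie in the cone
  of slope 4/7 about the real axis; as 4/7 is below 1, the angle between them is acute.\<close>

lemma radius_deriv:
  assumes y: "0 < y" "y < om \<kappa> x"
  shows "\<exists>d>0. ((\<lambda>y. (cmod (X \<kappa> (Complex x y)))\<^sup>2) has_real_derivative d) (at y)"
proof -
  have y': "\<bar>y\<bar> < om \<kappa> x" using y by auto
  let ?c = "cosh (Re (N y))" and ?b = "Im (N y)"
  have eq: "(\<lambda>y. (cmod (X \<kappa> (Complex x y)))\<^sup>2) = (\<lambda>y. (Re (xi y))\<^sup>2 + (Im (xi y))\<^sup>2)"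
    by (simp add: cmod_xi[symmetric] cmod_power2)
  have 1: "((\<lambda>y. (cmod (X \<kappa> (Complex x y)))\<^sup>2) has_real_derivative
      2 * ?c * (Re (xi y) * cos ?b - Im (xi y) * sin ?b)) (at y)"
    unfolding eq
    by (rule DERIV_cong[OF DERIV_add[OF DERIV_power[OF Re_xi_deriv[OF y'], of 2] DERIV_power[OF Im_xi_deriv[OF y'], of 2]]])
      (simp add: algebra_simps)
  have "\<bar>Im (xi y) * sin ?b\<bar> \<le> (4 / 7 * Re (xi y)) * (4 / 7 * cos ?b)"
    unfolding abs_mult using Im_xi_le[of y] cos_sin_bounds(2)[of y] Re_xi_pos[of y] y by (intro mult_mono) auto
  moreover have "0 < Re (xi y) * cos ?b"
    using Re_xi_pos[of y] cos_sin_bounds(1)[of y] y by (intro mult_pos_pos) auto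
  ultimately have "0 < Re (xi y) * cos ?b - Im (xi y) * sin ?b" by (simp add: abs_le_iff)
  then have "0 < 2 * ?c * (Re (xi y) * cos ?b - Im (xi y) * sin ?b)" by simp
  with 1 show ?thesis by blast
qed

lemma radius_strict_mono:
  assumes y: "0 \<le> y1" "y1 < y2" "y2 < om \<kappa> x"
  shows "cmod (X \<kappa> (Complex x y1)) < cmod (X \<kappa> (Complex x y2))"
proof -
  have "(cmod (X \<kappa> (Complex x y1)))\<^sup>2 < (cmod (X \<kappa> (Complex x y2)))\<^sup>2"
  \<comment> \<open>The squared radius has zero derivative on the axis, so a start at
    \<open>y1 = 0\<close> is compared directly.\<close>
  proof (cases "y1 = 0")
    case True
    have "xi y2 \<noteq> 0" using Re_xi_pos[of y2] y True by auto
    then have "cmod (xi y2) > 0" by simp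
    then show ?thesis using True X_of_real[of \<kappa> x] by (simp add: cmod_xi Complex_eq)
  next
    case False
    show ?thesis
    proof (rule DERIV_pos_imp_increasing[OF y(2)])
      fix t assume "y1 \<le> t" "t \<le> y2"
      then have "0 < t" "t < om \<kappa> x" using y False by auto
      from radius_deriv[OF this]
      show "\<exists>d. ((\<lambda>y. (cmod (X \<kappa> (Complex x y)))\<^sup>2) has_real_derivative d) (at t) \<and> 0 < d" by blast
    qed
  qed
  then show ?thesis by (rule power_less_imp_less_base) simp
qed

text \<open>On the interval from \<open>om / 4\<close> to \<open>om / 2\<close> the speed is at
  least of order \<open>m^4\<close>, while the interval has length of order \<open>dd / m\<close>.
  Because velocities stay in the cone, the length gained there is gained in \<open>Re xi\<close>,
  and hence in the radius, up to the factor 7/8.\<close>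

lemma radius_large: "2 \<le> cmod (X \<kappa> (Complex x (om \<kappa> x / 2)))"
proof -
  define m where "m = mm \<kappa> x"
  define w where "w = om \<kappa> x"
  have w: "0 < w" using om_pos[OF bnd] by (simp add: w_def)
  have m: "5000 \<le> m" "10 ^ 8 \<le> m\<^sup>2 * dd \<kappa> x" using mm_ge[OF bnd] mm_sq_dd[OF bnd] by (auto simp: m_def)
  \<comment> \<open>On the interval considered \<open>Re N\<close> is at least
    \<open>m / 20\<close>; \<open>m / 80\<close> is a quarter of this, as in
    \<open>cosh_lower_bound\<close>.\<close>
  define c where "c = (m / 80) ^ 4 / 2"
  have c: "c \<le> cosh (Re (N y))" if "w / 4 \<le> y" "y \<le> w / 2" for y
  proof -
    have "m / 20 \<le> 85 / 100 * (m / 4) / 4" using m by simp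
    also have "\<dots> = 85 / 100 * fr \<kappa> x * (w / 4)" using om_fr[OF bnd] by (simp add: m_def w_def mult_ac)
    also have "\<dots> \<le> 85 / 100 * fr \<kappa> x * y" using that fr_pos[OF bnd] by (intro mult_left_mono) auto
    also have "\<dots> \<le> Re (N y)" using that w by (intro Re_N_ge) (auto simp: w_def)
    finally have a: "m / 20 \<le> Re (N y)" .
    then have "(m / 20 / 4) ^ 4 \<le> (Re (N y) / 4) ^ 4" using m by (intro power_mono divide_right_mono) auto
    moreover have "(Re (N y) / 4) ^ 4 / 2 \<le> cosh (Re (N y))" using a m by (intro cosh_lower_bound) auto
    ultimately show ?thesis by (simp add: c_def)
  qed
  have "Re (xi (w / 4)) + 7 / 8 * c * (w / 2 - w / 4) \<le> Re (xi (w / 2))"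
    using w c by (intro Re_xi_mono) (auto simp: w_def)
  moreover have "0 < Re (xi (w / 4))" using w by (intro Re_xi_pos) (auto simp: w_def)
  moreover have "2 \<le> 7 / 8 * c * (w / 4)"
  proof -
    have "m * w = dd \<kappa> x / 4" using mm_pos[OF bnd] by (simp add: w_def om_def m_def)
    then have "7 / 8 * c * (w / 4) = 7 / (64 * 80 ^ 4) * (m ^ 3 * (dd \<kappa> x / 4))"
      by (simp add: c_def power4_eq_xxxx power3_eq_cube field_simps)
    also have "m ^ 3 * (dd \<kappa> x / 4) = m * (m\<^sup>2 * dd \<kappa> x) / 4" by (simp add: power3_eq_cube power2_eq_square)
    finally have eq: "7 / 8 * c * (w / 4) = 7 / (64 * 80 ^ 4) * (m * (m\<^sup>2 * dd \<kappa> x) / 4)" .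
    have "5000 * 10 ^ 8 \<le> m * (m\<^sup>2 * dd \<kappa> x)" using m by (intro mult_mono) auto
    then have "7 / (64 * 80 ^ 4) * (5000 * 10 ^ 8 / 4) \<le> 7 / (64 * 80 ^ 4) * (m * (m\<^sup>2 * dd \<kappa> x) / 4)"
      by (intro mult_left_mono divide_right_mono) auto
    moreover have "2 \<le> 7 / (64 * 80 ^ 4) * (5000 * 10 ^ 8 / 4 :: real)" by simp
    ultimately show ?thesis unfolding eq by (rule order_trans[rotated])
  qed
  ultimately have "2 \<le> Re (xi (w / 2))" by simp
  also have "\<dots> \<le> cmod (xi (w / 2))" by (rule complex_Re_le_cmod)
  finally show ?thesis by (simp add: cmod_xi w_def)
qed

text \<open>The speed \<open>cosh v\<close> increases along the half slice, so its final value
  bounds it throughout. Read backwards: a point far from the axis has a large \<open>cosh v\<close>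
  compared with its small height \<open>y\<close>, which damps the curvature.\<close>

lemma radius_upper:
  assumes y: "0 \<le> y" "y < om \<kappa> x"
  shows "cmod (X \<kappa> (Complex x y)) \<le> y * cosh (Re (N y))"
proof -
  have "norm (xi y - xi 0) \<le> cosh (Re (N y)) * norm (y - 0)"
  proof (rule differentiable_bound)
    show "convex {0..y}" by simp
    fix t assume "t \<in> {0..y}"
    then have t: "0 \<le> t" "t \<le> y" "\<bar>t\<bar> < om \<kappa> x" using y by auto
    show "(xi has_derivative (\<lambda>h. h *\<^sub>R (of_real (cosh (Re (N t))) * cis (- Im (N t))))) (at t within {0..y})"
      using xi_deriv[OF t(3)] by (auto simp: has_vector_derivative_def intro: has_derivative_at_withinI)
    have "0 \<le> 85 / 100 * fr \<kappa> x * t" using t fr_pos[OF bnd] by simp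
    then have "0 \<le> Re (N t)" using Re_N_ge[of t] t y by linarith
    moreover have "0 \<le> 85 / 100 * fr \<kappa> x * (y - t)" using t fr_pos[OF bnd] by simp
    then have "Re (N t) \<le> Re (N y)" using Re_N_mono[of t y] t y by linarith
    ultimately have "cosh (Re (N t)) \<le> cosh (Re (N y))" by (simp add: cosh_real_nonneg_le_iff)
    then show "onorm (\<lambda>h. h *\<^sub>R (of_real (cosh (Re (N t))) * cis (- Im (N t)))) \<le> cosh (Re (N y))"
      by (intro onorm_le) (simp add: norm_mult mult_ac mult_left_mono)
  qed (use y in auto)
  then show ?thesis using y by (simp add: xi_0 cmod_xi mult.commute)
qed

lemma X_continuous_slice: "continuous_on {-om \<kappa> x<..<om \<kappa> x} (\<lambda>y. cmod (X \<kappa> (Complex x y)))"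
proof -
  have "continuous_on {-om \<kappa> x<..<om \<kappa> x} xi"
  proof (rule continuous_at_imp_continuous_on, rule ballI)
    fix y assume "y \<in> {-om \<kappa> x<..<om \<kappa> x}"
    then have "\<bar>y\<bar> < om \<kappa> x" by auto
    from xi_deriv[OF this] show "isCont xi y" by (rule has_vector_derivative_continuous)
  qed
  then have "continuous_on {-om \<kappa> x<..<om \<kappa> x} (\<lambda>y. cmod (xi y))" by (intro continuous_intros)
  then show ?thesis by (simp add: cmod_xi)
qed

lemma ex1_radius:
  assumes "0 < r" "r < 2"
  shows "\<exists>!y. 0 < y \<and> y < om \<kappa> x \<and> cmod (X \<kappa> (Complex x y)) = r"
proof -
  define w where "w = om \<kappa> x / 2"
  have w: "0 < w" "w < om \<kappa> x" using om_pos[OF bnd] by (auto simp: w_def)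
  have 0: "cmod (X \<kappa> (Complex x 0)) = 0" using X_of_real[of \<kappa> x] by (simp add: Complex_eq)
  have "\<exists>y. 0 \<le> y \<and> y \<le> w \<and> cmod (X \<kappa> (Complex x y)) = r"
  proof (rule IVT')
    show "cmod (X \<kappa> (Complex x 0)) \<le> r" using 0 assms by simp
    show "r \<le> cmod (X \<kappa> (Complex x w))" using radius_large assms by (simp add: w_def)
    show "continuous_on {0..w} (\<lambda>y. cmod (X \<kappa> (Complex x y)))"
      using w by (intro continuous_on_subset[OF X_continuous_slice]) auto
  qed (use w in auto)
  then obtain y where y: "0 \<le> y" "y \<le> w" "cmod (X \<kappa> (Complex x y)) = r" by blast
  have "y \<noteq> 0" using y 0 assms by auto
  show ?thesis
  proof (rule ex1I)
    show "0 < y \<and> y < om \<kappa> x \<and> cmod (X \<kappa> (Complex x y)) = r" using y w \<open>y \<noteq> 0\<close> by auto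
    fix t assume t: "0 < t \<and> t < om \<kappa> x \<and> cmod (X \<kappa> (Complex x t)) = r"
    then show "t = y"
      using radius_strict_mono[of t y] radius_strict_mono[of y t] y w by (cases t y rule: linorder_cases) auto
  qed
qed

end

end

section \<open>The radius as a coordinate on slices\<close>

context blowup_set
begin

text \<open>The function \<open>g\<close> is an argument, outside the locale of the Weierstrass
  data, so that two data agreeing over a gap can be seen to give the same parametrization there;
  likewise for \<open>psiG\<close> and \<open>FG\<close>.\<close>

definition yyG :: "(complex \<Rightarrow> complex) \<Rightarrow> real \<Rightarrow> real \<Rightarrow> real \<Rightarrow> real" where
  "yyG g \<kappa> x r = (THE y. 0 < y \<and> y < om \<kappa> x \<and> cmod (Xm g (Complex x y)) = r)"

end

context weierstrass
begin

definition yy :: "real \<Rightarrow> real \<times> real \<Rightarrow> real" where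
  "yy \<kappa> = (\<lambda>(x, r). yyG (G \<kappa>) \<kappa> x r)"

definition \<Omega>2 :: "(real \<times> (real \<times> real)) set" where
  "\<Omega>2 = {(\<kappa>, (x, r)). \<kappa> \<in> T \<and> x \<in> J \<and> 0 < r \<and> r < 2}"

lemma yy:
  assumes "\<kappa> \<in> T" "x \<in> J" "0 < r" "r < 2"
  shows "0 < yy \<kappa> (x, r)" "yy \<kappa> (x, r) < om \<kappa> x" "cmod (X \<kappa> (Complex x (yy \<kappa> (x, r)))) = r"
  using theI'[OF ex1_radius[OF assms]] by (auto simp: yy_def yyG_def X_def)

lemma yy_unique:
  assumes "\<kappa> \<in> T" "x \<in> J" "0 < y" "y < om \<kappa> x" "cmod (X \<kappa> (Complex x y)) = r" "r < 2"
  shows "y = yy \<kappa> (x, r)"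
proof -
  have "r > 0"
    using radius_strict_mono[OF assms(1,2), of 0 y] assms(3-5) norm_ge_zero[of "X \<kappa> (Complex x 0)"] by linarith
  from ex1_radius[OF assms(1,2) this assms(6)] yy[OF assms(1,2) this assms(6)] assms
  show ?thesis by blast
qed

lemma open_slices_\<Omega>2: "open_slices \<Omega>2"
  unfolding open_slices_def
proof
  fix \<kappa>
  show "open {w. (\<kappa>, w) \<in> \<Omega>2}"
  proof (cases "\<kappa> \<in> T")
    case True
    then have "{w. (\<kappa>, w) \<in> \<Omega>2} = J \<times> {0<..<2}" by (auto simp: \<Omega>2_def)
    then show ?thesis using J by (simp add: open_Times)
  qed (simp add: \<Omega>2_def)
qed

lemma ck_G: "ck n \<Omega> G"
  using \<Omega>_product G_cont holomorphic_G by (intro ck_holomorphic) (auto simp: \<Omega>_def)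

lemma ck_inverse_G: "ck n \<Omega> (\<lambda>\<kappa> z. 1 / G \<kappa> z)"
proof (rule ck_holomorphic[OF \<Omega>_product])
  show "continuous_on \<Omega> (\<lambda>(\<kappa>, z). 1 / G \<kappa> z)"
    using ck_continuous[OF ck_G] G_nz by (auto simp: case_prod_unfold intro!: continuous_intros)
  show "(\<lambda>z. 1 / G \<kappa> z) holomorphic_on {z. (\<kappa>, z) \<in> \<Omega>}" for \<kappa>
    using G_nz by (intro holomorphic_intros holomorphic_G) auto
qed

lemma ck_X: "ck n \<Omega> X"
proof (cases n)
  case (Suc m)
  have "ck m \<Omega> (\<lambda>\<kappa> z. (cnj (b * (1 / G \<kappa> z)) - b * G \<kappa> z) * (1 / 2))" for b
    by (intro ck_mult ck_diff ck_cnj ck_const ck_G ck_inverse_G)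
  then have "ck m \<Omega> (\<lambda>\<kappa> z. (cnj (b / G \<kappa> z) - b * G \<kappa> z) / 2)" for b by simp
  then show ?thesis unfolding Suc
    by (intro ck_SucI[OF continuous_X X_deriv])
qed (simp add: continuous_X)

lemma continuous_yy: "continuous_on \<Omega>2 (\<lambda>(\<kappa>, w). yy \<kappa> w)"
proof -
  define D where "D = {(u :: real \<times> (real \<times> real), y). u \<in> \<Omega>2 \<and> 0 < y \<and> y < om (fst u) (fst (snd u))}"
  have "continuous_on \<Omega>2 (\<lambda>u. yy (fst u) (snd u))"
  proof (rule continuous_on_root)
    have "continuous_on D (\<lambda>v. (\<lambda>(\<kappa>, z). X \<kappa> z) (fst (fst v), Complex (fst (snd (fst v))) (snd v)))"
      unfolding Complex_eq
      by (rule continuous_on_compose2[OF continuous_X])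
        (auto simp: D_def \<Omega>2_def \<Omega>_def intro!: continuous_intros)
    then show "continuous_on D (\<lambda>(u, y). cmod (X (fst u) (Complex (fst (snd u)) y)) - snd (snd u))"
      by (auto simp: case_prod_unfold intro!: continuous_intros)
    show "open {v :: (real \<times> (real \<times> real)) \<times> real. (fst (fst v), Complex (fst (snd (fst v))) (snd v)) \<in> UU \<and> 0 < snd v}"
    proof -
      have "open ((\<lambda>v :: (real \<times> (real \<times> real)) \<times> real. (fst (fst v), Complex (fst (snd (fst v))) (snd v))) -` UU)"
        unfolding Complex_eq by (intro open_vimage open_UU continuous_intros)
      then show ?thesis
        by (intro open_Collect_conj open_Collect_less continuous_intros) (simp add: vimage_def)
    qed
    show "D = \<Omega>2 \<times> UNIV \<inter> {v. (fst (fst v), Complex (fst (snd (fst v))) (snd v)) \<in> UU \<and> 0 < snd v}"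
      using TJ_bounds by (auto simp: D_def \<Omega>2_def UU_def)
  next
    fix u y1 y2 assume "(u, y1) \<in> D" "(u, y2) \<in> D" "y1 < y2"
    then show "cmod (X (fst u) (Complex (fst (snd u)) y1)) - snd (snd u)
        < cmod (X (fst u) (Complex (fst (snd u)) y2)) - snd (snd u)"
      using radius_strict_mono[of "fst u" "fst (snd u)" y1 y2] by (auto simp: D_def \<Omega>2_def)
  next
    fix u assume "u \<in> \<Omega>2"
    then show "(u, yy (fst u) (snd u)) \<in> D"
      "cmod (X (fst u) (Complex (fst (snd u)) (yy (fst u) (snd u)))) - snd (snd u) = 0"
      using yy by (auto simp: D_def \<Omega>2_def)
  qed
  then show ?thesis by (simp add: case_prod_unfold)
qed

text \<open>The defining equation is squared, which makes it polynomial in the real and imaginary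
  parts of \<open>X\<close>; its derivative in \<open>y\<close> is the positive one of
  \<open>radius_deriv\<close>.\<close>

lemma ck_yy: "ck n \<Omega>2 yy"
proof (rule ck_implicit[OF open_slices_\<Omega>2])
  define \<Omega>' where "\<Omega>' = {(\<kappa>, ((x, r), y)). (\<kappa>, Complex x y) \<in> \<Omega>} \<inter> {(\<kappa>, ((x::real, r::real), y)). True}"
  have XX: "ck n \<Omega>' (\<lambda>\<kappa> w. X \<kappa> (of_real (fst (fst w)) + \<i> * of_real (snd w)))" for n
  proof (rule ck_compose[OF ck_X])
    have "bounded_linear (\<lambda>w :: (real \<times> real) \<times> real. complex_of_real (fst (fst w)) + \<i> * of_real (snd w))"
      by (intro bounded_linear_add bounded_linear_const_mult
          bounded_linear_compose[OF bounded_linear_of_real] bounded_linear_compose[OF bounded_linear_fst]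
          bounded_linear_fst bounded_linear_snd)
    then show "ck n \<Omega>' (\<lambda>\<kappa> w :: (real \<times> real) \<times> real. complex_of_real (fst (fst w)) + \<i> * of_real (snd w))"
      by (rule ck_linear)
  qed (auto simp: \<Omega>'_def Complex_eq)
  have r: "ck n \<Omega>' (\<lambda>\<kappa> w. snd (fst w))" for n
    by (intro ck_linear bounded_linear_compose[OF bounded_linear_snd] bounded_linear_fst)
  have cm: "(cmod w)\<^sup>2 = Re w * Re w + Im w * Im w" for w
    by (simp add: cmod_power2 flip: power2_eq_square)
  have "ck n \<Omega>' (\<lambda>\<kappa> w. Re (X \<kappa> (of_real (fst (fst w)) + \<i> * of_real (snd w))) * Re (X \<kappa> (of_real (fst (fst w)) + \<i> * of_real (snd w)))
      + Im (X \<kappa> (of_real (fst (fst w)) + \<i> * of_real (snd w))) * Im (X \<kappa> (of_real (fst (fst w)) + \<i> * of_real (snd w)))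
      - snd (fst w) * snd (fst w))" for n
    by (intro ck_diff ck_add ck_mult ck_Re ck_Im XX r)
  then show "ck n \<Omega>' (\<lambda>\<kappa> w. (cmod (X \<kappa> (Complex (fst (fst w)) (snd w))))\<^sup>2 - (snd (fst w))\<^sup>2)" for n
    unfolding cm by (simp add: power2_eq_square Complex_eq)
  show "continuous_on \<Omega>2 (\<lambda>(\<kappa>, w). yy \<kappa> w)" by (rule continuous_yy)
  fix \<kappa> and w :: "real \<times> real" assume w: "(\<kappa>, w) \<in> \<Omega>2"
  obtain x r where xr: "w = (x, r)" "\<kappa> \<in> T" "x \<in> J" "0 < r" "r < 2" using w by (auto simp: \<Omega>2_def)
  note y = yy[OF xr(2-5)]
  show "(\<kappa>, (w, yy \<kappa> w)) \<in> \<Omega>'"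
    using y xr by (auto simp: \<Omega>'_def \<Omega>_def)
  show "(cmod (X \<kappa> (Complex (fst (fst (w, yy \<kappa> w))) (snd (w, yy \<kappa> w)))))\<^sup>2 - (snd (fst (w, yy \<kappa> w)))\<^sup>2 = 0"
    using y xr by simp
  fix c assume c: "((\<lambda>s. (cmod (X \<kappa> (Complex (fst (fst (w, s))) (snd (w, s)))))\<^sup>2 - (snd (fst (w, s)))\<^sup>2) has_real_derivative c) (at (yy \<kappa> w))"
  obtain d where d: "d > 0" "((\<lambda>y. (cmod (X \<kappa> (Complex x y)))\<^sup>2) has_real_derivative d) (at (yy \<kappa> w))"
    using radius_deriv[OF xr(2,3)] y xr by blast
  have "((\<lambda>y. (cmod (X \<kappa> (Complex x y)))\<^sup>2 - r\<^sup>2) has_real_derivative d - 0) (at (yy \<kappa> w))"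
    by (intro DERIV_diff d(2) DERIV_const)
  then have "c = d" using c xr by (auto intro: DERIV_unique)
  then show "c \<noteq> 0" using d by simp
qed

end

section \<open>Curvature of the immersion\<close>

lemma matrix_inv_left_inverse:
  fixes A :: "'a::semiring_1^'n^'m"
  assumes "invertible A"
  shows "matrix_inv A ** A = mat 1"
  using someI_ex[OF assms[unfolded invertible_def]] unfolding matrix_inv_def by blast

lemma matrix_inv_2:
  fixes g :: "real^2^2"
  assumes "det g \<noteq> 0"
  shows "matrix_inv g = vector [vector [g$2$2 / det g, - g$1$2 / det g], vector [- g$2$1 / det g, g$1$1 / det g]]"
    (is "_ = ?K")
proof -
  define \<delta> where "\<delta> = det g"
  have D: "g$1$1 * g$2$2 - g$1$2 * g$2$1 = \<delta>" by (simp add: det_2 \<delta>_def)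
  have \<delta>: "\<delta> \<noteq> 0" using assms by (simp add: \<delta>_def)
  define K where "K = ?K"
  have K: "K$1$1 = g$2$2 / \<delta>" "K$1$2 = - g$1$2 / \<delta>" "K$2$1 = - g$2$1 / \<delta>" "K$2$2 = g$1$1 / \<delta>"
    by (simp_all add: K_def \<delta>_def)
  have e: "(g ** K)$i$j = g$i$1 * K$1$j + g$i$2 * K$2$j" for i j
    by (simp add: matrix_matrix_mult_def sum_2)
  have "(g ** K)$1$1 = (g$1$1 * g$2$2 - g$1$2 * g$2$1) / \<delta>" "(g ** K)$2$2 = (g$1$1 * g$2$2 - g$1$2 * g$2$1) / \<delta>"
    "(g ** K)$1$2 = 0" "(g ** K)$2$1 = 0"
    unfolding e K by (simp_all add: diff_divide_distrib mult.commute)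
  then have "(g ** K)$1$1 = 1" "(g ** K)$2$2 = 1" "(g ** K)$1$2 = 0" "(g ** K)$2$1 = 0"
    unfolding D using \<delta> by auto
  then have "g ** ?K = mat 1"
    unfolding K_def[symmetric] vec_eq_iff forall_2 by (simp add: mat_def)
  then have "matrix_inv g = matrix_inv g ** (g ** ?K)" by (simp only: matrix_mul_rid)
  also have "\<dots> = (matrix_inv g ** g) ** ?K" by (rule matrix_mul_assoc)
  also have "matrix_inv g ** g = mat 1"
    using assms by (intro matrix_inv_left_inverse) (simp add: invertible_det_nz)
  finally show ?thesis by (simp only: matrix_mul_lid)
qed

lemma trace_matrix_inv_mult_2:
  fixes g b :: "real^2^2"
  assumes "det g \<noteq> 0"
  shows "trace (matrix_inv g ** b) = (g$2$2 * b$1$1 - g$1$2 * b$2$1 - g$2$1 * b$1$2 + g$1$1 * b$2$2) / det g"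
  using assms
  by (simp add: matrix_inv_2 trace_def matrix_matrix_mult_def sum_2 add_divide_distrib diff_divide_distrib)

lemma trace_square_2:
  fixes s :: "real^2^2"
  shows "trace (s ** s) = (trace s)\<^sup>2 - 2 * det s"
  by (simp add: trace_def matrix_matrix_mult_def sum_2 det_2 power2_eq_square algebra_simps)

lemma det_matrix_inv_mult:
  fixes g b :: "real^2^2"
  assumes "det g \<noteq> 0"
  shows "det (matrix_inv g ** b) = det b / det g"
proof -
  have "invertible g" using assms by (simp add: invertible_det_nz)
  then have "matrix_inv g ** g = mat 1" by (rule matrix_inv_left_inverse)
  then have "det (matrix_inv g) * det g = 1" by (metis det_I det_mul)
  then show ?thesis using assms by (simp add: det_mul field_simps)
qed

text \<open>Here \<open>g = exp (- v + i u)\<close>, \<open>c + i s = exp (i u)\<close>, \<open>C = cosh v\<close>, \<open>H = sinh v\<close>; the conformal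
  parametrization has tangent vectors \<open>(H c, H s, 1)\<close> and \<open>(C s, - C c, 0)\<close>, and \<open>\<alpha>\<close>, \<open>\<beta>\<close> come from
  the reparametrization that straightens the boundary.\<close>

lemma curvature_algebra:
  fixes F :: "real^2 \<Rightarrow> real^3" and w :: "real^2"
  assumes C: "C > 0" "C\<^sup>2 = 1 + H\<^sup>2" and cs: "c\<^sup>2 + s\<^sup>2 = 1" and \<beta>: "\<beta> > 0"
    and B: "B = vector [C * s, - (C * c), 0]"
    and F1: "iter_deriv [axis 1 1] F w = vector [H * c, H * s, 1] + \<alpha> *\<^sub>R B"
    and F2: "iter_deriv [axis 2 1] F w = \<beta> *\<^sub>R B"
    and m: "m1 = p - q * \<alpha>" "n1 = q + p * \<alpha>" "m2 = - q * \<beta>" "n2 = p * \<beta>"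
    and A1: "A1 = vector [n1 * C * c - m1 * H * s, n1 * C * s + m1 * H * c, 0]"
    and B1: "B1 = vector [m1 * C * c + n1 * H * s, m1 * C * s - n1 * H * c, 0]"
    and A2: "A2 = vector [n2 * C * c - m2 * H * s, n2 * C * s + m2 * H * c, 0]"
    and B2: "B2 = vector [m2 * C * c + n2 * H * s, m2 * C * s - n2 * H * c, 0]"
    and F11: "iter_deriv [axis 1 1, axis 1 1] F w = A1 + \<alpha> *\<^sub>R B1 + t11 *\<^sub>R B"
    and F21: "iter_deriv [axis 2 1, axis 1 1] F w = A2 + \<alpha> *\<^sub>R B2 + t21 *\<^sub>R B"
    and F12: "iter_deriv [axis 1 1, axis 2 1] F w = \<beta> *\<^sub>R B1 + t12 *\<^sub>R B"
    and F22: "iter_deriv [axis 2 1, axis 2 1] F w = \<beta> *\<^sub>R B2 + t22 *\<^sub>R B"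
  shows "mean_curvature F w = 0"
    and "trace (shape_operator F w ** shape_operator F w) = 2 * (p\<^sup>2 + q\<^sup>2) / C ^ 4"
proof -
  \<comment> \<open>The inverse stereographic projection of \<open>g\<close>, that is, the Gauss map
    of the surface.\<close>
  define n :: "real^3" where "n = vector [c / C, s / C, - H / C]"
  have cc: "c * c + s * s = 1" and CC: "C * C = 1 + H * H" using C cs by (auto simp: power2_eq_square)
  have "cross3 (iter_deriv [axis 1 1] F w) (iter_deriv [axis 2 1] F w) = (\<beta> * C\<^sup>2) *\<^sub>R n"
  proof -
    have "- (\<beta> * (C * (H * (c * c)))) - \<beta> * (C * (H * (s * s))) = - (\<beta> * (C * H)) * (c * c + s * s)"
      by (simp add: algebra_simps)
    also have "\<dots> = - (\<beta> * (C * H))" by (simp add: cc)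
    finally have "cross3 (iter_deriv [axis 1 1] F w) (iter_deriv [axis 2 1] F w)
        = vector [\<beta> * C * c, \<beta> * C * s, - (\<beta> * C * H)]"
      unfolding F1 F2 B cross3_def vec_eq_iff forall_3
      by (simp add: algebra_simps)
    also have "\<dots> = (\<beta> * C\<^sup>2) *\<^sub>R n"
      unfolding n_def vec_eq_iff forall_3 using C(1) by (simp add: power2_eq_square)
    finally show ?thesis .
  qed
  moreover have nn: "norm n = 1"
  proof -
    have "n \<bullet> n = (c * c + s * s + H * H) / (C * C)"
      by (simp add: n_def inner_vec_def sum_3 add_divide_distrib)
    also have "\<dots> = 1" using C(1) by (simp add: cc CC[symmetric])
    finally show ?thesis by (simp add: norm_eq_1)
  qed
  moreover have "\<beta> * C\<^sup>2 > 0" using C(1) \<beta> by simp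
  ultimately have un: "unit_normal F w = n"
    unfolding unit_normal_def by (simp only: sgn_scaleR sgn_pos scaleR_one) (simp add: sgn_div_norm nn)
  have nB: "B \<bullet> n = 0" by (simp add: B n_def inner_vec_def sum_3)
  \<comment> \<open>If \<open>f\<close> times the derivative of the conformal parameter is
    \<open>m + i n\<close> in some direction, then the derivatives of the two conformal tangent
    vectors in this direction have normal components \<open>n\<close> and \<open>m\<close>; all
    multiples of \<open>B\<close> are tangential and drop out.\<close>
  have nA: "vector [k * C * c - l * H * s, k * C * s + l * H * c, 0] \<bullet> n = k" for k l
  proof -
    have "vector [k * C * c - l * H * s, k * C * s + l * H * c, 0] \<bullet> n = k * (c * c + s * s)"
      using C(1) by (simp add: n_def inner_vec_def sum_3 field_simps)
    then show ?thesis by (simp add: cc)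
  qed
  have nB': "vector [k * C * c + l * H * s, k * C * s - l * H * c, 0] \<bullet> n = k" for k l
  proof -
    have "vector [k * C * c + l * H * s, k * C * s - l * H * c, 0] \<bullet> n = k * (c * c + s * s)"
      using C(1) by (simp add: n_def inner_vec_def sum_3 field_simps)
    then show ?thesis by (simp add: cc)
  qed
  define b where "b = second_fundamental_form F w"
  define g where "g = first_fundamental_form F w"
  have b: "b$1$1 = n1 + \<alpha> * m1" "b$2$1 = n2 + \<alpha> * m2" "b$1$2 = \<beta> * m1" "b$2$2 = \<beta> * m2"
    unfolding b_def second_fundamental_form_def un
    by (simp_all only: vec_lambda_beta F11 F12 F21 F22 inner_add_left inner_scaleR_left nB A1 A2 B1 B2 nA nB')
  have AA: "(vector [H * c, H * s, 1] :: real^3) \<bullet> vector [H * c, H * s, 1] = C\<^sup>2"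
  proof -
    have "(vector [H * c, H * s, 1] :: real^3) \<bullet> vector [H * c, H * s, 1] = H * H * (c * c + s * s) + 1"
      by (simp add: inner_vec_def sum_3 algebra_simps)
    then show ?thesis by (simp add: cc CC power2_eq_square)
  qed
  have BB: "B \<bullet> B = C\<^sup>2"
  proof -
    have "B \<bullet> B = C * C * (c * c + s * s)" by (simp add: B inner_vec_def sum_3 algebra_simps)
    then show ?thesis by (simp add: cc power2_eq_square)
  qed
  have AB: "vector [H * c, H * s, 1] \<bullet> B = 0"
    by (simp add: B inner_vec_def sum_3)
  have g: "g$1$1 = C\<^sup>2 * (1 + \<alpha>\<^sup>2)" "g$1$2 = C\<^sup>2 * (\<alpha> * \<beta>)" "g$2$1 = C\<^sup>2 * (\<alpha> * \<beta>)" "g$2$2 = C\<^sup>2 * \<beta>\<^sup>2"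
  proof -
    define A :: "real^3" where "A = vector [H * c, H * s, 1]"
    have 1: "(A + \<alpha> *\<^sub>R B) \<bullet> (A + \<alpha> *\<^sub>R B) = A \<bullet> A + 2 * \<alpha> * (A \<bullet> B) + \<alpha>\<^sup>2 * (B \<bullet> B)"
      by (simp add: inner_add_left inner_add_right inner_commute[of B A] power2_eq_square algebra_simps)
    have 2: "(A + \<alpha> *\<^sub>R B) \<bullet> (\<beta> *\<^sub>R B) = \<beta> * (A \<bullet> B) + \<alpha> * \<beta> * (B \<bullet> B)"
      by (simp add: inner_add_left algebra_simps)
    have 3: "(\<beta> *\<^sub>R B) \<bullet> (A + \<alpha> *\<^sub>R B) = \<beta> * (A \<bullet> B) + \<alpha> * \<beta> * (B \<bullet> B)"
      using 2 by (simp add: inner_commute)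
    have 4: "(\<beta> *\<^sub>R B) \<bullet> (\<beta> *\<^sub>R B) = \<beta>\<^sup>2 * (B \<bullet> B)" by (simp add: power2_eq_square)
    have 5: "A \<bullet> A = C\<^sup>2" "A \<bullet> B = 0" using AA AB by (simp_all add: A_def)
    show "g$1$1 = C\<^sup>2 * (1 + \<alpha>\<^sup>2)"
      unfolding g_def first_fundamental_form_def vec_lambda_beta F1 F2 A_def[symmetric] 1 5 BB
      by (simp add: algebra_simps)
    show "g$1$2 = C\<^sup>2 * (\<alpha> * \<beta>)"
      unfolding g_def first_fundamental_form_def vec_lambda_beta F1 F2 A_def[symmetric] 2 5 BB by simp
    show "g$2$1 = C\<^sup>2 * (\<alpha> * \<beta>)"
      unfolding g_def first_fundamental_form_def vec_lambda_beta F1 F2 A_def[symmetric] 3 5 BB by simp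
    show "g$2$2 = C\<^sup>2 * \<beta>\<^sup>2"
      unfolding g_def first_fundamental_form_def vec_lambda_beta F1 F2 A_def[symmetric] 4 5 BB by simp
  qed
  have dg: "det g = (C\<^sup>2)\<^sup>2 * \<beta>\<^sup>2" by (simp add: det_2 g power2_eq_square algebra_simps)
  then have dg0: "det g \<noteq> 0" using C(1) \<beta> by simp
  have S: "shape_operator F w = matrix_inv g ** b" by (simp add: shape_operator_def g_def b_def)
  have "g$2$2 * b$1$1 - g$1$2 * b$2$1 - g$2$1 * b$1$2 + g$1$1 * b$2$2 = 0"
    unfolding g b m by (simp add: power2_eq_square algebra_simps)
  then have tr: "trace (shape_operator F w) = 0"
    unfolding S trace_matrix_inv_mult_2[OF dg0] by simp
  then show "mean_curvature F w = 0" by (simp add: mean_curvature_def)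
  have db: "det b = - (\<beta>\<^sup>2 * (p\<^sup>2 + q\<^sup>2))"
    unfolding det_2 b m by (simp add: power2_eq_square algebra_simps)
  have "trace (shape_operator F w ** shape_operator F w) = - 2 * (det b / det g)"
    unfolding trace_square_2 tr by (simp add: S det_matrix_inv_mult[OF dg0])
  also have "\<dots> = 2 * (p\<^sup>2 + q\<^sup>2) / C ^ 4"
  proof -
    have "(C\<^sup>2)\<^sup>2 = C ^ 4" by (simp flip: power_mult)
    then show ?thesis unfolding db dg using C(1) \<beta> by (simp add: field_simps)
  qed
  finally show "trace (shape_operator F w ** shape_operator F w) = 2 * (p\<^sup>2 + q\<^sup>2) / C ^ 4" .
qed

section \<open>The parametrization over a straight strip\<close>

definition hv :: "complex \<Rightarrow> real^3" where
  "hv z = vector [Re z, Im z, 0]"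

lemma hv_component [simp]: "hv z $ 1 = Re z" "hv z $ 2 = Im z" "hv z $ 3 = 0"
  by (simp_all add: hv_def)

lemma bounded_linear_hv: "bounded_linear hv"
proof -
  have "linear hv"
    by (auto intro!: linearI simp: vec_eq_iff forall_3)
  then show ?thesis by (simp add: linear_conv_bounded_linear)
qed

lemma axis_component_2 [simp]:
  "axis 1 1 $ (1::2) = (1::real)" "axis 1 1 $ (2::2) = (0::real)"
  "axis 2 1 $ (1::2) = (0::real)" "axis 2 1 $ (2::2) = (1::real)"
  by (simp_all add: axis_def)

context blowup_set
begin

text \<open>The second coordinate is measured in units of the height at which the radius reaches 1.
  All surfaces thus have the same kind of parameter domain, whatever \<kappa> is, and can be
  compared at equal parameters.\<close>

definition psiG :: "(complex \<Rightarrow> complex) \<Rightarrow> real \<Rightarrow> real^2 \<Rightarrow> complex" where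
  "psiG g \<kappa> w = Complex (w$1) (w$2 * yyG g \<kappa> (w$1) 1)"

definition FG :: "(complex \<Rightarrow> complex) \<Rightarrow> real \<Rightarrow> real^2 \<Rightarrow> real^3" where
  "FG g \<kappa> w = hv (Xm g (psiG g \<kappa> w)) + (w$1) *\<^sub>R axis 3 1"

end

context weierstrass
begin

definition Y :: "real \<Rightarrow> real \<Rightarrow> real" where
  "Y \<kappa> x = yy \<kappa> (x, 1)"

definition psi :: "real \<Rightarrow> real^2 \<Rightarrow> complex" where
  "psi \<kappa> = psiG (G \<kappa>) \<kappa>"

definition F :: "real \<Rightarrow> real^2 \<Rightarrow> real^3" where
  "F \<kappa> = FG (G \<kappa>) \<kappa>"

text \<open>An open neighbourhood, in each slice, of the closed strip
  \<open>\<bar>w$2\<bar> \<le> 1\<close> over \<open>J\<close>: the parametrization extends past the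
  boundary of the surface.\<close>

definition \<Omega>3 :: "(real \<times> (real^2)) set" where
  "\<Omega>3 = {(\<kappa>, w). \<kappa> \<in> T \<and> w$1 \<in> J \<and> \<bar>w$2 * Y \<kappa> (w$1)\<bar> < om \<kappa> (w$1)}"

lemma psi_eq: "psi \<kappa> w = Complex (w$1) (w$2 * Y \<kappa> (w$1))"
  by (simp add: psi_def psiG_def Y_def yy_def)

lemma F_eq: "F \<kappa> w = hv (X \<kappa> (psi \<kappa> w)) + (w$1) *\<^sub>R axis 3 1"
  by (simp add: F_def FG_def X_def psi_def)

lemma F_component [simp]:
  "F \<kappa> w $ 1 = Re (X \<kappa> (psi \<kappa> w))" "F \<kappa> w $ 2 = Im (X \<kappa> (psi \<kappa> w))" "F \<kappa> w $ 3 = w$1"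
  by (simp_all add: F_eq axis_def)

lemma psi_\<Omega>: "(\<kappa>, w) \<in> \<Omega>3 \<longleftrightarrow> (\<kappa>, psi \<kappa> w) \<in> \<Omega>"
  by (auto simp: \<Omega>3_def \<Omega>_def psi_eq)

lemma Y: "\<kappa> \<in> T \<Longrightarrow> x \<in> J \<Longrightarrow> 0 < Y \<kappa> x \<and> Y \<kappa> x < om \<kappa> x \<and> cmod (X \<kappa> (Complex x (Y \<kappa> x))) = 1"
  using yy[of \<kappa> x 1] by (simp add: Y_def)

lemma \<Omega>3_strip: "\<kappa> \<in> T \<Longrightarrow> w$1 \<in> J \<Longrightarrow> \<bar>w$2\<bar> \<le> 1 \<Longrightarrow> (\<kappa>, w) \<in> \<Omega>3"
proof -
  assume a: "\<kappa> \<in> T" "w$1 \<in> J" "\<bar>w$2\<bar> \<le> 1"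
  note y = Y[OF a(1,2)]
  have "\<bar>w$2 * Y \<kappa> (w$1)\<bar> = \<bar>w$2\<bar> * Y \<kappa> (w$1)" using y by (simp add: abs_mult)
  also have "\<dots> \<le> 1 * Y \<kappa> (w$1)" using a y by (intro mult_right_mono) auto
  finally show ?thesis using a y by (simp add: \<Omega>3_def)
qed

lemma ck_Y: "ck n {(\<kappa>, x). \<kappa> \<in> T \<and> x \<in> J} Y"
proof -
  have "ck n {(\<kappa>, x). \<kappa> \<in> T \<and> x \<in> J} (\<lambda>\<kappa> x. yy \<kappa> (x, 1))"
    by (rule ck_compose[OF ck_yy]) (auto intro!: ck_Pair ck_id ck_const simp: \<Omega>2_def)
  then show ?thesis by (simp add: Y_def[abs_def])
qed

lemma ck_Y_fst: "ck n {(\<kappa>, w :: real^2). \<kappa> \<in> T \<and> w$1 \<in> J} (\<lambda>\<kappa> w. Y \<kappa> (w$1))"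
  by (rule ck_compose[OF ck_Y]) (auto intro!: ck_linear bounded_linear_vec_nth)

lemma ck_psi: "ck n {(\<kappa>, w :: real^2). \<kappa> \<in> T \<and> w$1 \<in> J} psi"
proof -
  have "ck n {(\<kappa>, w :: real^2). \<kappa> \<in> T \<and> w$1 \<in> J}
      (\<lambda>\<kappa> w. of_real (w$1) + \<i> * of_real (w$2 * Y \<kappa> (w$1)))"
    by (intro ck_add ck_mult ck_const ck_Y_fst ck_bounded_linear[OF bounded_linear_of_real] ck_linear bounded_linear_vec_nth)
  then show ?thesis by (simp add: psi_eq[abs_def] Complex_eq)
qed

lemma open_slices_\<Omega>3: "open_slices \<Omega>3"
  unfolding open_slices_def
proof
  fix \<kappa>
  show "open {w. (\<kappa>, w) \<in> \<Omega>3}"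
  proof (cases "\<kappa> \<in> T")
    case True
    have "open {w :: real^2. w$1 \<in> J}"
      using open_vimage[OF J(1), of "\<lambda>w :: real^2. w$1"] by (simp add: vimage_def continuous_on_component)
    moreover have "continuous_on {w. w$1 \<in> J} (psi \<kappa>)"
    proof -
      have "continuous_on {w :: real^2. w$1 \<in> J} (\<lambda>w. (\<lambda>(\<kappa>, w). psi \<kappa> w) (\<kappa>, w))"
        by (rule continuous_on_compose2[OF ck_continuous[OF ck_psi]]) (use True in \<open>auto intro!: continuous_intros\<close>)
      then show ?thesis by simp
    qed
    ultimately have "open ({w. w$1 \<in> J} \<inter> psi \<kappa> -` {z. (\<kappa>, z) \<in> \<Omega>})"
      using open_slice by (intro continuous_open_preimage)
    moreover have "{w. w$1 \<in> J} \<inter> psi \<kappa> -` {z. (\<kappa>, z) \<in> \<Omega>} = {w. (\<kappa>, w) \<in> \<Omega>3}"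
      by (auto simp: psi_\<Omega>) (simp add: \<Omega>_def psi_eq)
    ultimately show ?thesis by simp
  qed (simp add: \<Omega>3_def)
qed

lemma ck_F: "ck n \<Omega>3 F"
proof -
  have "ck n \<Omega>3 psi" by (rule ck_subset[OF ck_psi]) (auto simp: \<Omega>3_def)
  then have "ck n \<Omega>3 (\<lambda>\<kappa> w. X \<kappa> (psi \<kappa> w))"
    by (rule ck_compose[OF ck_X]) (simp add: psi_\<Omega>)
  then have "ck n \<Omega>3 (\<lambda>\<kappa> w. hv (X \<kappa> (psi \<kappa> w)) + (w$1) *\<^sub>R axis 3 1)"
    by (intro ck_add ck_scaleR ck_const ck_bounded_linear[OF bounded_linear_hv] ck_linear bounded_linear_vec_nth)
  then show ?thesis by (simp add: F_eq[abs_def])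
qed

lemma ex_Y_derivs:
  obtains Y1 Y2 where "\<And>\<kappa> x. \<kappa> \<in> T \<Longrightarrow> x \<in> J \<Longrightarrow> (Y \<kappa> has_real_derivative Y1 \<kappa> x) (at x)"
    "\<And>\<kappa> x. \<kappa> \<in> T \<Longrightarrow> x \<in> J \<Longrightarrow> (Y1 \<kappa> has_real_derivative Y2 \<kappa> x) (at x)"
proof -
  have der: "\<exists>h'. (\<forall>\<kappa> x. \<kappa> \<in> T \<longrightarrow> x \<in> J \<longrightarrow> (h \<kappa> has_real_derivative h' \<kappa> x) (at x)) \<and>
      ck m {(\<kappa>, x). \<kappa> \<in> T \<and> x \<in> J} h'"
    if "ck (Suc m) {(\<kappa>, x). \<kappa> \<in> T \<and> x \<in> J} h" for m and h :: "real \<Rightarrow> real \<Rightarrow> real"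
  proof -
    obtain h' where h': "\<And>\<kappa> x. (\<kappa>, x) \<in> {(\<kappa>, x). \<kappa> \<in> T \<and> x \<in> J} \<Longrightarrow> (h \<kappa> has_derivative h' \<kappa> x) (at x)"
      and h'': "\<And>b. b \<in> Basis \<Longrightarrow> ck m {(\<kappa>, x). \<kappa> \<in> T \<and> x \<in> J} (\<lambda>\<kappa> x. h' \<kappa> x b)"
      using \<open>ck (Suc m) _ h\<close> by (rule ck_SucE) blast
    have "(h \<kappa> has_real_derivative h' \<kappa> x 1) (at x)" if "\<kappa> \<in> T" "x \<in> J" for \<kappa> x
    proof -
      have d: "(h \<kappa> has_derivative h' \<kappa> x) (at x)" using h' that by simp
      have "h' \<kappa> x = (*) (h' \<kappa> x 1)"
      proof
        fix t show "h' \<kappa> x t = h' \<kappa> x 1 * t"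
          using linear_cmul[OF has_derivative_linear[OF d], of t 1] by (simp add: mult.commute)
      qed
      then show ?thesis using d by (simp add: has_field_derivative_def)
    qed
    then show ?thesis using h''[of 1] by (intro exI[of _ "\<lambda>\<kappa> x. h' \<kappa> x 1"]) auto
  qed
  obtain Y1 where 1: "\<forall>\<kappa> x. \<kappa> \<in> T \<longrightarrow> x \<in> J \<longrightarrow> (Y \<kappa> has_real_derivative Y1 \<kappa> x) (at x)"
    "ck (Suc 0) {(\<kappa>, x). \<kappa> \<in> T \<and> x \<in> J} Y1"
    using der[OF ck_Y[of "Suc (Suc 0)"]] by blast
  obtain Y2 where 2: "\<forall>\<kappa> x. \<kappa> \<in> T \<longrightarrow> x \<in> J \<longrightarrow> (Y1 \<kappa> has_real_derivative Y2 \<kappa> x) (at x)"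
    using der[OF 1(2)] by blast
  from 1(1) 2 that show ?thesis by blast
qed

text \<open>This is \<open>cosh v\<close>, since \<open>cmod G = exp (- v)\<close>; written through
  \<open>G\<close> it makes sense at a complex point without reference to a slice.\<close>

definition coshv :: "real \<Rightarrow> complex \<Rightarrow> real" where
  "coshv \<kappa> z = (cmod (G \<kappa> z) + 1 / cmod (G \<kappa> z)) / 2"

lemma coshv_ge_1: "(\<kappa>, z) \<in> \<Omega> \<Longrightarrow> 1 \<le> coshv \<kappa> z"
proof -
  assume "(\<kappa>, z) \<in> \<Omega>"
  then have "0 < cmod (G \<kappa> z)" using G_nz by simp
  moreover have "0 \<le> (cmod (G \<kappa> z) - 1)\<^sup>2" by simp
  ultimately show ?thesis
    by (simp add: coshv_def field_simps power2_eq_square)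
qed

text \<open>Since \<open>G' = i f G\<close>, differentiating the tangent vectors brings in only
  \<open>f\<close> and the derivatives of the reparametrization, and the latter enter through
  multiples of \<open>B\<close> or through the derivative of \<open>psi\<close>. The geometry is
  then the algebra of \<open>curvature_algebra\<close>.\<close>

lemma surface_calculus:
  assumes w: "(\<kappa>, w) \<in> \<Omega>3"
  shows "inj (frechet_derivative (F \<kappa>) (at w))" (is ?inj)
    and "mean_curvature (F \<kappa>) w = 0" (is ?mc)
    and "trace (shape_operator (F \<kappa>) w ** shape_operator (F \<kappa>) w)
      = 2 * (cmod (f \<kappa> (psi \<kappa> w)))\<^sup>2 / coshv \<kappa> (psi \<kappa> w) ^ 4" (is ?tr)
proof -
  obtain Y1 Y2 where Y1: "\<And>\<kappa> x. \<kappa> \<in> T \<Longrightarrow> x \<in> J \<Longrightarrow> (Y \<kappa> has_real_derivative Y1 \<kappa> x) (at x)"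
    and Y2: "\<And>\<kappa> x. \<kappa> \<in> T \<Longrightarrow> x \<in> J \<Longrightarrow> (Y1 \<kappa> has_real_derivative Y2 \<kappa> x) (at x)"
    by (rule ex_Y_derivs) blast
  define V where "V = {w. (\<kappa>, w) \<in> \<Omega>3}"
  have V: "open V" "w \<in> V" using open_slices_\<Omega>3 w by (auto simp: V_def open_slices_def)
  have k: "\<kappa> \<in> T" using w by (simp add: \<Omega>3_def)
  define \<psi>' where "\<psi>' w v = complex_of_real (v$1) + \<i> * of_real (v$2 * Y \<kappa> (w$1) + w$2 * (Y1 \<kappa> (w$1) * v$1))"
    for w v :: "real^2"
  \<comment> \<open>\<open>A\<close> and \<open>B\<close> are the partial derivatives of the
    conformal immersion in \<open>x\<close> and in \<open>y\<close>, evaluated at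
    \<open>psi \<kappa> w\<close>.\<close>
  define A where "A w = hv ((cnj (1 / G \<kappa> (psi \<kappa> w)) - G \<kappa> (psi \<kappa> w)) / 2) + axis 3 1" for w
  define B where "B w = hv (- \<i> * (cnj (1 / G \<kappa> (psi \<kappa> w)) + G \<kappa> (psi \<kappa> w)) / 2)" for w
  have nth: "((\<lambda>w :: real^2. w$i) has_derivative (\<lambda>v. v$i)) (at w)" for i w
    by (rule bounded_linear_imp_has_derivative[OF bounded_linear_vec_nth])
  have comp: "((\<lambda>w :: real^2. h (w$1)) has_derivative (\<lambda>v. h' * v$1)) (at w)"
    if "(h has_real_derivative h') (at (w$1))" for h h' and w :: "real^2"
    using has_derivative_compose[OF nth] that by (simp add: has_field_derivative_def)
  have psi': "(psi \<kappa> has_derivative \<psi>' w) (at w)" if "w \<in> V" for w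
  proof -
    have x: "w$1 \<in> J" using that by (simp add: V_def \<Omega>3_def)
    have "((\<lambda>w :: real^2. w$2 * Y \<kappa> (w$1)) has_derivative (\<lambda>v. w$2 * (Y1 \<kappa> (w$1) * v$1) + v$2 * Y \<kappa> (w$1))) (at w)"
      by (intro has_derivative_mult nth comp Y1[OF k x])
    then have "((\<lambda>w. complex_of_real (w$1) + \<i> * of_real (w$2 * Y \<kappa> (w$1))) has_derivative
        (\<lambda>v. of_real (v$1) + \<i> * of_real (w$2 * (Y1 \<kappa> (w$1) * v$1) + v$2 * Y \<kappa> (w$1)))) (at w)"
      by (intro has_derivative_add has_derivative_mult_right bounded_linear.has_derivative[OF bounded_linear_of_real] nth)
    moreover have "psi \<kappa> = (\<lambda>w. complex_of_real (w$1) + \<i> * of_real (w$2 * Y \<kappa> (w$1)))"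
      by (simp add: psi_eq[abs_def] Complex_eq)
    moreover have "\<psi>' w = (\<lambda>v. of_real (v$1) + \<i> * of_real (w$2 * (Y1 \<kappa> (w$1) * v$1) + v$2 * Y \<kappa> (w$1)))"
      by (simp add: \<psi>'_def[abs_def] add.commute)
    ultimately show ?thesis by (simp only:)
  qed
  have F': "(F \<kappa> has_derivative (\<lambda>v. v$1 *\<^sub>R A w + (v$2 * Y \<kappa> (w$1) + w$2 * (Y1 \<kappa> (w$1) * v$1)) *\<^sub>R B w)) (at w)"
    if "w \<in> V" for w
  proof -
    have z: "(\<kappa>, psi \<kappa> w) \<in> \<Omega>" using that by (simp add: V_def psi_\<Omega>)
    let ?g = "G \<kappa> (psi \<kappa> w)"
    have "((\<lambda>w. X \<kappa> (psi \<kappa> w)) has_derivative (\<lambda>v. (cnj (\<psi>' w v / ?g) - \<psi>' w v * ?g) / 2)) (at w)"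
      by (rule has_derivative_compose[OF psi'[OF that] X_deriv[OF z]])
    then have 1: "((\<lambda>w. hv (X \<kappa> (psi \<kappa> w)) + (w$1) *\<^sub>R axis 3 1) has_derivative
        (\<lambda>v. hv ((cnj (\<psi>' w v / ?g) - \<psi>' w v * ?g) / 2) + (v$1) *\<^sub>R axis 3 1)) (at w)"
      by (intro has_derivative_add bounded_linear.has_derivative[OF bounded_linear_hv] has_derivative_scaleR_left nth)
    have 2: "hv ((cnj (\<psi>' w v / ?g) - \<psi>' w v * ?g) / 2) + (v$1) *\<^sub>R axis 3 1
        = v$1 *\<^sub>R A w + (v$2 * Y \<kappa> (w$1) + w$2 * (Y1 \<kappa> (w$1) * v$1)) *\<^sub>R B w" for v
    proof -
      define r where "r = v$1"
      define t where "t = v$2 * Y \<kappa> (w$1) + w$2 * (Y1 \<kappa> (w$1) * v$1)"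
      have "\<psi>' w v = of_real r + \<i> * of_real t" by (simp add: \<psi>'_def r_def t_def)
      then have eq: "(cnj (\<psi>' w v / ?g) - \<psi>' w v * ?g) / 2
          = r *\<^sub>R ((cnj (1 / ?g) - ?g) / 2) + t *\<^sub>R (- \<i> * (cnj (1 / ?g) + ?g) / 2)"
        using G_nz[OF z] by (simp add: scaleR_conv_of_real field_simps)
      show ?thesis
        unfolding t_def[symmetric] unfolding A_def B_def eq r_def[symmetric]
        by (simp only: linear_add[OF bounded_linear.linear[OF bounded_linear_hv]]
          linear_cmul[OF bounded_linear.linear[OF bounded_linear_hv]] scaleR_add_right add_ac)
    qed
    from 1 show ?thesis unfolding 2 F_eq[abs_def] .
  qed
  have g': "((\<lambda>w. G \<kappa> (psi \<kappa> w)) has_derivative (\<lambda>v. \<i> * f \<kappa> (psi \<kappa> w) * G \<kappa> (psi \<kappa> w) * \<psi>' w v)) (at w)"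
    and gi': "((\<lambda>w. 1 / G \<kappa> (psi \<kappa> w)) has_derivative (\<lambda>v. - \<i> * f \<kappa> (psi \<kappa> w) / G \<kappa> (psi \<kappa> w) * \<psi>' w v)) (at w)"
    if "w \<in> V" for w
  proof -
    have z: "(\<kappa>, psi \<kappa> w) \<in> \<Omega>" using that by (simp add: V_def psi_\<Omega>)
    have d: "(G \<kappa> has_field_derivative \<i> * f \<kappa> (psi \<kappa> w) * G \<kappa> (psi \<kappa> w)) (at (psi \<kappa> w))"
      using z by (intro G_deriv) (auto simp: \<Omega>_def)
    then show "((\<lambda>w. G \<kappa> (psi \<kappa> w)) has_derivative (\<lambda>v. \<i> * f \<kappa> (psi \<kappa> w) * G \<kappa> (psi \<kappa> w) * \<psi>' w v)) (at w)"
      using has_derivative_compose[OF psi'[OF that], of "G \<kappa>"] by (simp add: has_field_derivative_def)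
    have "((\<lambda>z. 1 / G \<kappa> z) has_field_derivative - \<i> * f \<kappa> (psi \<kappa> w) / G \<kappa> (psi \<kappa> w)) (at (psi \<kappa> w))"
      using d G_nz[OF z] by (auto intro!: derivative_eq_intros simp: field_simps)
    then show "((\<lambda>w. 1 / G \<kappa> (psi \<kappa> w)) has_derivative (\<lambda>v. - \<i> * f \<kappa> (psi \<kappa> w) / G \<kappa> (psi \<kappa> w) * \<psi>' w v)) (at w)"
      unfolding has_field_derivative_def by (rule has_derivative_compose[OF psi'[OF that]])
  qed
  define dA where "dA w v = hv ((cnj (- \<i> * f \<kappa> (psi \<kappa> w) / G \<kappa> (psi \<kappa> w) * \<psi>' w v)
      - \<i> * f \<kappa> (psi \<kappa> w) * G \<kappa> (psi \<kappa> w) * \<psi>' w v) / 2)" for w v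
  define dB where "dB w v = hv (- \<i> * (cnj (- \<i> * f \<kappa> (psi \<kappa> w) / G \<kappa> (psi \<kappa> w) * \<psi>' w v)
      + \<i> * f \<kappa> (psi \<kappa> w) * G \<kappa> (psi \<kappa> w) * \<psi>' w v) / 2)" for w v
  have A': "(A has_derivative dA w) (at w)" if "w \<in> V" for w
  proof -
    have "(A has_derivative (\<lambda>v. dA w v + 0)) (at w)"
      unfolding A_def[abs_def] dA_def
      by (intro has_derivative_add has_derivative_const bounded_linear.has_derivative[OF bounded_linear_hv]
          bounded_linear.has_derivative[OF bounded_linear_divide] has_derivative_diff
          bounded_linear.has_derivative[OF bounded_linear_cnj] g' gi' that)
    then show ?thesis by simp
  qed
  have B': "(B has_derivative dB w) (at w)" if "w \<in> V" for w
    unfolding B_def[abs_def] dB_def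
    by (intro bounded_linear.has_derivative[OF bounded_linear_hv]
        bounded_linear.has_derivative[OF bounded_linear_divide] has_derivative_mult_right has_derivative_add
        bounded_linear.has_derivative[OF bounded_linear_cnj] g' gi' that)
  have F1: "iter_deriv [axis 1 1] (F \<kappa>) w = A w + (w$2 * Y1 \<kappa> (w$1)) *\<^sub>R B w"
    and F2: "iter_deriv [axis 2 1] (F \<kappa>) w = Y \<kappa> (w$1) *\<^sub>R B w" if "w \<in> V" for w
    using frechet_derivative_at[OF F'[OF that], symmetric] by simp_all
  have F1': "(iter_deriv [axis 1 1] (F \<kappa>) has_derivative
      (\<lambda>v. dA w v + ((w$2 * Y1 \<kappa> (w$1)) *\<^sub>R dB w v + (w$2 * (Y2 \<kappa> (w$1) * v$1) + v$2 * Y1 \<kappa> (w$1)) *\<^sub>R B w))) (at w)"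
    if "w \<in> V" for w
  proof (rule has_derivative_transform_within_open[OF _ V(1) that F1[symmetric]])
    have x: "w$1 \<in> J" using that by (simp add: V_def \<Omega>3_def)
    show "((\<lambda>w. A w + (w$2 * Y1 \<kappa> (w$1)) *\<^sub>R B w) has_derivative
      (\<lambda>v. dA w v + ((w$2 * Y1 \<kappa> (w$1)) *\<^sub>R dB w v + (w$2 * (Y2 \<kappa> (w$1) * v$1) + v$2 * Y1 \<kappa> (w$1)) *\<^sub>R B w))) (at w)"
      by (intro has_derivative_add has_derivative_scaleR has_derivative_mult nth comp Y2[OF k x] A' B' that)
  qed
  have F2': "(iter_deriv [axis 2 1] (F \<kappa>) has_derivative
      (\<lambda>v. Y \<kappa> (w$1) *\<^sub>R dB w v + (Y1 \<kappa> (w$1) * v$1) *\<^sub>R B w)) (at w)"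
    if "w \<in> V" for w
  proof (rule has_derivative_transform_within_open[OF _ V(1) that F2[symmetric]])
    have x: "w$1 \<in> J" using that by (simp add: V_def \<Omega>3_def)
    show "((\<lambda>w. Y \<kappa> (w$1) *\<^sub>R B w) has_derivative
      (\<lambda>v. Y \<kappa> (w$1) *\<^sub>R dB w v + (Y1 \<kappa> (w$1) * v$1) *\<^sub>R B w)) (at w)"
      by (intro has_derivative_scaleR comp Y1[OF k x] B' that)
  qed
  note F1'_at = frechet_derivative_at[OF F1'[OF V(2)], symmetric]
  note F2'_at = frechet_derivative_at[OF F2'[OF V(2)], symmetric]
  define z where "z = psi \<kappa> w"
  have z: "(\<kappa>, z) \<in> \<Omega>" using w by (simp add: z_def psi_\<Omega>)
  define g where "g = G \<kappa> z"
  have g0: "cmod g > 0" using G_nz[OF z] by (simp add: g_def)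
  define e where "e = sgn g"
  define c where "c = Re e"
  define s where "s = Im e"
  \<comment> \<open>As \<open>cmod g = exp (- v)\<close>, these are \<open>cosh v\<close> and
    \<open>sinh v\<close>.\<close>
  define C where "C = (1 / cmod g + cmod g) / 2"
  define H where "H = (1 / cmod g - cmod g) / 2"
  have "cmod e = 1" using g0 by (simp add: e_def norm_sgn)
  then have cs: "c\<^sup>2 + s\<^sup>2 = 1" by (simp add: c_def s_def cmod_power2[symmetric])
  have e: "e = Complex c s" by (simp add: c_def s_def)
  have C: "C > 0" "C\<^sup>2 = 1 + H\<^sup>2"
    using g0 by (auto simp: C_def H_def field_simps power2_eq_square add_pos_pos)
  have ge: "g = of_real (cmod g) * e" by (simp add: e_def sgn_eq)
  have gie: "cnj (1 / g) = of_real (1 / cmod g) * e"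
  proof -
    have "cnj (1 / e) = e" using \<open>cmod e = 1\<close> by (rule cnj_inverse_unit)
    moreover have "cnj (1 / g) = of_real (1 / cmod g) * cnj (1 / e)" by (subst ge) simp
    ultimately show ?thesis by simp
  qed
  have m1: "1 / cmod g = C + H" "cmod g = C - H" by (auto simp: C_def H_def field_simps)
  have gie': "cnj (1 / g) = of_real (C + H) * e" using gie unfolding m1(1) .
  have ge': "g = of_real (C - H) * e" using ge unfolding m1(2) .
  define p where "p = Re (f \<kappa> z)"
  define q where "q = Im (f \<kappa> z)"
  have fpq: "f \<kappa> z = Complex p q" by (simp add: p_def q_def)
  define \<alpha> where "\<alpha> = w$2 * Y1 \<kappa> (w$1)"
  define \<beta> where "\<beta> = Y \<kappa> (w$1)"
  have \<beta>: "\<beta> > 0" using Y[OF k, of "w$1"] w by (simp add: \<beta>_def \<Omega>3_def)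
  have Aw: "A w = vector [H * c, H * s, 1]"
  proof -
    have "(cnj (1 / g) - g) / 2 = (of_real (C + H) * e - of_real (C - H) * e) / 2"
      by (rule arg_cong2[OF gie' ge', of "\<lambda>a b. (a - b) / 2"])
    also have "\<dots> = of_real H * e" by (simp add: algebra_simps)
    finally have "(cnj (1 / g) - g) / 2 = of_real H * e" .
    then show ?thesis
      unfolding A_def z_def[symmetric] g_def[symmetric] by (simp add: vec_eq_iff forall_3 axis_def e)
  qed
  have Bw: "B w = vector [C * s, - (C * c), 0]"
  proof -
    have "- \<i> * (cnj (1 / g) + g) / 2 = - \<i> * (of_real (C + H) * e + of_real (C - H) * e) / 2"
      by (rule arg_cong2[OF gie' ge', of "\<lambda>a b. - \<i> * (a + b) / 2"])
    also have "\<dots> = - \<i> * of_real C * e" by (simp add: algebra_simps)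
    finally have "- \<i> * (cnj (1 / g) + g) / 2 = - \<i> * of_real C * e" .
    then show ?thesis
      unfolding B_def z_def[symmetric] g_def[symmetric] by (simp add: vec_eq_iff forall_3 e)
  qed
  have dAw: "dA w v = vector [n * C * c - m * H * s, n * C * s + m * H * c, 0]"
    and dBw: "dB w v = vector [m * C * c + n * H * s, m * C * s - n * H * c, 0]"
    if mn: "f \<kappa> z * \<psi>' w v = Complex m n" for v m n
  proof -
    have 1: "cnj (- \<i> * f \<kappa> z / g * \<psi>' w v) = \<i> * cnj (Complex m n) * (of_real (C + H) * e)"
      unfolding mn[symmetric] gie'[symmetric] by simp
    have 2: "\<i> * f \<kappa> z * g * \<psi>' w v = \<i> * Complex m n * (of_real (C - H) * e)"
      unfolding mn[symmetric] ge'[symmetric] by simp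
    show "dA w v = vector [n * C * c - m * H * s, n * C * s + m * H * c, 0]"
      unfolding dA_def z_def[symmetric] g_def[symmetric] 1 2
      by (simp add: vec_eq_iff forall_3 e algebra_simps add_divide_distrib diff_divide_distrib)
    show "dB w v = vector [m * C * c + n * H * s, m * C * s - n * H * c, 0]"
      unfolding dB_def z_def[symmetric] g_def[symmetric] 1 2
      by (simp add: vec_eq_iff forall_3 e algebra_simps add_divide_distrib diff_divide_distrib)
  qed
  \<comment> \<open>The derivative of \<open>psi\<close> is \<open>1 + i \<alpha>\<close> in the
    first and \<open>i \<beta>\<close> in the second direction.\<close>
  have mn1: "f \<kappa> z * \<psi>' w (axis 1 1) = Complex (p - q * \<alpha>) (q + p * \<alpha>)"
    by (simp add: \<psi>'_def fpq \<alpha>_def complex_eq_iff)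
  have mn2: "f \<kappa> z * \<psi>' w (axis 2 1) = Complex (- q * \<beta>) (p * \<beta>)"
    by (simp add: \<psi>'_def fpq \<beta>_def complex_eq_iff)
  have "?mc \<and> trace (shape_operator (F \<kappa>) w ** shape_operator (F \<kappa>) w) = 2 * (p\<^sup>2 + q\<^sup>2) / C ^ 4"
  proof (intro conjI)
    note alg = curvature_algebra[OF C cs \<beta> Bw, of "F \<kappa>" w \<alpha> "p - q * \<alpha>" p q "q + p * \<alpha>" "- q * \<beta>" "p * \<beta>"
        "dA w (axis 1 1)" "dB w (axis 1 1)" "dA w (axis 2 1)" "dB w (axis 2 1)"
        "w$2 * Y2 \<kappa> (w$1)" "Y1 \<kappa> (w$1)" "Y1 \<kappa> (w$1)" 0,
        OF _ _ refl refl refl refl dAw[OF mn1] dBw[OF mn1] dAw[OF mn2] dBw[OF mn2]]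
    have f1: "iter_deriv [axis 1 1] (F \<kappa>) w = vector [H * c, H * s, 1] + \<alpha> *\<^sub>R B w"
      using F1[OF V(2)] by (simp add: Aw \<alpha>_def)
    have f2: "iter_deriv [axis 2 1] (F \<kappa>) w = \<beta> *\<^sub>R B w"
      using F2[OF V(2)] by (simp add: \<beta>_def)
    have f11: "iter_deriv [axis 1 1, axis 1 1] (F \<kappa>) w = dA w (axis 1 1) + \<alpha> *\<^sub>R dB w (axis 1 1) + (w$2 * Y2 \<kappa> (w$1)) *\<^sub>R B w"
      by (subst iter_deriv.simps(2), subst F1'_at) (simp add: \<alpha>_def)
    have f21: "iter_deriv [axis 2 1, axis 1 1] (F \<kappa>) w = dA w (axis 2 1) + \<alpha> *\<^sub>R dB w (axis 2 1) + Y1 \<kappa> (w$1) *\<^sub>R B w"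
      by (subst iter_deriv.simps(2), subst F1'_at) (simp add: \<alpha>_def)
    have f12: "iter_deriv [axis 1 1, axis 2 1] (F \<kappa>) w = \<beta> *\<^sub>R dB w (axis 1 1) + Y1 \<kappa> (w$1) *\<^sub>R B w"
      by (subst iter_deriv.simps(2), subst F2'_at) (simp add: \<beta>_def)
    have f22: "iter_deriv [axis 2 1, axis 2 1] (F \<kappa>) w = \<beta> *\<^sub>R dB w (axis 2 1) + 0 *\<^sub>R B w"
      by (subst iter_deriv.simps(2), subst F2'_at) (simp add: \<beta>_def)
    show ?mc by (rule alg(1)[OF f1 f2 f11 f21 f12 f22])
    show "trace (shape_operator (F \<kappa>) w ** shape_operator (F \<kappa>) w) = 2 * (p\<^sup>2 + q\<^sup>2) / C ^ 4"
      by (rule alg(2)[OF f1 f2 f11 f21 f12 f22])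
  qed
  then show ?mc ?tr
    by (auto simp: z_def[symmetric] coshv_def C_def g_def[symmetric] fpq cmod_power2 add.commute)
  have "frechet_derivative (F \<kappa>) (at w) = (\<lambda>v. v$1 *\<^sub>R A w + (v$2 * \<beta> + \<alpha> * v$1) *\<^sub>R B w)"
    using frechet_derivative_at[OF F'[OF V(2)], symmetric] by (simp add: \<alpha>_def \<beta>_def mult.assoc)
  moreover have "inj (\<lambda>v :: real^2. v$1 *\<^sub>R A w + (v$2 * \<beta> + \<alpha> * v$1) *\<^sub>R B w)"
  proof (rule injI)
    fix v v' :: "real^2"
    assume eq: "v$1 *\<^sub>R A w + (v$2 * \<beta> + \<alpha> * v$1) *\<^sub>R B w = v'$1 *\<^sub>R A w + (v'$2 * \<beta> + \<alpha> * v'$1) *\<^sub>R B w"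
    from arg_cong[OF eq, of "\<lambda>x. x$3"] have 1: "v$1 = v'$1" by (simp add: Aw Bw)
    have "(v$2 * \<beta>) *\<^sub>R B w = (v'$2 * \<beta>) *\<^sub>R B w" using eq 1 by (simp add: scaleR_add_left)
    moreover have "B w \<noteq> 0"
    proof
      assume "B w = 0"
      then have "C * s = 0" "C * c = 0" by (auto simp: Bw vec_eq_iff forall_3)
      then show False using C cs by simp
    qed
    ultimately have "v$2 = v'$2" using \<beta> by simp
    with 1 show "v = v'" by (simp add: vec_eq_iff forall_2)
  qed
  ultimately show ?inj by simp
qed

end

section \<open>Embeddedness and curvature bounds\<close>

definition strip :: "real set \<Rightarrow> (real^2) set" where
  "strip I = {w. w$1 \<in> I \<and> \<bar>w$2\<bar> \<le> 1}"

lemma strip_cbox: "strip {a..b} = cbox (vector [a, -1]) (vector [b, 1])"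
  by (auto simp: strip_def mem_box_cart forall_2 abs_le_iff)

lemma strip_homeomorphic_cball:
  assumes "a < b"
  shows "strip {a..b} homeomorphic cball (0::real^2) 1"
proof (rule homeomorphic_convex_compact_cball)
  have "vector [(a + b) / 2, 0] \<in> box (vector [a, -1]) (vector [b, 1] :: real^2)"
    using assms by (simp add: mem_box_cart forall_2)
  then show "interior (strip {a..b}) \<noteq> {}" unfolding strip_cbox interior_cbox by blast
qed (simp_all add: strip_cbox)

lemma norm_le_1_vec2: "norm (w :: real^2) \<le> 1 \<longleftrightarrow> (w$1)\<^sup>2 + (w$2)\<^sup>2 \<le> 1"
  by (simp add: norm_le_square inner_vec_def sum_2 power2_eq_square)

lemma norm_eq_1_vec2: "norm (w :: real^2) = 1 \<longleftrightarrow> (w$1)\<^sup>2 + (w$2)\<^sup>2 = 1"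
  by (simp add: norm_eq_square inner_vec_def sum_2 power2_eq_square)

text \<open>The open interval is rescaled to the one from -1 to 1 and each vertical segment is
  shrunk to the chord of the disk over the same abscissa. Only the two points where the chord
  degenerates are missed.\<close>

lemma open_strip_homeomorphic:
  assumes "a < b"
  shows "\<exists>Z. closed Z \<and> Z \<subseteq> sphere 0 1 \<and> strip {a<..<b} homeomorphic (cball (0::real^2) 1 - Z)"
proof (intro exI conjI)
  define Z :: "(real^2) set" where "Z = {vector [-1, 0], vector [1, 0]}"
  show "closed Z" by (simp add: Z_def)
  show "Z \<subseteq> sphere 0 1" by (auto simp: Z_def norm_eq_1_vec2)
  define l where "l x = (2 * x - a - b) / (b - a)" for x
  define k where "k t = ((b - a) * t + a + b) / 2" for t
  have kl: "k (l x) = x" "l (k t) = t" for x t using assms by (auto simp: k_def l_def field_simps)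
  have l: "\<bar>l x\<bar> < 1 \<longleftrightarrow> x \<in> {a<..<b}" for x
    using assms by (auto simp: l_def abs_less_iff field_simps)
  have mem: "w \<in> cball 0 1 - Z \<longleftrightarrow> \<bar>w$1\<bar> < 1 \<and> \<bar>w$2\<bar> \<le> sqrt (1 - (w$1)\<^sup>2)" for w :: "real^2"
  proof
    assume w: "w \<in> cball 0 1 - Z"
    then have n: "(w$1)\<^sup>2 + (w$2)\<^sup>2 \<le> 1" by (simp add: norm_le_1_vec2)
    have "\<bar>w$2\<bar> \<le> sqrt (1 - (w$1)\<^sup>2)" using n by (intro real_le_rsqrt) simp
    moreover have "(w$1)\<^sup>2 \<noteq> 1"
    proof
      assume 1: "(w$1)\<^sup>2 = 1"
      then have "w$2 = 0" using n by simp
      moreover have "w$1 = 1 \<or> w$1 = -1" using 1 by (simp add: power2_eq_1_iff)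
      ultimately have "w \<in> Z" by (auto simp: Z_def vec_eq_iff forall_2)
      then show False using w by simp
    qed
    then have "(w$1)\<^sup>2 < 1" using n by (smt (verit) zero_le_power2)
    then have "\<bar>w$1\<bar> < 1" by (simp add: abs_square_less_1)
    ultimately show "\<bar>w$1\<bar> < 1 \<and> \<bar>w$2\<bar> \<le> sqrt (1 - (w$1)\<^sup>2)" by simp
  next
    assume w: "\<bar>w$1\<bar> < 1 \<and> \<bar>w$2\<bar> \<le> sqrt (1 - (w$1)\<^sup>2)"
    then have "(w$1)\<^sup>2 < 1" by (simp add: abs_square_less_1)
    have "\<bar>w$2\<bar>\<^sup>2 \<le> (sqrt (1 - (w$1)\<^sup>2))\<^sup>2" using w by (intro power_mono) auto
    then have "(w$1)\<^sup>2 + (w$2)\<^sup>2 \<le> 1" using \<open>(w$1)\<^sup>2 < 1\<close> by simp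
    moreover have "w \<notin> Z" using w by (auto simp: Z_def)
    ultimately show "w \<in> cball 0 1 - Z" by (simp add: norm_le_1_vec2)
  qed
  have sq: "0 < sqrt (1 - t\<^sup>2)" if "\<bar>t\<bar> < 1" for t
    using that by (simp add: abs_square_less_1)
  define h :: "real^2 \<Rightarrow> real^2" where "h w = (\<chi> i. if i = 1 then l (w$1) else w$2 * sqrt (1 - (l (w$1))\<^sup>2))" for w
  define h' :: "real^2 \<Rightarrow> real^2" where "h' w = (\<chi> i. if i = 1 then k (w$1) else w$2 / sqrt (1 - (w$1)\<^sup>2))" for w
  have h: "h w $ 1 = l (w$1)" "h w $ 2 = w$2 * sqrt (1 - (l (w$1))\<^sup>2)"
    "h' w $ 1 = k (w$1)" "h' w $ 2 = w$2 / sqrt (1 - (w$1)\<^sup>2)" for w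
    by (simp_all add: h_def h'_def)
  show "strip {a<..<b} homeomorphic (cball (0::real^2) 1 - Z)"
    unfolding homeomorphic_minimal
  proof (intro exI conjI ballI)
    show "continuous_on (strip {a<..<b}) h"
      unfolding h_def
    proof (intro continuous_on_vec_lambda)
      fix i :: 2
      have "continuous_on (strip {a<..<b}) (\<lambda>w. l (w$1))" "continuous_on (strip {a<..<b}) (\<lambda>w. w$2 * sqrt (1 - (l (w$1))\<^sup>2))"
        unfolding l_def using assms by (auto intro!: continuous_intros)
      then show "continuous_on (strip {a<..<b}) (\<lambda>w. if i = 1 then l (w$1) else w$2 * sqrt (1 - (l (w$1))\<^sup>2))"
        by (cases "i = 1") simp_all
    qed
    show "continuous_on (cball 0 1 - Z) h'"
      unfolding h'_def
    proof (intro continuous_on_vec_lambda)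
      fix i :: 2
      have "sqrt (1 - (w$1)\<^sup>2) \<noteq> 0" if "w \<in> cball 0 1 - Z" for w
        using that sq unfolding mem by (metis less_irrefl)
      then have "continuous_on (cball 0 1 - Z) (\<lambda>w. k (w$1))" "continuous_on (cball 0 1 - Z) (\<lambda>w. w$2 / sqrt (1 - (w$1)\<^sup>2))"
        unfolding k_def by (auto intro!: continuous_intros simp del: real_sqrt_eq_0_iff)
      then show "continuous_on (cball 0 1 - Z) (\<lambda>w. if i = 1 then k (w$1) else w$2 / sqrt (1 - (w$1)\<^sup>2))"
        by (cases "i = 1") simp_all
    qed
    fix w :: "real^2" assume w: "w \<in> strip {a<..<b}"
    then have l1: "\<bar>l (w$1)\<bar> < 1" using l by (simp add: strip_def)
    have "\<bar>w$2\<bar> * sqrt (1 - (l (w$1))\<^sup>2) \<le> 1 * sqrt (1 - (l (w$1))\<^sup>2)"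
      using w sq[OF l1] by (intro mult_right_mono) (auto simp: strip_def)
    then show "h w \<in> cball 0 1 - Z"
      unfolding mem h using l1 sq[OF l1] by (simp add: abs_mult)
    show "h' (h w) = w"
      using sq[OF l1] by (simp add: vec_eq_iff forall_2 h kl)
  next
    fix w :: "real^2" assume w: "w \<in> cball 0 1 - Z"
    then have w: "\<bar>w$1\<bar> < 1" "\<bar>w$2\<bar> \<le> sqrt (1 - (w$1)\<^sup>2)" unfolding mem by auto
    show "h' w \<in> strip {a<..<b}"
      using w l[of "k (w$1)"] sq[OF w(1)] by (simp add: strip_def h kl divide_le_eq)
    show "h (h' w) = w"
      using sq[OF w(1)] by (simp add: vec_eq_iff forall_2 h kl)
  qed
qed

lemma closed_cylinder: "closed cylinder"
proof -
  have eq: "cylinder = {p. (p$1)\<^sup>2 + (p$2)\<^sup>2 \<le> 1} \<inter> {p. \<bar>p$3\<bar> \<le> 1/2}" by (auto simp: cylinder_def)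
  show ?thesis unfolding eq by (intro closed_Int closed_Collect_le continuous_intros)
qed

lemma frontier_cylinder:
  "frontier cylinder = {p \<in> cylinder. (p$1)\<^sup>2 + (p$2)\<^sup>2 = 1 \<or> \<bar>p$3\<bar> = 1/2}"
proof -
  have "interior cylinder = {p. (p$1)\<^sup>2 + (p$2)\<^sup>2 < 1 \<and> \<bar>p$3\<bar> < 1/2}"
  proof
    have "open ({p :: real^3. (p$1)\<^sup>2 + (p$2)\<^sup>2 < 1} \<inter> {p. \<bar>p$3\<bar> < 1/2})"
      by (intro open_Int open_Collect_less continuous_intros)
    then show "{p. (p$1)\<^sup>2 + (p$2)\<^sup>2 < 1 \<and> \<bar>p$3\<bar> < 1/2} \<subseteq> interior cylinder"
      by (intro interior_maximal) (auto simp: cylinder_def Int_def)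
    show "interior cylinder \<subseteq> {p. (p$1)\<^sup>2 + (p$2)\<^sup>2 < 1 \<and> \<bar>p$3\<bar> < 1/2}"
    proof
      fix p :: "real^3" assume "p \<in> interior cylinder"
      then obtain e where e: "e > 0" "cball p e \<subseteq> cylinder" by (auto simp: mem_interior_cball)
      \<comment> \<open>Dilating \<open>p\<close> by \<open>1 + t\<close> moves it by at most
        \<open>e\<close>; the dilated point still lies in the cylinder, which makes both
        inequalities strict for \<open>p\<close>. The summand 1 covers \<open>p = 0\<close>.\<close>
      define t where "t = e / (norm p + 1)"
      have n: "norm p + 1 > 0" using norm_ge_zero[of p] by linarith
      have t: "t > 0" unfolding t_def using e(1) n by (rule divide_pos_pos)
      have "t * norm p \<le> t * (norm p + 1)" using t by (intro mult_left_mono) auto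
      also have "\<dots> = e" using n by (simp add: t_def)
      finally have "t * norm p \<le> e" .
      then have "(1 + t) *\<^sub>R p \<in> cball p e"
        using t by (simp add: dist_norm scaleR_add_left)
      then have c: "(1 + t) *\<^sub>R p \<in> cylinder" using e by blast
      have 1: "(1 + t)\<^sup>2 > 1" using t by (simp add: power2_eq_square algebra_simps add_pos_pos)
      have "(1 + t)\<^sup>2 * ((p$1)\<^sup>2 + (p$2)\<^sup>2) \<le> 1"
        using c by (simp add: cylinder_def power_mult_distrib distrib_left)
      then have A: "(p$1)\<^sup>2 + (p$2)\<^sup>2 < 1"
      proof (rule contrapos_pp)
        assume "\<not> (p$1)\<^sup>2 + (p$2)\<^sup>2 < 1"
        then have "(1 + t)\<^sup>2 * 1 \<le> (1 + t)\<^sup>2 * ((p$1)\<^sup>2 + (p$2)\<^sup>2)" by (intro mult_left_mono) auto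
        then show "\<not> (1 + t)\<^sup>2 * ((p$1)\<^sup>2 + (p$2)\<^sup>2) \<le> 1" using 1 by linarith
      qed
      have "\<bar>(1 + t) * p$3\<bar> \<le> 1/2" using c by (simp add: cylinder_def)
      then have "(1 + t) * \<bar>p$3\<bar> \<le> 1/2" using t unfolding abs_mult by simp
      then have B: "\<bar>p$3\<bar> < 1/2"
      proof (rule contrapos_pp)
        assume "\<not> \<bar>p$3\<bar> < 1/2"
        then have "(1 + t) * (1/2) \<le> (1 + t) * \<bar>p$3\<bar>" using t by (intro mult_left_mono) auto
        moreover have "1/2 < (1 + t) * (1/2)" using t by simp
        ultimately show "\<not> (1 + t) * \<bar>p$3\<bar> \<le> 1/2" by linarith
      qed
      from A B show "p \<in> {p. (p$1)\<^sup>2 + (p$2)\<^sup>2 < 1 \<and> \<bar>p$3\<bar> < 1/2}" by simp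
    qed
  qed
  then have f: "frontier cylinder = cylinder - {p. (p$1)\<^sup>2 + (p$2)\<^sup>2 < 1 \<and> \<bar>p$3\<bar> < 1/2}"
    unfolding frontier_def closure_closed[OF closed_cylinder] by (simp only:)
  have *: "(a \<le> 1 \<and> b \<le> 1/2) \<and> \<not> (a < 1 \<and> b < 1/2) \<longleftrightarrow> (a \<le> 1 \<and> b \<le> 1/2) \<and> (a = 1 \<or> b = 1/2)" for a b :: real
    by linarith
  show ?thesis
    unfolding f unfolding cylinder_def set_eq_iff Diff_iff mem_Collect_eq by (intro allI *)
qed

section \<open>Embeddedness, properness and the curvature bound\<close>

context weierstrass
begin

lemma N_minus:
  assumes "\<kappa> \<in> T" "x \<in> J" "\<bar>y\<bar> < om \<kappa> x"
  shows "N \<kappa> x (- y) = - cnj (N \<kappa> x y)"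
proof -
  have in\<Omega>: "(\<kappa>, Complex x y) \<in> \<Omega>" using assms by (simp add: \<Omega>_def)
  have fc: "f \<kappa> (cnj w) = cnj (f \<kappa> w)" if "(\<kappa>, w) \<in> \<Omega>" for w
    using that \<Omega>_dom by (intro f_cnj) (auto simp: dom_def)
  have "SI (f \<kappa>) (cnj (of_real x)) (cnj (Complex x y)) = cnj (SI (\<lambda>z. cnj (f \<kappa> (cnj z))) (of_real x) (Complex x y))"
    by (rule SI_cnj)
  also have "SI (\<lambda>z. cnj (f \<kappa> (cnj z))) (of_real x) (Complex x y) = SI (f \<kappa>) (of_real x) (Complex x y)"
    using vertical_segment_\<Omega>[OF in\<Omega>] fc by (intro SI_cong) auto
  finally have "SI (f \<kappa>) (of_real x) (Complex x (- y)) = cnj (SI (f \<kappa>) (of_real x) (Complex x y))"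
    by (simp add: complex_cnj)
  then show ?thesis
    using assms by (simp add: N_def)
qed

lemma X_minus: "\<kappa> \<in> T \<Longrightarrow> x \<in> J \<Longrightarrow> \<bar>y\<bar> < om \<kappa> x \<Longrightarrow> X \<kappa> (Complex x (- y)) = - X \<kappa> (Complex x y)"
  using X_cnj[of \<kappa> "Complex x y"] by (simp add: \<Omega>_def complex_cnj)

text \<open>\<open>Re xi\<close> is strictly increasing on the upper half and odd under reflection,
  hence strictly increasing on the whole slice. Different slices lie at different heights, so this
  is all that embeddedness needs.\<close>

lemma X_inj:
  assumes k: "\<kappa> \<in> T" "x \<in> J" and y: "\<bar>y1\<bar> < om \<kappa> x" "\<bar>y2\<bar> < om \<kappa> x"
    and eq: "X \<kappa> (Complex x y1) = X \<kappa> (Complex x y2)"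
  shows "y1 = y2"
proof -
  have minus: "xi \<kappa> x (- y) = - xi \<kappa> x y" if "\<bar>y\<bar> < om \<kappa> x" for y
    using X_minus[OF k that] k by (simp add: xi_def)
  have mono: "Re (xi \<kappa> x a) < Re (xi \<kappa> x b)" if "a < b" "\<bar>a\<bar> < om \<kappa> x" "\<bar>b\<bar> < om \<kappa> x" for a b
  proof (cases "0 \<le> a")
    case True
    then show ?thesis using Re_xi_strict_mono[OF k True that(1)] that by simp
  next
    case False
    then have a: "0 < - a" by simp
    have "0 < Re (xi \<kappa> x (- a))" using Re_xi_pos[OF k a] that by simp
    then have a': "Re (xi \<kappa> x a) < 0" using minus[OF that(2)] by simp
    show ?thesis
    proof (cases "0 \<le> b")
      case True
      then have "0 \<le> Re (xi \<kappa> x b)"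
        using Re_xi_pos[OF k, of b] xi_0[OF k] that by (cases "b = 0") auto
      then show ?thesis using a' by simp
    next
      case False
      then have "Re (xi \<kappa> x (- b)) < Re (xi \<kappa> x (- a))"
        using Re_xi_strict_mono[OF k, of "- b" "- a"] that by simp
      then show ?thesis using minus that by simp
    qed
  qed
  have "xi \<kappa> x y1 = xi \<kappa> x y2" using eq k by (simp add: xi_def)
  then show ?thesis using mono[of y1 y2] mono[of y2 y1] y by (cases y1 y2 rule: linorder_cases) auto
qed

lemma F_inj: "inj_on (F \<kappa>) {w. (\<kappa>, w) \<in> \<Omega>3}"
proof (rule inj_onI)
  fix w w' assume a: "w \<in> {w. (\<kappa>, w) \<in> \<Omega>3}" "w' \<in> {w. (\<kappa>, w) \<in> \<Omega>3}" and eq: "F \<kappa> w = F \<kappa> w'"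
  have 1: "w$1 = w'$1" using arg_cong[OF eq, of "\<lambda>p. p$3"] by simp
  have "X \<kappa> (psi \<kappa> w) = X \<kappa> (psi \<kappa> w')"
    using arg_cong[OF eq, of "\<lambda>p. p$1"] arg_cong[OF eq, of "\<lambda>p. p$2"] by (simp add: complex_eq_iff)
  then have "w$2 * Y \<kappa> (w$1) = w'$2 * Y \<kappa> (w$1)"
    using a by (intro X_inj[of \<kappa> "w$1"]) (auto simp: psi_eq \<Omega>3_def 1)
  moreover have "Y \<kappa> (w$1) > 0" using a Y by (auto simp: \<Omega>3_def)
  ultimately have "w$2 = w'$2" by simp
  with 1 show "w = w'" by (simp add: vec_eq_iff forall_2)
qed

lemma cmod_X_psi:
  assumes "(\<kappa>, w) \<in> \<Omega>3"
  shows "cmod (X \<kappa> (psi \<kappa> w)) = cmod (X \<kappa> (Complex (w$1) (\<bar>w$2\<bar> * Y \<kappa> (w$1))))"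
proof (cases "0 \<le> w$2")
  case False
  then have "X \<kappa> (Complex (w$1) (- (w$2 * Y \<kappa> (w$1)))) = - X \<kappa> (psi \<kappa> w)"
    unfolding psi_eq using assms by (intro X_minus) (auto simp: \<Omega>3_def)
  then show ?thesis using False by simp
qed (simp add: psi_eq)

lemma radius_iff:
  assumes "(\<kappa>, w) \<in> \<Omega>3"
  shows "cmod (X \<kappa> (psi \<kappa> w)) \<le> 1 \<longleftrightarrow> \<bar>w$2\<bar> \<le> 1" "cmod (X \<kappa> (psi \<kappa> w)) = 1 \<longleftrightarrow> \<bar>w$2\<bar> = 1"
proof -
  have k: "\<kappa> \<in> T" "w$1 \<in> J" "\<bar>w$2 * Y \<kappa> (w$1)\<bar> < om \<kappa> (w$1)" using assms by (auto simp: \<Omega>3_def)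
  note y = Y[OF k(1,2)]
  have l: "\<bar>w$2\<bar> * Y \<kappa> (w$1) < om \<kappa> (w$1)" using k(3) y by (simp add: abs_mult)
  have *: "cmod (X \<kappa> (psi \<kappa> w)) < 1" if "\<bar>w$2\<bar> < 1"
    unfolding cmod_X_psi[OF assms]
    using radius_strict_mono[OF k(1,2), of "\<bar>w$2\<bar> * Y \<kappa> (w$1)" "Y \<kappa> (w$1)"] y that by simp
  have **: "cmod (X \<kappa> (psi \<kappa> w)) > 1" if "\<bar>w$2\<bar> > 1"
    unfolding cmod_X_psi[OF assms]
    using radius_strict_mono[OF k(1,2), of "Y \<kappa> (w$1)" "\<bar>w$2\<bar> * Y \<kappa> (w$1)"] y that l by simp
  have ***: "cmod (X \<kappa> (psi \<kappa> w)) = 1" if "\<bar>w$2\<bar> = 1"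
    unfolding cmod_X_psi[OF assms] using that y by simp
  show "cmod (X \<kappa> (psi \<kappa> w)) \<le> 1 \<longleftrightarrow> \<bar>w$2\<bar> \<le> 1"
    using * ** *** by (cases "\<bar>w$2\<bar>" "1::real" rule: linorder_cases) auto
  show "cmod (X \<kappa> (psi \<kappa> w)) = 1 \<longleftrightarrow> \<bar>w$2\<bar> = 1"
    using * ** *** by (cases "\<bar>w$2\<bar>" "1::real" rule: linorder_cases) auto
qed

lemma strip_\<Omega>3: "\<kappa> \<in> T \<Longrightarrow> I \<subseteq> J \<Longrightarrow> w \<in> strip I \<Longrightarrow> (\<kappa>, w) \<in> \<Omega>3"
  by (rule \<Omega>3_strip) (auto simp: strip_def)

lemma F_radius: "(F \<kappa> w $ 1)\<^sup>2 + (F \<kappa> w $ 2)\<^sup>2 = (cmod (X \<kappa> (psi \<kappa> w)))\<^sup>2"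
  by (simp add: cmod_power2)

lemma smooth_F: "smooth_on (F \<kappa>) {w. (\<kappa>, w) \<in> \<Omega>3}"
  by (rule ck_imp_smooth_on[OF open_slices_\<Omega>3 ck_F])

lemma continuous_F: "continuous_on {w. (\<kappa>, w) \<in> \<Omega>3} (F \<kappa>)"
proof -
  have "continuous_on {w. (\<kappa>, w) \<in> \<Omega>3} (\<lambda>w. (\<lambda>(\<kappa>, w). F \<kappa> w) (\<kappa>, w))"
    by (rule continuous_on_compose2[OF ck_continuous[OF ck_F]]) (auto intro!: continuous_intros)
  then show ?thesis by simp
qed

lemma homeomorphism_F_compact:
  assumes "\<kappa> \<in> T" "{a..b} \<subseteq> J"
  shows "\<exists>H. homeomorphism (strip {a..b}) (F \<kappa> ` strip {a..b}) (F \<kappa>) H"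
proof -
  have sub: "strip {a..b} \<subseteq> {w. (\<kappa>, w) \<in> \<Omega>3}" using strip_\<Omega>3 assms by blast
  have "compact (strip {a..b})" by (simp add: strip_cbox)
  then obtain H where "homeomorphism (strip {a..b}) (F \<kappa> ` strip {a..b}) (F \<kappa>) H"
    using homeomorphism_compact[OF _ continuous_on_subset[OF continuous_F sub] refl inj_on_subset[OF F_inj sub]]
    by blast
  then show ?thesis by blast
qed

text \<open>Continuity of the inverse is local, and the height of a point of the image is the first
  parameter. Near a given height the inverse is the one over a compact strip, where injectivity and
  continuity suffice.\<close>

lemma homeomorphism_F_open:
  assumes k: "\<kappa> \<in> T" and J': "{a<..<b} \<subseteq> J"
  shows "\<exists>H. homeomorphism (strip {a<..<b}) (F \<kappa> ` strip {a<..<b}) (F \<kappa>) H"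
proof -
  define W where "W = strip {a<..<b}"
  have sub: "W \<subseteq> {w. (\<kappa>, w) \<in> \<Omega>3}" unfolding W_def using strip_\<Omega>3 assms by blast
  have inj: "inj_on (F \<kappa>) W" using inj_on_subset[OF F_inj sub] .
  define H where "H = inv_into W (F \<kappa>)"
  have H: "H (F \<kappa> w) = w" if "w \<in> W" for w using that inj by (simp add: H_def)
  have "continuous_on (F \<kappa> ` W) H"
    unfolding continuous_on_eq_continuous_within
  proof
    fix p assume "p \<in> F \<kappa> ` W"
    then obtain w where w: "w \<in> W" "p = F \<kappa> w" by blast
    define c where "c = (a + w$1) / 2"
    define d where "d = (w$1 + b) / 2"
    have cd: "a < c" "c < w$1" "w$1 < d" "d < b" using w by (auto simp: W_def strip_def c_def d_def)
    then have "{c..d} \<subseteq> {a<..<b}" by auto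
    then have "{c..d} \<subseteq> J" using J' by blast
    then obtain H' where H': "homeomorphism (strip {c..d}) (F \<kappa> ` strip {c..d}) (F \<kappa>) H'"
      using homeomorphism_F_compact[OF k] by blast
    have sub': "strip {c..d} \<subseteq> W" using \<open>{c..d} \<subseteq> {a<..<b}\<close> by (auto simp: strip_def W_def)
    have "H q = H' q" if "q \<in> F \<kappa> ` strip {c..d}" for q
    proof -
      obtain v where v: "v \<in> strip {c..d}" "q = F \<kappa> v" using \<open>q \<in> _\<close> by blast
      then have "H' q = v" using H' by (auto simp: homeomorphism_def)
      moreover have "H q = v" using H v sub' by auto
      ultimately show ?thesis by simp
    qed
    moreover have "continuous_on (F \<kappa> ` strip {c..d}) H'" using H' by (simp add: homeomorphism_def)
    ultimately have "continuous_on (F \<kappa> ` strip {c..d}) H"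
      by (metis (no_types, lifting) continuous_on_eq)
    moreover have wcd: "w \<in> strip {c..d}" using w cd by (auto simp: W_def strip_def)
    ultimately have "continuous (at p within F \<kappa> ` strip {c..d}) H"
      using w by (auto simp: continuous_on_eq_continuous_within)
    moreover have "at p within F \<kappa> ` strip {c..d} = at p within F \<kappa> ` W"
    proof (rule at_within_nhd)
      show "p \<in> {q. c < q$3 \<and> q$3 < d}" using w cd by simp
      have "open ({q :: real^3. c < q$3} \<inter> {q. q$3 < d})"
        by (intro open_Int open_Collect_less continuous_intros)
      then show "open {q :: real^3. c < q$3 \<and> q$3 < d}" by (simp add: Int_def)
      show "F \<kappa> ` strip {c..d} \<inter> {q. c < q$3 \<and> q$3 < d} - {p} = F \<kappa> ` W \<inter> {q. c < q$3 \<and> q$3 < d} - {p}"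
        using sub' by (auto simp: W_def strip_def)
    qed
    ultimately show "continuous (at p within F \<kappa> ` W) H" by simp
  qed
  then have "homeomorphism W (F \<kappa> ` W) (F \<kappa>) H"
    using continuous_on_subset[OF continuous_F sub] H unfolding homeomorphism_def by force
  then show ?thesis unfolding W_def by blast
qed

lemma embedded:
  assumes "\<kappa> \<in> T" "I \<subseteq> J"
    and "\<exists>Z. closed Z \<and> Z \<subseteq> sphere 0 1 \<and> strip I homeomorphic (cball (0::real^2) 1 - Z)"
    and "\<exists>H. homeomorphism (strip I) (F \<kappa> ` strip I) (F \<kappa>) H"
  shows "embedded_minimal_disk (F \<kappa>) (strip I) (F \<kappa> ` strip I)"
  unfolding embedded_minimal_disk_def
proof (intro conjI ballI)
  show "\<exists>U. strip I \<subseteq> U \<and> smooth_on (F \<kappa>) U"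
    using smooth_F strip_\<Omega>3[OF assms(1,2)] by (intro exI[of _ "{w. (\<kappa>, w) \<in> \<Omega>3}"]) auto
  fix w assume "w \<in> strip I"
  then have "(\<kappa>, w) \<in> \<Omega>3" by (rule strip_\<Omega>3[OF assms(1,2)])
  then show "inj (frechet_derivative (F \<kappa>) (at w))" "mean_curvature (F \<kappa>) w = 0"
    by (rule surface_calculus)+
qed (use assms in auto)

lemma norm_A_sq_F:
  assumes "\<kappa> \<in> T" "I \<subseteq> J" "w \<in> strip I"
  shows "norm_A_sq (F \<kappa>) (strip I) (F \<kappa> w) = 2 * (cmod (f \<kappa> (psi \<kappa> w)))\<^sup>2 / coshv \<kappa> (psi \<kappa> w) ^ 4"
proof -
  have "strip I \<subseteq> {w. (\<kappa>, w) \<in> \<Omega>3}" using strip_\<Omega>3 assms by blast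
  then have "inv_into (strip I) (F \<kappa>) (F \<kappa> w) = w"
    using inj_on_subset[OF F_inj] assms(3) by (intro inv_into_f_f) blast
  then show ?thesis
    using surface_calculus(3)[OF strip_\<Omega>3[OF assms]] by (simp add: norm_A_sq_def Let_def)
qed

lemma psi_axis: "psi \<kappa> (vector [t, 0]) = of_real t"
  by (simp add: psi_eq Complex_eq)

lemma F_axis: "F \<kappa> (vector [t, 0]) = axis_point t"
  by (simp add: vec_eq_iff forall_3 psi_axis X_of_real axis_point_def)

lemma norm_A_sq_axis:
  assumes "\<kappa> \<in> T" "I \<subseteq> J" "t \<in> I"
  shows "norm_A_sq (F \<kappa>) (strip I) (axis_point t) = 2 * (fr \<kappa> t)\<^sup>2"
proof -
  have t: "t \<in> J" using assms by auto
  have "vector [t, 0] \<in> strip I" using assms by (simp add: strip_def)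
  from norm_A_sq_F[OF assms(1,2) this]
  have "norm_A_sq (F \<kappa>) (strip I) (axis_point t) = 2 * (cmod (f \<kappa> (of_real t)))\<^sup>2 / coshv \<kappa> (of_real t) ^ 4"
    by (simp add: F_axis psi_axis)
  moreover have "coshv \<kappa> (of_real t) = 1" using G_unit[OF assms(1) t] by (simp add: coshv_def)
  moreover have "cmod (f \<kappa> (of_real t)) = \<bar>fr \<kappa> t\<bar>"
    using f_of_real TJ[OF assms(1) t] by simp
  ultimately show ?thesis by simp
qed

lemma coshv_N: "\<kappa> \<in> T \<Longrightarrow> x \<in> J \<Longrightarrow> \<bar>y\<bar> < om \<kappa> x \<Longrightarrow> coshv \<kappa> (Complex x y) = cosh (Re (N \<kappa> x y))"
  by (simp add: coshv_def cmod_G cosh_field_def exp_minus field_simps)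

lemma radius_upper':
  assumes k: "\<kappa> \<in> T" "x \<in> J" and y: "\<bar>y\<bar> < om \<kappa> x"
  shows "cmod (X \<kappa> (Complex x y)) \<le> \<bar>y\<bar> * coshv \<kappa> (Complex x y)"
proof (cases "0 \<le> y")
  case True
  then show ?thesis using radius_upper[OF k True] y by (simp add: coshv_N[OF k y])
next
  case False
  then have "cmod (X \<kappa> (Complex x (- y))) \<le> - y * cosh (Re (N \<kappa> x (- y)))"
    using y by (intro radius_upper k) auto
  then show ?thesis using False by (simp add: coshv_N[OF k y] X_minus[OF k y] N_minus[OF k y])
qed

text \<open>Either the height is at distance at least \<open>\<delta> / 2\<close> from
  \<open>S\<close>, where \<open>fr\<close> is bounded, or the point is at distance at least
  \<open>\<delta> / 2\<close> from the axis. In the second case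
  \<open>\<delta> / 2 \<le> \<bar>y\<bar> * cosh v\<close>, and as \<open>y^2 * fr \<le> 1/4\<close>
  throughout the domain, \<open>fr\<close> is bounded by \<open>cosh^2 v / \<delta>^2\<close>.
  Adding the two bounds covers both cases, uniformly in \<kappa>.\<close>

lemma curvature_bound:
  assumes k: "\<kappa> \<in> T" and w: "(\<kappa>, w) \<in> \<Omega>3" and \<delta>: "\<delta> > 0"
    and far: "\<And>t. t \<in> S \<Longrightarrow> \<delta>\<^sup>2 \<le> (cmod (X \<kappa> (psi \<kappa> w)))\<^sup>2 + (w$1 - t)\<^sup>2"
  shows "2 * (cmod (f \<kappa> (psi \<kappa> w)))\<^sup>2 / coshv \<kappa> (psi \<kappa> w) ^ 4
    \<le> 8 * (suminf wt * (4 / (\<delta> / 2) ^ 4))\<^sup>2 + 8 / \<delta> ^ 4"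
proof -
  define x where "x = w$1"
  define y where "y = w$2 * Y \<kappa> (w$1)"
  have x: "x \<in> J" and y: "\<bar>y\<bar> < om \<kappa> x" using w by (auto simp: \<Omega>3_def x_def y_def)
  have psi: "psi \<kappa> w = Complex x y" by (simp add: psi_eq x_def y_def)
  note b = bnd[OF k x]
  define c where "c = coshv \<kappa> (psi \<kappa> w)"
  have c: "1 \<le> c" using coshv_ge_1 w by (simp add: c_def psi_\<Omega>)
  have "(cmod (f \<kappa> (psi \<kappa> w)))\<^sup>2 \<le> (2 * fr \<kappa> x)\<^sup>2"
    unfolding psi using f_slice(3)[OF k x y] by (intro power_mono) auto
  then have "2 * (cmod (f \<kappa> (psi \<kappa> w)))\<^sup>2 / c ^ 4 \<le> 2 * (2 * fr \<kappa> x)\<^sup>2 / c ^ 4"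
    using c by (intro divide_right_mono) auto
  then have 1: "2 * (cmod (f \<kappa> (psi \<kappa> w)))\<^sup>2 / c ^ 4 \<le> 8 * (fr \<kappa> x)\<^sup>2 / c ^ 4"
    by (simp add: power_mult_distrib)
  have 2: "8 * (fr \<kappa> x)\<^sup>2 / c ^ 4 \<le> 8 * (suminf wt * (4 / (\<delta> / 2) ^ 4))\<^sup>2 + 8 / \<delta> ^ 4"
  proof (cases "\<delta> / 2 \<le> infdist x S")
    case True
    have wt0: "0 \<le> suminf wt" using summable_wt by (intro suminf_nonneg less_imp_le[OF wt_pos])
    have "\<delta> / 2 \<le> dd \<kappa> x" using True by (simp add: dd_def)
    then have "suminf wt * (4 / dd \<kappa> x ^ 4) \<le> suminf wt * (4 / (\<delta> / 2) ^ 4)"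
      using wt0 \<delta> by (intro mult_left_mono frac_le power_mono) auto
    then have "fr \<kappa> x \<le> suminf wt * (4 / (\<delta> / 2) ^ 4)"
      using fr_upper[OF b(3)] by linarith
    then have 3: "(fr \<kappa> x)\<^sup>2 \<le> (suminf wt * (4 / (\<delta> / 2) ^ 4))\<^sup>2"
      using fr_pos[OF b] by (intro power_mono) auto
    have "8 * (fr \<kappa> x)\<^sup>2 / c ^ 4 \<le> 8 * (fr \<kappa> x)\<^sup>2 / 1"
      using c by (intro divide_left_mono) auto
    also have "\<dots> \<le> 8 * (suminf wt * (4 / (\<delta> / 2) ^ 4))\<^sup>2" using 3 by simp
    finally show ?thesis using \<delta> by (simp add: add_increasing2)
  next
    case False
    obtain t where t: "t \<in> S" "infdist x S = dist x t"
      using infdist_attains_inf[OF S(1,2)] by metis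
    have "\<bar>x - t\<bar> < \<delta> / 2" using False t by (simp add: dist_real_def)
    then have "\<bar>x - t\<bar>\<^sup>2 \<le> (\<delta> / 2)\<^sup>2" by (intro power_mono) auto
    then have "(w$1 - t)\<^sup>2 \<le> (\<delta> / 2)\<^sup>2" by (simp add: x_def)
    moreover have "(\<delta> / 2)\<^sup>2 = \<delta>\<^sup>2 / 4" by (simp add: power_divide)
    moreover have "0 \<le> \<delta>\<^sup>2" by simp
    ultimately have "(\<delta> / 2)\<^sup>2 \<le> (cmod (X \<kappa> (psi \<kappa> w)))\<^sup>2"
      using far[OF t(1)] by linarith
    then have "\<delta> / 2 \<le> cmod (X \<kappa> (psi \<kappa> w))" by (rule power2_le_imp_le) simp
    also have "\<dots> \<le> \<bar>y\<bar> * c" unfolding c_def psi by (rule radius_upper'[OF k x y])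
    finally have r: "\<delta> / 2 \<le> \<bar>y\<bar> * c" .
    have "(\<delta> / 2) ^ 4 \<le> (\<bar>y\<bar> * c) ^ 4" using r \<delta> by (intro power_mono) auto
    then have r4: "\<delta> ^ 4 / 16 \<le> y ^ 4 * c ^ 4" by (simp add: power_mult_distrib power_divide)
    have "\<bar>y\<bar>\<^sup>2 * fr \<kappa> x \<le> (om \<kappa> x)\<^sup>2 * fr \<kappa> x"
      using y fr_pos[OF b] by (intro mult_right_mono power_mono) auto
    also have "\<dots> \<le> 1 / 4" using om_sq_fr[OF b] dd_le4[OF b] by simp
    finally have "y\<^sup>2 * fr \<kappa> x \<le> 1 / 4" by simp
    then have "(y\<^sup>2 * fr \<kappa> x)\<^sup>2 \<le> (1 / 4)\<^sup>2"
      using fr_pos[OF b] by (intro power_mono) auto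
    then have yf: "y ^ 4 * (fr \<kappa> x)\<^sup>2 \<le> 1 / 16" by (simp add: power_mult_distrib power_divide flip: power_mult)
    have "(fr \<kappa> x)\<^sup>2 * (\<delta> ^ 4 / 16) \<le> (fr \<kappa> x)\<^sup>2 * (y ^ 4 * c ^ 4)"
      using r4 by (intro mult_left_mono) auto
    also have "\<dots> = (y ^ 4 * (fr \<kappa> x)\<^sup>2) * c ^ 4" by simp
    also have "\<dots> \<le> 1 / 16 * c ^ 4" using yf c by (intro mult_right_mono) auto
    finally have "(fr \<kappa> x)\<^sup>2 * \<delta> ^ 4 \<le> c ^ 4" by simp
    then have "8 * (fr \<kappa> x)\<^sup>2 / c ^ 4 \<le> 8 / \<delta> ^ 4"
      using c \<delta> by (simp add: divide_le_eq le_divide_eq mult.commute)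
    then show ?thesis by (simp add: add_increasing)
  qed
  from 1 2 show ?thesis by (simp add: c_def)
qed

lemma F_in_cylinder:
  assumes "\<kappa> \<in> T" "I \<subseteq> J" "I \<subseteq> {-1/2..1/2}" "w \<in> strip I"
  shows "F \<kappa> w \<in> cylinder"
proof -
  have "cmod (X \<kappa> (psi \<kappa> w)) \<le> 1"
    using radius_iff(1)[OF strip_\<Omega>3[OF assms(1,2,4)]] assms(4) by (simp add: strip_def)
  then have "(cmod (X \<kappa> (psi \<kappa> w)))\<^sup>2 \<le> 1" by (simp add: power_le_one)
  moreover have "w$1 \<in> {-1/2..1/2}" using assms(3,4) by (auto simp: strip_def)
  then have "\<bar>w$1\<bar> \<le> 1/2" by (auto simp: abs_le_iff)
  ultimately show ?thesis
    using F_radius[of \<kappa> w] by (simp add: cylinder_def del: F_component(1,2))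
qed

lemma properly_embedded:
  assumes k: "\<kappa> \<in> T" and J': "{-1/2..1/2} \<subseteq> J"
  shows "properly_embedded_minimal_disk (F \<kappa>) (strip {-1/2..1/2}) (F \<kappa> ` strip {-1/2..1/2}) cylinder"
  unfolding properly_embedded_minimal_disk_def
proof (intro conjI)
  show "embedded_minimal_disk (F \<kappa>) (strip {-1/2..1/2}) (F \<kappa> ` strip {-1/2..1/2})"
  proof (rule embedded[OF k J' _ homeomorphism_F_compact[OF k J']])
    show "\<exists>Z. closed Z \<and> Z \<subseteq> sphere 0 1 \<and> strip {-1/2..1/2} homeomorphic (cball (0::real^2) 1 - Z)"
      using strip_homeomorphic_cball[of "-1/2" "1/2"] by (intro exI[of _ "{}"]) auto
  qed
  show "compact (strip {-1/2..1/2})" by (simp add: strip_cbox)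
  show "F \<kappa> ` strip {-1/2..1/2} \<subseteq> cylinder" using F_in_cylinder[OF k J'] by auto
  have fw: "frontier (strip {-1/2..1/2}) = {w \<in> strip {-1/2..1/2}. \<bar>w$1\<bar> = 1/2 \<or> \<bar>w$2\<bar> = 1}"
    unfolding strip_cbox frontier_cbox by (auto simp: mem_box_cart forall_2)
  have "F \<kappa> w \<in> frontier cylinder \<longleftrightarrow> w \<in> frontier (strip {-1/2..1/2})" if w: "w \<in> strip {-1/2..1/2}" for w
  proof -
    have "(F \<kappa> w $ 1)\<^sup>2 + (F \<kappa> w $ 2)\<^sup>2 = 1 \<longleftrightarrow> cmod (X \<kappa> (psi \<kappa> w)) = 1"
      unfolding F_radius by (simp add: power2_eq_1_iff) (metis norm_ge_zero not_one_le_zero le_minus_one_simps(3))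
    also have "\<dots> \<longleftrightarrow> \<bar>w$2\<bar> = 1" by (rule radius_iff(2)[OF strip_\<Omega>3[OF k J' w]])
    finally show ?thesis
      unfolding frontier_cylinder fw using w F_in_cylinder[OF k J' _ w] by auto
  qed
  moreover have "frontier (strip {-1/2..1/2}) \<subseteq> strip {-1/2..1/2}" unfolding fw by auto
  ultimately show "F \<kappa> ` frontier (strip {-1/2..1/2}) = F \<kappa> ` strip {-1/2..1/2} \<inter> frontier cylinder"
    by blast
qed

end

section \<open>Multi-valued graphs\<close>

lemma isCont_closure_image:
  fixes m :: "'a::metric_space \<Rightarrow> 'b::metric_space"
  assumes "isCont m p" "p \<in> closure A"
  shows "m p \<in> closure (m ` A)"
proof -
  obtain s where s: "\<And>n. s n \<in> A" "s \<longlonglongrightarrow> p"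
    using assms(2) unfolding closure_sequential by blast
  then have "(\<lambda>n. m (s n)) \<longlonglongrightarrow> m p" by (intro isCont_tendsto_compose[OF assms(1)])
  then show ?thesis using s(1) unfolding closure_sequential by (intro exI[of _ "\<lambda>n. m (s n)"]) auto
qed

section \<open>The angle along a level of the radius\<close>

context weierstrass
begin

text \<open>Because \<open>J\<close> is an interval, the primitive \<open>U\<close> of
  \<open>fr\<close> is a global branch: \<open>G * cis (- U)\<close> is constant along
  \<open>J\<close>. The sign \<epsilon> chooses one of the two halves of the slices.\<close>

lemma ex_angle:
  assumes k: "\<kappa> \<in> T" and \<epsilon>: "\<epsilon> = 1 \<or> \<epsilon> = -1"
  obtains u0 where "\<And>x. x \<in> J \<Longrightarrow> of_real \<epsilon> * G \<kappa> (of_real x) = cis (u0 x)"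
    and "\<And>x. x \<in> J \<Longrightarrow> (u0 has_real_derivative fr \<kappa> x) (at x)"
proof (cases "J = {}")
  case True
  then show ?thesis using that[of "\<lambda>_. 0"] by simp
next
  case False
  then obtain x0 where x0: "x0 \<in> J" by blast
  define U where "U x = Re (SI (f \<kappa>) (of_real x0) (of_real x))" for x
  have U: "(U has_real_derivative fr \<kappa> x) (at x)" if x: "x \<in> J" for x
  proof -
    have "((\<lambda>w. SI (f \<kappa>) (of_real x0) (of_real (Re w))) has_derivative
        (\<lambda>v. f \<kappa> (of_real (Re (of_real x))) * of_real (Re v))) (at (of_real x))"
      using horizontal_segment_\<Omega>[OF k x0 x]
      by (intro has_derivative_SI_horizontal[OF open_slice _ holomorphic_f_\<Omega>]) simp
    from has_derivative_compose[OF bounded_linear_imp_has_derivative[OF bounded_linear_of_real] this]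
    have "((\<lambda>x. SI (f \<kappa>) (of_real x0) (of_real x)) has_derivative (\<lambda>h. f \<kappa> (of_real x) * of_real h)) (at x)"
      by simp
    then have "(U has_derivative (\<lambda>h. Re (f \<kappa> (of_real x) * of_real h))) (at x)"
      unfolding U_def[abs_def] by (rule bounded_linear.has_derivative[OF bounded_linear_Re])
    moreover have "(\<lambda>h. Re (f \<kappa> (of_real x) * of_real h)) = (*) (fr \<kappa> x)"
      using f_of_real TJ[OF k x] by auto
    ultimately show ?thesis by (simp add: has_field_derivative_def)
  qed
  have "\<exists>c. \<forall>x\<in>J. G \<kappa> (of_real x) * cis (- U x) = c"
  proof (rule has_vector_derivative_zero_constant)
    show "convex J" by (rule is_interval_convex[OF J(2)])
    fix x assume x: "x \<in> J"
    have d: "(G \<kappa> has_field_derivative \<i> * f \<kappa> (of_real x) * G \<kappa> (of_real x)) (at (of_real x))"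
      using of_real_\<Omega>[OF k x] by (intro G_deriv) (auto simp: \<Omega>_def)
    have "((\<lambda>x. G \<kappa> (of_real x)) has_vector_derivative \<i> * f \<kappa> (of_real x) * G \<kappa> (of_real x)) (at x)"
      by (rule has_vector_derivative_real_field[OF d])
    then have 1: "((\<lambda>x. G \<kappa> (of_real x)) has_vector_derivative \<i> * fr \<kappa> x * G \<kappa> (of_real x)) (at x)"
      using f_of_real TJ[OF k x] by simp
    have "((\<lambda>x. cis (- U x)) has_derivative (\<lambda>h. (- fr \<kappa> x * h) *\<^sub>R (\<i> * cis (- U x)))) (at x)"
      using U[OF x] by (auto intro!: derivative_eq_intros simp: has_field_derivative_def)
    then have 2: "((\<lambda>x. cis (- U x)) has_vector_derivative - fr \<kappa> x * (\<i> * cis (- U x))) (at x)"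
      by (simp add: has_vector_derivative_def scaleR_conv_of_real mult_ac)
    have "((\<lambda>x. G \<kappa> (of_real x) * cis (- U x)) has_vector_derivative
       G \<kappa> (of_real x) * (- fr \<kappa> x * (\<i> * cis (- U x))) + \<i> * fr \<kappa> x * G \<kappa> (of_real x) * cis (- U x)) (at x)"
      by (rule has_vector_derivative_mult[OF 1 2])
    then have "((\<lambda>x. G \<kappa> (of_real x) * cis (- U x)) has_vector_derivative 0) (at x)"
      by (simp add: mult_ac)
    then show "((\<lambda>x. G \<kappa> (of_real x) * cis (- U x)) has_vector_derivative 0) (at x within J)"
      by (rule has_vector_derivative_at_within)
  qed blast
  then obtain c where c: "\<And>x. x \<in> J \<Longrightarrow> G \<kappa> (of_real x) * cis (- U x) = c" by blast
  have Gc: "G \<kappa> (of_real x) = c * cis (U x)" if "x \<in> J" for x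
    using c[OF that, symmetric] by (simp add: cis_mult mult.assoc)
  have "cmod c = 1" using G_unit[OF k x0] c[OF x0, symmetric] by (simp add: norm_mult)
  then have "cmod (of_real \<epsilon> * c) = 1" using \<epsilon> by (auto simp: norm_mult)
  then obtain \<alpha> where \<alpha>: "of_real \<epsilon> * c = cis \<alpha>" by (metis cis_Arg_unique cis_Arg norm_eq_zero sgn_eq mult_1 of_real_1 div_by_1 zero_neq_one)
  show ?thesis
  proof (rule that[of "\<lambda>x. \<alpha> + U x"])
    fix x assume x: "x \<in> J"
    show "of_real \<epsilon> * G \<kappa> (of_real x) = cis (\<alpha> + U x)"
      using Gc[OF x] \<alpha> by (simp add: cis_mult[symmetric] mult.assoc[symmetric])
    show "((\<lambda>x. \<alpha> + U x) has_real_derivative fr \<kappa> x) (at x)"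
      using U[OF x] by (auto intro!: derivative_eq_intros)
  qed
qed

lemma ck_f: "ck n \<Omega> f"
proof (rule ck_holomorphic[OF \<Omega>_product])
  show "continuous_on \<Omega> (\<lambda>(\<kappa>, z). f \<kappa> z)" by (rule continuous_on_subset[OF continuous_f \<Omega>_dom])
  show "f \<kappa> holomorphic_on {z. (\<kappa>, z) \<in> \<Omega>}" for \<kappa> by (rule holomorphic_f_\<Omega>)
qed

lemma G_lt_1:
  assumes "\<kappa> \<in> T" "x \<in> J" "0 < y" "y < om \<kappa> x"
  shows "cmod (G \<kappa> (Complex x y)) < 1"
proof -
  have "0 < 85 / 100 * fr \<kappa> x * y" using fr_pos[OF bnd[OF assms(1,2)]] assms by simp
  then have "0 < Re (N \<kappa> x y)" using Re_N_ge[OF assms(1,2), of y] assms by linarith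
  then show ?thesis using cmod_G[OF assms(1,2), of y] assms by simp
qed

definition SgI :: "real \<Rightarrow> real \<Rightarrow> real set \<Rightarrow> (real^3) set" where
  "SgI \<kappa> \<epsilon> I = F \<kappa> ` {w. w$1 \<in> I \<and> 0 < \<epsilon> * w$2 \<and> \<epsilon> * w$2 \<le> 1}"

context
  fixes \<kappa> \<epsilon> :: real and u0 :: "real \<Rightarrow> real"
  assumes k: "\<kappa> \<in> T" and \<epsilon>: "\<epsilon> = 1 \<or> \<epsilon> = -1"
    and u0: "\<And>x. x \<in> J \<Longrightarrow> of_real \<epsilon> * G \<kappa> (of_real x) = cis (u0 x)"
    and u0': "\<And>x. x \<in> J \<Longrightarrow> (u0 has_real_derivative fr \<kappa> x) (at x)"
begin

lemma u0_cont: "continuous_on J u0"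
  by (rule continuous_at_imp_continuous_on) (auto intro: DERIV_isCont u0')

text \<open>A branch of the angle of \<open>\<epsilon> X\<close> at radius \<open>r\<close>.
  \<open>Re xi\<close> is positive, so the principal logarithm of \<open>xi\<close> does not jump;
  \<open>- pi / 2\<close> undoes the factor \<open>i\<close> in \<open>xi\<close>, and
  \<open>u0\<close> undoes its rotation.\<close>

definition th :: "real \<times> real \<Rightarrow> real" where
  "th = (\<lambda>(x, r). u0 x - pi / 2 + Im (Ln (xi \<kappa> x (yy \<kappa> (x, r)))))"

lemma xi_pos:
  assumes "x \<in> J" "0 < r" "r < 2"
  shows "0 < Re (xi \<kappa> x (yy \<kappa> (x, r)))"
  using yy[OF k assms] by (intro Re_xi_pos k assms)

lemma X_th:
  assumes "x \<in> J" "0 < r" "r < 2"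
  shows "of_real \<epsilon> * X \<kappa> (Complex x (yy \<kappa> (x, r))) = of_real r * cis (th (x, r))"
proof -
  define z where "z = X \<kappa> (Complex x (yy \<kappa> (x, r)))"
  define g where "g = G \<kappa> (of_real x)"
  define \<xi> where "\<xi> = xi \<kappa> x (yy \<kappa> (x, r))"
  have \<xi>: "\<xi> = \<i> * z * cnj g" by (simp add: \<xi>_def xi_def[OF k assms(1)] z_def g_def)
  have g: "g * cnj g = 1" using G_unit[OF k assms(1)] unit_mult_cnj by (simp add: g_def)
  have "cmod \<xi> = r" using cmod_xi[OF k assms(1)] yy(3)[OF k assms] by (simp add: \<xi>_def)
  moreover have "\<xi> \<noteq> 0" using xi_pos[OF assms] by (auto simp: \<xi>_def)
  then have "\<xi> = of_real (cmod \<xi>) * cis (Im (Ln \<xi>))"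
    by (metis Re_Ln exp_Ln exp_eq_polar exp_ln zero_less_norm_iff)
  ultimately have \<xi>r: "\<xi> = of_real r * cis (Im (Ln \<xi>))" by simp
  have "of_real \<epsilon> * z = - \<i> * (\<i> * z * cnj g) * (of_real \<epsilon> * g)"
    using g by (simp add: mult_ac)
  also have "\<dots> = - \<i> * (of_real r * cis (Im (Ln \<xi>))) * cis (u0 x)"
    using \<xi> \<xi>r u0[OF assms(1)] by (simp add: g_def)
  also have "- \<i> = cis (- pi / 2)" by (simp add: cis.ctr complex_eq_iff)
  also have "cis (- pi / 2) * (of_real r * cis (Im (Ln \<xi>))) * cis (u0 x)
      = of_real r * (cis (- pi / 2) * cis (Im (Ln \<xi>)) * cis (u0 x))"
    by (simp only: mult_ac)
  also have "\<dots> = of_real r * cis (- pi / 2 + Im (Ln \<xi>) + u0 x)"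
    by (simp only: cis_mult)
  also have "- pi / 2 + Im (Ln \<xi>) + u0 x = th (x, r)" by (simp add: th_def \<xi>_def)
  finally show ?thesis by (simp add: z_def)
qed

text \<open>The logarithm contributes less than \<open>pi / 2\<close> in absolute value. So the
  angle follows \<open>u0\<close> with an error below \<open>pi\<close> at every radius, and turns
  of \<open>u0\<close> become sheets of the graph.\<close>

lemma th_bounds:
  assumes "x \<in> J" "0 < r" "r < 2"
  shows "u0 x - pi < th (x, r)" "th (x, r) < u0 x"
proof -
  have "xi \<kappa> x (yy \<kappa> (x, r)) \<noteq> 0" using xi_pos[OF assms] by auto
  then have "\<bar>Im (Ln (xi \<kappa> x (yy \<kappa> (x, r))))\<bar> < pi / 2"
    using Re_Ln_pos_lt[of "xi \<kappa> x (yy \<kappa> (x, r))"] xi_pos[OF assms] by simp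
  then show "u0 x - pi < th (x, r)" "th (x, r) < u0 x" by (auto simp: th_def abs_less_iff)
qed

text \<open>This puts a single \<kappa> into the calculus of families: the slices over all other
  parameters are empty.\<close>

definition Jr :: "(real \<times> (real \<times> real)) set" where
  "Jr = {(\<kappa>', (x, r)). \<kappa>' = \<kappa> \<and> x \<in> J \<and> 0 < r \<and> r < 2}"

lemma open_slices_Jr: "open_slices Jr"
  unfolding open_slices_def
proof
  fix \<kappa>'
  show "open {w. (\<kappa>', w) \<in> Jr}"
  proof (cases "\<kappa>' = \<kappa>")
    case True
    then have "{w. (\<kappa>', w) \<in> Jr} = J \<times> {0<..<2}" by (auto simp: Jr_def)
    then show ?thesis using J by (simp add: open_Times)
  qed (simp add: Jr_def)
qed

lemma ck_th: "ck n Jr (\<lambda>_. th)"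
proof -
  have sub: "Jr \<subseteq> \<Omega>2" using k by (auto simp: Jr_def \<Omega>2_def)
  have fst: "ck n Jr (\<lambda>\<kappa>' w. complex_of_real (fst w))" for n
    by (intro ck_linear bounded_linear_compose[OF bounded_linear_of_real] bounded_linear_fst)
  \<comment> \<open>\<open>u0\<close> inherits smoothness from its derivative, which is the real
    part of \<open>f\<close> on the axis.\<close>
  have cu: "ck n Jr (\<lambda>_ w. u0 (fst w))"
  proof -
    have "ck n {(\<kappa>', x). \<kappa>' = \<kappa> \<and> x \<in> J} (\<lambda>_. u0)"
    proof (cases n)
      case 0
      note u0_cont
      then have "continuous_on {(\<kappa>', x). \<kappa>' = \<kappa> \<and> x \<in> J} (\<lambda>v. u0 (snd v))"
        by (rule continuous_on_compose2) (auto intro!: continuous_intros)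
      then show ?thesis using 0 by (simp add: case_prod_unfold)
    next
      case (Suc m)
      have "ck m {(\<kappa>', x). \<kappa>' = \<kappa> \<and> x \<in> J} (\<lambda>\<kappa>' x. Re (f \<kappa>' (of_real x)) * b)" for b
        by (intro ck_mult ck_Re ck_const ck_compose[OF ck_f] ck_linear bounded_linear_of_real)
          (use of_real_\<Omega> k in auto)
      moreover have "continuous_on {(\<kappa>', x). \<kappa>' = \<kappa> \<and> x \<in> J} (\<lambda>(\<kappa>', x). u0 x)"
      proof -
        note u0_cont
        then have "continuous_on {(\<kappa>', x). \<kappa>' = \<kappa> \<and> x \<in> J} (\<lambda>v. u0 (snd v))"
          by (rule continuous_on_compose2) (auto intro!: continuous_intros)
        then show ?thesis by (simp add: case_prod_unfold)
      qed
      moreover have "(u0 has_derivative (\<lambda>h. Re (f \<kappa>' (of_real x)) * h)) (at x)" if "\<kappa>' = \<kappa>" "x \<in> J" for \<kappa>' x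
        using u0'[OF that(2)] f_of_real TJ[OF k that(2)] that by (simp add: has_field_derivative_def)
      ultimately show ?thesis unfolding Suc
        by (intro ck_SucI[where f' = "\<lambda>\<kappa>' x h. Re (f \<kappa>' (of_real x)) * h"]) blast+
    qed
    then show ?thesis
      by (rule ck_compose[where f = "\<lambda>_. u0"]) (auto intro!: ck_linear bounded_linear_fst simp: Jr_def)
  qed
  have cz: "ck n Jr (\<lambda>\<kappa>' w. of_real (fst w) + \<i> * of_real (yy \<kappa>' w))"
    by (intro ck_add ck_mult ck_const fst ck_bounded_linear[OF bounded_linear_of_real] ck_subset[OF ck_yy sub])
  have cX: "ck n Jr (\<lambda>\<kappa>' w. X \<kappa>' (of_real (fst w) + \<i> * of_real (yy \<kappa>' w)))"
  proof (rule ck_compose[OF ck_X cz])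
    fix \<kappa>' w assume "(\<kappa>', w) \<in> Jr"
    then obtain x r where "w = (x, r)" "\<kappa>' = \<kappa>" "x \<in> J" "0 < r" "r < 2" by (auto simp: Jr_def)
    then show "(\<kappa>', of_real (fst w) + \<i> * of_real (yy \<kappa>' w)) \<in> \<Omega>"
      using yy(1,2)[OF k, of x r] k by (simp add: \<Omega>_def)
  qed
  have cG: "ck n Jr (\<lambda>\<kappa>' w. G \<kappa>' (of_real (fst w)))"
    by (rule ck_compose[OF ck_G fst]) (use of_real_\<Omega> k in \<open>auto simp: Jr_def\<close>)
  have cxi: "ck n Jr (\<lambda>\<kappa>' w. \<i> * X \<kappa>' (of_real (fst w) + \<i> * of_real (yy \<kappa>' w)) * cnj (G \<kappa>' (of_real (fst w))))"
    by (intro ck_mult ck_const cX ck_cnj cG)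
  have cLn: "ck n (UNIV \<times> {z. 0 < Re z}) (\<lambda>(\<kappa>'::real). Ln)"
  proof (rule ck_holomorphic)
    have o: "open {z. 0 < Re z}" by (intro open_Collect_less continuous_intros)
    show "\<exists>A r. open A \<and> \<kappa>' \<in> A \<and> r > 0 \<and> (fst ` (UNIV \<times> {z. 0 < Re z}) \<inter> A) \<times> cball w r \<subseteq> UNIV \<times> {z. 0 < Re z}"
      if "(\<kappa>', w) \<in> UNIV \<times> {z. 0 < Re z}" for \<kappa>' :: real and w
    proof -
      have "w \<in> {z. 0 < Re z}" using that by simp
      with o[unfolded open_contains_cball] obtain r where r: "r > 0" "cball w r \<subseteq> {z. 0 < Re z}"
        by (elim ballE exE) auto
      have "(fst ` (UNIV \<times> {z. 0 < Re z}) \<inter> UNIV) \<times> cball w r \<subseteq> UNIV \<times> {z. 0 < Re z}"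
        using r(2) by (intro Sigma_mono) auto
      then show ?thesis using r(1) open_UNIV by blast
    qed
    have "z \<notin> \<real>\<^sub>\<le>\<^sub>0" if "0 < Re z" for z using that by (auto simp: complex_nonpos_Reals_iff)
    then have h: "Ln holomorphic_on {z. 0 < Re z}" by (intro holomorphic_intros) auto
    then show "Ln holomorphic_on {w. (\<kappa>', w) \<in> UNIV \<times> {z. 0 < Re z}}" for \<kappa>' :: real by simp
    have "continuous_on {z. 0 < Re z} Ln" using h by (rule holomorphic_on_imp_continuous_on)
    then have "continuous_on (UNIV \<times> {z. 0 < Re z}) (\<lambda>v :: real \<times> complex. Ln (snd v))"
      by (rule continuous_on_compose2) (auto intro!: continuous_intros)
    then show "continuous_on (UNIV \<times> {z. 0 < Re z}) (\<lambda>(\<kappa>' :: real, z). Ln z)" by (simp add: case_prod_unfold)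
  qed
  have eq: "\<i> * X \<kappa>' (of_real (fst w) + \<i> * of_real (yy \<kappa>' w)) * cnj (G \<kappa>' (of_real (fst w)))
      = xi \<kappa> (fst w) (yy \<kappa> w)" if "(\<kappa>', w) \<in> Jr" for \<kappa>' w
  proof -
    have w: "\<kappa>' = \<kappa>" "fst w \<in> J" using that by (auto simp: Jr_def)
    show ?thesis unfolding xi_def[OF k w(2)] w(1) Complex_eq ..
  qed
  have "ck n Jr (\<lambda>\<kappa>' w. Ln (\<i> * X \<kappa>' (of_real (fst w) + \<i> * of_real (yy \<kappa>' w)) * cnj (G \<kappa>' (of_real (fst w)))))"
  proof (rule ck_compose[OF cLn cxi])
    fix \<kappa>' w assume a: "(\<kappa>', w) \<in> Jr"
    then show "(\<kappa>', \<i> * X \<kappa>' (of_real (fst w) + \<i> * of_real (yy \<kappa>' w)) * cnj (G \<kappa>' (of_real (fst w)))) \<in> UNIV \<times> {z. 0 < Re z}"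
      unfolding eq[OF a] using xi_pos by (auto simp: Jr_def)
  qed
  then have "ck n Jr (\<lambda>\<kappa>' w. u0 (fst w) - pi / 2 + Im (Ln (\<i> * X \<kappa>' (of_real (fst w) + \<i> * of_real (yy \<kappa>' w)) * cnj (G \<kappa>' (of_real (fst w))))))"
    by (intro ck_add ck_diff ck_const ck_Im cu)
  then show ?thesis
    by (rule ck_cong[OF open_slices_Jr, rotated]) (auto simp: eq th_def case_prod_unfold)
qed

lemma continuous_th: "continuous_on (J \<times> {0<..<2}) th"
proof -
  have "continuous_on (J \<times> {0<..<2}) (\<lambda>w. (\<lambda>(\<kappa>', w). th w) (\<kappa>, w))"
    by (rule continuous_on_compose2[OF ck_continuous[OF ck_th]]) (auto simp: Jr_def intro!: continuous_intros)
  then show ?thesis by simp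
qed

lemma partial_deriv:
  assumes "ck (Suc 0) Jr h" "x \<in> J" "0 < r" "r < 2"
  shows "\<exists>c. ((\<lambda>x. h \<kappa> (x, r)) has_real_derivative c) (at x)"
proof -
  obtain h' where h': "\<And>k w. (k, w) \<in> Jr \<Longrightarrow> (h k has_derivative h' k w) (at w)"
    using assms(1) by (rule ck_SucE) blast
  have d: "(h \<kappa> has_derivative h' \<kappa> (x, r)) (at (x, r))" using assms h' by (simp add: Jr_def)
  have "((\<lambda>x. (x, r)) has_derivative (\<lambda>t. (t, 0))) (at x)" by (auto intro!: derivative_eq_intros)
  from has_derivative_compose[OF this d]
  have "((\<lambda>x. h \<kappa> (x, r)) has_derivative (\<lambda>t. h' \<kappa> (x, r) (t, 0))) (at x)" .
  moreover have "(\<lambda>t. h' \<kappa> (x, r) (t, 0)) = (*) (h' \<kappa> (x, r) (1, 0))"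
  proof
    fix t show "h' \<kappa> (x, r) (t, 0) = h' \<kappa> (x, r) (1, 0) * t"
      using linear_cmul[OF has_derivative_linear[OF d], of t "(1, 0)"] by (simp add: mult.commute)
  qed
  ultimately show ?thesis unfolding has_field_derivative_def by metis
qed

text \<open>Along a level curve of the radius the angle increases, because the Jacobian determinant
  of the horizontal projection is \<open>sinh v cosh v > 0\<close> and the radius increases with \<open>y\<close>.\<close>

lemma th_deriv:
  assumes xr: "x \<in> J" "0 < r" "r < 2"
  shows "\<exists>c>0. ((\<lambda>x. th (x, r)) has_real_derivative c) (at x)"
proof -
  obtain c where c: "((\<lambda>x. th (x, r)) has_real_derivative c) (at x)"
    using partial_deriv[OF ck_th xr] by blast
  have sub: "Jr \<subseteq> \<Omega>2" using k by (auto simp: Jr_def \<Omega>2_def)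
  obtain y' where y': "((\<lambda>x. yy \<kappa> (x, r)) has_real_derivative y') (at x)"
    using partial_deriv[OF ck_subset[OF ck_yy sub] xr] by blast
  define y where "y = yy \<kappa> (x, r)"
  note yb = yy[OF k xr, folded y_def]
  define z where "z = Complex x y"
  have z: "(\<kappa>, z) \<in> \<Omega>" using yb xr k by (simp add: z_def \<Omega>_def)
  define g where "g = G \<kappa> z"
  define P where "P = X \<kappa> z"
  define Xx where "Xx = (cnj (1 / g) - g) / 2"
  define Xy where "Xy = (cnj (\<i> / g) - \<i> * g) / 2"
  have D: "(X \<kappa> has_derivative (\<lambda>v. (cnj (v / g) - v * g) / 2)) (at z)"
    using X_deriv[OF z] by (simp add: g_def)
  have lin: "(cnj ((of_real a + of_real b * \<i>) / g) - (of_real a + of_real b * \<i>) * g) / 2 = of_real a * Xx + of_real b * Xy" for a b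
    by (simp add: Xx_def Xy_def field_simps add_divide_distrib)
  have "((\<lambda>x. of_real x + of_real (yy \<kappa> (x, r)) * \<i>) has_derivative (\<lambda>h. of_real h + of_real (y' * h) * \<i>)) (at x)"
    using y' unfolding has_field_derivative_def
    by (intro has_derivative_add has_derivative_mult_left bounded_linear.has_derivative[OF bounded_linear_of_real]
        has_derivative_ident)
  moreover have "(\<lambda>x. of_real x + of_real (yy \<kappa> (x, r)) * \<i>) = (\<lambda>x. Complex x (yy \<kappa> (x, r)))"
    by (simp add: Complex_eq mult.commute)
  ultimately have "((\<lambda>x. Complex x (yy \<kappa> (x, r))) has_derivative (\<lambda>h. of_real h + of_real (y' * h) * \<i>)) (at x)"
    by simp
  from has_derivative_compose[OF this D[unfolded z_def y_def]]
  have "((\<lambda>x. X \<kappa> (Complex x (yy \<kappa> (x, r)))) has_derivative (\<lambda>h. of_real h * Xx + of_real (y' * h) * Xy)) (at x)"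
    unfolding lin .
  then have 1: "((\<lambda>x. of_real \<epsilon> * X \<kappa> (Complex x (yy \<kappa> (x, r)))) has_derivative
      (\<lambda>h. of_real \<epsilon> * (of_real h * Xx + of_real (y' * h) * Xy))) (at x)"
    by (rule has_derivative_mult_right)
  have "((\<lambda>x. of_real r * cis (th (x, r))) has_derivative (\<lambda>h. of_real r * ((c * h) *\<^sub>R (\<i> * cis (th (x, r)))))) (at x)"
    using c by (auto intro!: derivative_eq_intros simp: has_field_derivative_def)
  then have 2: "((\<lambda>x. of_real \<epsilon> * X \<kappa> (Complex x (yy \<kappa> (x, r)))) has_derivative
      (\<lambda>h. of_real r * ((c * h) *\<^sub>R (\<i> * cis (th (x, r)))))) (at x)"
    by (rule has_derivative_transform_within_open[OF _ J(1) xr(1)]) (use X_th xr in simp)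
  have "of_real \<epsilon> * (of_real 1 * Xx + of_real (y' * 1) * Xy) = of_real r * ((c * 1) *\<^sub>R (\<i> * cis (th (x, r))))"
    using has_derivative_unique[OF 1 2] by (rule fun_cong)
  then have "of_real \<epsilon> * (Xx + of_real y' * Xy) = of_real c * \<i> * (of_real r * cis (th (x, r)))"
    by (simp add: scaleR_conv_of_real mult_ac)
  also have "of_real r * cis (th (x, r)) = of_real \<epsilon> * P"
    using X_th[OF xr] by (simp add: P_def z_def y_def)
  finally have eq: "Xx + of_real y' * Xy = of_real c * \<i> * P"
    using \<epsilon> by (auto simp: mult_ac)
  \<comment> \<open>The identity \<open>Xx + y' * Xy = i * c * P\<close> has two unknowns;
    multiplying by \<open>cnj Xy\<close> and taking imaginary parts removes \<open>y'\<close>, since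
    \<open>Xy * cnj Xy\<close> is real.\<close>
  have "Im ((Xx + of_real y' * Xy) * cnj Xy) = Im (Xx * cnj Xy)"
    by (simp add: algebra_simps)
  moreover have "Im ((of_real c * \<i> * P) * cnj Xy) = c * Re (P * cnj Xy)"
    by (simp add: algebra_simps)
  ultimately have cr: "c * Re (P * cnj Xy) = Im (Xx * cnj Xy)" using eq by simp
  have g0: "g \<noteq> 0" using G_nz[OF z] by (simp add: g_def)
  have g1: "cmod g < 1" using G_lt_1[OF k xr(1) yb(1,2)] by (simp add: g_def z_def)
  have s: "Im (Xx * cnj Xy) > 0"
  proof -
    define n where "n = (cmod g)\<^sup>2"
    have n: "n > 0" "n < 1" using g0 g1 by (auto simp: n_def power_less_one_iff)
    have gg: "g * cnj g = of_real n" using complex_norm_square[of g] by (simp add: n_def)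
    have XX: "Xx = of_real (1 / n - 1) * g / 2"
    proof -
      have "cnj (1 / g) = g / of_real n" using g0 gg n by (simp add: field_simps)
      then show ?thesis by (simp add: Xx_def algebra_simps)
    qed
    have XY: "Xy = - \<i> * of_real (1 / n + 1) * g / 2"
    proof -
      have "cnj (\<i> / g) = - \<i> * g / of_real n" using g0 gg n by (simp add: field_simps)
      then show ?thesis by (simp add: Xy_def algebra_simps add_divide_distrib diff_divide_distrib)
    qed
    define K where "K = (1 / n - 1) * (1 / n + 1) / 4"
    have "Xx * cnj Xy = of_real K * \<i> * (g * cnj g)"
      unfolding XX XY K_def by simp
    then have "Im (Xx * cnj Xy) = Im (of_real K * \<i> * of_real n)" unfolding gg by (rule arg_cong)
    also have "\<dots> = (1 / n - 1) * (1 / n + 1) / 4 * n" by (simp add: K_def)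
    finally have "Im (Xx * cnj Xy) = (1 / n - 1) * (1 / n + 1) / 4 * n" .
    moreover have "1 / n > 1" using n by simp
    then have "0 < (1 / n - 1) * (1 / n + 1) / 4 * n"
      using n by (intro mult_pos_pos divide_pos_pos) linarith+
    ultimately show ?thesis by (simp only:)
  qed
  \<comment> \<open>The remaining factor \<open>Re (P * cnj Xy)\<close> is half the derivative of
    the squared radius along the slice.\<close>
  obtain d where d: "d > 0" "((\<lambda>y. (cmod (X \<kappa> (Complex x y)))\<^sup>2) has_real_derivative d) (at y)"
    using radius_deriv[OF k xr(1) yb(1,2)] by blast
  have "(Complex x has_derivative (\<lambda>h. of_real h * \<i>)) (at y)" by (rule Complex_deriv[OF k xr(1)])
  from has_derivative_compose[OF this D[unfolded z_def]]
  have Xd: "((\<lambda>y. X \<kappa> (Complex x y)) has_derivative (\<lambda>h. of_real h * Xy)) (at y)"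
    using lin[of 0] by simp
  have "((\<lambda>y. X \<kappa> (Complex x y) \<bullet> X \<kappa> (Complex x y)) has_derivative
      (\<lambda>h. P \<bullet> (of_real h * Xy) + (of_real h * Xy) \<bullet> P)) (at y)"
    using has_derivative_inner[OF Xd Xd] by (simp add: P_def z_def)
  moreover have "(\<lambda>h. P \<bullet> (of_real h * Xy) + (of_real h * Xy) \<bullet> P) = (*) (2 * Re (P * cnj Xy))"
    by (auto simp: inner_complex_def algebra_simps)
  ultimately have "((\<lambda>y. (cmod (X \<kappa> (Complex x y)))\<^sup>2) has_real_derivative 2 * Re (P * cnj Xy)) (at y)"
    by (simp add: has_field_derivative_def power2_norm_eq_inner)
  then have "d = 2 * Re (P * cnj Xy)" using d(2) DERIV_unique by blast
  then have "0 < Re (P * cnj Xy)" using d(1) by simp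
  then have "c > 0" using cr s by (metis zero_less_mult_pos2)
  with c show ?thesis by blast
qed

lemma th_mono:
  assumes "x1 \<in> J" "x2 \<in> J" "x1 < x2" "0 < r" "r < 2"
  shows "th (x1, r) < th (x2, r)"
proof (rule DERIV_pos_imp_increasing[OF assms(3)])
  fix x assume "x1 \<le> x" "x \<le> x2"
  then have "x \<in> J" using J(2) assms mem_is_interval_1_I by metis
  from th_deriv[OF this assms(4,5)] show "\<exists>c. ((\<lambda>x. th (x, r)) has_real_derivative c) (at x) \<and> 0 < c" by blast
qed

section \<open>The height as a function of polar coordinates\<close>

definition VV :: "(real \<times> real) set" where
  "VV = {(r, t). 0 < r \<and> r < 2 \<and> (\<exists>x\<in>J. th (x, r) = t)}"

text \<open>On each level of the radius \<open>th_mono\<close> makes the height recoverable from the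
  angle, so this is the function whose graph is one half of the surface.\<close>

definition uu :: "real \<times> real \<Rightarrow> real" where
  "uu = (\<lambda>(r, t). THE x. x \<in> J \<and> th (x, r) = t)"

lemma uu_th:
  assumes "x \<in> J" "0 < r" "r < 2"
  shows "uu (r, th (x, r)) = x"
  unfolding uu_def prod.case
proof (rule the_equality)
  fix x' assume "x' \<in> J \<and> th (x', r) = th (x, r)"
  then show "x' = x" using th_mono[of x x' r] th_mono[of x' x r] assms by (cases x x' rule: linorder_cases) auto
qed (use assms in auto)

lemma uu:
  assumes "(r, t) \<in> VV"
  shows "uu (r, t) \<in> J" "th (uu (r, t), r) = t" "0 < r" "r < 2"
  using assms uu_th by (auto simp: VV_def)

lemma th_slice_continuous: "x \<in> J \<Longrightarrow> continuous_on {0<..<2} (\<lambda>r. th (x, r))"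
  by (rule continuous_on_compose2[OF continuous_th]) (auto intro!: continuous_intros)

lemma th_IVT:
  assumes "x1 \<in> J" "x2 \<in> J" "x1 \<le> x2" "0 < r" "r < 2" "th (x1, r) \<le> t" "t \<le> th (x2, r)"
  shows "\<exists>x. x1 \<le> x \<and> x \<le> x2 \<and> th (x, r) = t"
proof (rule IVT'[OF assms(6,7,3)])
  have "{x1..x2} \<subseteq> J"
  proof
    fix x assume "x \<in> {x1..x2}"
    then show "x \<in> J" using J(2) assms(1,2) mem_is_interval_1_I by (metis atLeastAtMost_iff)
  qed
  then show "continuous_on {x1..x2} (\<lambda>x. th (x, r))"
    using assms by (intro continuous_on_compose2[OF continuous_th]) (auto intro!: continuous_intros)
qed

text \<open>The strict inequalities \<open>th (x1, r) < t < th (x2, r)\<close> persist under small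
  changes of \<open>r\<close> and \<open>t\<close>, and between \<open>x1\<close> and
  \<open>x2\<close> the intermediate value theorem then finds a height.\<close>

lemma open_VV: "open VV"
proof (rule openI)
  fix v assume "v \<in> VV"
  then obtain r t where v: "v = (r, t)" "(r, t) \<in> VV" by (cases v) auto
  note u = uu[OF v(2)]
  obtain e where e: "e > 0" "cball (uu (r, t)) e \<subseteq> J" using u(1) J(1) open_contains_cball by blast
  define x1 where "x1 = uu (r, t) - e"
  define x2 where "x2 = uu (r, t) + e"
  have x: "x1 \<in> J" "x2 \<in> J" using e by (auto simp: x1_def x2_def subset_iff dist_real_def)
  define W where "W = {w. fst w \<in> {0<..<2}} \<inter> (\<lambda>w. snd w - th (x1, fst w)) -` {0<..} \<inter> ({w. fst w \<in> {0<..<2}} \<inter> (\<lambda>w. th (x2, fst w) - snd w) -` {0<..})"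
  have o: "open {w :: real \<times> real. fst w \<in> {0<..<2}}"
    using open_vimage[of "{0<..<2::real}" "fst :: real \<times> real \<Rightarrow> real"] by (simp add: vimage_def continuous_on_fst)
  have c: "continuous_on {w :: real \<times> real. fst w \<in> {0<..<2}} (\<lambda>w. th (x, fst w))" if "x \<in> J" for x
    by (rule continuous_on_compose2[OF th_slice_continuous[OF that]]) (auto intro!: continuous_intros)
  have "open W" unfolding W_def
    by (intro open_Int continuous_open_preimage o continuous_intros c x open_greaterThan)
  moreover have "v \<in> W"
    using u e th_mono[OF x(1) u(1) _ u(3,4)] th_mono[OF u(1) x(2) _ u(3,4)] v(1) by (auto simp: W_def x1_def x2_def)
  moreover have "W \<subseteq> VV"
  proof
    fix w assume w: "w \<in> W"
    obtain r' t' where w': "w = (r', t')" by (cases w)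
    have "\<exists>x. x1 \<le> x \<and> x \<le> x2 \<and> th (x, r') = t'"
      by (rule th_IVT[OF x]) (use w w' e in \<open>auto simp: W_def x1_def x2_def\<close>)
    then obtain x where x': "x1 \<le> x" "x \<le> x2" "th (x, r') = t'" by blast
    then have "x \<in> cball (uu (r, t)) e" by (auto simp: x1_def x2_def dist_real_def abs_le_iff)
    then show "w \<in> VV" using w w' x' e(2) by (auto simp: VV_def W_def)
  qed
  ultimately show "\<exists>e>0. ball v e \<subseteq> VV" by (meson openE order_trans)
qed

lemma ck_uu: "ck n ({\<kappa>} \<times> VV) (\<lambda>_. uu)"
proof (rule ck_implicit)
  show "open_slices ({\<kappa>} \<times> VV)" unfolding open_slices_def
  proof
    fix \<kappa>' show "open {w. (\<kappa>', w) \<in> {\<kappa>} \<times> VV}" using open_VV by (cases "\<kappa>' = \<kappa>") auto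
  qed
  define \<Omega>' where "\<Omega>' = {(\<kappa>', ((r :: real, t :: real), x)). (\<kappa>', (x, r)) \<in> Jr}"
  have "ck n \<Omega>' (\<lambda>\<kappa>' w. th (snd w, fst (fst w)) - snd (fst w))" for n
  proof (intro ck_diff)
    have 1: "ck n \<Omega>' (\<lambda>\<kappa>' w. snd w)" "ck n \<Omega>' (\<lambda>\<kappa>' w. fst (fst w))"
      by (intro ck_linear bounded_linear_snd bounded_linear_compose[OF bounded_linear_fst] bounded_linear_fst)+
    show "ck n \<Omega>' (\<lambda>\<kappa>' w. th (snd w, fst (fst w)))"
      by (rule ck_compose[OF ck_th ck_Pair[OF 1]]) (auto simp: \<Omega>'_def)
    show "ck n \<Omega>' (\<lambda>\<kappa>' w. snd (fst w))"
      by (intro ck_linear bounded_linear_compose[OF bounded_linear_snd] bounded_linear_fst)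
  qed
  then show "ck n \<Omega>' (\<lambda>\<kappa>' w. th (snd w, fst (fst w)) - snd (fst w))" for n .
  have "continuous_on VV uu"
  proof (rule continuous_on_root)
    show "open {v :: (real \<times> real) \<times> real. snd v \<in> J}"
      using open_vimage[OF J(1), of snd] by (simp add: vimage_def continuous_on_snd)
    show "{(u, x). u \<in> VV \<and> x \<in> J} = VV \<times> UNIV \<inter> {v. snd v \<in> J}" by auto
    have "continuous_on {(u, x). u \<in> VV \<and> x \<in> J} (\<lambda>v. th (snd v, fst (fst v)) - snd (fst v))"
      by (intro continuous_intros continuous_on_compose2[OF continuous_th]) (auto simp: VV_def)
    then show "continuous_on {(u, x). u \<in> VV \<and> x \<in> J} (\<lambda>(u, x). th (x, fst u) - snd u)"
      by (simp add: case_prod_unfold)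
  next
    fix v x1 x2 assume a: "(v, x1) \<in> {(u, x). u \<in> VV \<and> x \<in> J}" "(v, x2) \<in> {(u, x). u \<in> VV \<and> x \<in> J}" "x1 < x2"
    then have "0 < fst v" "fst v < 2" "x1 \<in> J" "x2 \<in> J" by (auto simp: VV_def)
    then show "th (x1, fst v) - snd v < th (x2, fst v) - snd v" using th_mono[of x1 x2 "fst v"] a(3) by simp
  next
    fix v assume v: "v \<in> VV"
    have "(fst v, snd v) \<in> VV" using v by simp
    from uu[OF this] v show "(v, uu v) \<in> {(u, x). u \<in> VV \<and> x \<in> J}" "th (uu v, fst v) - snd v = 0"
      by simp_all
  qed
  then have "continuous_on ({\<kappa>} \<times> VV) (\<lambda>v. uu (snd v))"
    by (rule continuous_on_compose2) (auto intro!: continuous_intros)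
  then show "continuous_on ({\<kappa>} \<times> VV) (\<lambda>(\<kappa>', w). uu w)" by (simp add: case_prod_unfold)
  fix \<kappa>' and w :: "real \<times> real" assume "(\<kappa>', w) \<in> {\<kappa>} \<times> VV"
  then obtain r t where w: "\<kappa>' = \<kappa>" "w = (r, t)" "(r, t) \<in> VV" by (cases w) auto
  note u = uu[OF w(3)]
  show "(\<kappa>', (w, uu w)) \<in> \<Omega>'" using u w by (simp add: \<Omega>'_def Jr_def)
  show "th (snd (w, uu w), fst (fst (w, uu w))) - snd (fst (w, uu w)) = 0" using u w by simp
  fix c assume c: "((\<lambda>s. th (snd (w, s), fst (fst (w, s))) - snd (fst (w, s))) has_real_derivative c) (at (uu w))"
  obtain d where d: "d > 0" "((\<lambda>x. th (x, r)) has_real_derivative d) (at (uu w))"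
    using th_deriv[OF u(1,3,4)] w by blast
  have "((\<lambda>x. th (x, r) - t) has_real_derivative d - 0) (at (uu w))"
    by (intro DERIV_diff d(2) DERIV_const)
  then have "c = d" using c w by (auto intro: DERIV_unique)
  then show "c \<noteq> 0" using d by simp
qed

lemma smooth_uu: "smooth_on uu VV"
proof -
  have "open_slices ({\<kappa>} \<times> VV)" unfolding open_slices_def
  proof
    fix \<kappa>' show "open {w. (\<kappa>', w) \<in> {\<kappa>} \<times> VV}" using open_VV by (cases "\<kappa>' = \<kappa>") auto
  qed
  from ck_imp_smooth_on[OF this ck_uu, of \<kappa>] show ?thesis by simp
qed

definition DI :: "real set \<Rightarrow> (real \<times> real) set" where
  "DI I = {(r, th (x, r)) | x r. x \<in> I \<and> 0 < r \<and> r \<le> 1}"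

text \<open>The map \<open>(x, r) \<mapsto> (r, th (x, r))\<close> takes the open rectangle
  \<open>A\<close> to the open connected core of the domain; its image is open because it is cut out
  of \<open>VV\<close> by conditions on the continuous inverse \<open>uu\<close>. Boundary points
  are limits by continuity.\<close>

lemma polar_domain_DI:
  assumes ab: "a < b" "{a<..<b} \<subseteq> I" "I \<subseteq> {a..b}" "I \<subseteq> J"
  shows "polar_domain (DI I)"
  unfolding polar_domain_def
proof (intro conjI exI)
  define m where "m w = (snd w, th w)" for w :: "real \<times> real"
  define A where "A = {a<..<b} \<times> {0<..<1::real}"
  have sub: "A \<subseteq> J \<times> {0<..<2}" using ab by (auto simp: A_def)
  have cm: "continuous_on (J \<times> {0<..<2}) m"
    unfolding m_def by (intro continuous_intros continuous_th)
  show "DI I \<subseteq> {p. 0 < fst p}" by (auto simp: DI_def)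
  show "m ` A \<subseteq> DI I"
  proof (rule image_subsetI)
    fix w assume "w \<in> A"
    then have "fst w \<in> I" "0 < snd w" "snd w \<le> 1" using ab(2) by (auto simp: A_def)
    then show "m w \<in> DI I" unfolding m_def DI_def
      by (intro CollectI exI[of _ "fst w"] exI[of _ "snd w"]) simp
  qed
  show "m ` A \<noteq> {}" using ab by (simp add: A_def)
  show "connected (m ` A)"
  proof (rule connected_continuous_image)
    show "continuous_on A m" using cm sub by (rule continuous_on_subset)
    show "connected A" unfolding A_def by (intro connected_Times connected_Ioo)
  qed
  show "open (m ` A)"
  proof -
    have "open (VV \<inter> uu -` {a<..<b} \<inter> {w. fst w \<in> {0<..<1}})"
    proof (rule open_Int)
      have "continuous_on VV (\<lambda>w. (\<lambda>(\<kappa>', w). uu w) (\<kappa>, w))"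
        by (rule continuous_on_compose2[OF ck_continuous[OF ck_uu]]) (auto intro!: continuous_intros)
      then have "continuous_on VV uu" by simp
      then show "open (VV \<inter> uu -` {a<..<b})"
        by (rule continuous_open_preimage[OF _ open_VV open_greaterThanLessThan])
      show "open {w :: real \<times> real. fst w \<in> {0<..<1}}"
        using open_vimage[of "{0<..<1::real}" "fst :: real \<times> real \<Rightarrow> real"] by (simp add: vimage_def continuous_on_fst)
    qed
    moreover have "VV \<inter> uu -` {a<..<b} \<inter> {w. fst w \<in> {0<..<1}} = m ` A"
    proof (intro subset_antisym subsetI)
      fix v assume v: "v \<in> VV \<inter> uu -` {a<..<b} \<inter> {w. fst w \<in> {0<..<1}}"
      have w: "(fst v, snd v) \<in> VV" using v by simp
      have "v = m (uu v, fst v)" using uu(2)[OF w] by (simp add: m_def prod_eq_iff)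
      moreover have "(uu v, fst v) \<in> A" using v by (simp add: A_def)
      ultimately show "v \<in> m ` A" by (rule image_eqI)
    next
      fix v assume "v \<in> m ` A"
      then obtain w where v: "v = m w" "w \<in> A" by blast
      obtain x r where w: "w = (x, r)" by (cases w)
      have xr: "x \<in> J" "0 < r" "r < 1" "x \<in> {a<..<b}" using ab v w by (auto simp: A_def)
      have "m (x, r) \<in> VV" using xr by (auto simp: m_def VV_def)
      moreover have "uu (m (x, r)) \<in> {a<..<b}" using xr uu_th[of x r] by (simp add: m_def)
      moreover have "fst (m (x, r)) \<in> {0<..<1}" using xr by (simp add: m_def)
      ultimately show "v \<in> VV \<inter> uu -` {a<..<b} \<inter> {w. fst w \<in> {0<..<1}}" using v w by simp
    qed
    ultimately show ?thesis by simp
  qed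
  show "DI I \<subseteq> closure (m ` A)"
  proof
    fix w assume "w \<in> DI I"
    then obtain x r where xr: "w = (r, th (x, r))" "x \<in> I" "0 < r" "r \<le> 1" by (auto simp: DI_def)
    have "isCont m (x, r)"
    proof (rule continuous_on_interior[OF cm])
      have "open (J \<times> {0<..<2::real})" using J by (simp add: open_Times)
      then show "(x, r) \<in> interior (J \<times> {0<..<2})" using xr ab by (auto simp: interior_open)
    qed
    moreover have "(x, r) \<in> closure A"
      unfolding A_def closure_Times using xr ab by auto
    ultimately have "m (x, r) \<in> closure (m ` A)" by (rule isCont_closure_image)
    then show "w \<in> closure (m ` A)" by (simp add: m_def xr)
  qed
qed

lemma F_graph:
  assumes "x \<in> J" "0 < r" "r \<le> 1" "\<epsilon> * w$2 * Y \<kappa> x = yy \<kappa> (x, r)" "w$1 = x"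
  shows "F \<kappa> w = vector [r * cos (th (x, r)), r * sin (th (x, r)), x]"
proof -
  have r2: "r < 2" using assms by simp
  have "X \<kappa> (psi \<kappa> w) = of_real \<epsilon> * X \<kappa> (Complex x (yy \<kappa> (x, r)))"
  proof (cases "\<epsilon> = 1")
    case True
    then show ?thesis using assms by (simp add: psi_eq)
  next
    case False
    then have e: "\<epsilon> = -1" using \<epsilon> by simp
    have "X \<kappa> (Complex x (- yy \<kappa> (x, r))) = - X \<kappa> (Complex x (yy \<kappa> (x, r)))"
      using yy[OF k assms(1,2) r2] by (intro X_minus k assms) auto
    moreover have "w$2 * Y \<kappa> x = - yy \<kappa> (x, r)" using assms e by simp
    ultimately show ?thesis using assms e by (simp add: psi_eq)
  qed
  also have "\<dots> = of_real r * cis (th (x, r))" by (rule X_th[OF assms(1,2) r2])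
  finally show ?thesis using assms by (simp add: vec_eq_iff forall_3)
qed

lemma graph_over_DI:
  assumes ab: "a < b" "{a<..<b} \<subseteq> I" "I \<subseteq> {a..b}" "I \<subseteq> J"
  shows "graph_over (DI I) uu (SgI \<kappa> \<epsilon> I)"
  unfolding graph_over_def
proof (intro conjI exI)
  show "polar_domain (DI I)" by (rule polar_domain_DI[OF ab])
  show "smooth_on uu VV" by (rule smooth_uu)
  show "DI I \<subseteq> VV"
  proof
    fix v assume "v \<in> DI I"
    then obtain x r where "v = (r, th (x, r))" "x \<in> I" "0 < r" "r \<le> 1" by (auto simp: DI_def)
    then show "v \<in> VV" using ab(4) by (auto simp: VV_def)
  qed
  show "SgI \<kappa> \<epsilon> I = (\<lambda>(\<rho>, \<theta>). vector [\<rho> * cos \<theta>, \<rho> * sin \<theta>, uu (\<rho>, \<theta>)]) ` DI I"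
  proof
    show "SgI \<kappa> \<epsilon> I \<subseteq> (\<lambda>(\<rho>, \<theta>). vector [\<rho> * cos \<theta>, \<rho> * sin \<theta>, uu (\<rho>, \<theta>)]) ` DI I"
    proof
      fix p assume "p \<in> SgI \<kappa> \<epsilon> I"
      then obtain w where w: "p = F \<kappa> w" "w$1 \<in> I" "0 < \<epsilon> * w$2" "\<epsilon> * w$2 \<le> 1" by (auto simp: SgI_def)
      define x where "x = w$1"
      have x: "x \<in> J" using w ab by (auto simp: x_def)
      note y = Y[OF k x]
      define y' where "y' = \<epsilon> * w$2 * Y \<kappa> x"
      have y': "0 < y'" "y' \<le> Y \<kappa> x" "y' < om \<kappa> x"
      proof -
        show "0 < y'" using w y by (simp add: y'_def)
        show le: "y' \<le> Y \<kappa> x" using w y mult_right_mono[of "\<epsilon> * w$2" 1 "Y \<kappa> x"] by (simp add: y'_def)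
        show "y' < om \<kappa> x" using le y by linarith
      qed
      define r where "r = cmod (X \<kappa> (Complex x y'))"
      have r: "0 < r" "r \<le> 1"
      proof -
        show "0 < r"
          using radius_strict_mono[OF k x, of 0 y'] y' X_of_real[of \<kappa> x] by (simp add: r_def Complex_eq)
        show "r \<le> 1"
          using radius_strict_mono[OF k x, of y' "Y \<kappa> x"] y' y by (cases "y' = Y \<kappa> x") (auto simp: r_def)
      qed
      have "y' = yy \<kappa> (x, r)"
        using r y' by (intro yy_unique k x) (auto simp: r_def)
      then have "F \<kappa> w = vector [r * cos (th (x, r)), r * sin (th (x, r)), x]"
        by (intro F_graph x r) (auto simp: y'_def x_def)
      moreover have "uu (r, th (x, r)) = x" using x r by (intro uu_th) auto
      moreover have "(r, th (x, r)) \<in> DI I" using r w by (auto simp: DI_def x_def)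
      ultimately show "p \<in> (\<lambda>(\<rho>, \<theta>). vector [\<rho> * cos \<theta>, \<rho> * sin \<theta>, uu (\<rho>, \<theta>)]) ` DI I"
        using w(1) by (intro image_eqI[of _ _ "(r, th (x, r))"]) auto
    qed
    show "(\<lambda>(\<rho>, \<theta>). vector [\<rho> * cos \<theta>, \<rho> * sin \<theta>, uu (\<rho>, \<theta>)]) ` DI I \<subseteq> SgI \<kappa> \<epsilon> I"
    proof clarify
      fix r t assume "(r, t) \<in> DI I"
      then obtain x where x: "x \<in> I" "0 < r" "r \<le> 1" "t = th (x, r)" by (auto simp: DI_def)
      have xJ: "x \<in> J" using x ab by auto
      note y = Y[OF k xJ]
      have r2: "r < 2" using x by simp
      note yr = yy[OF k xJ x(2) r2]
      have le: "yy \<kappa> (x, r) \<le> Y \<kappa> x"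
        using radius_strict_mono[OF k xJ, of "Y \<kappa> x" "yy \<kappa> (x, r)"] y yr x by force
      define w :: "real^2" where "w = vector [x, \<epsilon> * (yy \<kappa> (x, r) / Y \<kappa> x)]"
      have ee: "\<epsilon> * \<epsilon> = 1" using \<epsilon> by auto
      have w: "w$1 = x" "\<epsilon> * w$2 = yy \<kappa> (x, r) / Y \<kappa> x"
        using ee by (simp_all add: w_def mult.assoc[symmetric])
      have "F \<kappa> w = vector [r * cos (th (x, r)), r * sin (th (x, r)), x]"
        using y w by (intro F_graph xJ x) auto
      moreover have "uu (r, t) = x" unfolding x(4) by (rule uu_th[OF xJ x(2) r2])
      moreover have "F \<kappa> w \<in> SgI \<kappa> \<epsilon> I"
        unfolding SgI_def using w x y yr le by (intro imageI) simp
      ultimately show "vector [r * cos t, r * sin t, uu (r, t)] \<in> SgI \<kappa> \<epsilon> I" using x(4) by simp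
    qed
  qed
qed

text \<open>By \<open>th_bounds\<close> the angle at \<open>x1\<close> is below \<open>u0 x1\<close>
  and at \<open>x2\<close> above \<open>u0 x2 - pi\<close>, so all values in between are taken. The
  interval does not depend on \<open>r\<close>, which yields a full rectangle of polar
  coordinates.\<close>

lemma DI_covers:
  assumes "{x1..x2} \<subseteq> I" "x1 \<le> x2" "I \<subseteq> J" "0 < r" "r \<le> 1" "u0 x1 \<le> t" "t \<le> u0 x2 - pi"
  shows "(r, t) \<in> DI I"
proof -
  have x: "x1 \<in> J" "x2 \<in> J" using assms by auto
  have r: "r < 2" using assms by simp
  have "\<exists>x. x1 \<le> x \<and> x \<le> x2 \<and> th (x, r) = t"
    by (rule th_IVT[OF x assms(2,4) r])
      (use th_bounds[OF x(1) assms(4) r] th_bounds[OF x(2) assms(4) r] assms in auto)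
  then obtain x where "x1 \<le> x" "x \<le> x2" "th (x, r) = t" by blast
  then show ?thesis using assms by (auto simp: DI_def)
qed

lemma N_valued_DI:
  assumes "{x1..x2} \<subseteq> I" "x1 \<le> x2" "I \<subseteq> J" "0 < s" "u0 x1 + 2 * pi * real n \<le> u0 x2 - pi"
  shows "N_valued_over n s 1 (DI I)"
  unfolding N_valued_over_def
proof (intro exI subsetI)
  fix v assume "v \<in> {s..1} \<times> {u0 x1..u0 x1 + 2 * pi * real n}"
  then show "v \<in> DI I" using assms by (cases v) (auto intro!: DI_covers[of x1 x2])
qed

end

end

section \<open>The limit over a gap\<close>

context weierstrass
begin

lemma F_in_axis_iff:
  assumes "(\<kappa>, w) \<in> \<Omega>3"
  shows "F \<kappa> w \<in> x3_axis \<longleftrightarrow> w$2 = 0"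
proof -
  have k: "\<kappa> \<in> T" "w$1 \<in> J" "\<bar>w$2 * Y \<kappa> (w$1)\<bar> < om \<kappa> (w$1)" using assms by (auto simp: \<Omega>3_def)
  have 0: "X \<kappa> (Complex (w$1) 0) = 0" using X_of_real[of \<kappa> "w$1"] by (simp add: Complex_eq)
  have "F \<kappa> w \<in> x3_axis \<longleftrightarrow> X \<kappa> (psi \<kappa> w) = 0"
    by (simp add: x3_axis_def complex_eq_iff)
  also have "\<dots> \<longleftrightarrow> w$2 * Y \<kappa> (w$1) = 0"
    unfolding psi_eq using X_inj[OF k(1,2,3), of 0] 0 om_pos[OF bnd[OF k(1,2)]] by auto
  also have "\<dots> \<longleftrightarrow> w$2 = 0" using Y[OF k(1,2)] by simp
  finally show ?thesis .
qed

lemma image_minus_axis: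
  assumes "\<kappa> \<in> T" "I \<subseteq> J"
  shows "F \<kappa> ` strip I - x3_axis = SgI \<kappa> 1 I \<union> SgI \<kappa> (-1) I"
proof -
  have 1: "F \<kappa> ` strip I - x3_axis = F \<kappa> ` {w \<in> strip I. w$2 \<noteq> 0}"
    using F_in_axis_iff[OF strip_\<Omega>3[OF assms]] by blast
  have 2: "{w \<in> strip I. w$2 \<noteq> 0} =
      {w. w$1 \<in> I \<and> 0 < 1 * w$2 \<and> 1 * w$2 \<le> 1} \<union> {w. w$1 \<in> I \<and> 0 < -1 * w$2 \<and> -1 * w$2 \<le> 1}"
    unfolding strip_def set_eq_iff Un_iff mem_Collect_eq by (auto simp: abs_le_iff)
  show ?thesis
    by (simp only: 1 2 image_Un SgI_def)
qed

lemma multi_valued_SgI: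
  assumes "\<kappa> \<in> T" "\<epsilon> = 1 \<or> \<epsilon> = -1" "a < b" "{a..b} \<subseteq> J"
  shows "multi_valued_graph (SgI \<kappa> \<epsilon> {a..b})"
proof -
  obtain u0 where u0: "\<And>x. x \<in> J \<Longrightarrow> of_real \<epsilon> * G \<kappa> (of_real x) = cis (u0 x)"
    "\<And>x. x \<in> J \<Longrightarrow> (u0 has_real_derivative fr \<kappa> x) (at x)"
    using ex_angle[OF assms(1,2)] by blast
  have "graph_over (DI \<kappa> u0 {a..b}) (uu \<kappa> u0) (SgI \<kappa> \<epsilon> {a..b})"
    by (rule graph_over_DI[OF assms(1,2) u0 assms(3) _ _ assms(4)]) auto
  then show ?thesis unfolding multi_valued_graph_def by blast
qed

lemma SgI_mono: "\<kappa> \<in> T \<Longrightarrow> I \<subseteq> I' \<Longrightarrow> SgI \<kappa> \<epsilon> I \<subseteq> SgI \<kappa> \<epsilon> I'"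
  by (auto simp: SgI_def)

lemma SgI_height: "\<kappa> \<in> T \<Longrightarrow> q \<in> SgI \<kappa> \<epsilon> I \<Longrightarrow> q $ 3 \<in> I"
  by (auto simp: SgI_def)

end

locale gap = weierstrass +
  fixes t1 t2 :: real
  assumes gap: "t1 < t2" "t1 \<in> S" "t2 \<in> S" "J = {t1<..<t2}" and zero: "0 \<in> T"
begin

text \<open>At \<open>\<kappa> = 0\<close> the scale \<open>dd\<close> is at most the distance to
  either end of the gap. The constant in \<open>fr_ge\<close> is dropped, which leaves functions
  with simple primitives.\<close>

lemma fr_gap:
  assumes x: "x \<in> J"
  shows "1 / (x - t1)\<^sup>2 \<le> fr 0 x" "1 / (t2 - x)\<^sup>2 \<le> fr 0 x"
proof -
  note b = bnd[OF zero x]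
  have d1: "dd 0 x \<le> x - t1" using infdist_le[OF gap(2), of x] x gap(4) by (simp add: dd_def dist_real_def)
  have d2: "dd 0 x \<le> t2 - x" using infdist_le[OF gap(3), of x] x gap(4) by (simp add: dd_def dist_real_def)
  have *: "1 / a\<^sup>2 \<le> fr 0 x" if "dd 0 x \<le> a" for a
  proof -
    have "1 / a\<^sup>2 \<le> 10 ^ 8 / (dd 0 x)\<^sup>2"
      using that b(3) by (intro frac_le power_mono) auto
    then show ?thesis using fr_ge[OF b] by linarith
  qed
  show "1 / (x - t1)\<^sup>2 \<le> fr 0 x" "1 / (t2 - x)\<^sup>2 \<le> fr 0 x" using *[OF d1] *[OF d2] .
qed

context
  fixes u0 :: "real \<Rightarrow> real"
  assumes u0': "\<And>x. x \<in> J \<Longrightarrow> (u0 has_real_derivative fr 0 x) (at x)"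
begin

text \<open>By \<open>fr_gap\<close> the function \<open>u0 x + 1 / (x - t1)\<close> is
  nondecreasing, so \<open>u0\<close> tends to minus infinity at \<open>t1\<close> at least as fast
  as \<open>- 1 / (x - t1)\<close>.\<close>

lemma u0_below:
  assumes x2: "x2 \<in> J"
  shows "\<exists>x1. t1 < x1 \<and> x1 < x2 \<and> u0 x1 + K \<le> u0 x2"
proof -
  define m where "m = \<bar>K\<bar> + 1 / (x2 - t1) + 1"
  have x: "t1 < x2" "x2 < t2" using x2 gap by auto
  have m: "m > 1 / (x2 - t1)" "m > 0" "m \<ge> K + 1 / (x2 - t1)"
  proof -
    have "0 < 1 / (x2 - t1)" using x by simp
    then show "m > 1 / (x2 - t1)" "m > 0" "m \<ge> K + 1 / (x2 - t1)" unfolding m_def by linarith+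
  qed
  \<comment> \<open>Chosen so that \<open>1 / (x1 - t1)\<close> is exactly \<open>m\<close>, which
    exceeds the value at \<open>x2\<close> by at least \<open>K\<close>.\<close>
  define x1 where "x1 = t1 + 1 / m"
  have x1: "t1 < x1" "x1 < x2"
  proof -
    show "t1 < x1" using m by (simp add: x1_def)
    have "1 < m * (x2 - t1)" using m(1) x by (simp add: divide_less_eq)
    then have "1 / m < x2 - t1" using m(2) by (simp add: divide_less_eq mult.commute)
    then show "x1 < x2" by (simp add: x1_def)
  qed
  have "u0 x1 + 1 / (x1 - t1) \<le> u0 x2 + 1 / (x2 - t1)"
  proof (rule DERIV_nonneg_imp_nondecreasing[where f = "\<lambda>x. u0 x + 1 / (x - t1)"])
    show "x1 \<le> x2" using x1 by simp
    fix x assume "x1 \<le> x" "x \<le> x2"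
    then have xx: "x \<in> J" "x - t1 > 0" using x1 x gap by auto
    have "((\<lambda>x. u0 x + 1 / (x - t1)) has_real_derivative (fr 0 x - 1 / (x - t1)\<^sup>2)) (at x)"
      using xx u0'[OF xx(1)] by (auto intro!: derivative_eq_intros simp: power2_eq_square)
    then show "\<exists>d. ((\<lambda>x. u0 x + 1 / (x - t1)) has_real_derivative d) (at x) \<and> 0 \<le> d"
      using fr_gap(1)[OF xx(1)] by (intro exI conjI) auto
  qed
  moreover have "1 / (x1 - t1) = m" using m by (simp add: x1_def)
  ultimately have "u0 x1 + K \<le> u0 x2" using m by linarith
  then show ?thesis using x1 by blast
qed

lemma u0_above:
  assumes x1: "x1 \<in> J"
  shows "\<exists>x2. x1 < x2 \<and> x2 < t2 \<and> u0 x1 + K \<le> u0 x2"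
proof -
  define m where "m = \<bar>K\<bar> + 1 / (t2 - x1) + 1"
  have x: "t1 < x1" "x1 < t2" using x1 gap by auto
  have m: "m > 1 / (t2 - x1)" "m > 0" "m \<ge> K + 1 / (t2 - x1)"
  proof -
    have "0 < 1 / (t2 - x1)" using x by simp
    then show "m > 1 / (t2 - x1)" "m > 0" "m \<ge> K + 1 / (t2 - x1)" unfolding m_def by linarith+
  qed
  define x2 where "x2 = t2 - 1 / m"
  have x2: "x2 < t2" "x1 < x2"
  proof -
    show "x2 < t2" using m by (simp add: x2_def)
    have "1 < m * (t2 - x1)" using m(1) x by (simp add: divide_less_eq)
    then have "1 / m < t2 - x1" using m(2) by (simp add: divide_less_eq mult.commute)
    then show "x1 < x2" by (simp add: x2_def)
  qed
  have "u0 x1 - 1 / (t2 - x1) \<le> u0 x2 - 1 / (t2 - x2)"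
  proof (rule DERIV_nonneg_imp_nondecreasing[where f = "\<lambda>x. u0 x - 1 / (t2 - x)"])
    show "x1 \<le> x2" using x2 by simp
    fix x assume "x1 \<le> x" "x \<le> x2"
    then have xx: "x \<in> J" "t2 - x > 0" using x2 x gap by auto
    have "((\<lambda>x. u0 x - 1 / (t2 - x)) has_real_derivative (fr 0 x - 1 / (t2 - x)\<^sup>2)) (at x)"
      using xx u0'[OF xx(1)] by (auto intro!: derivative_eq_intros simp: power2_eq_square)
    then show "\<exists>d. ((\<lambda>x. u0 x - 1 / (t2 - x)) has_real_derivative d) (at x) \<and> 0 \<le> d"
      using fr_gap(2)[OF xx(1)] by (intro exI conjI) auto
  qed
  moreover have "1 / (t2 - x2) = m" using m by (simp add: x2_def)
  ultimately have "u0 x1 + K \<le> u0 x2" using m by linarith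
  then show ?thesis using x2 by blast
qed

end

definition \<Sigma>I :: "(real^3) set" where
  "\<Sigma>I = F 0 ` strip J"

lemma embedded_\<Sigma>I: "embedded_minimal_disk (F 0) (strip J) \<Sigma>I"
  unfolding \<Sigma>I_def
proof (rule embedded[OF zero order_refl])
  show "\<exists>Z. closed Z \<and> Z \<subseteq> sphere 0 1 \<and> strip J homeomorphic (cball (0::real^2) 1 - Z)"
    using open_strip_homeomorphic[OF gap(1)] gap(4) by simp
  show "\<exists>H. homeomorphism (strip J) (F 0 ` strip J) (F 0) H"
    using homeomorphism_F_open[OF zero, of t1 t2] gap(4) by simp
qed

context
  assumes half: "-1/2 \<le> t1" "t2 \<le> 1/2"
begin

lemma \<Sigma>I_sub: "\<Sigma>I \<subseteq> cylinder \<inter> slab t1 t2"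
proof -
  have "F 0 w \<in> cylinder \<inter> slab t1 t2" if w: "w \<in> strip J" for w
  proof -
    have "J \<subseteq> {-1/2..1/2}" using gap(4) half by auto
    then have "F 0 w \<in> cylinder" using F_in_cylinder[OF zero order_refl _ w] by blast
    moreover have "w$1 \<in> J" using w by (simp add: strip_def)
    ultimately show ?thesis using gap(4) by (simp add: slab_def)
  qed
  then show ?thesis by (auto simp: \<Sigma>I_def)
qed

text \<open>Arbitrarily close to either end of the gap \<open>u0\<close> still has unbounded
  variation, so the part of each half over any interval ending there contains every number of
  turns.\<close>

lemma spirals:
  assumes \<epsilon>: "\<epsilon> = 1 \<or> \<epsilon> = -1"
  shows "infinite_valued_graph (SgI 0 \<epsilon> J)"
    and "spirals_into_from_above (SgI 0 \<epsilon> J) t1" and "spirals_into_from_below (SgI 0 \<epsilon> J) t2"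
proof -
  obtain u0 where u0: "\<And>x. x \<in> J \<Longrightarrow> of_real \<epsilon> * G 0 (of_real x) = cis (u0 x)"
    "\<And>x. x \<in> J \<Longrightarrow> (u0 has_real_derivative fr 0 x) (at x)"
    using ex_angle[OF zero \<epsilon>] by blast
  have graph: "graph_over (DI 0 u0 {a<..<b}) (uu 0 u0) (SgI 0 \<epsilon> {a<..<b})"
    if "a < b" "t1 \<le> a" "b \<le> t2" for a b
    by (rule graph_over_DI[OF zero \<epsilon> u0 that(1)]) (use that gap(4) in auto)
  have above: "N_valued_over n s 1 (DI 0 u0 {t1<..<b})" if "0 < s" "t1 < b" "b \<le> t2" for n s b
  proof -
    \<comment> \<open>Any interior height will do; the angle asked for below it is that of
      \<open>n\<close> turns plus the \<open>pi\<close> lost in \<open>DI_covers\<close>.\<close>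
    define x2 where "x2 = (t1 + b) / 2"
    have x2: "t1 < x2" "x2 < b" "x2 \<in> J" using that gap(4) by (auto simp: x2_def)
    obtain x1 where x1: "t1 < x1" "x1 < x2" "u0 x1 + (2 * pi * real n + pi) \<le> u0 x2"
      using u0_below[OF u0(2) x2(3)] by blast
    show ?thesis
      by (rule N_valued_DI[OF zero \<epsilon> u0, of x1 x2]) (use x1 x2 that gap(4) in auto)
  qed
  have below: "N_valued_over n s 1 (DI 0 u0 {a<..<t2})" if "0 < s" "a < t2" "t1 \<le> a" for n s a
  proof -
    define x1 where "x1 = (a + t2) / 2"
    have x1: "a < x1" "x1 < t2" "x1 \<in> J" using that gap(4) by (auto simp: x1_def)
    obtain x2 where x2: "x1 < x2" "x2 < t2" "u0 x1 + (2 * pi * real n + pi) \<le> u0 x2"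
      using u0_above[OF u0(2) x1(3)] by blast
    show ?thesis
      by (rule N_valued_DI[OF zero \<epsilon> u0, of x1 x2]) (use x1 x2 that gap(4) in auto)
  qed
  have "\<forall>n. N_valued_over n (1/2) 1 (DI 0 u0 {t1<..<t2})"
    using above[of "1/2" t2] gap(1) by auto
  then show "infinite_valued_graph (SgI 0 \<epsilon> J)"
    unfolding infinite_valued_graph_def gap(4)
    using graph[OF gap(1)] by (intro exI conjI[of "graph_over _ _ _"] exI[of _ "1/2"] exI[of _ 1]) auto
  show "spirals_into_from_above (SgI 0 \<epsilon> J) t1"
    unfolding spirals_into_from_above_def
  proof (intro allI impI ballI)
    fix \<tau> s :: real and n assume \<tau>: "0 < \<tau>" and s: "s \<in> {0<..<1}"
    define b where "b = min t2 (t1 + \<tau>)"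
    have b: "t1 < b" "b \<le> t2" "b \<le> t1 + \<tau>" using \<tau> gap(1) by (auto simp: b_def)
    have "SgI 0 \<epsilon> {t1<..<b} \<subseteq> SgI 0 \<epsilon> J" using b gap(4) by (intro SgI_mono[OF zero]) auto
    moreover have "SgI 0 \<epsilon> {t1<..<b} \<subseteq> slab t1 (t1 + \<tau>)"
    proof
      fix p assume "p \<in> SgI 0 \<epsilon> {t1<..<b}"
      from SgI_height[OF zero this] show "p \<in> slab t1 (t1 + \<tau>)" using b by (simp add: slab_def)
    qed
    moreover have "N_valued_graph_over n s 1 (SgI 0 \<epsilon> {t1<..<b})"
      unfolding N_valued_graph_over_def using graph[of t1 b] above[of s b n] b s by auto
    ultimately show "\<exists>Gr\<subseteq>SgI 0 \<epsilon> J \<inter> slab t1 (t1 + \<tau>). N_valued_graph_over n s 1 Gr" by blast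
  qed
  show "spirals_into_from_below (SgI 0 \<epsilon> J) t2"
    unfolding spirals_into_from_below_def
  proof (intro allI impI ballI)
    fix \<tau> s :: real and n assume \<tau>: "0 < \<tau>" and s: "s \<in> {0<..<1}"
    define a where "a = max t1 (t2 - \<tau>)"
    have a: "a < t2" "t1 \<le> a" "t2 - \<tau> \<le> a" using \<tau> gap(1) by (auto simp: a_def)
    have "SgI 0 \<epsilon> {a<..<t2} \<subseteq> SgI 0 \<epsilon> J" using a gap(4) by (intro SgI_mono[OF zero]) auto
    moreover have "SgI 0 \<epsilon> {a<..<t2} \<subseteq> slab (t2 - \<tau>) t2"
    proof
      fix p assume "p \<in> SgI 0 \<epsilon> {a<..<t2}"
      from SgI_height[OF zero this] show "p \<in> slab (t2 - \<tau>) t2" using a by (simp add: slab_def)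
    qed
    moreover have "N_valued_graph_over n s 1 (SgI 0 \<epsilon> {a<..<t2})"
      unfolding N_valued_graph_over_def using graph[of a t2] below[of s a n] a s by auto
    ultimately show "\<exists>Gr\<subseteq>SgI 0 \<epsilon> J \<inter> slab (t2 - \<tau>) t2. N_valued_graph_over n s 1 Gr" by blast
  qed
qed

text \<open>Near an end of the gap each level of the radius runs through more than a full turn, so
  every horizontal position off the axis is attained at some height there.\<close>

lemma dense_near_end:
  assumes ab: "a < b" "t1 \<le> a" "b \<le> t2" and e: "a = t1 \<or> b = t2" and r: "0 < r" "r \<le> 1"
  shows "\<exists>x. a < x \<and> x < b \<and> vector [r * cos \<theta>, r * sin \<theta>, x] \<in> \<Sigma>I"
proof -
  obtain u0 where u0: "\<And>x. x \<in> J \<Longrightarrow> of_real 1 * G 0 (of_real x) = cis (u0 x)"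
    "\<And>x. x \<in> J \<Longrightarrow> (u0 has_real_derivative fr 0 x) (at x)"
    using ex_angle[OF zero, of 1] by blast
  define c where "c = (a + b) / 2"
  have c: "a < c" "c < b" "c \<in> J" using ab gap(4) by (auto simp: c_def)
  \<comment> \<open>One full turn plus the \<open>pi\<close> lost in
    \<open>DI_covers\<close>.\<close>
  have "\<exists>x1 x2. a < x1 \<and> x1 < x2 \<and> x2 < b \<and> u0 x1 + 3 * pi \<le> u0 x2"
    using e
  proof
    assume "a = t1"
    then show ?thesis using u0_below[OF u0(2) c(3), of "3 * pi"] c by blast
  next
    assume "b = t2"
    then show ?thesis using u0_above[OF u0(2) c(3), of "3 * pi"] c by blast
  qed
  then obtain x1 x2 where x: "a < x1" "x1 < x2" "x2 < b" "u0 x1 + 3 * pi \<le> u0 x2" by blast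
  \<comment> \<open>Rounding up gives the first representative of \<theta> modulo
    \<open>2 * pi\<close> at or above \<open>u0 x1\<close>.\<close>
  define n where "n = \<lceil>(u0 x1 - \<theta>) / (2 * pi)\<rceil>"
  define t where "t = \<theta> + 2 * pi * of_int n"
  have "(u0 x1 - \<theta>) / (2 * pi) \<le> of_int n" "of_int n < (u0 x1 - \<theta>) / (2 * pi) + 1"
    unfolding n_def by linarith+
  then have t: "u0 x1 \<le> t" "t \<le> u0 x2 - pi"
    using x(4) by (auto simp: t_def field_simps)
  have sub: "{a<..<b} \<subseteq> J" using ab gap(4) by auto
  have "(r, t) \<in> DI 0 u0 {a<..<b}"
    by (rule DI_covers[OF zero _ u0 _ _ sub r t]) (use x in auto)
  moreover have "graph_over (DI 0 u0 {a<..<b}) (uu 0 u0) (SgI 0 1 {a<..<b})"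
    by (rule graph_over_DI[OF zero _ u0 ab(1) _ _ sub]) auto
  then have "SgI 0 1 {a<..<b} = (\<lambda>(\<rho>, \<theta>). vector [\<rho> * cos \<theta>, \<rho> * sin \<theta>, uu 0 u0 (\<rho>, \<theta>)]) ` DI 0 u0 {a<..<b}"
    by (simp add: graph_over_def)
  ultimately have p: "vector [r * cos t, r * sin t, uu 0 u0 (r, t)] \<in> SgI 0 1 {a<..<b}"
    by (force intro: image_eqI[of _ _ "(r, t)"])
  from SgI_height[OF zero p] have h: "a < uu 0 u0 (r, t)" "uu 0 u0 (r, t) < b" by auto
  have "SgI 0 1 {a<..<b} \<subseteq> \<Sigma>I"
    using sub by (auto simp: SgI_def \<Sigma>I_def strip_def abs_le_iff)
  moreover have "cos t = cos \<theta>" "sin t = sin \<theta>"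
    by (simp_all add: t_def cos_add sin_add)
  ultimately show ?thesis using p h by auto
qed

text \<open>At a height inside the gap nothing is added, because locally the surface is the compact
  image of a closed strip. At the two end heights every point of the cylinder is a limit, by
  \<open>dense_near_end\<close> off the axis and because the surface contains the axis
  segment.\<close>

lemma closure_\<Sigma>I: "closure \<Sigma>I - \<Sigma>I = cylinder \<inter> {p. p $ 3 = t1 \<or> p $ 3 = t2}"
proof
  show "closure \<Sigma>I - \<Sigma>I \<subseteq> cylinder \<inter> {p. p $ 3 = t1 \<or> p $ 3 = t2}"
  proof
    fix p assume p: "p \<in> closure \<Sigma>I - \<Sigma>I"
    have "closed (cylinder \<inter> ({p :: real^3. t1 \<le> p$3} \<inter> {p. p$3 \<le> t2}))"
      by (intro closed_Int closed_cylinder closed_Collect_le continuous_intros)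
    moreover have "\<Sigma>I \<subseteq> cylinder \<inter> ({p :: real^3. t1 \<le> p$3} \<inter> {p. p$3 \<le> t2})"
      using \<Sigma>I_sub by (auto simp: slab_def)
    ultimately have cp: "p \<in> cylinder" "t1 \<le> p$3" "p$3 \<le> t2"
      using p closure_minimal by blast+
    have "\<not> (t1 < p$3 \<and> p$3 < t2)"
    proof
      assume a: "t1 < p$3 \<and> p$3 < t2"
      define c where "c = (t1 + p$3) / 2"
      define d where "d = (p$3 + t2) / 2"
      have cd: "t1 < c" "c < p$3" "p$3 < d" "d < t2" using a by (auto simp: c_def d_def)
      define Q where "Q = {q :: real^3. c < q$3} \<inter> {q. q$3 < d}"
      have "open Q" unfolding Q_def by (intro open_Int open_Collect_less continuous_intros)
      then have "p \<in> closure (Q \<inter> \<Sigma>I)"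
        using open_Int_closure_subset[of Q \<Sigma>I] p cd by (auto simp: Q_def)
      also have "closure (Q \<inter> \<Sigma>I) \<subseteq> F 0 ` strip {c..d}"
      proof (rule closure_minimal)
        show "Q \<inter> \<Sigma>I \<subseteq> F 0 ` strip {c..d}" by (auto simp: Q_def \<Sigma>I_def strip_def)
        have cJ: "{c..d} \<subseteq> J" using cd gap(4) by auto
        have "strip {c..d} \<subseteq> {w. (0, w) \<in> \<Omega>3}"
          using strip_\<Omega>3[OF zero cJ] by auto
        then have "compact (F 0 ` strip {c..d})"
          by (intro compact_continuous_image continuous_on_subset[OF continuous_F]) (simp_all add: strip_cbox)
        then show "closed (F 0 ` strip {c..d})" by (rule compact_imp_closed)
      qed
      also have "strip {c..d} \<subseteq> strip J" using cd gap(4) by (auto simp: strip_def)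
      then have "F 0 ` strip {c..d} \<subseteq> \<Sigma>I" unfolding \<Sigma>I_def by (rule image_mono)
      finally show False using p by blast
    qed
    then show "p \<in> cylinder \<inter> {p. p $ 3 = t1 \<or> p $ 3 = t2}" using cp by auto
  qed
next
  have main: "\<exists>q\<in>\<Sigma>I. dist q v < e"
    if p: "v \<in> cylinder" "v $ 3 = t1 \<or> v $ 3 = t2" and e: "e > 0" for v :: "real^3" and e
  proof -
    define a where "a = (if v$3 = t1 then t1 else max t1 (t2 - e))"
    define b where "b = (if v$3 = t1 then min t2 (t1 + e) else t2)"
    have ab: "a < b" "t1 \<le> a" "b \<le> t2" "a = t1 \<or> b = t2" using e gap(1) by (auto simp: a_def b_def)
    have near: "\<bar>x - v$3\<bar> < e" if "a < x" "x < b" for x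
      using that p(2) by (auto simp: a_def b_def split: if_splits)
    define z where "z = Complex (v$1) (v$2)"
    define r where "r = cmod z"
    have "r\<^sup>2 \<le> 1" using p(1) by (simp add: r_def z_def cmod_power2 cylinder_def)
    then have r1: "r \<le> 1" by (intro power2_le_imp_le[of r 1]) simp_all
    have "\<exists>x. a < x \<and> x < b \<and> vector [v$1, v$2, x] \<in> \<Sigma>I"
    proof (cases "r = 0")
      case True
      then have "z = 0" by (simp add: r_def)
      then have "v$1 = 0" "v$2 = 0" by (simp_all add: z_def complex_eq_iff)
      define x where "x = (a + b) / 2"
      have x: "a < x" "x < b" using ab by (auto simp: x_def)
      have "F 0 (vector [x, 0]) = vector [v$1, v$2, x]"
        using \<open>v$1 = 0\<close> \<open>v$2 = 0\<close> by (simp add: F_axis axis_point_def)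
      moreover have "vector [x, 0] \<in> strip J" using x ab gap(4) by (simp add: strip_def)
      ultimately have "vector [v$1, v$2, x] \<in> \<Sigma>I" unfolding \<Sigma>I_def by (metis imageI)
      then show ?thesis using x by blast
    next
      case False
      then have r: "0 < r" by (simp add: r_def)
      have "v$1 = r * cos (Arg z)" "v$2 = r * sin (Arg z)"
        using cos_Arg[of z] sin_Arg[of z] r by (auto simp: r_def z_def)
      then show ?thesis using dense_near_end[OF ab r r1, of "Arg z"] by simp
    qed
    then obtain x where x: "a < x" "x < b" "vector [v$1, v$2, x] \<in> \<Sigma>I" by blast
    have "vector [v$1, v$2, x] - v = (x - v$3) *\<^sub>R axis 3 1"
      by (simp add: vec_eq_iff forall_3 axis_def)
    then have "dist (vector [v$1, v$2, x]) v < e"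
      using near[OF x(1,2)] by (simp add: dist_norm)
    then show ?thesis using x(3) by blast
  qed
  show "cylinder \<inter> {p. p $ 3 = t1 \<or> p $ 3 = t2} \<subseteq> closure \<Sigma>I - \<Sigma>I"
    using main \<Sigma>I_sub by (auto simp: closure_approachable slab_def)
qed

text \<open>All parametrizations have \<open>w$1\<close> as height, so a compact set within the slab
  is covered by the strip over one compact interval of heights, for every \<open>k\<close> and for
  the limit. There the convergence is continuity of the family at \<open>\<kappa> = 0\<close>. The
  maps \<open>Fs\<close> need to agree with the family over the gap only.\<close>

lemma convergence:
  assumes \<kappa>: "\<And>n. \<kappa>s n \<in> T" "\<kappa>s \<longlonglongrightarrow> 0"
    and Fs: "\<And>n w. w \<in> strip J \<Longrightarrow> Fs n w = F (\<kappa>s n) w" "\<And>n w. Fs n w $ 3 = w$1"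
  shows "converge_smoothly_on_compacts (\<lambda>n. Fs n ` strip {-1/2..1/2} \<inter> slab t1 t2) (F 0) (strip J) (cylinder \<inter> slab t1 t2)"
  unfolding converge_smoothly_on_compacts_def
proof (intro allI impI)
  fix K :: "(real^3) set" assume K: "compact K \<and> K \<subseteq> cylinder \<inter> slab t1 t2"
  have "\<exists>a b. t1 < a \<and> b < t2 \<and> (\<forall>p\<in>K. a \<le> p$3 \<and> p$3 \<le> b)"
  proof (cases "K = {}")
    case True
    \<comment> \<open>For empty \<open>K\<close> the reversed ends \<open>a = t2\<close>,
      \<open>b = t1\<close> are admissible and make the strip \<open>L\<close> empty.\<close>
    then show ?thesis using gap(1) by (intro exI[of _ "t2"] exI[of _ t1]) simp
  next
    case False
    have c: "continuous_on K (\<lambda>p. p$3)" by (intro continuous_intros)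
    obtain p where p: "p \<in> K" "\<forall>q\<in>K. p$3 \<le> q$3"
      using continuous_attains_inf[OF _ False c] K by blast
    obtain q where q: "q \<in> K" "\<forall>p\<in>K. p$3 \<le> q$3"
      using continuous_attains_sup[OF _ False c] K by blast
    have "t1 < p$3" "q$3 < t2" using p q K by (auto simp: slab_def)
    then show ?thesis using p q by blast
  qed
  then obtain a b where ab: "t1 < a" "b < t2" "\<And>p. p \<in> K \<Longrightarrow> a \<le> p$3 \<and> p$3 \<le> b" by blast
  define L where "L = strip {a..b}"
  have LJ: "L \<subseteq> strip J" using ab gap(4) by (auto simp: L_def strip_def)
  have cL: "compact L" by (simp add: L_def strip_cbox)
  have L\<Omega>: "{k} \<times> L \<subseteq> \<Omega>3" if "k \<in> T" for k
    using strip_\<Omega>3[OF that order_refl] LJ by auto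
  have half': "L \<subseteq> strip {-1/2..1/2}" using ab half by (auto simp: L_def strip_def)
  show "\<exists>L \<phi>. compact L \<and> L \<subseteq> strip J \<and> {w \<in> strip J. F 0 w \<in> K} \<subseteq> L \<and>
      (\<forall>\<^sub>F k in sequentially. (\<exists>U. L \<subseteq> U \<and> smooth_on (\<phi> k) U) \<and> inj_on (\<phi> k) L \<and>
        \<phi> k ` L \<subseteq> Fs k ` strip {-1/2..1/2} \<inter> slab t1 t2 \<and>
        Fs k ` strip {-1/2..1/2} \<inter> slab t1 t2 \<inter> K \<subseteq> \<phi> k ` L) \<and>
      (\<forall>vs. set vs \<subseteq> Basis \<longrightarrow> uniform_limit L (\<lambda>k. iter_deriv vs (\<phi> k)) (iter_deriv vs (F 0)) sequentially)"
  proof (rule exI[of _ L], rule exI[of _ "\<lambda>k. F (\<kappa>s k)"], intro conjI always_eventually allI impI)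
    show "compact L" by (rule cL)
    show "L \<subseteq> strip J" by (rule LJ)
    show "{w \<in> strip J. F 0 w \<in> K} \<subseteq> L"
    proof clarify
      fix w assume "w \<in> strip J" "F 0 w \<in> K"
      then show "w \<in> L" using ab(3)[of "F 0 w"] by (auto simp: L_def strip_def)
    qed
    fix k
    show "\<exists>U. L \<subseteq> U \<and> smooth_on (F (\<kappa>s k)) U"
      using smooth_F[of "\<kappa>s k"] L\<Omega>[OF \<kappa>(1)[of k]] by (intro exI[of _ "{w. (\<kappa>s k, w) \<in> \<Omega>3}"]) auto
    show "inj_on (F (\<kappa>s k)) L"
      by (rule inj_on_subset[OF F_inj]) (use L\<Omega>[OF \<kappa>(1)[of k]] in auto)
    show "F (\<kappa>s k) ` L \<subseteq> Fs k ` strip {-1/2..1/2} \<inter> slab t1 t2"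
    proof (rule image_subsetI, rule IntI)
      fix w assume w: "w \<in> L"
      then show "F (\<kappa>s k) w \<in> Fs k ` strip {-1/2..1/2}"
        using LJ half' Fs(1)[of w k] by (metis imageI subsetD)
      show "F (\<kappa>s k) w \<in> slab t1 t2" using w ab by (auto simp: slab_def L_def strip_def)
    qed
    show "Fs k ` strip {-1/2..1/2} \<inter> slab t1 t2 \<inter> K \<subseteq> F (\<kappa>s k) ` L"
    proof
      fix p assume "p \<in> Fs k ` strip {-1/2..1/2} \<inter> slab t1 t2 \<inter> K"
      then obtain w where w: "p = Fs k w" "w \<in> strip {-1/2..1/2}" "p \<in> K" by blast
      then have "w \<in> L" using ab(3)[of p] Fs(2)[of k w] by (auto simp: L_def strip_def)
      then show "p \<in> F (\<kappa>s k) ` L" using w(1) Fs(1)[of w k] LJ by blast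
    qed
  next
    fix vs :: "(real^2) list" assume vs: "set vs \<subseteq> Basis"
    have "ck 0 \<Omega>3 (\<lambda>\<kappa>. iter_deriv vs (F \<kappa>))"
      using ck_F by (intro ck_iter_deriv[OF open_slices_\<Omega>3 vs])
    then have "continuous_on \<Omega>3 (\<lambda>(\<kappa>, w). iter_deriv vs (F \<kappa>) w)" by simp
    from continuous_imp_uniform_limit[OF this cL \<kappa>(2)]
    show "uniform_limit L (\<lambda>k. iter_deriv vs (F (\<kappa>s k))) (iter_deriv vs (F 0)) sequentially"
      using L\<Omega>[OF \<kappa>(1)] L\<Omega>[OF zero] by blast
  qed
qed

end

end

section \<open>Construction of the sequence\<close>

lemma diagonal_convergence:
  fixes u :: "nat \<Rightarrow> nat \<Rightarrow> complex"
  assumes "\<And>n i. norm (u n i) \<le> B"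
  obtains \<sigma> :: "nat \<Rightarrow> nat" where "strict_mono \<sigma>" "\<And>i. convergent (\<lambda>n. u (\<sigma> n) i)"
proof -
  interpret subseqs "\<lambda>i s. convergent (\<lambda>n. u (s n) i)"
  proof
    fix i and s :: "nat \<Rightarrow> nat" assume "strict_mono s"
    have "bounded (range (\<lambda>n. u (s n) i))"
      using assms by (auto simp: bounded_iff)
    then obtain l r where r: "strict_mono (r :: nat \<Rightarrow> nat)" "((\<lambda>n. u (s n) i) \<circ> r) \<longlonglongrightarrow> l"
      using bounded_imp_convergent_subsequence by blast
    then show "\<exists>r'. strict_mono r' \<and> convergent (\<lambda>n. u ((s \<circ> r') n) i)"
      by (intro exI[of _ r]) (auto simp: o_def convergent_def)
  qed
  have "convergent (\<lambda>n. u (diagseq n) i)" for i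
  proof -
    have "convergent (\<lambda>n. u ((diagseq \<circ> (+) (Suc i)) n) i)"
    proof (rule diagseq_holds)
      fix r s :: "nat \<Rightarrow> nat" and n
      assume "strict_mono r" "convergent (\<lambda>m. u (s m) n)"
      then show "convergent (\<lambda>m. u ((s \<circ> r) m) n)"
        using convergent_subseq_convergent[of "\<lambda>m. u (s m) n" r] by (simp add: o_def)
    qed
    then have "convergent (\<lambda>n. u (diagseq (n + Suc i)) i)" by (simp add: o_def add.commute)
    then show ?thesis
      using convergent_ignore_initial_segment[of "\<lambda>n. u (diagseq n) i" "Suc i"] by simp
  qed
  then show ?thesis using subseq_diagseq that by blast
qed

text \<open>Every member of the sequence is positive and hence isolated among the parameters; only
  at 0 is there something to check, and there it is the assumed limit.\<close>

lemma continuous_on_sequence_limit: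
  fixes c :: "real \<Rightarrow> 'a::metric_space"
  assumes s: "\<And>n. 0 < s n" "s \<longlonglongrightarrow> 0" and c: "(\<lambda>n. c (s n)) \<longlonglongrightarrow> c 0"
  shows "continuous_on (insert 0 (range s)) c"
  unfolding continuous_on_iff
proof (intro ballI allI impI)
  fix x e :: real assume x: "x \<in> insert 0 (range s)" and e: "0 < e"
  obtain K where K: "\<And>n. n \<ge> K \<Longrightarrow> dist (c (s n)) (c 0) < e"
    using c e unfolding lim_sequentially by blast
  show "\<exists>d>0. \<forall>x'\<in>insert 0 (range s). dist x' x < d \<longrightarrow> dist (c x') (c x) < e"
  proof (cases "x = 0")
    case True
    obtain d where d: "d > 0" "\<forall>x\<in>s ` {..<K}. x \<noteq> 0 \<longrightarrow> d \<le> dist 0 x"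
      using finite_set_avoid[of "s ` {..<K}" 0] by auto
    have "dist (c x') (c x) < e" if x': "x' \<in> insert 0 (range s)" "dist x' x < d" for x'
    proof (cases "x' = 0")
      case False
      then obtain n where n: "x' = s n" using x' by blast
      have "\<not> n < K"
      proof
        assume "n < K"
        then have "d \<le> dist 0 x'" using d(2) n False by auto
        then show False using x'(2) True by (simp add: dist_commute)
      qed
      then show ?thesis using K[of n] n True by simp
    qed (use True e in simp)
    then show ?thesis using d by blast
  next
    case False
    then have x0: "x > 0" using x s(1) by auto
    obtain L where L: "\<And>n. n \<ge> L \<Longrightarrow> dist (s n) 0 < x / 2"
      using s(2) x0 unfolding lim_sequentially by (metis half_gt_zero)
    obtain d where d: "d > 0" "\<forall>y\<in>insert 0 (s ` {..<L}). y \<noteq> x \<longrightarrow> d \<le> dist x y"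
      using finite_set_avoid[of "insert 0 (s ` {..<L})" x] by auto
    have "x' = x" if x': "x' \<in> insert 0 (range s)" "dist x' x < min d (x / 2)" for x'
    proof (rule ccontr)
      assume ne: "x' \<noteq> x"
      show False
      proof (cases "x' \<in> insert 0 (s ` {..<L})")
        case True
        then have "d \<le> dist x x'" using d(2) ne by blast
        then show False using x'(2) by (simp add: dist_commute)
      next
        case False
        then obtain n where n: "x' = s n" using x'(1) by blast
        then have "\<not> n < L" using False by blast
        then have "dist x' 0 < x / 2" using L[of n] n by simp
        then show False using x'(2) x0 by (simp add: dist_real_def)
      qed
    qed
    then have "dist (c x') (c x) < e" if "x' \<in> insert 0 (range s)" "dist x' x < min d (x / 2)" for x'
      using that e by (metis dist_self)
    then show ?thesis using d(1) x0 by (intro exI[of _ "min d (x / 2)"]) simp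
  qed
qed

context blowup_set
begin

text \<open>\<open>exp (i h)\<close> with prescribed value \<open>c \<kappa>\<close> at
  \<open>x0\<close>. The path runs along the real axis first and then vertically, which keeps it
  inside the domain of \<open>f \<kappa>\<close> also at \<open>\<kappa> = 0\<close>, when it must
  not leave the gap.\<close>

definition Gb :: "real \<Rightarrow> (real \<Rightarrow> complex) \<Rightarrow> real \<Rightarrow> complex \<Rightarrow> complex" where
  "Gb x0 c \<kappa> z = c \<kappa> * exp (\<i> * (SI (f \<kappa>) (of_real x0) (of_real (Re z)) + SI (f \<kappa>) (of_real (Re z)) z))"

definition Gfin :: "real \<Rightarrow> complex \<Rightarrow> complex" where
  "Gfin = Gb 0 (\<lambda>_. 1)"

lemma weierstrass_Gb:
  assumes T: "\<And>\<kappa>. \<kappa> \<in> T \<Longrightarrow> \<bar>\<kappa>\<bar> < 1" and J: "open J" "is_interval J" "J \<subseteq> {-1<..<1}"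
    and TJ: "\<And>\<kappa> x. \<kappa> \<in> T \<Longrightarrow> x \<in> J \<Longrightarrow> 0 < dd \<kappa> x" and x0: "x0 \<in> J"
    and c: "continuous_on T c" "\<And>\<kappa>. \<kappa> \<in> T \<Longrightarrow> cmod (c \<kappa>) = 1"
  shows "weierstrass S p T J (Gb x0 c)"
proof -
  define \<Omega> where "\<Omega> = {(\<kappa>, z). \<kappa> \<in> T \<and> Re z \<in> J \<and> \<bar>Im z\<bar> < om \<kappa> (Re z)}"
  have b: "\<bar>\<kappa>\<bar> < 1 \<and> \<bar>x\<bar> < 1 \<and> 0 < dd \<kappa> x" if "\<kappa> \<in> T" "x \<in> J" for \<kappa> x
    using T TJ that J(3) by (auto simp: abs_less_iff)
  have \<Omega>_dom: "\<Omega> \<subseteq> dom 0" using UU_dom b by (auto simp: \<Omega>_def UU_def)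
  have o: "open {z. (\<kappa>, z) \<in> dom 0}" for \<kappa>
    using open_vimage[OF open_dom, of "\<lambda>z. (\<kappa>, z)" 0] by (simp add: vimage_def continuous_on_Pair)
  have vert: "closed_segment (of_real (Re z)) z \<subseteq> {z. (\<kappa>, z) \<in> dom 0}" if "(\<kappa>, z) \<in> \<Omega>" for \<kappa> z
  proof
    fix w assume "w \<in> closed_segment (of_real (Re z)) z"
    from vertical_segment[OF this] subsetD[OF \<Omega>_dom that]
    show "w \<in> {z. (\<kappa>, z) \<in> dom 0}" by (auto simp: dom_def)
  qed
  have real_dom: "(\<kappa>, of_real x) \<in> dom 0" if "\<kappa> \<in> T" "x \<in> J" for \<kappa> x
    using b[OF that] by (simp add: dom_def)
  have hor0: "of_real x0 + of_real t * (of_real x - of_real x0) = complex_of_real (x0 + t * (x - x0))" for t x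
    by simp
  have horJ: "x0 + t * (x - x0) \<in> J" if "x \<in> J" "0 \<le> t" "t \<le> 1" for x t
    using convexD_alt[OF is_interval_convex[OF J(2)] x0 that] by (simp add: algebra_simps)
  have hor: "closed_segment (complex_of_real x0) (of_real x) \<subseteq> {z. (\<kappa>, z) \<in> dom 0}" if "\<kappa> \<in> T" "x \<in> J" for \<kappa> x
  proof
    fix z assume "z \<in> closed_segment (complex_of_real x0) (of_real x)"
    then obtain t where t: "0 \<le> t" "t \<le> 1" "z = (1 - t) *\<^sub>R complex_of_real x0 + t *\<^sub>R of_real x"
      by (auto simp: closed_segment_def)
    have "z = of_real (x0 + t * (x - x0))" by (simp add: t(3) scaleR_conv_of_real algebra_simps)
    then show "z \<in> {z. (\<kappa>, z) \<in> dom 0}" using real_dom[OF that(1) horJ[OF that(2) t(1,2)]] by simp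
  qed
  show ?thesis
  proof unfold_locales
    show "continuous_on {(\<kappa>, z). \<kappa> \<in> T \<and> Re z \<in> J \<and> \<bar>Im z\<bar> < om \<kappa> (Re z)} (\<lambda>(\<kappa>, z). Gb x0 c \<kappa> z)"
    proof -
      have 1: "continuous_on \<Omega> (\<lambda>u. SI (f (fst u)) (of_real x0) (of_real (Re (snd u))))"
      proof (rule continuous_on_SI)
        have "continuous_on (\<Omega> \<times> {0..1}) (\<lambda>v. (\<lambda>(\<kappa>, z). f \<kappa> z)
            (fst (fst v), of_real (x0 + snd v * (Re (snd (fst v)) - x0))))"
        proof (rule continuous_on_compose2[OF continuous_f])
          show "(\<lambda>v. (fst (fst v), complex_of_real (x0 + snd v * (Re (snd (fst v)) - x0)))) ` (\<Omega> \<times> {0..1}) \<subseteq> dom 0"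
          proof (rule image_subsetI)
            fix v assume "v \<in> \<Omega> \<times> {0..1::real}"
            then have "fst (fst v) \<in> T" "Re (snd (fst v)) \<in> J" "0 \<le> snd v" "snd v \<le> 1" by (auto simp: \<Omega>_def)
            then show "(fst (fst v), complex_of_real (x0 + snd v * (Re (snd (fst v)) - x0))) \<in> dom 0"
              by (intro real_dom horJ)
          qed
        qed (intro continuous_intros)
        then show "continuous_on (\<Omega> \<times> {0..1}) (\<lambda>(u, t). f (fst u) (of_real x0 + of_real t * (of_real (Re (snd u)) - of_real x0)))"
          by (simp add: case_prod_unfold)
      qed (intro continuous_intros)+
      have 2: "continuous_on \<Omega> (\<lambda>u. SI (f (fst u)) (of_real (Re (snd u))) (snd u))"
      proof (rule continuous_on_SI)
        have "continuous_on (\<Omega> \<times> {0..1}) (\<lambda>v. (\<lambda>(\<kappa>, z). f \<kappa> z)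
            (fst (fst v), of_real (Re (snd (fst v))) + of_real (snd v) * (snd (fst v) - of_real (Re (snd (fst v))))))"
        proof (rule continuous_on_compose2[OF continuous_f])
          show "(\<lambda>v. (fst (fst v), of_real (Re (snd (fst v))) + of_real (snd v) * (snd (fst v) - of_real (Re (snd (fst v))))))
              ` (\<Omega> \<times> {0..1}) \<subseteq> dom 0"
          proof (rule image_subsetI)
            fix v assume v: "v \<in> \<Omega> \<times> {0..1::real}"
            define z where "z = snd (fst v)"
            define t where "t = snd v"
            have z: "(fst (fst v), z) \<in> \<Omega>" and t: "0 \<le> t" "t \<le> 1" using v by (auto simp: z_def t_def)
            have "of_real (Re z) + of_real t * (z - of_real (Re z)) = (1 - t) *\<^sub>R of_real (Re z) + t *\<^sub>R z"
              by (simp add: scaleR_conv_of_real algebra_simps)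
            then have "of_real (Re z) + of_real t * (z - of_real (Re z)) \<in> closed_segment (of_real (Re z)) z"
              using t by (auto simp: closed_segment_def)
            then show "(fst (fst v), of_real (Re (snd (fst v))) + of_real (snd v) * (snd (fst v) - of_real (Re (snd (fst v))))) \<in> dom 0"
              using vert[OF z] unfolding z_def[symmetric] t_def[symmetric] by blast
          qed
        qed (intro continuous_intros)
        then show "continuous_on (\<Omega> \<times> {0..1}) (\<lambda>(u, t). f (fst u) (of_real (Re (snd u)) + of_real t * (snd u - of_real (Re (snd u)))))"
          by (simp add: case_prod_unfold)
      qed (intro continuous_intros)+
      have 3: "continuous_on \<Omega> (\<lambda>u. c (fst u))"
        by (rule continuous_on_compose2[OF c(1)]) (auto simp: \<Omega>_def intro!: continuous_intros)
      show ?thesis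
        unfolding \<Omega>_def[symmetric] unfolding Gb_def case_prod_unfold by (intro continuous_intros 1 2 3)
    qed
  next
    fix \<kappa> z assume a: "\<kappa> \<in> T" "Re z \<in> J" "\<bar>Im z\<bar> < om \<kappa> (Re z)"
    then have z: "(\<kappa>, z) \<in> \<Omega>" by (simp add: \<Omega>_def)
    \<comment> \<open>The terms from the moving corner of the path cancel, so the sum is complex
      differentiable with derivative \<open>f \<kappa> z\<close>.\<close>
    have "((\<lambda>w. SI (f \<kappa>) (of_real x0) (of_real (Re w)) + SI (f \<kappa>) (of_real (Re w)) w) has_derivative
        (\<lambda>v. f \<kappa> (of_real (Re z)) * of_real (Re v) + (f \<kappa> z * v - f \<kappa> (of_real (Re z)) * of_real (Re v)))) (at z)"
      by (intro has_derivative_add has_derivative_SI_horizontal[OF o hor holomorphic_f]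
          has_derivative_SI_vertical[OF o vert[OF z] holomorphic_f] a)
    then have H: "((\<lambda>w. SI (f \<kappa>) (of_real x0) (of_real (Re w)) + SI (f \<kappa>) (of_real (Re w)) w) has_field_derivative f \<kappa> z) (at z)"
      by (simp add: has_field_derivative_def)
    show "(Gb x0 c \<kappa> has_field_derivative \<i> * f \<kappa> z * Gb x0 c \<kappa> z) (at z)"
      unfolding Gb_def[abs_def] by (rule derivative_eq_intros H refl)+ (simp add: mult_ac)
  next
    fix \<kappa> x assume a: "\<kappa> \<in> T" "x \<in> J"
    \<comment> \<open>Reflection shows that the integral along the axis is real, so the exponential
      has modulus one there.\<close>
    have fc: "f \<kappa> (cnj w) = cnj (f \<kappa> w)" if "(\<kappa>, w) \<in> dom 0" for w
      using that by (intro f_cnj) (auto simp: dom_def)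
    have "SI (f \<kappa>) (cnj (of_real x0)) (cnj (of_real x)) = cnj (SI (\<lambda>z. cnj (f \<kappa> (cnj z))) (of_real x0) (of_real x))"
      by (rule SI_cnj)
    also have "SI (\<lambda>z. cnj (f \<kappa> (cnj z))) (of_real x0) (of_real x) = SI (f \<kappa>) (of_real x0) (of_real x)"
      using hor[OF a] fc by (intro SI_cong) auto
    finally have "Im (SI (f \<kappa>) (of_real x0) (of_real x)) = 0" by (simp add: complex_eq_iff)
    then show "cmod (Gb x0 c \<kappa> (of_real x)) = 1"
      using c(2)[OF a(1)] by (simp add: Gb_def norm_mult SI_def[of _ "of_real x" "of_real x"])
  qed (use T J TJ in auto)
qed

lemma weierstrass_Gfin:
  assumes "0 < \<kappa>" "\<kappa> < 1"
  shows "weierstrass S p {\<kappa>} {-1<..<1} Gfin"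
  unfolding Gfin_def
proof (rule weierstrass_Gb)
  show "0 < dd \<kappa>' x" if "\<kappa>' \<in> {\<kappa>}" for \<kappa>' x
    using that assms infdist_nonneg[of x S] by (simp add: dd_def add_nonneg_pos)
qed (use assms in \<open>auto simp: is_interval_oo\<close>)

text \<open>Both sides solve \<open>G' = i f G\<close> and agree at \<open>x0\<close>.
  \<open>Gfin\<close> is based at height 0, which may lie in \<open>S\<close> and so has no meaning
  in the limit; this changes the base point to one inside the gap.\<close>

lemma Gfin_eq_Gb:
  assumes k: "0 < \<kappa>" "\<kappa> < 1" and x0: "x0 \<in> {-1<..<1}" and z: "Re z \<in> {-1<..<1}" "\<bar>Im z\<bar> < om \<kappa> (Re z)"
    and c: "c \<kappa> = Gfin \<kappa> (of_real x0)"
  shows "Gfin \<kappa> z = Gb x0 c \<kappa> z"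
proof -
  interpret w: weierstrass S p "{\<kappa>}" "{-1<..<1}" Gfin by (rule weierstrass_Gfin[OF k])
  have z\<Omega>: "(\<kappa>, z) \<in> w.\<Omega>" using z by (simp add: w.\<Omega>_def)
  have "Gfin \<kappa> z = Gfin \<kappa> (of_real (Re z)) * exp (\<i> * SI (f \<kappa>) (of_real (Re z)) z)"
    by (rule w.G_polar[OF z\<Omega>])
  also have "Gfin \<kappa> (of_real (Re z)) = Gfin \<kappa> (of_real x0) * exp (\<i> * SI (f \<kappa>) (of_real x0) (of_real (Re z)))"
    using x0 z by (intro w.G_segment w.horizontal_segment_\<Omega>) auto
  finally show ?thesis
    by (simp add: Gb_def c distrib_left exp_add mult.assoc)
qed

lemma Xm_cong:
  assumes "\<And>z. Re z = x \<Longrightarrow> \<bar>Im z\<bar> \<le> \<bar>y\<bar> \<Longrightarrow> g1 z = g2 z"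
  shows "Xm g1 (Complex x y) = Xm g2 (Complex x y)"
proof -
  have "g1 z = g2 z" if "z \<in> closed_segment (of_real (Re (Complex x y))) (Complex x y)" for z
    using vertical_segment[OF that] by (intro assms) auto
  then show ?thesis unfolding Xm_def by (intro arg_cong2[where f = "\<lambda>a b. (cnj a - b) / 2"] SI_cong) auto
qed

text \<open>A point of the surface depends on \<open>g\<close> only along its own vertical line
  below \<open>om\<close>, including the unit of height \<open>yyG\<close>.\<close>

lemma FG_cong:
  assumes eq: "\<And>z. Re z = w$1 \<Longrightarrow> \<bar>Im z\<bar> < om \<kappa> (w$1) \<Longrightarrow> g1 z = g2 z"
    and w: "\<bar>w$2 * yyG g1 \<kappa> (w$1) 1\<bar> < om \<kappa> (w$1)"
  shows "FG g1 \<kappa> w = FG g2 \<kappa> w"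
proof -
  have X: "Xm g1 (Complex (w$1) y) = Xm g2 (Complex (w$1) y)" if "\<bar>y\<bar> < om \<kappa> (w$1)" for y
    using that by (intro Xm_cong eq) auto
  have "(0 < y \<and> y < om \<kappa> (w$1) \<and> cmod (Xm g1 (Complex (w$1) y)) = 1)
      \<longleftrightarrow> (0 < y \<and> y < om \<kappa> (w$1) \<and> cmod (Xm g2 (Complex (w$1) y)) = 1)" for y
    using X[of y] by auto
  then have y: "yyG g1 \<kappa> (w$1) 1 = yyG g2 \<kappa> (w$1) 1" by (simp add: yyG_def)
  show ?thesis using X[OF w] by (simp add: FG_def psiG_def y)
qed

text \<open>The clauses of the theorem with \<open>M\<close> replaced by the set \<open>S\<close> of
  heights and components of the complement by gaps of \<open>S\<close> inside the cylinder.\<close>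

lemma ex_disk_sequence:
  obtains F W \<Sigma> where
    "\<And>k. properly_embedded_minimal_disk (F k) (W k) (\<Sigma> k) cylinder"
      "\<And>k. axis_point ` {-1/2..1/2} \<subseteq> \<Sigma> k" and
    "\<And>t. t \<in> S \<Longrightarrow> \<bar>t\<bar> \<le> 1/2 \<Longrightarrow> filterlim (\<lambda>k. norm_A_sq (F k) (W k) (axis_point t)) at_top sequentially" and
    "\<And>\<delta>. \<delta> > 0 \<Longrightarrow> (SUP k. SUP v\<in>\<Sigma> k - (\<Union>t\<in>S. ball (axis_point t) \<delta>). ereal (norm_A_sq (F k) (W k) v)) < \<infinity>" and
    "\<And>k. \<exists>\<Sigma>1 \<Sigma>2. multi_valued_graph \<Sigma>1 \<and> multi_valued_graph \<Sigma>2 \<and> \<Sigma> k - x3_axis = \<Sigma>1 \<union> \<Sigma>2" and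
    "\<And>t1 t2. t1 < t2 \<and> t1 \<in> S \<and> t2 \<in> S \<and> {t1<..<t2} \<inter> S = {} \<and> -1/2 \<le> t1 \<and> t2 \<le> 1/2 \<Longrightarrow>
      (\<exists>F_I W_I \<Sigma>_I.
         embedded_minimal_disk F_I W_I \<Sigma>_I \<and>
         \<Sigma>_I \<subseteq> cylinder \<inter> slab t1 t2 \<and>
         converge_smoothly_on_compacts (\<lambda>k. \<Sigma> k \<inter> slab t1 t2) F_I W_I (cylinder \<inter> slab t1 t2) \<and>
         closure \<Sigma>_I - \<Sigma>_I = cylinder \<inter> {v. v $ 3 = t1 \<or> v $ 3 = t2} \<and>
         (\<exists>\<Sigma>1 \<Sigma>2. infinite_valued_graph \<Sigma>1 \<and> infinite_valued_graph \<Sigma>2 \<and>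
            \<Sigma>_I - x3_axis = \<Sigma>1 \<union> \<Sigma>2 \<and>
            spirals_into_from_above \<Sigma>1 t1 \<and> spirals_into_from_below \<Sigma>1 t2 \<and>
            spirals_into_from_above \<Sigma>2 t1 \<and> spirals_into_from_below \<Sigma>2 t2))"
proof -
  define rt :: "nat \<Rightarrow> real" where "rt i = of_rat (from_nat i)" for i
  \<comment> \<open>Rational heights outside the interval from -1 to 1, where the phases are not
    controlled, get the dummy value 1. The shift \<open>n + 2\<close> keeps the parameters below
    1.\<close>
  define ph where "ph n i = (if \<bar>rt i\<bar> < 1 then Gfin (1 / (real n + 2)) (of_real (rt i)) else 1)" for n i
  have unit: "cmod (Gfin \<kappa> (of_real x)) = 1" if "0 < \<kappa>" "\<kappa> < 1" "\<bar>x\<bar> < 1" for \<kappa> x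
    using weierstrass.G_unit[OF weierstrass_Gfin[OF that(1,2)], of \<kappa> x] that(3) by (auto simp: abs_less_iff)
  have "norm (ph n i) \<le> 1" for n i
    using unit[of "1 / (real n + 2)" "rt i"] by (simp add: ph_def)
  then obtain \<sigma> where \<sigma>: "strict_mono (\<sigma> :: nat \<Rightarrow> nat)" "\<And>i. convergent (\<lambda>n. ph (\<sigma> n) i)"
    using diagonal_convergence[of ph 1] by blast
  define ks where "ks n = 1 / (real (\<sigma> n) + 2)" for n
  have ks: "0 < ks n" "ks n < 1" for n by (auto simp: ks_def)
  have ks_le: "real n \<le> 1 / ks n" for n
    using seq_suble[OF \<sigma>(1), of n] by (simp add: ks_def)
  have ks0: "ks \<longlonglongrightarrow> 0"
  proof (rule tendsto_sandwich[of "\<lambda>_. 0" _ _ "\<lambda>n. inverse (real n + 1)"])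
    have "ks n \<le> inverse (real n + 1)" for n
      using seq_suble[OF \<sigma>(1), of n] by (simp add: ks_def field_simps)
    then show "\<forall>\<^sub>F n in sequentially. ks n \<le> inverse (real n + 1)" by simp
    show "(\<lambda>n. inverse (real n + 1)) \<longlonglongrightarrow> 0"
      using LIMSEQ_inverse_real_of_nat by (simp add: add.commute)
    show "\<forall>\<^sub>F n in sequentially. 0 \<le> ks n"
      using less_imp_le[OF ks(1)] by simp
  qed simp
  define I where "I = {-1/2..1/2::real}"
  define F where "F k = FG (Gfin (ks k)) (ks k)" for k
  have w: "weierstrass S p {ks k} {-1<..<1} Gfin" for k by (rule weierstrass_Gfin[OF ks])
  have F_eq: "F k = weierstrass.F S p Gfin (ks k)" for k
    unfolding F_def by (rule weierstrass.F_def[OF w, symmetric])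
  have IJ: "I \<subseteq> {-1<..<1}" by (auto simp: I_def)
  have A1: "properly_embedded_minimal_disk (F k) (strip I) (F k ` strip I) cylinder" for k
    using weierstrass.properly_embedded[OF w, of "ks k" k] IJ unfolding F_eq I_def by simp
  have A2: "axis_point ` {-1/2..1/2} \<subseteq> F k ` strip I" for k
  proof (rule image_subsetI)
    fix t :: real assume "t \<in> {-1/2..1/2}"
    then have "vector [t, 0] \<in> strip I" by (simp add: strip_def I_def)
    moreover have "F k (vector [t, 0]) = axis_point t" unfolding F_eq by (rule weierstrass.F_axis[OF w])
    ultimately show "axis_point t \<in> F k ` strip I" by (metis imageI)
  qed
  have A3: "filterlim (\<lambda>k. norm_A_sq (F k) (strip I) (axis_point t)) at_top sequentially"
    if t: "t \<in> S" "\<bar>t\<bar> \<le> 1/2" for t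
  proof (rule filterlim_at_top_mono[OF filterlim_real_sequentially], rule always_eventually, rule allI)
    fix k
    have tI: "t \<in> I" using t by (auto simp: I_def abs_le_iff)
    \<comment> \<open>Over a point of \<open>S\<close> the length scale is \<kappa> itself, so
      \<open>fr\<close> is at least of order \<open>\<kappa>^-2\<close>.\<close>
    have "dd (ks k) t = ks k" using t(1) ks[of k] by (simp add: dd_def)
    then have "10 ^ 8 / (ks k)\<^sup>2 \<le> fr (ks k) t" using fr_lower[of "ks k" t] ks[of k] by simp
    moreover have "1 / (ks k)\<^sup>2 \<le> 10 ^ 8 / (ks k)\<^sup>2" using ks[of k] by (intro divide_right_mono) auto
    ultimately have f1: "1 / (ks k)\<^sup>2 \<le> fr (ks k) t" by linarith
    have k1: "1 \<le> 1 / ks k" using ks[of k] by simp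
    have "1 / ks k * 1 \<le> 1 / ks k * (1 / ks k)" using k1 less_imp_le[OF ks(1)] by (intro mult_left_mono) auto
    then have "1 / ks k \<le> 1 / (ks k)\<^sup>2" by (simp add: power2_eq_square)
    then have f2: "1 \<le> fr (ks k) t" "real k \<le> fr (ks k) t" using f1 k1 ks_le[of k] by linarith+
    then have "fr (ks k) t * 1 \<le> fr (ks k) t * fr (ks k) t" by (intro mult_left_mono) auto
    then have "real k \<le> 2 * (fr (ks k) t)\<^sup>2" using f2 unfolding power2_eq_square by linarith
    also have "\<dots> = norm_A_sq (F k) (strip I) (axis_point t)"
      unfolding F_eq by (rule weierstrass.norm_A_sq_axis[OF w _ IJ tI, symmetric]) simp
    finally show "real k \<le> norm_A_sq (F k) (strip I) (axis_point t)" .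
  qed
  have A4: "(SUP k. SUP v\<in>F k ` strip I - (\<Union>t\<in>S. ball (axis_point t) \<delta>). ereal (norm_A_sq (F k) (strip I) v)) < \<infinity>"
    if \<delta>: "\<delta> > 0" for \<delta>
  proof -
    have "(SUP k. SUP v\<in>F k ` strip I - (\<Union>t\<in>S. ball (axis_point t) \<delta>). ereal (norm_A_sq (F k) (strip I) v))
        \<le> ereal (8 * (suminf wt * (4 / (\<delta> / 2) ^ 4))\<^sup>2 + 8 / \<delta> ^ 4)"
    proof (intro SUP_least)
      fix k v assume v: "v \<in> F k ` strip I - (\<Union>t\<in>S. ball (axis_point t) \<delta>)"
      interpret w: weierstrass S p "{ks k}" "{-1<..<1}" Gfin by (rule w)
      obtain y where y: "y \<in> strip I" "v = w.F (ks k) y" using v unfolding F_eq by blast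
      have y3: "(ks k, y) \<in> w.\<Omega>3" by (rule w.strip_\<Omega>3[OF _ IJ y(1)]) simp
      have far: "\<delta>\<^sup>2 \<le> (cmod (w.X (ks k) (w.psi (ks k) y)))\<^sup>2 + (y$1 - t)\<^sup>2" if "t \<in> S" for t
      proof -
        have "\<delta> \<le> dist (axis_point t) v" using v that by auto
        then have "\<delta>\<^sup>2 \<le> (dist (axis_point t) v)\<^sup>2" using \<delta> by (intro power_mono) auto
        also have "(dist (axis_point t) v)\<^sup>2 = (v$1)\<^sup>2 + (v$2)\<^sup>2 + (t - v$3)\<^sup>2"
          unfolding dist_norm power2_norm_eq_inner
          by (simp add: inner_vec_def sum_3 axis_point_def power2_eq_square)
        also have "\<dots> = (cmod (w.X (ks k) (w.psi (ks k) y)))\<^sup>2 + (y$1 - t)\<^sup>2"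
          unfolding y(2) w.F_radius by (simp add: power2_commute)
        finally show ?thesis .
      qed
      have "norm_A_sq (F k) (strip I) v
          = 2 * (cmod (f (ks k) (w.psi (ks k) y)))\<^sup>2 / w.coshv (ks k) (w.psi (ks k) y) ^ 4"
        unfolding F_eq y(2) by (rule w.norm_A_sq_F[OF _ IJ y(1)]) simp
      also have "\<dots> \<le> 8 * (suminf wt * (4 / (\<delta> / 2) ^ 4))\<^sup>2 + 8 / \<delta> ^ 4"
        by (rule w.curvature_bound[OF _ y3 \<delta> far]) auto
      finally show "ereal (norm_A_sq (F k) (strip I) v) \<le> ereal (8 * (suminf wt * (4 / (\<delta> / 2) ^ 4))\<^sup>2 + 8 / \<delta> ^ 4)"
        by simp
    qed
    also have "\<dots> < \<infinity>" by simp
    finally show ?thesis .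
  qed
  have A5: "\<exists>\<Sigma>1 \<Sigma>2. multi_valued_graph \<Sigma>1 \<and> multi_valued_graph \<Sigma>2 \<and> F k ` strip I - x3_axis = \<Sigma>1 \<union> \<Sigma>2" for k
  proof -
    interpret w: weierstrass S p "{ks k}" "{-1<..<1}" Gfin by (rule w)
    have "multi_valued_graph (w.SgI (ks k) \<epsilon> I)" if "\<epsilon> = 1 \<or> \<epsilon> = -1" for \<epsilon>
      unfolding I_def by (rule w.multi_valued_SgI) (use that IJ in \<open>auto simp: I_def\<close>)
    moreover have "F k ` strip I - x3_axis = w.SgI (ks k) 1 I \<union> w.SgI (ks k) (-1) I"
      unfolding F_eq by (rule w.image_minus_axis[OF _ IJ]) simp
    ultimately show ?thesis by blast
  qed
  have A6: "\<exists>F_I W_I \<Sigma>_I.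
         embedded_minimal_disk F_I W_I \<Sigma>_I \<and>
         \<Sigma>_I \<subseteq> cylinder \<inter> slab t1 t2 \<and>
         converge_smoothly_on_compacts (\<lambda>k. F k ` strip I \<inter> slab t1 t2) F_I W_I (cylinder \<inter> slab t1 t2) \<and>
         closure \<Sigma>_I - \<Sigma>_I = cylinder \<inter> {v. v $ 3 = t1 \<or> v $ 3 = t2} \<and>
         (\<exists>\<Sigma>1 \<Sigma>2. infinite_valued_graph \<Sigma>1 \<and> infinite_valued_graph \<Sigma>2 \<and>
            \<Sigma>_I - x3_axis = \<Sigma>1 \<union> \<Sigma>2 \<and>
            spirals_into_from_above \<Sigma>1 t1 \<and> spirals_into_from_below \<Sigma>1 t2 \<and>
            spirals_into_from_above \<Sigma>2 t1 \<and> spirals_into_from_below \<Sigma>2 t2)"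
    if t: "t1 < t2" "t1 \<in> S" "t2 \<in> S" "{t1<..<t2} \<inter> S = {}" "-1/2 \<le> t1" "t2 \<le> 1/2" for t1 t2
  proof -
    \<comment> \<open>Every gap contains a rational height, where the phases converge along the
      common subsequence; it becomes the base point for this gap.\<close>
    obtain q where q: "t1 < of_rat q" "of_rat q < t2" using of_rat_dense[OF t(1)] by blast
    define x0 where "x0 = rt (to_nat q)"
    have x0: "x0 = of_rat q" by (simp add: x0_def rt_def)
    have x01: "\<bar>x0\<bar> < 1" using q t(5,6) unfolding x0 by linarith
    have "convergent (\<lambda>n. Gfin (ks n) (of_real x0))"
      using \<sigma>(2)[of "to_nat q"] x01 by (simp add: ph_def ks_def x0_def)
    then obtain l where l: "(\<lambda>n. Gfin (ks n) (of_real x0)) \<longlonglongrightarrow> l" by (auto simp: convergent_def)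
    \<comment> \<open>The value at 0 is the limiting phase, which makes \<open>c\<close> continuous
      on the parameter set and defines the limit surface.\<close>
    define c where "c \<kappa> = (if \<kappa> = 0 then l else Gfin \<kappa> (of_real x0))" for \<kappa> :: real
    have cks: "c (ks n) = Gfin (ks n) (of_real x0)" for n using ks[of n] by (simp add: c_def)
    define T where "T = insert 0 (range ks)"
    define J where "J = {t1<..<t2}"
    have J1: "J \<subseteq> {-1<..<1}" using t by (auto simp: J_def)
    have "cmod l = 1"
    proof (rule LIMSEQ_unique[OF tendsto_norm[OF l]])
      show "(\<lambda>n. norm (Gfin (ks n) (of_real x0))) \<longlonglongrightarrow> 1"
        using unit[OF ks x01] by simp
    qed
    have "weierstrass S p T J (Gb x0 c)"
    proof (rule weierstrass_Gb)
      show "\<bar>\<kappa>\<bar> < 1" if "\<kappa> \<in> T" for \<kappa> using that ks by (auto simp: T_def abs_less_iff intro: less_trans[of "-1" 0])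
      show "0 < dd \<kappa> x" if "\<kappa> \<in> T" "x \<in> J" for \<kappa> x
      proof -
        have "x \<notin> S" using that(2) t(4) by (auto simp: J_def)
        then have "infdist x S > 0" using S infdist_pos_not_in_closed by blast
        then show ?thesis by (simp add: dd_def add_pos_nonneg)
      qed
      show "continuous_on T c"
        unfolding T_def
        by (rule continuous_on_sequence_limit[OF ks(1) ks0]) (use l in \<open>simp add: cks\<close>, simp add: c_def)
      show "cmod (c \<kappa>) = 1" if "\<kappa> \<in> T" for \<kappa>
        using that \<open>cmod l = 1\<close> unit[OF ks x01] by (auto simp: T_def c_def)
    qed (use J1 q in \<open>auto simp: J_def x0 is_interval_oo\<close>)
    then interpret g: gap S p T J "Gb x0 c" t1 t2
      by (intro gap.intro gap_axioms.intro) (use t in \<open>auto simp: J_def T_def\<close>)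
    \<comment> \<open>The disks were built from \<open>Gfin\<close> over the whole cylinder; over
      this gap they are members of the family that extends to \<open>\<kappa> = 0\<close>.\<close>
    have F_gap: "F n v = g.F (ks n) v" if v: "v \<in> strip J" for n v
      unfolding g.F_def unfolding F_def
    proof (rule FG_cong)
      have vJ: "v$1 \<in> J" using v by (simp add: strip_def)
      fix z assume z: "Re z = v$1" "\<bar>Im z\<bar> < om (ks n) (v$1)"
      show "Gfin (ks n) z = Gb x0 c (ks n) z"
        by (rule Gfin_eq_Gb[where c = c and ?x0.0 = x0, OF ks _ _ _ cks]) (use z vJ J1 x01 in \<open>auto simp: abs_less_iff\<close>)
    next
      interpret w: weierstrass S p "{ks n}" "{-1<..<1}" Gfin by (rule w)
      have "(ks n, v) \<in> w.\<Omega>3" by (rule w.strip_\<Omega>3[OF _ J1 v]) simp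
      then show "\<bar>v$2 * yyG (Gfin (ks n)) (ks n) (v$1) 1\<bar> < om (ks n) (v$1)"
        by (simp add: w.\<Omega>3_def w.Y_def w.yy_def)
    qed
    have conv: "converge_smoothly_on_compacts (\<lambda>k. F k ` strip I \<inter> slab t1 t2) (g.F 0) (strip J) (cylinder \<inter> slab t1 t2)"
      unfolding I_def
    proof (rule g.convergence[OF t(5,6) _ ks0 F_gap])
      show "ks n \<in> T" for n by (simp add: T_def)
      show "F n v $ 3 = v$1" for n v unfolding F_eq by (rule weierstrass.F_component(3)[OF w])
    qed
    show ?thesis
    proof (rule exI[of _ "g.F 0"], rule exI[of _ "strip J"], rule exI[of _ g.\<Sigma>I], intro conjI)
      show "embedded_minimal_disk (g.F 0) (strip J) g.\<Sigma>I" by (rule g.embedded_\<Sigma>I)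
      show "g.\<Sigma>I \<subseteq> cylinder \<inter> slab t1 t2" by (rule g.\<Sigma>I_sub[OF t(5,6)])
      show "converge_smoothly_on_compacts (\<lambda>k. F k ` strip I \<inter> slab t1 t2) (g.F 0) (strip J) (cylinder \<inter> slab t1 t2)"
        by (rule conv)
      show "closure g.\<Sigma>I - g.\<Sigma>I = cylinder \<inter> {v. v $ 3 = t1 \<or> v $ 3 = t2}" by (rule g.closure_\<Sigma>I[OF t(5,6)])
      have "g.\<Sigma>I - x3_axis = g.SgI 0 1 J \<union> g.SgI 0 (-1) J"
        unfolding g.\<Sigma>I_def by (rule g.image_minus_axis[OF g.zero order_refl])
      moreover note g.spirals[OF t(5,6), of 1] g.spirals[OF t(5,6), of "-1"]
      ultimately show "\<exists>\<Sigma>1 \<Sigma>2. infinite_valued_graph \<Sigma>1 \<and> infinite_valued_graph \<Sigma>2 \<and>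
            g.\<Sigma>I - x3_axis = \<Sigma>1 \<union> \<Sigma>2 \<and>
            spirals_into_from_above \<Sigma>1 t1 \<and> spirals_into_from_below \<Sigma>1 t2 \<and>
            spirals_into_from_above \<Sigma>2 t1 \<and> spirals_into_from_below \<Sigma>2 t2" by blast
    qed
  qed
  show thesis
  proof (rule that[of F "\<lambda>k. strip I" "\<lambda>k. F k ` strip I"])
  qed (rule A1 A2 A3 A4 A5 | assumption | (elim conjE, rule A6, assumption+))+
qed

end

section \<open>From the set of heights back to the compact set\<close>

lemma axis_point_scaleR: "axis_point t = t *\<^sub>R axis 3 1"
  by (simp add: axis_point_def vec_eq_iff forall_3 axis_def)

text \<open>If an end point were outside the closed set \<open>M\<close>, so would be a
  neighbourhood of it on the axis, and the interval could be prolonged to a larger connected set,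
  against maximality of the component.\<close>

lemma component_of_axis:
  assumes M: "closed M" and C: "axis_point ` {t1<..<t2} \<in> components (x3_axis - M)"
  shows "t1 < t2" "axis_point t1 \<in> M" "axis_point t2 \<in> M" "\<And>t. t1 < t \<Longrightarrow> t < t2 \<Longrightarrow> axis_point t \<notin> M"
proof -
  have inj: "axis_point s = axis_point t \<Longrightarrow> s = t" for s t
    by (metis axis_point_def vector_3(3))
  have ax: "axis_point t \<in> x3_axis" for t by (simp add: axis_point_def x3_axis_def)
  have dist: "dist (axis_point s) (axis_point t) = \<bar>s - t\<bar>" for s t
    by (simp add: axis_point_scaleR dist_norm flip: scaleR_left_diff_distrib)
  have conn: "connected (axis_point ` {a<..<b})" for a b
    unfolding axis_point_scaleR[abs_def]
    by (intro connected_continuous_image connected_Ioo continuous_intros)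
  have "axis_point ` {t1<..<t2} \<noteq> {}" using C by (rule in_components_nonempty)
  then show t12: "t1 < t2" by auto
  have sub: "axis_point ` {t1<..<t2} \<subseteq> x3_axis - M" using C by (rule in_components_subset)
  then show "axis_point t \<notin> M" if "t1 < t" "t < t2" for t
    using that imageI[of t "{t1<..<t2}" axis_point] by (metis DiffD2 greaterThanLessThan_iff subsetD)
  then have out: "axis_point t \<in> x3_axis - M" if "t1 < t" "t < t2" for t using that ax by simp
  have max: "{a<..<b} \<subseteq> {t1<..<t2}"
    if "a \<le> t1" "t2 \<le> b" and D: "axis_point ` {a<..<b} \<subseteq> x3_axis - M" for a b
  proof -
    have "(t1 + t2) / 2 \<in> {t1<..<t2} \<inter> {a<..<b}" using that t12 by simp
    then have "axis_point ` {t1<..<t2} \<inter> axis_point ` {a<..<b} \<noteq> {}" by blast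
    then have "axis_point ` {a<..<b} \<subseteq> axis_point ` {t1<..<t2}"
      by (rule components_maximal[OF C conn D])
    then show ?thesis using inj by blast
  qed
  have near: "\<exists>e>0. \<forall>t. \<bar>t - s\<bar> < e \<longrightarrow> axis_point t \<notin> M" if "axis_point s \<notin> M" for s
  proof -
    have "open (- M)" "axis_point s \<in> - M" using M that by (simp_all add: open_Compl)
    then obtain e where "e > 0" "ball (axis_point s) e \<subseteq> - M" by (rule openE)
    then show ?thesis by (intro exI[of _ e]) (auto simp: subset_iff dist abs_minus_commute)
  qed
  show "axis_point t1 \<in> M"
  proof (rule ccontr)
    assume "axis_point t1 \<notin> M"
    then obtain e where e: "e > 0" "\<And>t. \<bar>t - t1\<bar> < e \<Longrightarrow> axis_point t \<notin> M" using near by blast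
    have "axis_point t \<in> x3_axis - M" if "t \<in> {t1 - e<..<t2}" for t
      using that e(2)[of t] out[of t] ax by (cases "t \<le> t1") auto
    then have "{t1 - e<..<t2} \<subseteq> {t1<..<t2}" using e(1) by (intro max) auto
    moreover have "t1 \<in> {t1 - e<..<t2}" using e(1) t12 by simp
    ultimately have "t1 \<in> {t1<..<t2}" by blast
    then show False by simp
  qed
  show "axis_point t2 \<in> M"
  proof (rule ccontr)
    assume "axis_point t2 \<notin> M"
    then obtain e where e: "e > 0" "\<And>t. \<bar>t - t2\<bar> < e \<Longrightarrow> axis_point t \<notin> M" using near by blast
    have "axis_point t \<in> x3_axis - M" if "t \<in> {t1<..<t2 + e}" for t
      using that e(2)[of t] out[of t] ax by (cases "t < t2") auto
    then have "{t1<..<t2 + e} \<subseteq> {t1<..<t2}" using e(1) by (intro max) auto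
    moreover have "t2 \<in> {t1<..<t2 + e}" using e(1) t12 by simp
    ultimately have "t2 \<in> {t1<..<t2}" by blast
    then show False by simp
  qed
qed

theorem theorem1:
  fixes M :: "(real^3) set"
  assumes "compact M"
    and "M \<subseteq> {p. p $ 1 = 0 \<and> p $ 2 = 0 \<and> \<bar>p $ 3\<bar> \<le> 1/2}"
  shows "\<exists>(F :: nat \<Rightarrow> real^2 \<Rightarrow> real^3) (W :: nat \<Rightarrow> (real^2) set) (\<Sigma> :: nat \<Rightarrow> (real^3) set).
    (\<forall>k. properly_embedded_minimal_disk (F k) (W k) (\<Sigma> k) cylinder \<and>
         axis_point ` {-1/2..1/2} \<subseteq> \<Sigma> k) \<and>
    (\<forall>p\<in>M. filterlim (\<lambda>k. norm_A_sq (F k) (W k) p) at_top sequentially) \<and>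
    (\<forall>\<delta>>0. (SUP k. SUP p\<in>\<Sigma> k - (\<Union>q\<in>M. ball q \<delta>). ereal (norm_A_sq (F k) (W k) p)) < \<infinity>) \<and>
    (\<forall>k. \<exists>\<Sigma>1 \<Sigma>2. multi_valued_graph \<Sigma>1 \<and> multi_valued_graph \<Sigma>2 \<and>
         \<Sigma> k - x3_axis = \<Sigma>1 \<union> \<Sigma>2) \<and>
    (\<forall>t1 t2. axis_point ` {t1<..<t2} \<in> components (x3_axis - M) \<longrightarrow>
      (\<exists>F_I W_I \<Sigma>_I.
         embedded_minimal_disk F_I W_I \<Sigma>_I \<and>
         \<Sigma>_I \<subseteq> cylinder \<inter> slab t1 t2 \<and>
         converge_smoothly_on_compacts (\<lambda>k. \<Sigma> k \<inter> slab t1 t2) F_I W_I (cylinder \<inter> slab t1 t2) \<and>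
         closure \<Sigma>_I - \<Sigma>_I = cylinder \<inter> {p. p $ 3 = t1 \<or> p $ 3 = t2} \<and>
         (\<exists>\<Sigma>1 \<Sigma>2. infinite_valued_graph \<Sigma>1 \<and> infinite_valued_graph \<Sigma>2 \<and>
            \<Sigma>_I - x3_axis = \<Sigma>1 \<union> \<Sigma>2 \<and>
            spirals_into_from_above \<Sigma>1 t1 \<and> spirals_into_from_below \<Sigma>1 t2 \<and>
            spirals_into_from_above \<Sigma>2 t1 \<and> spirals_into_from_below \<Sigma>2 t2)))"
proof -
  \<comment> \<open>If \<open>M\<close> is empty, any height outside the cylinder can play the role of the singular set.\<close>
  define S :: "real set" where "S = (if M = {} then {2} else (\<lambda>v. v$3) ` M)"
  have axM: "v = axis_point (v$3)" "\<bar>v$3\<bar> \<le> 1/2" if "v \<in> M" for v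
    using that assms(2) by (auto simp: axis_point_def vec_eq_iff forall_3)
  have MS: "v$3 \<in> S" if "v \<in> M" for v using that by (auto simp: S_def)
  have SM: "axis_point t \<in> M" if "t \<in> S" "M \<noteq> {}" for t
  proof -
    obtain v where v: "v \<in> M" "t = v$3" using \<open>t \<in> S\<close> \<open>M \<noteq> {}\<close> by (auto simp: S_def)
    then show ?thesis using axM(1)[OF v(1)] by simp
  qed
  have "compact S"
    using assms(1) by (auto simp: S_def intro!: compact_continuous_image continuous_intros)
  then have cS: "closed S" by (rule compact_imp_closed)
  have S2: "S \<noteq> {}" "S \<subseteq> {-2..2}"
    using axM(2) by (auto simp: S_def abs_le_iff; force)+
  obtain p where p: "\<And>j. p j \<in> S"
    "\<And>x \<eta>. x \<in> S \<Longrightarrow> 0 < \<eta> \<Longrightarrow> \<eta> \<le> 4 \<Longrightarrow> \<exists>j. \<bar>x - p j\<bar> \<le> \<eta> \<and> \<eta> * (real j + 1) \<le> 32"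
    using ex_dense_sequence[OF cS S2] by blast
  interpret blowup_set S p by unfold_locales (use cS S2 p in auto)
  obtain F W \<Sigma> where
    1: "\<And>k. properly_embedded_minimal_disk (F k) (W k) (\<Sigma> k) cylinder"
      "\<And>k. axis_point ` {-1/2..1/2} \<subseteq> \<Sigma> k" and
    2: "\<And>t. t \<in> S \<Longrightarrow> \<bar>t\<bar> \<le> 1/2 \<Longrightarrow> filterlim (\<lambda>k. norm_A_sq (F k) (W k) (axis_point t)) at_top sequentially" and
    3: "\<And>\<delta>. \<delta> > 0 \<Longrightarrow> (SUP k. SUP v\<in>\<Sigma> k - (\<Union>t\<in>S. ball (axis_point t) \<delta>). ereal (norm_A_sq (F k) (W k) v)) < \<infinity>" and
    4: "\<And>k. \<exists>\<Sigma>1 \<Sigma>2. multi_valued_graph \<Sigma>1 \<and> multi_valued_graph \<Sigma>2 \<and> \<Sigma> k - x3_axis = \<Sigma>1 \<union> \<Sigma>2" and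
    5: "\<And>t1 t2. t1 < t2 \<and> t1 \<in> S \<and> t2 \<in> S \<and> {t1<..<t2} \<inter> S = {} \<and> -1/2 \<le> t1 \<and> t2 \<le> 1/2 \<Longrightarrow>
      (\<exists>F_I W_I \<Sigma>_I.
         embedded_minimal_disk F_I W_I \<Sigma>_I \<and>
         \<Sigma>_I \<subseteq> cylinder \<inter> slab t1 t2 \<and>
         converge_smoothly_on_compacts (\<lambda>k. \<Sigma> k \<inter> slab t1 t2) F_I W_I (cylinder \<inter> slab t1 t2) \<and>
         closure \<Sigma>_I - \<Sigma>_I = cylinder \<inter> {v. v $ 3 = t1 \<or> v $ 3 = t2} \<and>
         (\<exists>\<Sigma>1 \<Sigma>2. infinite_valued_graph \<Sigma>1 \<and> infinite_valued_graph \<Sigma>2 \<and>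
            \<Sigma>_I - x3_axis = \<Sigma>1 \<union> \<Sigma>2 \<and>
            spirals_into_from_above \<Sigma>1 t1 \<and> spirals_into_from_below \<Sigma>1 t2 \<and>
            spirals_into_from_above \<Sigma>2 t1 \<and> spirals_into_from_below \<Sigma>2 t2))"
    by (rule ex_disk_sequence) (rule that; assumption | blast)
  have B2: "filterlim (\<lambda>k. norm_A_sq (F k) (W k) v) at_top sequentially" if "v \<in> M" for v
    using 2[OF MS[OF that] axM(2)[OF that]] axM(1)[OF that] by simp
  have B3: "(SUP k. SUP v\<in>\<Sigma> k - (\<Union>q\<in>M. ball q \<delta>). ereal (norm_A_sq (F k) (W k) v)) < \<infinity>" if \<delta>: "\<delta> > 0" for \<delta>
  proof -
    \<comment> \<open>For empty \<open>M\<close> the substitute \<open>S = {2}\<close> is used with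
      balls of radius 1, which miss the cylinder; removing them removes nothing from the
      disks.\<close>
    define \<delta>' where "\<delta>' = (if M = {} then 1 else \<delta>)"
    have "\<Sigma> k - (\<Union>q\<in>M. ball q \<delta>) \<subseteq> \<Sigma> k - (\<Union>t\<in>S. ball (axis_point t) \<delta>')" for k
    proof (cases "M = {}")
      case True
      have "v \<notin> ball (axis_point 2) 1" if "v \<in> \<Sigma> k" for v
      proof
        assume "v \<in> ball (axis_point 2) 1"
        then have "norm (axis_point 2 - v) < 1" by (simp add: dist_norm)
        then have "\<bar>(axis_point 2 - v) $ 3\<bar> < 1" using component_le_norm_cart[of "axis_point 2 - v" 3] by linarith
        moreover have "v \<in> cylinder" using 1(1)[of k] that by (auto simp: properly_embedded_minimal_disk_def)
        ultimately show False by (simp add: cylinder_def axis_point_def abs_le_iff abs_less_iff)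
      qed
      then show ?thesis using True by (auto simp: S_def \<delta>'_def)
    next
      case False
      then show ?thesis using SM by (auto simp: \<delta>'_def)
    qed
    then have "(SUP k. SUP v\<in>\<Sigma> k - (\<Union>q\<in>M. ball q \<delta>). ereal (norm_A_sq (F k) (W k) v))
        \<le> (SUP k. SUP v\<in>\<Sigma> k - (\<Union>t\<in>S. ball (axis_point t) \<delta>'). ereal (norm_A_sq (F k) (W k) v))"
      by (intro SUP_mono' SUP_subset_mono) auto
    also have "\<dots> < \<infinity>" using \<delta> by (intro 3) (simp add: \<delta>'_def)
    finally show ?thesis .
  qed
  \<comment> \<open>The end points belong to \<open>M\<close>, which lies within the cylinder, so
    the gap does too; in particular \<open>M\<close> is not empty and \<open>S\<close> consists of
    its heights.\<close>
  have B5: "t1 < t2 \<and> t1 \<in> S \<and> t2 \<in> S \<and> {t1<..<t2} \<inter> S = {} \<and> -1/2 \<le> t1 \<and> t2 \<le> 1/2"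
    if C: "axis_point ` {t1<..<t2} \<in> components (x3_axis - M)" for t1 t2
  proof -
    note comp = component_of_axis[OF compact_imp_closed[OF assms(1)] C]
    have ne: "M \<noteq> {}" using comp(2) by auto
    have "x \<notin> S" if "t1 < x" "x < t2" for x
      using comp(4)[OF that] SM[OF _ ne] by blast
    then have "{t1<..<t2} \<inter> S = {}" by auto
    then show ?thesis
      using comp(1) MS[OF comp(2)] MS[OF comp(3)] axM(2)[OF comp(2)] axM(2)[OF comp(3)]
      by (auto simp: axis_point_def abs_le_iff)
  qed
  show ?thesis
  proof (rule exI[of _ F], rule exI[of _ W], rule exI[of _ \<Sigma>], intro conjI)
    show "\<forall>k. properly_embedded_minimal_disk (F k) (W k) (\<Sigma> k) cylinder \<and> axis_point ` {-1/2..1/2} \<subseteq> \<Sigma> k"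
      using 1 by simp
    show "\<forall>p\<in>M. filterlim (\<lambda>k. norm_A_sq (F k) (W k) p) at_top sequentially" using B2 by blast
    show "\<forall>\<delta>>0. (SUP k. SUP p\<in>\<Sigma> k - (\<Union>q\<in>M. ball q \<delta>). ereal (norm_A_sq (F k) (W k) p)) < \<infinity>"
      using B3 by blast
    show "\<forall>k. \<exists>\<Sigma>1 \<Sigma>2. multi_valued_graph \<Sigma>1 \<and> multi_valued_graph \<Sigma>2 \<and> \<Sigma> k - x3_axis = \<Sigma>1 \<union> \<Sigma>2"
      using 4 by blast
  qed (intro allI impI, rule 5, rule B5)
qed

end
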